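(* Let $\ell>0$, $m^2\ge0$, $\alpha\in[0,\pi)$ and $\beta_1,\beta_2,\beta_1',\beta_2'\in\mathbb R$ satisfy: $\rho:=\beta_1'\beta_2-\beta_1\beta_2'>0$; $\beta_2'\neq0$; either $\alpha=0$ or $\pi/2\le\alpha<\pi$; if $\beta_2'>0$ then $\beta_1\ge0$, $\beta_2<0$, $\beta_1'<0$; if $\beta_2'<0$ then $\beta_1\le0$, $\beta_2>0$, $\beta_1'>0$; and $\beta_2\neq0$. Let $A$ be the operator described in the context and $E(t):=-\sin(\sqrt A\,t)/\sqrt A$. Define, for $f\in C^2_0(\mathbb R,D(A))$, $$(\mathsf E_{\rm ret}f)(t)=\int_t^\infty dt'\,E(t-t')f(t'),\qquad (\mathsf E_{\rm adv}f)(t)=-\int_{-\infty}^t dt'\,E(t-t')f(t').$$ Then $\mathsf E_{\rm ret}$ is a retarded Green's operator and $\mathsf E_{\rm adv}$ is an advanced Green's operator.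
   Context: $\mathcal H:=L^2((0,\ell))\oplus\mathbb C$ with inner product $(\varphi,\chi)_{\mathcal H}=\int_0^\ell \overline{\varphi_1}\chi_1\,dz+\rho^{-1}\overline{\varphi_2}\chi_2$. $D(A)$ is the set of $\varphi=(\varphi_1,\varphi_2)^\top\in\mathcal H$ with $\varphi_1,\partial_z\varphi_1$ absolutely continuous on $[0,\ell]$, $\partial_z^2\varphi_1\in L^2((0,\ell))$, $\cos\alpha\,\varphi_1(0)+\sin\alpha\,\partial_z\varphi_1(0)=0$, and $\varphi_2=\beta_1'\varphi_1(\ell)-\beta_2'\partial_z\varphi_1(\ell)$; $A\varphi:=\big((-\partial_z^2+m^2)\varphi_1,\ -[\beta_1\varphi_1(\ell)-\beta_2\partial_z\varphi_1(\ell)]\big)^\top$; $A$ is self-adjoint and functions of $A$ are defined by spectral calculus. $D(A)$ carries the graph norm $\|\varphi\|_{\mathcal H}+\|A\varphi\|_{\mathcal H}$; $C^j(\mathbb R,D(A))$ are the $j$ times continuously differentiable maps $\mathbb R\to D(A)$ and $C^j_0(\mathbb R,D(A))$ those with compact support. For $f\in C^2_0(\mathbb R,D(A))$, $f(t)=(f_1(t,\cdot),f_2(t))^\top$ and $f_1$ is regarded as a function on $\mathbb R\times[0,\ell]$. $Q_A:=\partial_t^2+A$. For $O\subset\mathbb R\times[0,\ell]$, $J_+(O)$ (resp. $J_-(O)$) is the set of $(t,z)\in\mathbb R\times[0,\ell]$ with $t-t'\ge|z-z'|$ (resp. $t'-t\ge|z-z'|$) for some $(t',z')\in O$. An integral operator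 from $C^2_0(\mathbb R,D(A))$ into $C^2(\mathbb R,D(A))$ is one of the form $(\mathsf Ef)(t,z)=\int_{\mathbb R}dt'\,(K(t-t')f(t'))(z)$ with $K\in C^2(\mathbb R,\mathcal B(\mathcal H))$. Such an operator $\mathsf E_{\rm ret}$ (resp. $\mathsf E_{\rm adv}$) is a retarded (resp. advanced) Green's operator if $Q_A\mathsf E f=\mathsf EQ_Af=f$ for all $f\in C^2_0(\mathbb R,D(A))$ and $\operatorname{supp}(\mathsf E_{\rm ret}f)_1\subset J_-(\operatorname{supp}f_1)$ (resp. $\operatorname{supp}(\mathsf E_{\rm adv}f)_1\subset J_+(\operatorname{supp}f_1)$) for all such $f$.
   Formalization: The requirement that the integral kernel K be in C²(ℝ,B(H)) is dropped: the retarded kernel (E(s) for s≤0, 0 for s>0) has one-sided derivatives −I and 0 at s=0, so it is never C¹; the explicit integral form and mapping C²₀(ℝ,D(A))→C²(ℝ,D(A)) are kept. *)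

theory Defs
  imports "HOL-Analysis.Analysis"
begin

record bvp =
  len :: real
  msq :: real
  alpha :: real
  b1 :: real
  b2 :: real
  b1' :: real
  b2' :: real

definition rho :: "bvp \<Rightarrow> real" where
  "rho P = b1' P * b2 P - b1 P * b2' P"

text \<open>Vectors of H = L^2((0,ell)) + C are represented by pairs
  (function on the reals, complex number); only the restriction of the
  function to (0,ell) matters, and equality in H is the relation heq.\<close>
type_synonym hvec = "(real \<Rightarrow> complex) \<times> complex"

definition hadd :: "hvec \<Rightarrow> hvec \<Rightarrow> hvec" where
  "hadd \<phi> \<psi> = ((\<lambda>z. fst \<phi> z + fst \<psi> z), snd \<phi> + snd \<psi>)"

definition hscale :: "complex \<Rightarrow> hvec \<Rightarrow> hvec" where
  "hscale c \<phi> = ((\<lambda>z. c * fst \<phi> z), c * snd \<phi>)"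

definition hsub :: "hvec \<Rightarrow> hvec \<Rightarrow> hvec" where
  "hsub \<phi> \<psi> = hadd \<phi> (hscale (-1) \<psi>)"

definition L2_on :: "real \<Rightarrow> (real \<Rightarrow> complex) \<Rightarrow> bool" where
  "L2_on l u \<longleftrightarrow> u \<in> borel_measurable (lebesgue_on {0<..<l})
      \<and> integrable (lebesgue_on {0<..<l}) (\<lambda>z. (cmod (u z))^2)"

definition Hsp :: "bvp \<Rightarrow> hvec \<Rightarrow> bool" where
  "Hsp P \<phi> \<longleftrightarrow> L2_on (len P) (fst \<phi>)"

definition heq :: "bvp \<Rightarrow> hvec \<Rightarrow> hvec \<Rightarrow> bool" where
  "heq P \<phi> \<psi> \<longleftrightarrow> (AE z in lebesgue_on {0<..<len P}. fst \<phi> z = fst \<psi> z) \<and> snd \<phi> = snd \<psi>"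

definition hinner :: "bvp \<Rightarrow> hvec \<Rightarrow> hvec \<Rightarrow> complex" where
  "hinner P \<phi> \<psi> = integral\<^sup>L (lebesgue_on {0<..<len P}) (\<lambda>z. cnj (fst \<phi> z) * fst \<psi> z)
      + cnj (snd \<phi>) * snd \<psi> / complex_of_real (rho P)"

definition hnorm :: "bvp \<Rightarrow> hvec \<Rightarrow> real" where
  "hnorm P \<phi> = sqrt (Re (hinner P \<phi> \<phi>))"

definition ac_on :: "real \<Rightarrow> real \<Rightarrow> (real \<Rightarrow> 'a::real_normed_vector) \<Rightarrow> bool" where
  "ac_on a b f \<longleftrightarrow> (\<forall>\<epsilon>>0. \<exists>\<delta>>0. \<forall>(n::nat) (u::nat \<Rightarrow> real) v.
      (\<forall>i<n. a \<le> u i \<and> u i \<le> v i \<and> v i \<le> b)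
      \<and> (\<forall>i<n. \<forall>j<n. i \<noteq> j \<longrightarrow> v i \<le> u j \<or> v j \<le> u i)
      \<and> (\<Sum>i<n. v i - u i) < \<delta>
      \<longrightarrow> (\<Sum>i<n. norm (f (v i) - f (u i))) < \<epsilon>)"

definition dz :: "bvp \<Rightarrow> (real \<Rightarrow> complex) \<Rightarrow> real \<Rightarrow> complex" where
  "dz P u z = vector_derivative u (at z within {0..len P})"

text \<open>D(A), membership of a representative (the continuous one on [0,ell])\<close>
definition domA :: "bvp \<Rightarrow> hvec \<Rightarrow> bool" where
  "domA P \<phi> \<longleftrightarrow>
     ac_on 0 (len P) (fst \<phi>) \<and> ac_on 0 (len P) (dz P (fst \<phi>))
     \<and> L2_on (len P) (dz P (dz P (fst \<phi>)))
     \<and> complex_of_real (cos (alpha P)) * fst \<phi> 0 + complex_of_real (sin (alpha P)) * dz P (fst \<phi>) 0 = 0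
     \<and> snd \<phi> = complex_of_real (b1' P) * fst \<phi> (len P) - complex_of_real (b2' P) * dz P (fst \<phi>) (len P)"

definition Aop :: "bvp \<Rightarrow> hvec \<Rightarrow> hvec" where
  "Aop P \<phi> = ((\<lambda>z. - dz P (dz P (fst \<phi>)) z + complex_of_real (msq P) * fst \<phi> z),
     - (complex_of_real (b1 P) * fst \<phi> (len P) - complex_of_real (b2 P) * dz P (fst \<phi>) (len P)))"

definition gnorm :: "bvp \<Rightarrow> hvec \<Rightarrow> real" where
  "gnorm P \<phi> = hnorm P \<phi> + hnorm P (Aop P \<phi>)"

definition bop :: "bvp \<Rightarrow> (hvec \<Rightarrow> hvec) \<Rightarrow> bool" where
  "bop P T \<longleftrightarrow> (\<forall>\<phi>. Hsp P \<phi> \<longrightarrow> Hsp P (T \<phi>))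
     \<and> (\<forall>\<phi> \<psi>. Hsp P \<phi> \<and> Hsp P \<psi> \<and> heq P \<phi> \<psi> \<longrightarrow> heq P (T \<phi>) (T \<psi>))
     \<and> (\<forall>\<phi> \<psi> a c. Hsp P \<phi> \<and> Hsp P \<psi> \<longrightarrow>
           heq P (T (hadd (hscale a \<phi>) (hscale c \<psi>))) (hadd (hscale a (T \<phi>)) (hscale c (T \<psi>))))
     \<and> (\<exists>C. \<forall>\<phi>. Hsp P \<phi> \<longrightarrow> hnorm P (T \<phi>) \<le> C * hnorm P \<phi>)"

definition eigA :: "bvp \<Rightarrow> real \<Rightarrow> hvec \<Rightarrow> bool" where
  "eigA P lam v \<longleftrightarrow> domA P v \<and> hnorm P v \<noteq> 0 \<and> heq P (Aop P v) (hscale (complex_of_real lam) v)"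

text \<open>T = g(A) by the spectral calculus (A has purely discrete spectrum with a complete
  system of eigenvectors, so g(A) is the bounded operator acting as g(lambda) on each eigenvector)\<close>
definition spec_fun :: "bvp \<Rightarrow> (real \<Rightarrow> real) \<Rightarrow> (hvec \<Rightarrow> hvec) \<Rightarrow> bool" where
  "spec_fun P g T \<longleftrightarrow> bop P T \<and>
     (\<forall>lam v. eigA P lam v \<longrightarrow> heq P (T v) (hscale (complex_of_real (g lam)) v))"

text \<open>the function lambda |-> - sin(sqrt(lambda) t)/sqrt(lambda) (entire in lambda)\<close>
definition gE :: "real \<Rightarrow> real \<Rightarrow> real" where
  "gE t lam = (if lam > 0 then - sin (sqrt lam * t) / sqrt lam
             else if lam = 0 then - t
             else - sinh (sqrt (- lam) * t) / sqrt (- lam))"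

text \<open>G is the (weak = Bochner, for the integrands at hand) integral over S of h\<close>
definition hint_on :: "bvp \<Rightarrow> real set \<Rightarrow> (real \<Rightarrow> hvec) \<Rightarrow> hvec \<Rightarrow> bool" where
  "hint_on P S h G \<longleftrightarrow> Hsp P G \<and>
     (\<forall>\<psi>. Hsp P \<psi> \<longrightarrow> set_integrable lborel S (\<lambda>t. hinner P \<psi> (h t))
        \<and> hinner P \<psi> G = (LINT t:S|lborel. hinner P \<psi> (h t)))"

definition hderiv_DA :: "bvp \<Rightarrow> (real \<Rightarrow> hvec) \<Rightarrow> (real \<Rightarrow> hvec) \<Rightarrow> real \<Rightarrow> bool" where
  "hderiv_DA P F F' t \<longleftrightarrow>
     ((\<lambda>h. gnorm P (hsub (hscale (complex_of_real (1 / h)) (hsub (F (t + h)) (F t))) (F' t))) \<longlongrightarrow> 0) (at 0)"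

definition cont_DA :: "bvp \<Rightarrow> (real \<Rightarrow> hvec) \<Rightarrow> real \<Rightarrow> bool" where
  "cont_DA P F t \<longleftrightarrow> ((\<lambda>s. gnorm P (hsub (F s) (F t))) \<longlongrightarrow> 0) (at t)"

definition C1_DA :: "bvp \<Rightarrow> (real \<Rightarrow> hvec) \<Rightarrow> (real \<Rightarrow> hvec) \<Rightarrow> bool" where
  "C1_DA P F F' \<longleftrightarrow> (\<forall>t. domA P (F t) \<and> domA P (F' t) \<and> hderiv_DA P F F' t \<and> cont_DA P F' t)"

definition C2_DA :: "bvp \<Rightarrow> (real \<Rightarrow> hvec) \<Rightarrow> (real \<Rightarrow> hvec) \<Rightarrow> (real \<Rightarrow> hvec) \<Rightarrow> bool" where
  "C2_DA P F F' F'' \<longleftrightarrow> C1_DA P F F' \<and> C1_DA P F' F''"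

definition C2_0_DA :: "bvp \<Rightarrow> (real \<Rightarrow> hvec) \<Rightarrow> (real \<Rightarrow> hvec) \<Rightarrow> (real \<Rightarrow> hvec) \<Rightarrow> bool" where
  "C2_0_DA P F F' F'' \<longleftrightarrow> C2_DA P F F' F'' \<and> (\<exists>T. \<forall>t. T < \<bar>t\<bar> \<longrightarrow> hnorm P (F t) = 0)"

definition QA :: "bvp \<Rightarrow> (real \<Rightarrow> hvec) \<Rightarrow> (real \<Rightarrow> hvec) \<Rightarrow> real \<Rightarrow> hvec" where
  "QA P F F'' t = hadd (F'' t) (Aop P (F t))"

definition supp1 :: "bvp \<Rightarrow> (real \<Rightarrow> hvec) \<Rightarrow> (real \<times> real) set" where
  "supp1 P F = closure {(t, z). z \<in> {0..len P} \<and> fst (F t) z \<noteq> 0}"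

definition Jplus :: "bvp \<Rightarrow> (real \<times> real) set \<Rightarrow> (real \<times> real) set" where
  "Jplus P Ob = {(t, z). z \<in> {0..len P} \<and> (\<exists>(t', z') \<in> Ob. t - t' \<ge> \<bar>z - z'\<bar>)}"

definition Jminus :: "bvp \<Rightarrow> (real \<times> real) set \<Rightarrow> (real \<times> real) set" where
  "Jminus P Ob = {(t, z). z \<in> {0..len P} \<and> (\<exists>(t', z') \<in> Ob. t' - t \<ge> \<bar>z - z'\<bar>)}"

text \<open>An operator E is given as a relation: E f G means (E f)(t) = G t (in H) for all t.\<close>
definition Eret :: "bvp \<Rightarrow> (real \<Rightarrow> hvec \<Rightarrow> hvec) \<Rightarrow> (real \<Rightarrow> hvec) \<Rightarrow> (real \<Rightarrow> hvec) \<Rightarrow> bool" where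
  "Eret P K f G \<longleftrightarrow> (\<forall>t. hint_on P {t..} (\<lambda>t'. K (t - t') (f t')) (G t))"

definition Eadv :: "bvp \<Rightarrow> (real \<Rightarrow> hvec \<Rightarrow> hvec) \<Rightarrow> (real \<Rightarrow> hvec) \<Rightarrow> (real \<Rightarrow> hvec) \<Rightarrow> bool" where
  "Eadv P K f G \<longleftrightarrow> (\<forall>t. hint_on P {..t} (\<lambda>t'. hscale (-1) (K (t - t') (f t'))) (G t))"

definition retarded_green :: "bvp \<Rightarrow> ((real \<Rightarrow> hvec) \<Rightarrow> (real \<Rightarrow> hvec) \<Rightarrow> bool) \<Rightarrow> bool" where
  "retarded_green P E \<longleftrightarrow> (\<forall>f f' f''. C2_0_DA P f f' f'' \<longrightarrow>
     (\<exists>F F' F''. C2_DA P F F' F'' \<and> E f F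
        \<and> (\<forall>t. heq P (QA P F F'' t) (f t))
        \<and> E (QA P f f'') f
        \<and> supp1 P F \<subseteq> Jminus P (supp1 P f)))"

definition advanced_green :: "bvp \<Rightarrow> ((real \<Rightarrow> hvec) \<Rightarrow> (real \<Rightarrow> hvec) \<Rightarrow> bool) \<Rightarrow> bool" where
  "advanced_green P E \<longleftrightarrow> (\<forall>f f' f''. C2_0_DA P f f' f'' \<longrightarrow>
     (\<exists>F F' F''. C2_DA P F F' F'' \<and> E f F
        \<and> (\<forall>t. heq P (QA P F F'' t) (f t))
        \<and> E (QA P f f'') f
        \<and> supp1 P F \<subseteq> Jplus P (supp1 P f)))"

end

theory Submission
  imports Defs "HOL-Complex_Analysis.Great_Picard"
begin

text \<open>The sign conditions make the quadratic form of \<open>A\<close> nonnegative: integrating by parts,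
  \<open>\<langle>\<phi>, A \<phi>\<rangle>\<close> is the sum of the Dirichlet and mass terms, of \<open>- cot \<alpha> \<bar>\<phi>(0)\<bar>\<^sup>2 \<ge> 0\<close> and of a
  nonnegative form in the boundary values at \<open>\<ell>\<close>. Hence \<open>A\<close> is symmetric and nonnegative, and \<open>A + 1\<close> is a bijection onto
  \<open>H\<close> with compact inverse, so that \<open>H\<close> has an orthonormal basis of eigenvectors of \<open>A\<close>. In the
  coordinates of this basis the retarded solution is a convolution with the scalar kernels
  \<open>- sin(\<surd>\<lambda> s) / \<surd>\<lambda>\<close>, and \<open>Q\<^sub>A E f = E Q\<^sub>A f = f\<close> is an integration by parts in time.

  The support property is an energy estimate with the weight
  \<open>w(t, z) = max(0, (t - t0)\<^sup>2 - (z - z0)\<^sup>2)\<^sup>2\<close>: if \<open>f\<close> vanishes on the forward cone of \<open>(t0, z0)\<close>, then the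
  weighted energy, which contains the two nonnegative boundary terms, is nondecreasing for \<open>t \<ge> t0\<close>.
  It vanishes for large \<open>t\<close>, hence for all \<open>t \<ge> t0\<close>, and the solution vanishes at \<open>(t0, z0)\<close>.
  The advanced case follows by time reversal.\<close>

section \<open>Absolutely continuous functions\<close>

text \<open>Membership in \<open>domA\<close> is an epsilon-delta condition, and \<open>dz\<close>
  takes an unspecified value wherever the derivative does not exist. Green's formula therefore rests
  on the fundamental theorem for absolutely continuous functions: the density comes from the
  positive variation and Radon-Nikodym, its identification with the derivative almost everywhere
  from a Vitali covering.

  The operators \<open>K s\<close> are given only by boundedness and by their values on
  eigenvectors. Completeness of the eigenvectors determines \<open>K s\<close> on all of
  \<open>H\<close> and lets every identity be checked coefficientwise. Regularity in the graph norm
  comes from bounds for \<open>A + 1\<close>, whose coefficients carry the factor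
  \<open>1 + \<lambda>\<close>.

  The energy weight is continuously differentiable across the light cone, so no integral is ever cut
  along the cone. The condition at \<ell> is dynamical: the second component contributes a kinetic
  term of its own, and the boundary form is exactly what cancels the flux through that end.\<close>

definition nonoverlapping_in :: "real \<Rightarrow> real \<Rightarrow> (real \<times> real) set \<Rightarrow> bool" where
  "nonoverlapping_in x y D \<longleftrightarrow> finite D \<and> (\<forall>p\<in>D. x \<le> fst p \<and> fst p < snd p \<and> snd p \<le> y)
     \<and> (\<forall>p\<in>D. \<forall>q\<in>D. p \<noteq> q \<longrightarrow> snd p \<le> fst q \<or> snd q \<le> fst p)"

text \<open>Increments are signed, so the supremum over all families is the positive variation; with
  absolute values it would be the total variation.\<close>

definition increment_sum :: "(real \<Rightarrow> real) \<Rightarrow> (real \<times> real) set \<Rightarrow> real" where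
  "increment_sum f D = (\<Sum>p\<in>D. f (snd p) - f (fst p))"

lemma nonoverlapping_in_mono:
  "nonoverlapping_in x y D \<Longrightarrow> x' \<le> x \<Longrightarrow> y \<le> y' \<Longrightarrow> nonoverlapping_in x' y' D"
  unfolding nonoverlapping_in_def by force

lemma nonoverlapping_in_empty [simp]: "nonoverlapping_in x y {}"
  by (simp add: nonoverlapping_in_def)

lemma increment_sum_empty [simp]: "increment_sum f {} = 0"
  by (simp add: increment_sum_def)

text \<open>The half-open intervals between the paired endpoints are pairwise disjoint, so the sum
  is the Lebesgue measure of their union.\<close>

lemma nonoverlapping_in_length:
  assumes "nonoverlapping_in x y D" "x \<le> y"
  shows "(\<Sum>p\<in>D. snd p - fst p) \<le> y - x"
proof -
  have fin: "finite D" and D: "\<And>p. p \<in> D \<Longrightarrow> x \<le> fst p \<and> fst p < snd p \<and> snd p \<le> y"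
    using assms by (auto simp: nonoverlapping_in_def)
  have "(\<Sum>p\<in>D. snd p - fst p) = (\<Sum>p\<in>D. measure lborel {fst p<..snd p})"
    by (intro sum.cong) (auto dest: D simp: less_imp_le)
  also have "\<dots> = measure lborel (\<Union>p\<in>D. {fst p<..snd p})"
  proof (rule measure_finite_Union[symmetric])
    show "disjoint_family_on (\<lambda>p. {fst p<..snd p}) D"
      unfolding disjoint_family_on_def
    proof (intro ballI impI)
      fix p q assume "p \<in> D" "q \<in> D" "p \<noteq> q"
      then have "snd p \<le> fst q \<or> snd q \<le> fst p"
        using assms(1) by (auto simp: nonoverlapping_in_def)
      then show "{fst p<..snd p} \<inter> {fst q<..snd q} = {}" by auto
    qed
  qed (use fin D in \<open>auto simp: emeasure_lborel_Ioc less_imp_le\<close>)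
  also have "\<dots> \<le> measure lborel {x..y}"
  proof (rule measure_mono_fmeasurable)
    show "(\<Union>p\<in>D. {fst p<..snd p}) \<subseteq> {x..y}"
      using D by force
    show "(\<Union>p\<in>D. {fst p<..snd p}) \<in> sets lborel"
      using fin by (intro sets.finite_UN) auto
    show "{x..y} \<in> fmeasurable lborel"
      by (rule fmeasurableI) (use assms in auto)
  qed
  finally show ?thesis using assms by simp
qed

text \<open>Cut at \<open>y\<close>: an interval straddling \<open>y\<close> is replaced by its two
  parts, whose signed increments telescope through \<open>f y\<close>.\<close>

lemma nonoverlapping_in_split:
  assumes D: "nonoverlapping_in x z D" and xy: "x \<le> y" and yz: "y \<le> z"
  obtains D1 D2 where "nonoverlapping_in x y D1" "nonoverlapping_in y z D2"
    "increment_sum f D = increment_sum f D1 + increment_sum f D2"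
proof -
  define c1 :: "real \<times> real \<Rightarrow> real \<times> real" where "c1 p = (fst p, min (snd p) y)" for p
  define c2 :: "real \<times> real \<Rightarrow> real \<times> real" where "c2 p = (max (fst p) y, snd p)" for p
  let ?E1 = "{p\<in>D. fst p < y}" and ?E2 = "{p\<in>D. y < snd p}"
  have fin: "finite D" and DD: "\<And>p. p \<in> D \<Longrightarrow> x \<le> fst p \<and> fst p < snd p \<and> snd p \<le> z"
    and non: "\<And>p q. p \<in> D \<Longrightarrow> q \<in> D \<Longrightarrow> p \<noteq> q \<Longrightarrow> snd p \<le> fst q \<or> snd q \<le> fst p"
    using D by (auto simp: nonoverlapping_in_def)
  have inj1: "inj_on c1 ?E1"
    using non DD by (smt (verit) c1_def inj_onI mem_Collect_eq fst_conv)
  have inj2: "inj_on c2 ?E2"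
    using non DD by (smt (verit) c2_def inj_onI mem_Collect_eq snd_conv)
  have 1: "nonoverlapping_in x y (c1 ` ?E1)"
    unfolding nonoverlapping_in_def using fin DD non xy
    by (auto simp: c1_def) (metis less_le_not_le min.coboundedI1)+
  have 2: "nonoverlapping_in y z (c2 ` ?E2)"
    unfolding nonoverlapping_in_def using fin DD non yz
    by (auto simp: c2_def) (metis le_max_iff_disj)+
  have "increment_sum f (c1 ` ?E1) + increment_sum f (c2 ` ?E2)
      = (\<Sum>p\<in>?E1. f (min (snd p) y) - f (fst p)) + (\<Sum>p\<in>?E2. f (snd p) - f (max (fst p) y))"
    unfolding increment_sum_def sum.reindex[OF inj1] sum.reindex[OF inj2] by (simp add: o_def c1_def c2_def)
  also have "\<dots> = (\<Sum>p\<in>D. if fst p < y then f (min (snd p) y) - f (fst p) else 0)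
      + (\<Sum>p\<in>D. if y < snd p then f (snd p) - f (max (fst p) y) else 0)"
    using fin by (simp add: sum.inter_filter)
  also have "\<dots> = (\<Sum>p\<in>D. (if fst p < y then f (min (snd p) y) - f (fst p) else 0)
      + (if y < snd p then f (snd p) - f (max (fst p) y) else 0))"
    by (simp add: sum.distrib)
  also have "\<dots> = increment_sum f D"
    unfolding increment_sum_def
    by (intro sum.cong refl) (use DD in \<open>force simp: min_def max_def\<close>)
  finally show ?thesis using that[OF 1 2] by simp
qed

text \<open>The definition of \<open>ac_on\<close> numbers the intervals by an initial segment of
  the naturals. Families met later are indexed by pairs of reals or by sets of reals, so the
  condition is transported once along a bijection.\<close>

lemma ac_on_family:
  fixes f :: "real \<Rightarrow> 'a::real_normed_vector"
  assumes "ac_on a b f" "0 < e"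
  obtains d where "0 < d"
    "\<forall>(I::'i set) u v. finite I \<longrightarrow> (\<forall>i\<in>I. a \<le> u i \<and> u i \<le> v i \<and> v i \<le> b) \<longrightarrow>
       (\<forall>i\<in>I. \<forall>j\<in>I. i \<noteq> j \<longrightarrow> v i \<le> u j \<or> v j \<le> u i) \<longrightarrow>
       (\<Sum>i\<in>I. v i - u i) < d \<longrightarrow> (\<Sum>i\<in>I. norm (f (v i) - f (u i))) < e"
proof -
  obtain d where d: "d > 0" and H: "\<forall>(n::nat) (u::nat \<Rightarrow> real) v.
      (\<forall>i<n. a \<le> u i \<and> u i \<le> v i \<and> v i \<le> b)
      \<and> (\<forall>i<n. \<forall>j<n. i \<noteq> j \<longrightarrow> v i \<le> u j \<or> v j \<le> u i)
      \<and> (\<Sum>i<n. v i - u i) < d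
      \<longrightarrow> (\<Sum>i<n. norm (f (v i) - f (u i))) < e"
    using assms unfolding ac_on_def by blast
  show ?thesis
  proof (rule that[OF d], intro allI impI)
    fix I :: "'i set" and u v :: "'i \<Rightarrow> real"
    assume A: "finite I" "\<forall>i\<in>I. a \<le> u i \<and> u i \<le> v i \<and> v i \<le> b"
      "\<forall>i\<in>I. \<forall>j\<in>I. i \<noteq> j \<longrightarrow> v i \<le> u j \<or> v j \<le> u i" "(\<Sum>i\<in>I. v i - u i) < d"
    obtain h where h: "bij_betw h {0..<card I} I"
      using ex_bij_betw_nat_finite[OF A(1)] by blast
    have h': "bij_betw h {..<card I} I" using h by (simp add: lessThan_atLeast0)
    have hI: "\<And>i. i < card I \<Longrightarrow> h i \<in> I" using h' by (auto simp: bij_betw_def)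
    have hne: "\<And>i j. i < card I \<Longrightarrow> j < card I \<Longrightarrow> i \<noteq> j \<Longrightarrow> h i \<noteq> h j"
      using h' by (auto simp: bij_betw_def inj_on_def)
    have "(\<Sum>i<card I. norm (f (v (h i)) - f (u (h i)))) < e"
      using H[rule_format, of "card I" "\<lambda>i. u (h i)" "\<lambda>i. v (h i)"] A hI hne
        sum.reindex_bij_betw[OF h', of "\<lambda>i. v i - u i"] by simp
    then show "(\<Sum>i\<in>I. norm (f (v i) - f (u i))) < e"
      using sum.reindex_bij_betw[OF h', of "\<lambda>i. norm (f (v i) - f (u i))"] by simp
  qed
qed

lemma ac_on_increment_sum:
  fixes f :: "real \<Rightarrow> real"
  assumes "ac_on a b f" "0 < e"
  obtains d where "0 < d" "\<And>D. nonoverlapping_in a b D \<Longrightarrow> (\<Sum>p\<in>D. snd p - fst p) < d \<Longrightarrow> increment_sum f D < e"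
proof -
  obtain d where d: "0 < d"
    "\<forall>(I::(real\<times>real) set) u v. finite I \<longrightarrow> (\<forall>i\<in>I. a \<le> u i \<and> u i \<le> v i \<and> v i \<le> b) \<longrightarrow>
       (\<forall>i\<in>I. \<forall>j\<in>I. i \<noteq> j \<longrightarrow> v i \<le> u j \<or> v j \<le> u i) \<longrightarrow>
       (\<Sum>i\<in>I. v i - u i) < d \<longrightarrow> (\<Sum>i\<in>I. norm (f (v i) - f (u i))) < e"
    by (rule ac_on_family[OF assms])
  show ?thesis
  proof (rule that[OF d(1)])
    fix D assume D: "nonoverlapping_in a b D" "(\<Sum>p\<in>D. snd p - fst p) < d"
    have "increment_sum f D \<le> (\<Sum>p\<in>D. norm (f (snd p) - f (fst p)))"
      unfolding increment_sum_def by (intro sum_mono) auto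
    also have "\<dots> < e"
      using D by (intro d(2)[rule_format]) (auto simp: nonoverlapping_in_def less_imp_le)
    finally show "increment_sum f D < e" .
  qed
qed

text \<open>Absolute continuity with \<epsilon> = 1 bounds the sum by 1 on every stretch of length
  less than \<open>d\<close>, and finitely many stretches of length \<open>d / 2\<close> cover
  [a, b].\<close>

lemma ac_on_increment_sum_bounded:
  fixes f :: "real \<Rightarrow> real"
  assumes "ac_on a b f"
  obtains B where "\<And>D. nonoverlapping_in a b D \<Longrightarrow> increment_sum f D \<le> B"
proof -
  obtain d where d: "0 < d" "\<And>D. nonoverlapping_in a b D \<Longrightarrow> (\<Sum>p\<in>D. snd p - fst p) < d \<Longrightarrow> increment_sum f D < 1"
    using ac_on_increment_sum[OF assms, of 1] by auto
  \<comment> \<open>Induction on the number of stretches. Their length is \<open>d / 2\<close>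
    rather than \<open>d\<close> because the smallness condition is strict.\<close>
  have *: "increment_sum f D \<le> real n"
    if "nonoverlapping_in a y D" "a \<le> y" "y \<le> b" "y \<le> a + real n * (d / 2)" for n y D
    using that
  proof (induction n arbitrary: y D)
    case 0
    then have "D = {}" unfolding nonoverlapping_in_def by force
    then show ?case by simp
  next
    case (Suc n)
    let ?m = "a + real n * (d / 2)"
    show ?case
    proof (cases "y \<le> ?m")
      case True
      then show ?thesis using Suc.IH[OF Suc.prems(1-3)] by linarith
    next
      case False
      have "a \<le> ?m" using d by simp
      then obtain D1 D2 where D12: "nonoverlapping_in a ?m D1" "nonoverlapping_in ?m y D2"
          "increment_sum f D = increment_sum f D1 + increment_sum f D2"
        using nonoverlapping_in_split[OF Suc.prems(1), of ?m f] False by (metis nle_le)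
      have "increment_sum f D1 \<le> real n"
        using Suc.IH[OF D12(1)] Suc.prems False \<open>a \<le> ?m\<close> by linarith
      moreover have "increment_sum f D2 < 1"
      proof (rule d(2))
        show "nonoverlapping_in a b D2"
          using nonoverlapping_in_mono[OF D12(2)] \<open>a \<le> ?m\<close> Suc.prems by blast
        show "(\<Sum>p\<in>D2. snd p - fst p) < d"
          using nonoverlapping_in_length[OF D12(2)] False Suc.prems(4) d(1) by (simp add: field_simps)
      qed
      ultimately show ?thesis using D12(3) by simp
    qed
  qed
  obtain n where n: "b - a \<le> real n * (d / 2)"
    using d(1) by (meson ex_less_of_nat_mult half_gt_zero less_imp_le)
  show ?thesis
  proof (rule that[of "real n"])
    fix D assume D: "nonoverlapping_in a b D"
    show "increment_sum f D \<le> real n"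
    proof (cases "a \<le> b")
      case True then show ?thesis using *[OF D True order_refl, of n] n by linarith
    next
      case False
      then have "D = {}" using D unfolding nonoverlapping_in_def by force
      then show ?thesis by simp
    qed
  qed
qed

section \<open>Jordan decomposition through the positive variation\<close>

definition positive_variation :: "(real \<Rightarrow> real) \<Rightarrow> real \<Rightarrow> real \<Rightarrow> real" where
  "positive_variation f x y = Sup (increment_sum f ` {D. nonoverlapping_in x y D})"

context
  fixes f :: "real \<Rightarrow> real" and a b :: real
  assumes ac: "ac_on a b f"
begin

lemma bdd_above_increment_sum:
  assumes "a \<le> x" "y \<le> b"
  shows "bdd_above (increment_sum f ` {D. nonoverlapping_in x y D})"
proof -
  obtain B where "\<And>D. nonoverlapping_in a b D \<Longrightarrow> increment_sum f D \<le> B"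
    using ac_on_increment_sum_bounded[OF ac] by blast
  then show ?thesis using assms nonoverlapping_in_mono by (intro bdd_aboveI2[of _ _ B]) blast
qed

lemma increment_sum_le_positive_variation:
  assumes "a \<le> x" "y \<le> b" "nonoverlapping_in x y D"
  shows "increment_sum f D \<le> positive_variation f x y"
  unfolding positive_variation_def
  by (rule cSUP_upper[OF _ bdd_above_increment_sum]) (use assms in auto)

lemma positive_variation_subadditive:
  assumes "a \<le> x" "x \<le> y" "y \<le> z" "z \<le> b"
  shows "positive_variation f x z \<le> positive_variation f x y + positive_variation f y z"
  unfolding positive_variation_def[of f x z]
proof (rule cSUP_least)
  show "{D. nonoverlapping_in x z D} \<noteq> {}" using nonoverlapping_in_empty by blast
next
  fix D assume "D \<in> {D. nonoverlapping_in x z D}"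
  then obtain D1 D2 where "nonoverlapping_in x y D1" "nonoverlapping_in y z D2"
    "increment_sum f D = increment_sum f D1 + increment_sum f D2"
    using nonoverlapping_in_split[of x z D y f] assms by auto
  then show "increment_sum f D \<le> positive_variation f x y + positive_variation f y z"
    using increment_sum_le_positive_variation assms by (simp add: add_mono)
qed

text \<open>Nondegeneracy of the intervals makes the two families disjoint: a common member would
  have to end before \<open>y\<close> and start after it.\<close>

lemma increment_sum_Un:
  assumes "nonoverlapping_in x y D1" "nonoverlapping_in y z D2" "x \<le> y" "y \<le> z"
  shows "nonoverlapping_in x z (D1 \<union> D2)" "increment_sum f (D1 \<union> D2) = increment_sum f D1 + increment_sum f D2"
proof -
  have "D1 \<inter> D2 = {}" using assms(1,2) unfolding nonoverlapping_in_def by force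
  then show "increment_sum f (D1 \<union> D2) = increment_sum f D1 + increment_sum f D2"
    using assms(1,2) unfolding increment_sum_def nonoverlapping_in_def by (simp add: sum.union_disjoint)
  show "nonoverlapping_in x z (D1 \<union> D2)"
    using assms unfolding nonoverlapping_in_def by (auto; force)
qed

lemma positive_variation_superadditive:
  assumes "a \<le> x" "x \<le> y" "y \<le> z" "z \<le> b" "nonoverlapping_in y z D"
  shows "positive_variation f x y + increment_sum f D \<le> positive_variation f x z"
proof -
  have "positive_variation f x y \<le> positive_variation f x z - increment_sum f D"
    unfolding positive_variation_def[of f x y]
  proof (rule cSUP_least)
    show "{D. nonoverlapping_in x y D} \<noteq> {}" using nonoverlapping_in_empty by blast
  next
    fix D' assume "D' \<in> {D. nonoverlapping_in x y D}"
    then show "increment_sum f D' \<le> positive_variation f x z - increment_sum f D"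
      using increment_sum_Un[of x y D' z D] assms increment_sum_le_positive_variation[of x z "D' \<union> D"] by simp
  qed
  then show ?thesis by simp
qed

text \<open>Use superadditivity with the empty family and with the single interval from
  \<open>x\<close> to \<open>y\<close>. The two inequalities say that the positive variation and its
  difference with \<open>f\<close> are both nondecreasing, which is a Jordan decomposition of
  \<open>f\<close>.\<close>

lemma positive_variation_mono:
  assumes "a \<le> x" "x \<le> y" "y \<le> b"
  shows "positive_variation f a x \<le> positive_variation f a y"
    "positive_variation f a x + (f y - f x) \<le> positive_variation f a y"
proof -
  show "positive_variation f a x \<le> positive_variation f a y"
    using positive_variation_superadditive[of a x y "{}"] assms by simp
  show "positive_variation f a x + (f y - f x) \<le> positive_variation f a y"
  proof (cases "x = y")
    case False
    then show ?thesis using positive_variation_superadditive[of a x y "{(x,y)}"] assms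
      by (simp add: nonoverlapping_in_def increment_sum_def)
  qed simp
qed

text \<open>Inside each given interval choose a family that almost attains the positive variation
  there. Together these form one family in [a, b] whose total length is still below
  \<open>d\<close>, so absolute continuity of \<open>f\<close> itself bounds the sum.\<close>

lemma ac_on_positive_variation: "ac_on a b (positive_variation f a)"
  unfolding ac_on_def
proof (intro allI impI)
  fix e :: real assume e: "0 < e"
  then obtain d where d: "0 < d"
    "\<And>D. nonoverlapping_in a b D \<Longrightarrow> (\<Sum>p\<in>D. snd p - fst p) < d \<Longrightarrow> increment_sum f D < e / 2"
    using ac_on_increment_sum[OF ac, of "e / 2"] by auto
  show "\<exists>d>0. \<forall>(n::nat) (u::nat \<Rightarrow> real) v.
      (\<forall>i<n. a \<le> u i \<and> u i \<le> v i \<and> v i \<le> b)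
      \<and> (\<forall>i<n. \<forall>j<n. i \<noteq> j \<longrightarrow> v i \<le> u j \<or> v j \<le> u i)
      \<and> (\<Sum>i<n. v i - u i) < d
      \<longrightarrow> (\<Sum>i<n. norm (positive_variation f a (v i) - positive_variation f a (u i))) < e"
  proof (intro exI[of _ d] conjI allI impI; (elim conjE)?)
    fix n :: nat and u v :: "nat \<Rightarrow> real"
    assume uv: "\<forall>i<n. a \<le> u i \<and> u i \<le> v i \<and> v i \<le> b"
      and non: "\<forall>i<n. \<forall>j<n. i \<noteq> j \<longrightarrow> v i \<le> u j \<or> v j \<le> u i"
      and small: "(\<Sum>i<n. v i - u i) < d"
    \<comment> \<open>Each of the \<open>n\<close> choices loses at most \<open>eta\<close>, in
      total less than \<open>e / 2\<close>; the \<open>+ 1\<close> covers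
      \<open>n = 0\<close>.\<close>
    define eta where "eta = e / (4 * (real n + 1))"
    have eta: "eta > 0" "real n * eta < e / 2" using e by (simp_all add: eta_def field_simps add_pos_nonneg)
    have "\<exists>D. nonoverlapping_in (u i) (v i) D \<and> positive_variation f (u i) (v i) < increment_sum f D + eta"
      if "i < n" for i
    proof -
      have "positive_variation f (u i) (v i) - eta < Sup (increment_sum f ` {D. nonoverlapping_in (u i) (v i) D})"
        unfolding positive_variation_def using eta by simp
      then show ?thesis
        using less_cSUP_iff[OF _ bdd_above_increment_sum[of "u i" "v i"]] uv that nonoverlapping_in_empty
        by (smt (verit, ccfv_threshold) empty_iff mem_Collect_eq)
    qed
    then obtain D where D: "\<And>i. i < n \<Longrightarrow> nonoverlapping_in (u i) (v i) (D i)"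
      "\<And>i. i < n \<Longrightarrow> positive_variation f (u i) (v i) < increment_sum f (D i) + eta" by metis
    have disj: "D i \<inter> D j = {}" if "i < n" "j < n" "i \<noteq> j" for i j
    proof (rule ccontr)
      assume "D i \<inter> D j \<noteq> {}"
      then obtain p where "p \<in> D i" "p \<in> D j" by blast
      then have "u i \<le> fst p" "u j \<le> fst p" "fst p < snd p" "snd p \<le> v i" "snd p \<le> v j"
        using D(1)[OF that(1)] D(1)[OF that(2)] by (auto simp: nonoverlapping_in_def)
      then show False using non that by force
    qed
    let ?D = "\<Union>i<n. D i"
    have sums: "(\<Sum>p\<in>?D. g p) = (\<Sum>i<n. \<Sum>p\<in>D i. g p)" for g :: "real \<times> real \<Rightarrow> real"
      by (rule sum.UNION_disjoint) (use D(1) disj in \<open>auto simp: nonoverlapping_in_def\<close>)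
    have "nonoverlapping_in a b ?D"
      unfolding nonoverlapping_in_def
    proof (intro conjI ballI impI)
      show "finite ?D" using D(1) by (auto simp: nonoverlapping_in_def)
    next
      fix p q assume "p \<in> ?D" "q \<in> ?D" "p \<noteq> q"
      then obtain i j where ij: "i < n" "p \<in> D i" "j < n" "q \<in> D j" by blast
      show "snd p \<le> fst q \<or> snd q \<le> fst p"
      proof (cases "i = j")
        case True then show ?thesis using D(1)[OF ij(1)] ij \<open>p \<noteq> q\<close> by (auto simp: nonoverlapping_in_def)
      next
        case False
        then have "v i \<le> u j \<or> v j \<le> u i" using non ij by blast
        moreover have "snd p \<le> v i" "u i \<le> fst p" "snd q \<le> v j" "u j \<le> fst q"
          using D(1)[OF ij(1)] D(1)[OF ij(3)] ij by (auto simp: nonoverlapping_in_def)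
        ultimately show ?thesis by linarith
      qed
    qed (use D(1) uv in \<open>force simp: nonoverlapping_in_def\<close>)+
    moreover have "(\<Sum>p\<in>?D. snd p - fst p) < d"
    proof -
      have "(\<Sum>p\<in>?D. snd p - fst p) \<le> (\<Sum>i<n. v i - u i)"
        unfolding sums by (intro sum_mono nonoverlapping_in_length D(1)) (use uv in auto)
      then show ?thesis using small by simp
    qed
    ultimately have "(\<Sum>i<n. increment_sum f (D i)) < e / 2"
      using d(2)[of ?D] sums unfolding increment_sum_def by simp
    moreover have "(\<Sum>i<n. norm (positive_variation f a (v i) - positive_variation f a (u i)))
        \<le> (\<Sum>i<n. increment_sum f (D i) + eta)"
    proof (rule sum_mono)
      fix i assume "i \<in> {..<n}"
      then show "norm (positive_variation f a (v i) - positive_variation f a (u i)) \<le> increment_sum f (D i) + eta"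
        using positive_variation_mono(1)[of "u i" "v i"] positive_variation_subadditive[of a "u i" "v i"] uv D(2)[of i]
        by force
    qed
    ultimately show "(\<Sum>i<n. norm (positive_variation f a (v i) - positive_variation f a (u i))) < e"
      using eta(2) by (simp add: sum.distrib)
  qed (use d in auto)
qed

end

section \<open>Stieltjes measures and densities of absolutely continuous functions\<close>

lemma ac_on_imp_continuous_on:
  fixes f :: "real \<Rightarrow> 'a::real_normed_vector"
  assumes "ac_on a b f"
  shows "continuous_on {a..b} f"
  unfolding continuous_on_iff
proof (intro ballI allI impI)
  fix x e :: real assume x: "x \<in> {a..b}" and e: "0 < e"
  obtain d where d: "0 < d"
    "\<forall>(I::nat set) u v. finite I \<longrightarrow> (\<forall>i\<in>I. a \<le> u i \<and> u i \<le> v i \<and> v i \<le> b) \<longrightarrow>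
       (\<forall>i\<in>I. \<forall>j\<in>I. i \<noteq> j \<longrightarrow> v i \<le> u j \<or> v j \<le> u i) \<longrightarrow>
       (\<Sum>i\<in>I. v i - u i) < d \<longrightarrow> (\<Sum>i\<in>I. norm (f (v i) - f (u i))) < e"
    by (rule ac_on_family[OF assms e])
  have "dist (f y) (f x) < e" if "y \<in> {a..b}" "dist y x < d" for y
    using d(2)[rule_format, of "{0}" "\<lambda>_. min x y" "\<lambda>_. max x y"] that x
    by (cases "x \<le> y") (auto simp: dist_norm norm_minus_commute)
  then show "\<exists>d>0. \<forall>x'\<in>{a..b}. dist x' x < d \<longrightarrow> dist (f x') (f x) < e"
    using d(1) by blast
qed

text \<open>By outer regularity \<open>K\<close> lies in an open set of measure at most
  \<open>d / 2\<close>, and by compactness finitely many closed balls inside that set cover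
  \<open>K\<close>. Their union is subdivided into nonoverlapping intervals, and absolute continuity
  bounds the sum of the increments by \<open>e\<close>. Clamping the argument to [a, b] extends
  \<open>F\<close> to the monotone function on the whole line that \<open>interval_measure\<close>
  works with.\<close>

lemma emeasure_compact_null_interval_measure:
  fixes F :: "real \<Rightarrow> real"
  assumes ab: "a \<le> b" and ac: "ac_on a b F"
    and mono: "\<And>x y. a \<le> x \<Longrightarrow> x \<le> y \<Longrightarrow> y \<le> b \<Longrightarrow> F x \<le> F y"
    and K: "compact K" "K \<in> null_sets lborel"
  shows "emeasure (interval_measure (\<lambda>x. F (max a (min b x)))) K = 0"
proof -
  define c where "c x = max a (min b x)" for x
  define G where "G x = F (c x)" for x
  have c: "a \<le> c x" "c x \<le> b" "x \<le> y \<Longrightarrow> c x \<le> c y" for x y using ab by (auto simp: c_def)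
  have Gmono: "G x \<le> G y" if "x \<le> y" for x y unfolding G_def using mono c that by blast
  have Gcont: "continuous_on UNIV G"
    unfolding G_def using ab
    by (intro continuous_on_compose2[OF ac_on_imp_continuous_on[OF ac]])
       (auto simp: c_def intro!: continuous_intros)
  let ?M = "interval_measure G"
  have Icc: "emeasure ?M {x..y} = ennreal (G y - G x)" if "x \<le> y" for x y
    by (rule emeasure_interval_measure_Icc[OF that Gmono Gcont])
  have "emeasure ?M K \<le> ennreal e" if e: "e > 0" for e
  proof -
    obtain d where d: "0 < d"
      "\<forall>(I::real set set) u v. finite I \<longrightarrow> (\<forall>i\<in>I. a \<le> u i \<and> u i \<le> v i \<and> v i \<le> b) \<longrightarrow>
       (\<forall>i\<in>I. \<forall>j\<in>I. i \<noteq> j \<longrightarrow> v i \<le> u j \<or> v j \<le> u i) \<longrightarrow>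
       (\<Sum>i\<in>I. v i - u i) < d \<longrightarrow> (\<Sum>i\<in>I. norm (F (v i) - F (u i))) < e"
      by (rule ac_on_family[OF ac e])
    have Kb: "K \<in> sets borel" using K(1) by (simp add: borel_compact)
    obtain U where U: "open U" "K \<subseteq> U" "emeasure lborel (U - K) \<le> d / 2"
      using outer_regular_lborel_le[OF Kb, of "d / 2"] d(1) by auto
    have "emeasure lborel U = emeasure lborel (U - K)"
      using K(2) U(1) by (simp add: emeasure_Diff_null_set)
    then have U': "emeasure lborel U \<le> d / 2" using U(3) by simp
    have "\<exists>r>0. cball x r \<subseteq> U" if "x \<in> K" for x
      using U(1,2) that open_contains_cball by blast
    then obtain r where r: "\<And>x. x \<in> K \<Longrightarrow> r x > 0 \<and> cball x (r x) \<subseteq> U" by metis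
    obtain C where C: "C \<subseteq> K" "finite C" "K \<subseteq> (\<Union>x\<in>C. ball x (r x))"
    proof (rule compactE_image[OF K(1), of K "\<lambda>x. ball x (r x)"])
      show "K \<subseteq> (\<Union>x\<in>K. ball x (r x))" using r by force
    qed (use that in auto)
    define F' where "F' = (\<lambda>x. cball x (r x)) ` C"
    have KF: "K \<subseteq> \<Union>F'" proof
      fix x assume "x \<in> K"
      then obtain y where "y \<in> C" "x \<in> ball y (r y)" using C(3) by blast
      then show "x \<in> \<Union>F'" unfolding F'_def using ball_subset_cball by blast
    qed
    have FU: "\<Union>F' \<subseteq> U" unfolding F'_def using C(1) r by blast
    have "finite F'" "\<And>s. s \<in> F' \<Longrightarrow> \<exists>a b. s = cbox a b"
      unfolding F'_def using C(2) cball_eq_atLeastAtMost by (blast, metis cbox_interval imageE)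
    then obtain p where p: "p division_of \<Union>F'" using elementary_unions_intervals by blast
    have pf: "finite p" using p by (rule division_of_finite)
    have pk: "Inf k \<le> Sup k" "emeasure ?M k = ennreal (G (Sup k) - G (Inf k))"
      "measure lebesgue k = Sup k - Inf k" "k \<in> sets borel" "interior k = {Inf k<..<Sup k}"
      if kp: "k \<in> p" for k
    proof -
      obtain l u where "k = cbox l u" using division_ofD(4)[OF p kp] by blast
      moreover have "k \<noteq> {}" by (rule division_ofD(3)[OF p kp])
      ultimately have k: "k = {l..u}" "l \<le> u" by simp_all
      then show "Inf k \<le> Sup k" "measure lebesgue k = Sup k - Inf k" "k \<in> sets borel" "interior k = {Inf k<..<Sup k}"
        by (simp_all add: measure_completion)
      show "emeasure ?M k = ennreal (G (Sup k) - G (Inf k))" using k Icc by simp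
    qed
    \<comment> \<open>Degenerate intervals are dropped: only for nonempty interiors does
      disjointness of the interiors order two intervals.\<close>
    define q where "q = {k\<in>p. Inf k < Sup k}"
    have q: "finite q" "q \<subseteq> p" using pf by (auto simp: q_def)
    have "(\<Sum>k\<in>q. Sup k - Inf k) < d"
    proof -
      have "(\<Sum>k\<in>q. Sup k - Inf k) \<le> (\<Sum>k\<in>p. Sup k - Inf k)"
        by (rule sum_mono2) (use q pf pk(1) in auto)
      also have "\<dots> = (\<Sum>k\<in>p. measure lebesgue k)"
        using pk(3) by (intro sum.cong) auto
      also have "\<dots> = measure lebesgue (\<Union>F')" by (rule content_division[OF p])
      also have "\<dots> < d"
      proof -
        have m: "\<Union>F' \<in> sets borel"
          unfolding F'_def using C(2) by (intro sets.finite_Union) auto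
        have "emeasure lborel (\<Union>F') \<le> d / 2"
          using emeasure_mono[OF FU, of lborel] U' U(1) by simp
        then have "measure lborel (\<Union>F') \<le> d / 2"
          unfolding measure_def using d(1) by (intro enn2real_leI) auto
        then show ?thesis using m d(1) by (simp add: measure_completion)
      qed
      finally show ?thesis .
    qed
    moreover have "c v - c u \<le> v - u" if "u \<le> v" for u v using that by (auto simp: c_def)
    then have "(\<Sum>k\<in>q. c (Sup k) - c (Inf k)) \<le> (\<Sum>k\<in>q. Sup k - Inf k)"
      using pk(1) q(2) by (intro sum_mono) blast
    ultimately have small: "(\<Sum>k\<in>q. c (Sup k) - c (Inf k)) < d" by linarith
    have sep: "c (Sup k) \<le> c (Inf k') \<or> c (Sup k') \<le> c (Inf k)" if "k \<in> q" "k' \<in> q" "k \<noteq> k'" for k k'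
    proof -
      have "interior k \<inter> interior k' = {}" using division_ofD(5)[OF p] that q(2) by blast
      then have "{Inf k<..<Sup k} \<inter> {Inf k'<..<Sup k'} = {}"
        using pk(5) that q(2) by (metis subsetD)
      moreover have "Inf k < Sup k" "Inf k' < Sup k'" using that by (auto simp: q_def)
      ultimately have "Sup k \<le> Inf k' \<or> Sup k' \<le> Inf k"
      proof -
        assume *: "{Inf k<..<Sup k} \<inter> {Inf k'<..<Sup k'} = {}" "Inf k < Sup k" "Inf k' < Sup k'"
        \<comment> \<open>The test point is the midpoint of the would-be overlap.\<close>
        have "(max (Inf k) (Inf k') + min (Sup k) (Sup k')) / 2 \<notin> {Inf k<..<Sup k} \<inter> {Inf k'<..<Sup k'}"
          using *(1) by simp
        then show ?thesis using *(2,3) by (auto simp: field_simps min_def max_def split: if_splits)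
      qed
      then show ?thesis using c(3) by blast
    qed
    have "(\<Sum>k\<in>q. norm (F (c (Sup k)) - F (c (Inf k)))) < e"
      by (rule d(2)[rule_format]) (use q small sep c pk(1) in auto)
    then have lt: "(\<Sum>k\<in>q. G (Sup k) - G (Inf k)) < e"
      using sum_mono[of q "\<lambda>k. G (Sup k) - G (Inf k)" "\<lambda>k. norm (F (c (Sup k)) - F (c (Inf k)))"]
      unfolding G_def by force
    have "emeasure ?M K \<le> emeasure ?M (\<Union>p)"
    proof (rule emeasure_mono)
      show "K \<subseteq> \<Union>p" using KF division_ofD(6)[OF p] by simp
      show "\<Union>p \<in> sets ?M" using pf pk(4) by (intro sets.finite_Union) auto
    qed
    also have "\<dots> \<le> (\<Sum>k\<in>p. emeasure ?M k)"
      using emeasure_subadditive_finite[of p "\<lambda>k. k" ?M] pf pk(4) by (simp add: subset_eq)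
    also have "\<dots> = (\<Sum>k\<in>p. ennreal (G (Sup k) - G (Inf k)))"
      by (intro sum.cong refl pk(2))
    also have "\<dots> = ennreal (\<Sum>k\<in>p. G (Sup k) - G (Inf k))"
      by (rule sum_ennreal) (use Gmono pk(1) in auto)
    also have "(\<Sum>k\<in>p. G (Sup k) - G (Inf k)) = (\<Sum>k\<in>q. G (Sup k) - G (Inf k))"
      by (rule sum.mono_neutral_right) (use pf pk(1) in \<open>force simp: q_def not_less\<close>)+
    finally show ?thesis using lt by (meson ennreal_leI less_imp_le order_trans)
  qed
  then have "emeasure ?M K \<le> 0 + ennreal e" if "e > 0" for e using that by simp
  then have "emeasure ?M K \<le> 0" by (rule ennreal_le_epsilon)
  then show ?thesis unfolding G_def c_def by simp
qed

text \<open>The Stieltjes measure of a monotone absolutely continuous function is absolutely continuous,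
  so the Radon-Nikodym theorem applies.\<close>

lemma mono_ac_on_has_density:
  fixes F :: "real \<Rightarrow> real"
  assumes ab: "a \<le> b" and ac: "ac_on a b F"
    and mono: "\<And>x y. a \<le> x \<Longrightarrow> x \<le> y \<Longrightarrow> y \<le> b \<Longrightarrow> F x \<le> F y"
  obtains g where "g \<in> borel_measurable borel" "set_integrable lborel {a..b} g"
    "\<And>x. x \<in> {a..b} \<Longrightarrow> (LINT s:{a..x}|lborel. g s) = F x - F a"
proof -
  define c where "c x = max a (min b x)" for x
  define G where "G x = F (c x)" for x
  have c: "a \<le> c x" "c x \<le> b" "x \<le> y \<Longrightarrow> c x \<le> c y" for x y using ab by (auto simp: c_def)
  have Gmono: "G x \<le> G y" if "x \<le> y" for x y unfolding G_def using mono c that by blast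
  have Gcont: "continuous_on UNIV G"
    unfolding G_def using ab
    by (intro continuous_on_compose2[OF ac_on_imp_continuous_on[OF ac]])
       (auto simp: c_def intro!: continuous_intros)
  let ?M = "interval_measure G"
  have Icc: "emeasure ?M {x..y} = ennreal (G y - G x)" if "x \<le> y" for x y
    by (rule emeasure_interval_measure_Icc[OF that Gmono Gcont])
  have "emeasure ?M UNIV = (SUP n. emeasure ?M {- real n..real n})"
  proof -
    have "(\<Union>n. {- real n..real n}) = UNIV"
    proof (intro equalityI subsetI)
      fix x :: real
      obtain n :: nat where "\<bar>x\<bar> \<le> real n" using real_arch_simple by blast
      then have "x \<in> {- real n..real n}" by auto
      then show "x \<in> (\<Union>n. {- real n..real n})" by blast
    qed auto
    moreover have "incseq (\<lambda>n. {- real n..real n})" by (auto simp: incseq_def)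
    ultimately show ?thesis using SUP_emeasure_incseq[of "\<lambda>n. {- real n..real n}" ?M]
      by (metis (no_types, lifting) atLeastAtMost_borel image_subsetI sets_interval_measure)
  qed
  also have "\<dots> \<le> ennreal (F b - F a)"
  proof (rule SUP_least)
    fix n :: nat
    show "emeasure ?M {- real n..real n} \<le> ennreal (F b - F a)"
      using Icc[of "- real n" "real n"] mono[of a "c (- real n)"] mono[of "c (real n)" b] c
      by (auto simp: G_def intro!: ennreal_leI)
  qed
  finally have fin: "emeasure ?M UNIV < \<infinity>" using ennreal_less_top order_le_less_trans by (metis infinity_ennreal_def)
  have "absolutely_continuous lborel ?M"
    unfolding absolutely_continuous_def
  proof
    fix N :: "real set" assume N: "N \<in> null_sets lborel"
    then have Nb: "N \<in> sets borel" by auto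
    \<comment> \<open>Inner regularity of the finite measure reduces an arbitrary null set to its
      compact subsets.\<close>
    have "emeasure ?M N = (SUP K \<in> {K. K \<subseteq> N \<and> compact K}. emeasure ?M K)"
      by (rule inner_regular) (use fin Nb in auto)
    also have "\<dots> \<le> 0"
    proof (rule SUP_least)
      fix K assume "K \<in> {K. K \<subseteq> N \<and> compact K}"
      then have K: "compact K" "K \<in> null_sets lborel"
        using N null_sets_subset[of N lborel K] by (auto simp: borel_compact)
      show "emeasure ?M K \<le> 0"
        using emeasure_compact_null_interval_measure[OF ab ac mono K] unfolding G_def c_def by simp
    qed
    finally show "N \<in> null_sets ?M" using Nb by (auto simp: null_sets_def)
  qed
  then obtain f where f: "f \<in> borel_measurable lborel" "density lborel f = ?M"
    using sigma_finite_measure.Radon_Nikodym[OF sigma_finite_lborel, of ?M] by auto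
  have fb[measurable]: "f \<in> borel_measurable borel" using f(1) by simp
  have em: "emeasure ?M A = (\<integral>\<^sup>+s. f s * indicator A s \<partial>lborel)" if "A \<in> sets borel" for A
    using emeasure_density[OF f(1), of A] that f(2) by simp
  have "(\<integral>\<^sup>+s. f s \<partial>lborel) \<noteq> \<infinity>" using em[of UNIV] fin by simp
  \<comment> \<open>The density is extended-valued; finiteness of the total mass allows the passage
    to a real-valued one.\<close>
  then have ffin: "AE s in lborel. f s \<noteq> \<infinity>" by (rule nn_integral_PInf_AE[OF f(1)])
  define g where "g s = enn2real (f s)" for s
  have gm[measurable]: "g \<in> borel_measurable borel" unfolding g_def by measurable
  have hb: "has_bochner_integral lborel (\<lambda>s. indicator {x..y} s *\<^sub>R g s) (G y - G x)" if "x \<le> y" for x y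
  proof (rule has_bochner_integral_nn_integral)
    have "(\<integral>\<^sup>+s. ennreal (indicator {x..y} s *\<^sub>R g s) \<partial>lborel) = (\<integral>\<^sup>+s. f s * indicator {x..y} s \<partial>lborel)"
      by (rule nn_integral_cong_AE)
         (use ffin in \<open>auto simp: g_def indicator_def less_top elim!: eventually_mono\<close>)
    then show "(\<integral>\<^sup>+s. ennreal (indicator {x..y} s *\<^sub>R g s) \<partial>lborel) = ennreal (G y - G x)"
      using em[of "{x..y}"] Icc[OF that] by simp
  qed (use Gmono[OF that] in \<open>auto simp: g_def\<close>)
  show ?thesis
  proof (rule that[OF gm])
    show "set_integrable lborel {a..b} g"
      unfolding set_integrable_def using hb[OF ab] by (auto simp: has_bochner_integral_iff)
    fix x assume "x \<in> {a..b}"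
    then show "(LINT s:{a..x}|lborel. g s) = F x - F a"
      unfolding set_lebesgue_integral_def using hb[of a x] ab by (auto simp: has_bochner_integral_iff G_def c_def)
  qed
qed

text \<open>The sum over a family of intervals is bounded termwise. Differences, products, real
  parts, conjugates and Lipschitz functions are all handled as instances.\<close>

lemma ac_on_dominated:
  fixes f g :: "real \<Rightarrow> 'a::real_normed_vector" and h :: "real \<Rightarrow> 'b::real_normed_vector"
  assumes f: "ac_on a b f" and g: "ac_on a b g"
    and h: "\<And>x y. a \<le> x \<Longrightarrow> x \<le> y \<Longrightarrow> y \<le> b \<Longrightarrow> norm (h y - h x) \<le> C * (norm (f y - f x) + norm (g y - g x))"
  shows "ac_on a b h"
  unfolding ac_on_def
proof (intro allI impI)
  fix e :: real assume e: "0 < e"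
  define C' where "C' = \<bar>C\<bar> + 1"
  have C': "C' > 0" "C \<le> C'" by (auto simp: C'_def)
  define e' where "e' = e / (2 * C')"
  have e': "e' > 0" "C' * (e' + e') = e" using e C' by (simp_all add: e'_def field_simps)
  obtain d1 where d1: "0 < d1"
    "\<forall>(I::nat set) u v. finite I \<longrightarrow> (\<forall>i\<in>I. a \<le> u i \<and> u i \<le> v i \<and> v i \<le> b) \<longrightarrow>
       (\<forall>i\<in>I. \<forall>j\<in>I. i \<noteq> j \<longrightarrow> v i \<le> u j \<or> v j \<le> u i) \<longrightarrow>
       (\<Sum>i\<in>I. v i - u i) < d1 \<longrightarrow> (\<Sum>i\<in>I. norm (f (v i) - f (u i))) < e'"
    by (rule ac_on_family[OF f e'(1)])
  obtain d2 where d2: "0 < d2"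
    "\<forall>(I::nat set) u v. finite I \<longrightarrow> (\<forall>i\<in>I. a \<le> u i \<and> u i \<le> v i \<and> v i \<le> b) \<longrightarrow>
       (\<forall>i\<in>I. \<forall>j\<in>I. i \<noteq> j \<longrightarrow> v i \<le> u j \<or> v j \<le> u i) \<longrightarrow>
       (\<Sum>i\<in>I. v i - u i) < d2 \<longrightarrow> (\<Sum>i\<in>I. norm (g (v i) - g (u i))) < e'"
    by (rule ac_on_family[OF g e'(1)])
  show "\<exists>d>0. \<forall>(n::nat) (u::nat \<Rightarrow> real) v.
      (\<forall>i<n. a \<le> u i \<and> u i \<le> v i \<and> v i \<le> b)
      \<and> (\<forall>i<n. \<forall>j<n. i \<noteq> j \<longrightarrow> v i \<le> u j \<or> v j \<le> u i)
      \<and> (\<Sum>i<n. v i - u i) < d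
      \<longrightarrow> (\<Sum>i<n. norm (h (v i) - h (u i))) < e"
  proof (intro exI[of _ "min d1 d2"] conjI allI impI; (elim conjE)?)
    fix n :: nat and u v :: "nat \<Rightarrow> real"
    assume uv: "\<forall>i<n. a \<le> u i \<and> u i \<le> v i \<and> v i \<le> b"
      and non: "\<forall>i<n. \<forall>j<n. i \<noteq> j \<longrightarrow> v i \<le> u j \<or> v j \<le> u i"
      and small: "(\<Sum>i<n. v i - u i) < min d1 d2"
    have "(\<Sum>i<n. norm (h (v i) - h (u i)))
      \<le> (\<Sum>i<n. C' * (norm (f (v i) - f (u i)) + norm (g (v i) - g (u i))))"
    proof (rule sum_mono)
      fix i assume "i \<in> {..<n}"
      then have "norm (h (v i) - h (u i)) \<le> C * (norm (f (v i) - f (u i)) + norm (g (v i) - g (u i)))"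
        using h uv by simp
      also have "\<dots> \<le> C' * (norm (f (v i) - f (u i)) + norm (g (v i) - g (u i)))"
        using C' by (intro mult_right_mono) auto
      finally show "norm (h (v i) - h (u i)) \<le> C' * (norm (f (v i) - f (u i)) + norm (g (v i) - g (u i)))" .
    qed
    also have "\<dots> = C' * ((\<Sum>i<n. norm (f (v i) - f (u i))) + (\<Sum>i<n. norm (g (v i) - g (u i))))"
      by (simp only: sum.distrib[symmetric] sum_distrib_left[symmetric])
    also have "\<dots> < C' * (e' + e')"
    proof (rule mult_strict_left_mono[OF add_strict_mono C'(1)])
      show "(\<Sum>i<n. norm (f (v i) - f (u i))) < e'"
        by (rule d1(2)[rule_format]) (use uv non small in auto)
      show "(\<Sum>i<n. norm (g (v i) - g (u i))) < e'"
        by (rule d2(2)[rule_format]) (use uv non small in auto)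
    qed
    finally show "(\<Sum>i<n. norm (h (v i) - h (u i))) < e" using e'(2) by simp
  qed (use d1 d2 in auto)
qed

lemma ac_on_diff:
  fixes f g :: "real \<Rightarrow> 'a::real_normed_vector"
  assumes "ac_on a b f" "ac_on a b g"
  shows "ac_on a b (\<lambda>x. f x - g x)"
proof (rule ac_on_dominated[OF assms, where C = 1])
  show "norm ((f y - g y) - (f x - g x)) \<le> 1 * (norm (f y - f x) + norm (g y - g x))" for x y
    using norm_triangle_ineq4[of "f y - f x" "g y - g x"] by (simp add: algebra_simps)
qed

text \<open>Write \<open>f\<close> as the positive variation minus the nondecreasing remainder of
  the Jordan decomposition, and subtract the two densities.\<close>

lemma real_ac_on_has_density:
  fixes f :: "real \<Rightarrow> real"
  assumes ab: "a \<le> b" and ac: "ac_on a b f"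
  obtains g where "g \<in> borel_measurable borel" "set_integrable lborel {a..b} g"
    "\<And>x. x \<in> {a..b} \<Longrightarrow> (LINT s:{a..x}|lborel. g s) = f x - f a"
proof -
  let ?P = "positive_variation f a"
  have 1: "ac_on a b ?P" by (rule ac_on_positive_variation[OF ac])
  have 2: "ac_on a b (\<lambda>x. ?P x - f x)" by (rule ac_on_diff[OF 1 ac])
  obtain g1 where g1: "g1 \<in> borel_measurable borel" "set_integrable lborel {a..b} g1"
    "\<And>x. x \<in> {a..b} \<Longrightarrow> (LINT s:{a..x}|lborel. g1 s) = ?P x - ?P a"
    using mono_ac_on_has_density[OF ab 1 positive_variation_mono(1)[OF ac]] by blast
  obtain g2 where g2: "g2 \<in> borel_measurable borel" "set_integrable lborel {a..b} g2"
    "\<And>x. x \<in> {a..b} \<Longrightarrow> (LINT s:{a..x}|lborel. g2 s) = (?P x - f x) - (?P a - f a)"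
    using mono_ac_on_has_density[OF ab 2] positive_variation_mono(2)[OF ac] by (smt (verit, best))
  show ?thesis
  proof (rule that[of "\<lambda>s. g1 s - g2 s"])
    show "(\<lambda>s. g1 s - g2 s) \<in> borel_measurable borel" using g1 g2 by simp
    show "set_integrable lborel {a..b} (\<lambda>s. g1 s - g2 s)" using g1 g2 by simp
    fix x assume x: "x \<in> {a..b}"
    have "set_integrable lborel {a..x} g1" "set_integrable lborel {a..x} g2"
      by (rule set_integrable_subset[OF g1(2)] set_integrable_subset[OF g2(2)]; use x in auto)+
    then show "(LINT s:{a..x}|lborel. g1 s - g2 s) = f x - f a"
      using g1(3)[OF x] g2(3)[OF x] by (simp add: set_integral_diff)
  qed
qed

subsection \<open>Lebesgue differentiation\<close>

text \<open>A Vitali covering argument. Choose an open set around \<open>E\<close> of small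
  \<open>M\<close>-measure. The short intervals inside it whose \<open>M\<close>-mass exceeds
  \<open>al\<close> times their length cover the set finely, so a disjoint subfamily covers it up to
  a negligible set. The total length of that subfamily is at most the mass divided by
  \<open>al\<close>, hence at most \<open>e / 2\<close>.\<close>

lemma negligible_positive_upper_density:
  fixes M :: "real measure"
  assumes M: "sets M = sets borel" "emeasure M UNIV \<noteq> \<infinity>"
    and E: "E \<in> sets borel" "emeasure M E = 0" and al: "0 < al"
  shows "negligible {x\<in>E. \<forall>d>0. \<exists>u v. u \<le> x \<and> x \<le> v \<and> u < v \<and> v - u < d \<and> ennreal (al * (v - u)) < emeasure M {u..v}}"
    (is "negligible ?S")
  unfolding negligible_outer
proof (intro allI impI)
  fix e :: real assume e: "0 < e"
  have "emeasure M E = (INF U \<in> {U. E \<subseteq> U \<and> open U}. emeasure M U)"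
    by (rule outer_regular) (use M E sets_eq_imp_space_eq[OF M(1)] in auto)
  moreover have "(0::ennreal) < ennreal (al * e / 2)" using al e by simp
  ultimately obtain U where U: "E \<subseteq> U" "open U" "emeasure M U < ennreal (al * e / 2)"
    using E(2) by (metis (no_types, lifting) INF_less_iff mem_Collect_eq)
  \<comment> \<open>Intervals are indexed by their endpoints, while the covering theorem speaks of
    balls; \<open>ce\<close> and \<open>ra\<close> translate between the two.\<close>
  define K where "K = {(u, v). u < v \<and> {u..v} \<subseteq> U \<and> ennreal (al * (v - u)) < emeasure M {u..v}}"
  define ce where "ce = (\<lambda>(u::real, v). (u + v) / 2)"
  define ra where "ra = (\<lambda>(u::real, v). (v - u) / 2)"
  have cb: "cball (ce p) (ra p) = {fst p..snd p}" for p
    by (cases p) (simp add: ce_def ra_def cball_eq_atLeastAtMost field_simps)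
  obtain C where C: "countable C" "C \<subseteq> K"
    "pairwise (\<lambda>i j. disjnt (cball (ce i) (ra i)) (cball (ce j) (ra j))) C"
    "negligible (?S - (\<Union>i\<in>C. cball (ce i) (ra i)))"
  proof (rule Vitali_covering_theorem_cballs[of K ra ?S ce])
    show "0 < ra i" if "i \<in> K" for i using that by (auto simp: K_def ra_def)
    show "\<exists>i. i \<in> K \<and> x \<in> cball (ce i) (ra i) \<and> ra i < d" if x: "x \<in> ?S" and d: "0 < d" for x d
    proof -
      obtain r where r: "r > 0" "cball x r \<subseteq> U" using x U(1,2) open_contains_cball by blast
      have "0 < min r d" using r d by simp
      then obtain u v where uv: "u \<le> x" "x \<le> v" "u < v" "v - u < min r d" "ennreal (al * (v - u)) < emeasure M {u..v}"
        using x by blast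
      have "{u..v} \<subseteq> cball x r" using uv by (auto simp: cball_eq_atLeastAtMost)
      then have "(u, v) \<in> K" using uv r by (auto simp: K_def)
      moreover have "x \<in> cball (ce (u,v)) (ra (u,v))" unfolding cb using uv by simp
      moreover have "ra (u,v) < d" using uv by (simp add: ra_def)
      ultimately show ?thesis by blast
    qed
  qed auto
  let ?T = "\<Union>p\<in>C. {fst p..snd p}"
  have dis: "disjoint_family_on (\<lambda>p. {fst p..snd p}) C"
    using C(3) unfolding cb pairwise_def disjnt_def disjoint_family_on_def by blast
  have Tb: "?T \<in> sets borel" using C(1) by (intro sets.countable_UN') auto
  have "ennreal al * emeasure lborel ?T = ennreal al * (\<integral>\<^sup>+p. emeasure lborel {fst p..snd p} \<partial>count_space C)"
    by (subst emeasure_UN_countable[OF _ C(1) dis]) auto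
  also have "\<dots> = (\<integral>\<^sup>+p. ennreal al * emeasure lborel {fst p..snd p} \<partial>count_space C)"
    by (rule nn_integral_cmult[symmetric]) simp
  also have "\<dots> \<le> (\<integral>\<^sup>+p. emeasure M {fst p..snd p} \<partial>count_space C)"
  proof (rule nn_integral_mono)
    fix p assume "p \<in> space (count_space C)"
    then have "p \<in> K" using C(2) by auto
    then show "ennreal al * emeasure lborel {fst p..snd p} \<le> emeasure M {fst p..snd p}"
      using al by (auto simp: K_def ennreal_mult' less_imp_le split: prod.splits)
  qed
  also have "\<dots> = emeasure M ?T"
    by (rule emeasure_UN_countable[OF _ C(1) dis, symmetric]) (use M in auto)
  also have "\<dots> \<le> emeasure M U"
  proof (rule emeasure_mono)
    show "?T \<subseteq> U" using C(2) unfolding K_def by fastforce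
  qed (use M U(2) in auto)
  also have "\<dots> \<le> ennreal (al * (e / 2))" using U(3) by (simp add: less_imp_le)
  also have "\<dots> = ennreal al * ennreal (e / 2)" using al e by (intro ennreal_mult) auto
  finally have le: "emeasure lborel ?T \<le> ennreal (e / 2)"
    using al by (simp add: ennreal_mult_le_mult_iff)
  have Tm: "?T \<in> lmeasurable" 
    using le Tb by (intro fmeasurableI) (auto simp: le_less_trans[OF _ ennreal_less_top] simp del: emeasure_UN_countable)
  have Tl: "measure lebesgue ?T \<le> e / 2"
  proof -
    have "enn2real (emeasure lborel ?T) \<le> e / 2" by (rule enn2real_leI) (use le e in auto)
    then show ?thesis using Tb by (simp add: measure_completion measure_def)
  qed
  let ?N = "?S - ?T"
  have N: "negligible ?N" using C(4) unfolding cb .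
  show "\<exists>T. ?S \<subseteq> T \<and> T \<in> lmeasurable \<and> measure lebesgue T < e"
  proof (intro exI conjI)
    show "?S \<subseteq> ?T \<union> ?N" by blast
    show "?T \<union> ?N \<in> lmeasurable"       by (rule fmeasurable.Un[OF Tm negligible_imp_measurable[OF N]])
    have "measure lebesgue (?T \<union> ?N) = measure lebesgue ?T"
      by (rule measure_Un_null_set) (use N Tb in \<open>auto simp: negligible_iff_null_sets\<close>)
    then show "measure lebesgue (?T \<union> ?N) < e" using Tl e by simp
  qed
qed

text \<open>If averages over arbitrarily short intervals around \<open>x\<close> exceed
  \<open>g x + e\<close>, choose rationals with \<open>g x < r\<close> and
  \<open>r + al < g x + e\<close>. The measure with density \<open>max 0 (g - r)\<close> gives no
  mass to the set where \<open>g\<close> is at most \<open>r\<close>, which contains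
  \<open>x\<close>, yet more than \<open>al\<close> times their length to these intervals. So
  \<open>x\<close> lies in one of countably many negligible sets.\<close>

lemma negligible_upper_average:
  fixes g :: "real \<Rightarrow> real"
  assumes g: "integrable lborel g"
  shows "negligible {x\<in>{A<..<B}. \<exists>e>0. \<forall>d>0. \<exists>u v. u \<le> x \<and> x \<le> v \<and> u < v \<and> v - u < d
           \<and> (g x + e) * (v - u) < (LINT s:{u..v}|lborel. g s)}" (is "negligible ?S")
proof -
  have gm[measurable]: "g \<in> borel_measurable borel" using g by auto
  define h where "h r s = indicator {A..B} s * max 0 (g s - r)" for r s
  define M where "M r = density lborel (\<lambda>s. ennreal (h r s))" for r
  have hm[measurable]: "h r \<in> borel_measurable borel" for r unfolding h_def by measurable
  have h0: "0 \<le> h r s" for r s by (simp add: h_def)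
  have hint: "integrable lborel (h r)" for r
  proof (rule Bochner_Integration.integrable_bound)
    show "integrable lborel (\<lambda>s. norm (g s) + \<bar>r\<bar> * indicator {A..B} s)"
      using g by (intro Bochner_Integration.integrable_add integrable_norm integrable_mult_right integrable_real_indicator) (auto simp: emeasure_lborel_Icc_eq)
  qed (auto simp: h_def indicator_def intro!: AE_I2)
  have Mem: "emeasure (M r) X = (\<integral>\<^sup>+s. ennreal (h r s) * indicator X s \<partial>lborel)" if "X \<in> sets borel" for r X
    unfolding M_def using that by (simp add: emeasure_density)
  have Mfin: "emeasure (M r) UNIV \<noteq> \<infinity>" for r
    using Mem[of UNIV r] nn_integral_eq_integral[OF hint AE_I2[OF h0]] by simp
  have Ms: "sets (M r) = sets borel" for r by (simp add: M_def)
  define E where "E r = {x\<in>{A<..<B}. g x \<le> r}" for r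
  have Eb: "E r \<in> sets borel" for r unfolding E_def by measurable
  have E0: "emeasure (M r) (E r) = 0" for r
    unfolding Mem[OF Eb] by (subst nn_integral_0_iff_AE) (auto simp: h_def E_def indicator_def)
  define N where "N r al = {x\<in>E r. \<forall>d>0. \<exists>u v. u \<le> x \<and> x \<le> v \<and> u < v \<and> v - u < d \<and> ennreal (al * (v - u)) < emeasure (M r) {u..v}}" for r al
  have Nn: "negligible (N r al)" if "al > 0" for r al
    unfolding N_def by (rule negligible_positive_upper_density[OF Ms Mfin Eb E0 that])
  have "?S \<subseteq> (\<Union>r\<in>\<rat>. \<Union>al\<in>{q\<in>\<rat>. q > 0}. N r al)"
  proof
    fix x assume "x \<in> ?S"
    then obtain e where x: "A < x" "x < B" and e: "e > 0" and
      H: "\<And>d. d > 0 \<Longrightarrow> \<exists>u v. u \<le> x \<and> x \<le> v \<and> u < v \<and> v - u < d \<and> (g x + e) * (v - u) < (LINT s:{u..v}|lborel. g s)"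
      by auto
    obtain r where r: "r \<in> \<rat>" "g x < r" "r < g x + e / 2" using Rats_dense_in_real[of "g x" "g x + e / 2"] e by auto
    obtain al where al: "al \<in> \<rat>" "0 < al" "al < e / 2" using Rats_dense_in_real[of 0 "e / 2"] e by auto
    have "x \<in> N r al"
      unfolding N_def
    proof (intro CollectI conjI allI impI)
      show "x \<in> E r" using x r by (simp add: E_def)
      fix d :: real assume d: "d > 0"
      \<comment> \<open>The intervals are taken so short that they stay inside [A, B], where the
        cut-off in \<open>h\<close> equals 1.\<close>
      obtain u v where uv: "u \<le> x" "x \<le> v" "u < v" "v - u < min d (min (x - A) (B - x))"
        "(g x + e) * (v - u) < (LINT s:{u..v}|lborel. g s)"
        using H[of "min d (min (x - A) (B - x))"] d x by auto
      have sub: "{u..v} \<subseteq> {A..B}" using uv by auto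
      have i1: "integrable lborel (\<lambda>s. indicator {u..v} s * g s)"
        using integrable_real_mult_indicator[of "{u..v}" lborel g] g by (simp add: mult.commute)
      have i2: "integrable lborel (\<lambda>s. indicator {u..v} s * h r s)"
        using integrable_real_mult_indicator[of "{u..v}" lborel "h r"] hint by (simp add: mult.commute)
      have i3: "integrable lborel (\<lambda>s. r * indicator {u..v} s)"
        by (intro integrable_mult_right integrable_real_indicator) (auto simp: emeasure_lborel_Icc_eq)
      have "(LINT s:{u..v}|lborel. g s) \<le> (\<integral>s. r * indicator {u..v} s + indicator {u..v} s * h r s \<partial>lborel)"
        unfolding set_lebesgue_integral_def
        by (rule integral_mono) (use i1 i2 i3 sub in \<open>auto simp: h_def indicator_def\<close>)
      also have "\<dots> = r * (v - u) + (\<integral>s. indicator {u..v} s * h r s \<partial>lborel)"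
        using i2 i3 uv by (simp add: measure_lborel_Icc)
      finally have "al * (v - u) < (\<integral>s. indicator {u..v} s * h r s \<partial>lborel)"
        using uv(5) mult_strict_right_mono[of "r + al" "g x + e" "v - u"] r al uv(3) by (simp add: algebra_simps)
      moreover have "emeasure (M r) {u..v} = ennreal (\<integral>s. indicator {u..v} s * h r s \<partial>lborel)"
      proof -
        have "emeasure (M r) {u..v} = (\<integral>\<^sup>+s. ennreal (indicator {u..v} s * h r s) \<partial>lborel)"
          by (subst Mem) (auto intro!: nn_integral_cong simp: indicator_def)
        also have "\<dots> = ennreal (\<integral>s. indicator {u..v} s * h r s \<partial>lborel)"
          by (rule nn_integral_eq_integral[OF i2]) (use h0 in auto)
        finally show ?thesis .
      qed
      ultimately have "ennreal (al * (v - u)) < emeasure (M r) {u..v}"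
        using al uv(3) by (simp add: ennreal_less_iff)
      then show "\<exists>u v. u \<le> x \<and> x \<le> v \<and> u < v \<and> v - u < d \<and> ennreal (al * (v - u)) < emeasure (M r) {u..v}"
        using uv by auto
    qed
    then show "x \<in> (\<Union>r\<in>\<rat>. \<Union>al\<in>{q\<in>\<rat>. q > 0}. N r al)" using r al by blast
  qed
  moreover have "negligible (\<Union>r\<in>\<rat>. \<Union>al\<in>{q\<in>\<rat>. q > 0}. N r al)"
    by (intro negligible_countable_Union countable_image countable_rat)
       (auto intro!: negligible_countable_Union countable_image Nn intro: countable_subset[OF _ countable_rat])
  ultimately show ?thesis by (rule negligible_subset[rotated])
qed

text \<open>The one-sided estimate is applied to \<open>g\<close> and to \<open>- g\<close>. The
  intervals there need only contain \<open>x\<close>, so \<open>x\<close> may be an endpoint, which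
  is the case of a difference quotient.\<close>

lemma lebesgue_differentiation_real:
  fixes g :: "real \<Rightarrow> real"
  assumes g: "integrable lborel g"
  obtains N where "negligible N"
    "\<And>x. x \<in> {A<..<B} - N \<Longrightarrow> ((\<lambda>y. LINT s:{A..y}|lborel. g s) has_real_derivative g x) (at x)"
proof -
  define S1 where "S1 = {x\<in>{A<..<B}. \<exists>e>0. \<forall>d>0. \<exists>u v. u \<le> x \<and> x \<le> v \<and> u < v \<and> v - u < d
           \<and> (g x + e) * (v - u) < (LINT s:{u..v}|lborel. g s)}"
  define S2 where "S2 = {x\<in>{A<..<B}. \<exists>e>0. \<forall>d>0. \<exists>u v. u \<le> x \<and> x \<le> v \<and> u < v \<and> v - u < d
           \<and> (- g x + e) * (v - u) < (LINT s:{u..v}|lborel. - g s)}"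
  have n: "negligible (S1 \<union> S2)"
    using negligible_upper_average[OF g, of A B] negligible_upper_average[of "\<lambda>x. - g x" A B] g
    unfolding S1_def S2_def by (intro negligible_Un) auto
  have si: "set_integrable lborel {u..v} g" for u v
    using g unfolding set_integrable_def by (intro integrable_mult_indicator) auto
  have "((\<lambda>y. LINT s:{A..y}|lborel. g s) has_real_derivative g x) (at x)" if x: "x \<in> {A<..<B} - (S1 \<union> S2)" for x
  proof -
    let ?G = "\<lambda>y. LINT s:{A..y}|lborel. g s"
    have Gd: "?G v - ?G u = (LINT s:{u..v}|lborel. g s)" if "A \<le> u" "u \<le> v" for u v
    proof -
      have "(LINT s:{A..v}|lborel. g s) = (LINT s:{A..u} \<union> {u<..v}|lborel. g s)"
        using that by (simp add: ivl_disj_un)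
      also have "\<dots> = (LINT s:{A..u}|lborel. g s) + (LINT s:{u<..v}|lborel. g s)"
      proof (rule set_integral_Un)
        show "set_integrable lborel {u<..v} g" by (rule set_integrable_subset[OF si[of u v]]) auto
      qed (use si in auto)
      also have "(LINT s:{u<..v}|lborel. g s) = (LINT s:{u..v}|lborel. g s)"
        unfolding set_lebesgue_integral_def
        by (rule integral_cong_AE) (use g AE_lborel_singleton[of u] in \<open>auto simp: indicator_def elim!: eventually_mono\<close>)
      finally show ?thesis by simp
    qed
    have key: "\<exists>d>0. \<forall>u v. u \<le> x \<and> x \<le> v \<and> u < v \<and> v - u < d \<longrightarrow>
        \<bar>(LINT s:{u..v}|lborel. g s) - g x * (v - u)\<bar> \<le> e * (v - u)" if e: "e > 0" for e
    proof -
      define Q1 where "Q1 e d u v \<longleftrightarrow> u \<le> x \<and> x \<le> v \<and> u < v \<and> v - u < d \<and> (g x + e) * (v - u) < (LINT s:{u..v}|lborel. g s)" for e d u v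
      have "\<not> (\<exists>e>0. \<forall>d>0. \<exists>u v. Q1 e d u v)"
      proof -
        have "x \<in> S1 \<longleftrightarrow> x \<in> {A<..<B} \<and> (\<exists>e>0. \<forall>d>0. \<exists>u v. Q1 e d u v)"
          unfolding S1_def Q1_def by (rule mem_Collect_eq)
        then show ?thesis using x by blast
      qed
      then obtain d1 where d1: "d1 > 0" "\<forall>u v. \<not> Q1 e d1 u v"
        using e by blast
      define Q2 where "Q2 e d u v \<longleftrightarrow> u \<le> x \<and> x \<le> v \<and> u < v \<and> v - u < d \<and> (- g x + e) * (v - u) < (LINT s:{u..v}|lborel. - g s)" for e d u v
      have "\<not> (\<exists>e>0. \<forall>d>0. \<exists>u v. Q2 e d u v)"
      proof -
        have "x \<in> S2 \<longleftrightarrow> x \<in> {A<..<B} \<and> (\<exists>e>0. \<forall>d>0. \<exists>u v. Q2 e d u v)"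
          unfolding S2_def Q2_def by (rule mem_Collect_eq)
        then show ?thesis using x by blast
      qed
      then obtain d2 where d2: "d2 > 0" "\<forall>u v. \<not> Q2 e d2 u v"
        using e by blast
      have neg: "(LINT s:{u..v}|lborel. - g s) = - (LINT s:{u..v}|lborel. g s)" for u v
        unfolding set_lebesgue_integral_def by simp
      show ?thesis
      proof (intro exI[of _ "min d1 d2"] conjI allI impI)
        fix u v assume uv: "u \<le> x \<and> x \<le> v \<and> u < v \<and> v - u < min d1 d2"
        then have "\<not> (g x + e) * (v - u) < (LINT s:{u..v}|lborel. g s)"
          "\<not> (- g x + e) * (v - u) < - (LINT s:{u..v}|lborel. g s)"
          using d1(2) d2(2) neg by (auto simp: Q1_def Q2_def)
        then show "\<bar>(LINT s:{u..v}|lborel. g s) - g x * (v - u)\<bar> \<le> e * (v - u)"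
          by (simp add: abs_le_iff algebra_simps)
      qed (use d1 d2 in auto)
    qed
    have "((\<lambda>y. (?G y - ?G x) / (y - x)) \<longlongrightarrow> g x) (at x)"
      unfolding LIM_eq
    proof (intro allI impI)
      fix r :: real assume "r > 0"
      then obtain d where d: "d > 0" "\<And>u v. u \<le> x \<Longrightarrow> x \<le> v \<Longrightarrow> u < v \<Longrightarrow> v - u < d \<Longrightarrow>
        \<bar>(LINT s:{u..v}|lborel. g s) - g x * (v - u)\<bar> \<le> r / 2 * (v - u)"
        using key[of "r / 2"] by auto
      have "norm ((?G y - ?G x) / (y - x) - g x) < r" if y: "y \<noteq> x" "norm (y - x) < min d (x - A)" for y
      proof (cases "x < y")
        case True
        then have "\<bar>(?G y - ?G x) - g x * (y - x)\<bar> \<le> r / 2 * (y - x)"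
          using d(2)[of x y] Gd[of x y] y x by simp
        then have "\<bar>(?G y - ?G x) / (y - x) - g x\<bar> \<le> r / 2"
          using True by (simp add: field_simps abs_le_iff)
        then show ?thesis using \<open>r > 0\<close> by simp
      next
        case False
        then have "y < x" using y by simp
        then have "\<bar>(?G x - ?G y) - g x * (x - y)\<bar> \<le> r / 2 * (x - y)"
          using d(2)[of y x] Gd[of y x] y x by simp
        then have "\<bar>(?G y - ?G x) / (y - x) - g x\<bar> \<le> r / 2"
          using \<open>y < x\<close> by (simp add: field_simps abs_if split: if_splits)
        then show ?thesis using \<open>r > 0\<close> by simp
      qed
      then show "\<exists>s>0. \<forall>y. y \<noteq> x \<and> norm (y - x) < s \<longrightarrow> norm ((?G y - ?G x) / (y - x) - g x) < r"
        using d(1) x by (intro exI[of _ "min d (x - A)"]) auto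
    qed
    then show ?thesis by (simp add: has_field_derivative_iff)
  qed
  then show ?thesis using that[OF n] by blast
qed

section \<open>Closure properties and indefinite integrals\<close>

lemma ac_on_Re: "ac_on a b f \<Longrightarrow> ac_on a b (\<lambda>x. Re (f x))"
  by (rule ac_on_dominated[where f = f and g = f and C = 1])
     (auto simp flip: minus_complex.sel intro: order_trans[OF abs_Re_le_cmod] add_increasing2)

lemma ac_on_Im: "ac_on a b f \<Longrightarrow> ac_on a b (\<lambda>x. Im (f x))"
  by (rule ac_on_dominated[where f = f and g = f and C = 1])
     (auto simp flip: minus_complex.sel intro: order_trans[OF abs_Im_le_cmod] add_increasing2)

lemma ac_on_cnj: "ac_on a b f \<Longrightarrow> ac_on a b (\<lambda>x. cnj (f x))"
  by (rule ac_on_dominated[where f = f and g = f and C = 1])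
     (auto simp flip: complex_cnj_diff)

lemma ac_on_mult:
  fixes f g :: "real \<Rightarrow> 'a::real_normed_algebra"
  assumes f: "ac_on a b f" and g: "ac_on a b g"
  shows "ac_on a b (\<lambda>x. f x * g x)"
proof -
  have "bounded (f ` {a..b})" "bounded (g ` {a..b})"
    using f g by (auto intro!: compact_imp_bounded compact_continuous_image ac_on_imp_continuous_on)
  then obtain A B where A: "\<And>x. x \<in> {a..b} \<Longrightarrow> norm (f x) \<le> A" and B: "\<And>x. x \<in> {a..b} \<Longrightarrow> norm (g x) \<le> B"
    unfolding bounded_iff by blast
  show ?thesis
  proof (rule ac_on_dominated[OF f g, where C = "max A B"])
    fix x y assume xy: "a \<le> x" "x \<le> y" "y \<le> b"
    have "f y * g y - f x * g x = (f y - f x) * g y + f x * (g y - g x)" by (simp add: algebra_simps)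
    then have "norm (f y * g y - f x * g x) \<le> norm (f y - f x) * norm (g y) + norm (f x) * norm (g y - g x)"
      by (metis (no_types) norm_triangle_mono norm_mult_ineq)
    also have "\<dots> \<le> norm (f y - f x) * max A B + max A B * norm (g y - g x)"
      by (intro add_mono mult_left_mono mult_right_mono) (use A[of x] B[of y] xy in auto)
    finally show "norm (f y * g y - f x * g x) \<le> max A B * (norm (f y - f x) + norm (g y - g x))"
      by (simp add: algebra_simps)
  qed
qed

lemma lipschitz_imp_ac_on:
  fixes h :: "real \<Rightarrow> 'b::real_normed_vector"
  assumes "\<And>x y. a \<le> x \<Longrightarrow> x \<le> y \<Longrightarrow> y \<le> b \<Longrightarrow> norm (h y - h x) \<le> C * (y - x)"
  shows "ac_on a b h"
proof -
  have id: "ac_on a b (\<lambda>x::real. x)"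
    unfolding ac_on_def by (auto intro!: exI)
  show ?thesis
  proof (rule ac_on_dominated[OF id id, where C = "\<bar>C\<bar>"])
    fix x y assume xy: "a \<le> x" "x \<le> y" "y \<le> b"
    have "C * (y - x) \<le> \<bar>C\<bar> * (y - x)" using xy by (intro mult_right_mono) auto
    also have "\<dots> \<le> \<bar>C\<bar> * (norm (y - x) + norm (y - x))" using xy by (intro mult_left_mono) auto
    finally show "norm (h y - h x) \<le> \<bar>C\<bar> * (norm (y - x) + norm (y - x))" using assms[OF xy] by linarith
  qed
qed

lemma C1_imp_ac_on:
  fixes h :: "real \<Rightarrow> 'b::real_normed_vector"
  assumes d: "\<And>x. x \<in> {a..b} \<Longrightarrow> (h has_vector_derivative h' x) (at x within {a..b})"
    and c: "continuous_on {a..b} h'"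
  shows "ac_on a b h"
proof -
  have "bounded (h' ` {a..b})" using c by (intro compact_imp_bounded compact_continuous_image) auto
  then obtain B where B: "\<And>x. x \<in> {a..b} \<Longrightarrow> norm (h' x) \<le> B" unfolding bounded_iff by blast
  show ?thesis
  proof (rule lipschitz_imp_ac_on[where C = B])
    fix x y assume xy: "a \<le> x" "x \<le> y" "y \<le> b"
    have "norm (h y - h x) \<le> B * norm (y - x)"
    proof (rule differentiable_bound[where S = "{a..b}" and f' = "\<lambda>x t. t *\<^sub>R h' x"])
      show "(h has_derivative (\<lambda>t. t *\<^sub>R h' s)) (at s within {a..b})" if "s \<in> {a..b}" for s
        using d[OF that] by (simp add: has_vector_derivative_def)
      show "onorm (\<lambda>t. t *\<^sub>R h' s) \<le> B" if "s \<in> {a..b}" for s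
        using mult_right_mono[OF B[OF that] abs_ge_zero] by (intro onorm_le) (simp add: mult.commute)
    qed (use xy in auto)
    then show "norm (h y - h x) \<le> B * (y - x)" using xy by simp
  qed
qed

text \<open>Truncation: the excess of the modulus of \<open>h\<close> over a large level
  \<open>n\<close> has integral below \<open>e / 2\<close>, and the part below the level contributes
  at most \<open>n\<close> times the total length of the intervals.\<close>

lemma ac_on_integral:
  fixes h :: "real \<Rightarrow> complex"
  assumes h: "h absolutely_integrable_on {a..b}"
  shows "ac_on a b (\<lambda>x. integral {a..x} h)"
  unfolding ac_on_def
proof (intro allI impI)
  fix e :: real assume e: "0 < e"
  define p where "p s = norm (indicator {a..b} s *\<^sub>R h s)" for s
  have pint: "integrable lebesgue p"
    using h unfolding p_def set_integrable_def by (rule integrable_norm)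
  have pm[measurable]: "p \<in> borel_measurable lebesgue" using pint by auto
  have p0: "0 \<le> p s" for s by (simp add: p_def)
  define psi where "psi n s = max 0 (p s - real n)" for n s
  have "(\<lambda>n. \<integral>s. psi n s \<partial>lebesgue) \<longlonglongrightarrow> (\<integral>s. 0 \<partial>(lebesgue :: real measure))"
  proof (rule integral_dominated_convergence[where w = p])
    show "AE s in lebesgue. (\<lambda>n. psi n s) \<longlonglongrightarrow> 0"
    proof (rule AE_I2, rule tendsto_eventually)
      fix s
      obtain N :: nat where "p s \<le> real N" using real_arch_simple by blast
      then show "\<forall>\<^sub>F n in sequentially. psi n s = 0"
        unfolding eventually_sequentially psi_def by (intro exI[of _ N]) auto
    qed
  qed (use p0 pint in \<open>auto simp: psi_def\<close>)
  then have "\<forall>\<^sub>F n in sequentially. (\<integral>s. psi n s \<partial>lebesgue) < e / 2"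
    using e by (intro order_tendstoD(2)[of _ 0]) auto
  then obtain n where n: "(\<integral>s. psi n s \<partial>lebesgue) < e / 2" by (auto simp: eventually_sequentially)
  have psim: "psi n \<in> borel_measurable lebesgue" unfolding psi_def by measurable
  have psii: "integrable lebesgue (psi n)"
    by (rule Bochner_Integration.integrable_bound[OF pint psim]) (auto simp: psi_def p_def)
  have psi0: "0 \<le> psi n s" for s by (simp add: psi_def)
  define d where "d = e / (2 * (real n + 1))"
  have d: "d > 0" "real n * d < e / 2" using e by (auto simp: d_def field_simps)
  show "\<exists>d>0. \<forall>(n::nat) (u::nat \<Rightarrow> real) v.
      (\<forall>i<n. a \<le> u i \<and> u i \<le> v i \<and> v i \<le> b)
      \<and> (\<forall>i<n. \<forall>j<n. i \<noteq> j \<longrightarrow> v i \<le> u j \<or> v j \<le> u i)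
      \<and> (\<Sum>i<n. v i - u i) < d
      \<longrightarrow> (\<Sum>i<n. norm (integral {a..v i} h - integral {a..u i} h)) < e"
  proof (intro exI[of _ d] conjI allI impI; (elim conjE)?)
    fix k :: nat and u v :: "nat \<Rightarrow> real"
    assume uv: "\<forall>i<k. a \<le> u i \<and> u i \<le> v i \<and> v i \<le> b"
      and non: "\<forall>i<k. \<forall>j<k. i \<noteq> j \<longrightarrow> v i \<le> u j \<or> v j \<le> u i"
      and small: "(\<Sum>i<k. v i - u i) < d"
    let ?I = "\<lambda>i. {u i<..v i}"
    have dis: "disjoint_family_on ?I {..<k}"
      unfolding disjoint_family_on_def
    proof (intro ballI impI)
      fix i j assume "i \<in> {..<k}" "j \<in> {..<k}" "i \<noteq> j"
      then have "v i \<le> u j \<or> v j \<le> u i" using non by auto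
      then show "?I i \<inter> ?I j = {}" by auto
    qed
    have ii: "integrable lebesgue (\<lambda>s. indicator (?I i) s * psi n s)" for i
      using integrable_mult_indicator[OF _ psii, of "?I i"] by simp
    have "norm (integral {a..v i} h - integral {a..u i} h) \<le> (\<integral>s. indicator (?I i) s * psi n s \<partial>lebesgue) + real n * (v i - u i)"
      if i: "i < k" for i
    proof -
      have le: "a \<le> u i" "u i \<le> v i" "v i \<le> b" using uv i by auto
      have hI: "h absolutely_integrable_on {a..v i}"
        by (rule absolutely_integrable_on_subinterval[OF h]) (use le in auto)
      have hJ: "h absolutely_integrable_on {u i..v i}"
        by (rule absolutely_integrable_on_subinterval[OF h]) (use le in auto)
      have "integral {a..v i} h - integral {a..u i} h = integral {u i..v i} h"
        using Henstock_Kurzweil_Integration.integral_combine[OF le(1,2) set_lebesgue_integral_eq_integral(1)[OF hI]] by (simp add: algebra_simps)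
      also have "\<dots> = (\<integral>s. indicator {u i..v i} s *\<^sub>R h s \<partial>lebesgue)"
        using set_lebesgue_integral_eq_integral(2)[OF hJ] by (simp add: set_lebesgue_integral_def)
      also have "\<dots> = (\<integral>s. indicator (?I i) s *\<^sub>R h s \<partial>lebesgue)"
      proof (rule integral_cong_AE)
        show "AE s in lebesgue. indicator {u i..v i} s *\<^sub>R h s = indicator (?I i) s *\<^sub>R h s"
          using AE_completion[OF AE_lborel_singleton[of "u i"]] by (auto simp: indicator_def elim!: eventually_mono)
        show "(\<lambda>s. indicator {u i..v i} s *\<^sub>R h s) \<in> borel_measurable lebesgue"
          using hJ unfolding set_integrable_def by auto
        have "set_integrable lebesgue (?I i) h" by (rule set_integrable_subset[OF hJ]) auto
        then show "(\<lambda>s. indicator (?I i) s *\<^sub>R h s) \<in> borel_measurable lebesgue"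
          unfolding set_integrable_def by auto
      qed
      also have "norm \<dots> \<le> (\<integral>s. norm (indicator (?I i) s *\<^sub>R h s) \<partial>lebesgue)"
        by (rule integral_norm_bound)
      also have "\<dots> \<le> (\<integral>s. indicator (?I i) s * psi n s + real n * indicator (?I i) s \<partial>lebesgue)"
      proof (rule integral_mono)
        have "set_integrable lebesgue (?I i) h" by (rule set_integrable_subset[OF hJ]) auto
        then show "integrable lebesgue (\<lambda>s. norm (indicator (?I i) s *\<^sub>R h s))"
          unfolding set_integrable_def by (rule integrable_norm)
        show "integrable lebesgue (\<lambda>s. indicator (?I i) s * psi n s + real n * indicator (?I i) s)"
          by (intro Bochner_Integration.integrable_add ii integrable_mult_right integrable_real_indicator)
             (use le in auto)
        show "norm (indicator (?I i) s *\<^sub>R h s) \<le> indicator (?I i) s * psi n s + real n * indicator (?I i) s" for s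
          using le by (auto simp: indicator_def psi_def p_def)
      qed
      also have "\<dots> = (\<integral>s. indicator (?I i) s * psi n s \<partial>lebesgue) + real n * (v i - u i)"
      proof -
        have "integrable lebesgue (\<lambda>s. real n * indicator (?I i) s)"
          by (intro integrable_mult_right integrable_real_indicator) (use le in auto)
        then show ?thesis using ii[of i] le by (simp add: measure_completion)
      qed
      finally show ?thesis .
    qed
    then have "(\<Sum>i<k. norm (integral {a..v i} h - integral {a..u i} h))
      \<le> (\<Sum>i<k. (\<integral>s. indicator (?I i) s * psi n s \<partial>lebesgue) + real n * (v i - u i))"
      by (intro sum_mono) auto
    also have "\<dots> = (\<Sum>i<k. \<integral>s. indicator (?I i) s * psi n s \<partial>lebesgue) + real n * (\<Sum>i<k. v i - u i)"
      by (simp add: sum.distrib sum_distrib_left)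
    also have "(\<Sum>i<k. \<integral>s. indicator (?I i) s * psi n s \<partial>lebesgue)
        = (\<integral>s. (\<Sum>i<k. indicator (?I i) s * psi n s) \<partial>lebesgue)"
      by (rule Bochner_Integration.integral_sum[symmetric, OF ii])
    also have "\<dots> \<le> (\<integral>s. psi n s \<partial>lebesgue)"
    proof (rule integral_mono)
      show "integrable lebesgue (\<lambda>s. \<Sum>i<k. indicator (?I i) s * psi n s)"
        by (rule Bochner_Integration.integrable_sum[OF ii])
      show "(\<Sum>i<k. indicator (?I i) s * psi n s) \<le> psi n s" for s
      proof -
        have "(\<Sum>i<k. indicator (?I i) s * psi n s) = indicator (\<Union>i<k. ?I i) s * psi n s"
          by (simp add: indicator_UN_disjoint[OF _ dis] sum_distrib_right)
        then show ?thesis using psi0[of s] by (auto simp: indicator_def)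
      qed
    qed (rule psii)
    also have "(\<integral>s. psi n s \<partial>lebesgue) + real n * (\<Sum>i<k. v i - u i) < e / 2 + e / 2"
      using n d(2) small mult_left_mono[of "\<Sum>i<k. v i - u i" d "real n"] by linarith
    finally show "(\<Sum>i<k. norm (integral {a..v i} h - integral {a..u i} h)) < e" by simp
  qed (use d in auto)
qed

text \<open>The Lebesgue measurable integrand is replaced by a Borel one that agrees with it off a
  null set. The endpoints join the exceptional set because the differentiation theorem speaks only
  of interior points.\<close>

lemma ae_derivative_integral_real:
  fixes h :: "real \<Rightarrow> real"
  assumes h: "h absolutely_integrable_on {a..b}"
  obtains N where "negligible N"
    "\<And>x. x \<in> {a..b} - N \<Longrightarrow> ((\<lambda>y. integral {a..y} h) has_real_derivative h x) (at x within {a..b})"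
proof -
  have m: "(\<lambda>s. indicator {a..b} s *\<^sub>R h s) \<in> borel_measurable lebesgue"
    using h unfolding set_integrable_def by auto
  obtain g where g: "g \<in> borel_measurable lborel" "AE s in lborel. indicator {a..b} s *\<^sub>R h s = g s"
    using completion_ex_borel_measurable_real[OF m] by blast
  have "integrable lebesgue g"
    using h unfolding set_integrable_def
    by (rule integrable_cong_AE_imp) (use g AE_completion[OF g(2)] in \<open>auto intro: measurable_completion elim!: eventually_mono\<close>)
  then have gi: "integrable lborel g" using g(1) by (simp add: integrable_completion)
  obtain N where N: "negligible N"
    "\<And>x. x \<in> {a<..<b} - N \<Longrightarrow> ((\<lambda>y. LINT s:{a..y}|lborel. g s) has_real_derivative g x) (at x)"
    using lebesgue_differentiation_real[OF gi, of a b] by blast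
  obtain N' where N': "N' \<in> null_sets lborel" "{s. \<not> (indicator {a..b} s *\<^sub>R h s = g s)} \<subseteq> N'"
    using g(2) by (auto elim!: AE_E simp: null_sets_def)
  have N'n: "negligible N'" using N'(1) by (simp add: negligible_iff_null_sets null_sets_completionI)
  have eq: "indicator {a..b} s *\<^sub>R h s = g s" if "s \<notin> N'" for s using N'(2) that by auto
  have gI: "(LINT s:{a..y}|lborel. g s) = integral {a..y} h" if "y \<in> {a..b}" for y
  proof -
    have "set_integrable lborel {a..y} g" using gi unfolding set_integrable_def by (intro integrable_mult_indicator) auto
    then have "(LINT s:{a..y}|lborel. g s) = integral {a..y} g" by (rule set_borel_integral_eq_integral(2))
    also have "\<dots> = integral {a..y} h"
      by (rule integral_spike[OF N'n]) (use eq that in \<open>force simp: indicator_def\<close>)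
    finally show ?thesis .
  qed
  show ?thesis
  proof (rule that[of "N \<union> N' \<union> {a, b}"])
    show "negligible (N \<union> N' \<union> {a, b})" using N(1) N'n by auto
    fix x assume x: "x \<in> {a..b} - (N \<union> N' \<union> {a, b})"
    have "((\<lambda>y. LINT s:{a..y}|lborel. g s) has_real_derivative g x) (at x within {a..b})"
      by (rule has_field_derivative_at_within[OF N(2)]) (use x in auto)
    moreover have "g x = h x" using eq[of x] x by auto
    ultimately show "((\<lambda>y. integral {a..y} h) has_real_derivative h x) (at x within {a..b})"
      using has_field_derivative_transform_within[of "\<lambda>y. LINT s:{a..y}|lborel. g s" "g x" x "{a..b}" 1 "\<lambda>y. integral {a..y} h"] gI x
      by simp
  qed
qed

lemma ae_derivative_integral:
  fixes h :: "real \<Rightarrow> complex"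
  assumes h: "h absolutely_integrable_on {a..b}"
  obtains N where "negligible N"
    "\<And>x. x \<in> {a..b} - N \<Longrightarrow> ((\<lambda>y. integral {a..y} h) has_vector_derivative h x) (at x within {a..b})"
proof -
  have R: "(\<lambda>x. Re (h x)) absolutely_integrable_on {a..b}" and I: "(\<lambda>x. Im (h x)) absolutely_integrable_on {a..b}"
    using absolutely_integrable_linear[OF h bounded_linear_Re] absolutely_integrable_linear[OF h bounded_linear_Im]
    by (auto simp: o_def)
  obtain N1 where N1: "negligible N1"
    "\<And>x. x \<in> {a..b} - N1 \<Longrightarrow> ((\<lambda>y. integral {a..y} (\<lambda>x. Re (h x))) has_real_derivative Re (h x)) (at x within {a..b})"
    using ae_derivative_integral_real[OF R] by blast
  obtain N2 where N2: "negligible N2"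
    "\<And>x. x \<in> {a..b} - N2 \<Longrightarrow> ((\<lambda>y. integral {a..y} (\<lambda>x. Im (h x))) has_real_derivative Im (h x)) (at x within {a..b})"
    using ae_derivative_integral_real[OF I] by blast
  show ?thesis
  proof (rule that[of "N1 \<union> N2"])
    fix x assume x: "x \<in> {a..b} - (N1 \<union> N2)"
    have int: "h integrable_on {a..y}" if "y \<in> {a..b}" for y
      by (rule integrable_on_subinterval[OF set_lebesgue_integral_eq_integral(1)[OF h]]) (use that in auto)
    have "Re (integral {a..y} h) = integral {a..y} (\<lambda>x. Re (h x))" "Im (integral {a..y} h) = integral {a..y} (\<lambda>x. Im (h x))"
      if "y \<in> {a..b}" for y
      using integral_linear[OF int[OF that] bounded_linear_Re] integral_linear[OF int[OF that] bounded_linear_Im]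
      by (auto simp: o_def)
    then show "((\<lambda>y. integral {a..y} h) has_vector_derivative h x) (at x within {a..b})"
      unfolding has_vector_derivative_complex_iff
      using has_field_derivative_transform_within[OF N1(2), of x 1 "\<lambda>y. Re (integral {a..y} h)"]
        has_field_derivative_transform_within[OF N2(2), of x 1 "\<lambda>y. Im (integral {a..y} h)"] x
      by simp
  qed (use N1 N2 in auto)
qed

text \<open>Both descriptions of the derivative meet here: \<open>g\<close> is a Radon-Nikodym
  density and so integrates back to \<open>f\<close>, and differentiating that integral identifies
  \<open>g\<close> with the pointwise derivative off \<open>N\<close>.\<close>

theorem ac_on_fundamental_theorem:
  fixes f :: "real \<Rightarrow> complex"
  assumes ab: "a \<le> b" and ac: "ac_on a b f"
  obtains g N where "g absolutely_integrable_on {a..b}" "negligible N"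
    "\<And>x. x \<in> {a..b} - N \<Longrightarrow> (f has_vector_derivative g x) (at x within {a..b})"
    "\<And>x. x \<in> {a..b} \<Longrightarrow> integral {a..x} g = f x - f a"
proof -
  obtain g1 where g1: "g1 \<in> borel_measurable borel" "set_integrable lborel {a..b} g1"
    "\<And>x. x \<in> {a..b} \<Longrightarrow> (LINT s:{a..x}|lborel. g1 s) = Re (f x) - Re (f a)"
    using real_ac_on_has_density[OF ab ac_on_Re[OF ac]] by blast
  obtain g2 where g2: "g2 \<in> borel_measurable borel" "set_integrable lborel {a..b} g2"
    "\<And>x. x \<in> {a..b} \<Longrightarrow> (LINT s:{a..x}|lborel. g2 s) = Im (f x) - Im (f a)"
    using real_ac_on_has_density[OF ab ac_on_Im[OF ac]] by blast
  define g where "g s = complex_of_real (g1 s) + \<i> * complex_of_real (g2 s)" for s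
  have of_real: "set_integrable lborel S (\<lambda>s. complex_of_real (u s))"
      "(LINT s:S|lborel. complex_of_real (u s)) = complex_of_real (LINT s:S|lborel. u s)"
    if "set_integrable lborel S u" for S and u :: "real \<Rightarrow> real"
    using integrable_of_real[OF that[unfolded set_integrable_def], where 'a = complex]
      integral_of_real[where 'a = complex, of lborel "\<lambda>s. indicator S s *\<^sub>R u s"]
      that[unfolded set_integrable_def]
    unfolding set_integrable_def set_lebesgue_integral_def by (simp_all add: scaleR_conv_of_real)
  have gi: "set_integrable lborel {a..b} g"
    unfolding g_def by (intro set_integral_add set_integrable_mult_right of_real g1(2) g2(2))
  have ga: "g absolutely_integrable_on {a..b}"
    using gi unfolding set_integrable_def by (simp add: integrable_completion borel_measurable_integrable)
  have I: "integral {a..x} g = f x - f a" if x: "x \<in> {a..b}" for x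
  proof -
    have s: "set_integrable lborel {a..x} g" "set_integrable lborel {a..x} g1" "set_integrable lborel {a..x} g2"
      by (rule set_integrable_subset[OF gi] set_integrable_subset[OF g1(2)] set_integrable_subset[OF g2(2)]; use x in auto)+
    have "integral {a..x} g = (LINT s:{a..x}|lborel. g s)" using set_borel_integral_eq_integral(2)[OF s(1)] by simp
    also have "\<dots> = complex_of_real (LINT s:{a..x}|lborel. g1 s) + \<i> * complex_of_real (LINT s:{a..x}|lborel. g2 s)"
      unfolding g_def using s(2,3)
      by (subst set_integral_add) (auto simp: of_real)
    also have "\<dots> = f x - f a" using g1(3)[OF x] g2(3)[OF x] by (simp add: complex_eq_iff)
    finally show ?thesis .
  qed
  obtain N where N: "negligible N"
    "\<And>x. x \<in> {a..b} - N \<Longrightarrow> ((\<lambda>y. integral {a..y} g) has_vector_derivative g x) (at x within {a..b})"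
    using ae_derivative_integral[OF ga] by blast
  have "(f has_vector_derivative g x) (at x within {a..b})" if x: "x \<in> {a..b} - N" for x
  proof -
    have "((\<lambda>y. f a + integral {a..y} g) has_vector_derivative 0 + g x) (at x within {a..b})"
      by (intro has_vector_derivative_add has_vector_derivative_const N(2) x)
    then show ?thesis
      using has_vector_derivative_transform_within[of "\<lambda>y. f a + integral {a..y} g" "g x" x "{a..b}" 1 f] I x by simp
  qed
  then show ?thesis using that[OF ga N(1)] I by blast
qed

section \<open>The operator A\<close>

text \<open>Complete the square: the worst case is \<open>c = - x * y\<close>, and the determinant
  condition \<open>q * r < p * s\<close> makes the last coefficient large enough to absorb the rest.
  In the application \<open>q\<close>, \<open>r\<close>, \<open>p\<close>, \<open>s\<close> are the
  absolute values of \<open>b1\<close>, \<open>b2'\<close>, \<open>b1'\<close>, \<open>b2\<close>,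
  and the determinant condition is \<rho> > 0.\<close>

lemma quadratic_form_nonneg:
  fixes p q r s x y :: real
  assumes "0 \<le> q" "0 < r" "0 < p" "0 < s" "q * r < p * s" "\<bar>c\<bar> \<le> x * y" "0 \<le> x" "0 \<le> y"
  shows "0 \<le> q * p * x\<^sup>2 + 2 * q * r * c + s * r * y\<^sup>2"
proof -
  have "q * r\<^sup>2 / p * y\<^sup>2 \<le> s * r * y\<^sup>2"
  proof (rule mult_right_mono)
    have "q * r * r \<le> p * s * r" using assms by (intro mult_right_mono) auto
    then show "q * r\<^sup>2 / p \<le> s * r" using assms by (simp add: field_simps power2_eq_square)
  qed simp
  moreover have "- (2 * q * r * (x * y)) \<le> 2 * q * r * c"
  proof -
    have "2 * q * r * (- (x * y)) \<le> 2 * q * r * c"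
      using assms by (intro mult_left_mono) auto
    then show ?thesis by simp
  qed
  moreover have "q * p * x\<^sup>2 - 2 * q * r * (x * y) + q * r\<^sup>2 / p * y\<^sup>2 = q / p * (p * x - r * y)\<^sup>2"
    using assms by (simp add: field_simps power2_eq_square)
  moreover have "0 \<le> q / p * (p * x - r * y)\<^sup>2" using assms by simp
  ultimately show ?thesis by linarith
qed

locale wave_bvp =
  fixes P :: bvp
  assumes len_pos: "len P > 0"
    and msq_nonneg: "msq P \<ge> 0"
    and rho_pos: "rho P > 0"
    and b2'_nonzero: "b2' P \<noteq> 0"
    and alpha_range: "alpha P = 0 \<or> (pi / 2 \<le> alpha P \<and> alpha P < pi)"
    and signs_pos: "b2' P > 0 \<longrightarrow> b1 P \<ge> 0 \<and> b2 P < 0 \<and> b1' P < 0"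
    and signs_neg: "b2' P < 0 \<longrightarrow> b1 P \<le> 0 \<and> b2 P > 0 \<and> b1' P > 0"
begin

section \<open>Sign conditions and nonnegativity of the boundary terms\<close>

abbreviation "L \<equiv> len P"
abbreviation "leb \<equiv> lebesgue_on {0<..<L}"

text \<open>Here \<open>a\<close> and \<open>b\<close> stand for the value and the slope at \<ell>.
  The form is what remains of the second-component part of the inner product of \<phi> with
  \<open>A \<xi>\<close> after the flux \<open>cnj a * b'\<close> has been subtracted, with second
  components expressed through boundary values.\<close>

definition bdry_form :: "complex \<Rightarrow> complex \<Rightarrow> complex \<Rightarrow> complex \<Rightarrow> complex" where
  "bdry_form a b a' b' = (- of_real (b1 P * b1' P) * cnj a * a' + of_real (b1 P * b2' P) * (cnj a * b' + cnj b * a')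
     - of_real (b2 P * b2' P) * cnj b * b') / of_real (rho P)"

lemma bdry_form_cnj: "bdry_form a b a' b' = cnj (bdry_form a' b' a b)"
  by (simp add: bdry_form_def algebra_simps)

lemma bdry_form_self_nonneg: "0 \<le> Re (bdry_form a b a b)"
proof -
  let ?c = "Re (cnj a * b)"
  have c: "\<bar>?c\<bar> \<le> cmod a * cmod b"
    using abs_Re_le_cmod[of "cnj a * b"] by (simp add: norm_mult)
  have re: "Re (bdry_form a b a b) = (- (b1 P * b1' P) * (cmod a)\<^sup>2 + 2 * (b1 P * b2' P) * ?c - b2 P * b2' P * (cmod b)\<^sup>2) / rho P"
    unfolding bdry_form_def cmod_power2 Re_divide_of_real
    by (rule arg_cong[where f = "\<lambda>x. x / rho P"]) (simp add: algebra_simps power2_eq_square)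
  have rho: "b1' P * b2 P - b1 P * b2' P > 0" using rho_pos by (simp add: rho_def)
  have "0 \<le> - (b1 P * b1' P) * (cmod a)\<^sup>2 + 2 * (b1 P * b2' P) * ?c - b2 P * b2' P * (cmod b)\<^sup>2"
  proof (cases "b2' P > 0")
    case True
    then show ?thesis using quadratic_form_nonneg[of "b1 P" "b2' P" "- b1' P" "- b2 P" ?c "cmod a" "cmod b"] signs_pos rho c
      by (simp add: algebra_simps)
  next
    case False
    then have "b2' P < 0" using b2'_nonzero by simp
    then show ?thesis using quadratic_form_nonneg[of "- b1 P" "- b2' P" "b1' P" "b2 P" ?c "cmod a" "cmod b"] signs_neg rho c
      by (simp add: algebra_simps)
  qed
  then show ?thesis unfolding re using rho_pos by simp
qed

text \<open>At \<alpha> = 0 the cotangent is a division by zero, hence 0, which suits the Dirichlet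
  case, where the boundary term is absent. For \<alpha> from \<pi>/2 on, the cosine is nonpositive
  and the sine positive.\<close>

lemma cot_alpha: "- cot (alpha P) \<ge> 0"
proof (cases "alpha P = 0")
  case False
  then have "pi / 2 \<le> alpha P" "alpha P < pi" using alpha_range by auto
  then have "cos (alpha P) \<le> 0" "sin (alpha P) > 0"
    using cos_monotone_0_pi_le[of "pi / 2" "alpha P"] pi_gt_zero by (auto intro!: sin_gt_zero)
  then show ?thesis by (simp add: cot_def divide_nonpos_pos)
qed (simp add: cot_def)

subsection \<open>The Hilbert space\<close>

lemma fst_hadd [simp]: "fst (hadd a b) = (\<lambda>z. fst a z + fst b z)" by (simp add: hadd_def)
lemma snd_hadd [simp]: "snd (hadd a b) = snd a + snd b" by (simp add: hadd_def)
lemma fst_hscale [simp]: "fst (hscale c a) = (\<lambda>z. c * fst a z)" by (simp add: hscale_def)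
lemma snd_hscale [simp]: "snd (hscale c a) = c * snd a" by (simp add: hscale_def)
lemma fst_hsub [simp]: "fst (hsub a b) = (\<lambda>z. fst a z - fst b z)" by (simp add: hsub_def)
lemma snd_hsub [simp]: "snd (hsub a b) = snd a - snd b" by (simp add: hsub_def)

lemma integrable_L2_product:
  assumes "L2_on L u" "L2_on L v"
  shows "integrable leb (\<lambda>z. cnj (u z) * v z)"
proof (rule Bochner_Integration.integrable_bound)
  show "integrable leb (\<lambda>z. (cmod (u z))\<^sup>2 + (cmod (v z))\<^sup>2)"
    using assms by (simp add: L2_on_def)
  have [measurable]: "u \<in> borel_measurable leb" "v \<in> borel_measurable leb" using assms by (auto simp: L2_on_def)
  have [measurable]: "cnj \<in> borel_measurable borel"
    by (intro borel_measurable_continuous_onI continuous_intros)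
  show "(\<lambda>z. cnj (u z) * v z) \<in> borel_measurable leb" by measurable
  have "cmod x * cmod y \<le> (cmod x)\<^sup>2 + (cmod y)\<^sup>2" for x y
  proof -
    have "0 \<le> cmod x * cmod y" by simp
    then show ?thesis using sum_squares_bound[of "cmod x" "cmod y"] by linarith
  qed
  then show "AE z in leb. norm (cnj (u z) * v z) \<le> norm ((cmod (u z))\<^sup>2 + (cmod (v z))\<^sup>2)"
    by (intro AE_I2) (simp add: norm_mult)
qed

lemma L2_on_add: "L2_on L u \<Longrightarrow> L2_on L v \<Longrightarrow> L2_on L (\<lambda>z. u z + v z)"
proof -
  assume uv: "L2_on L u" "L2_on L v"
  have [measurable]: "u \<in> borel_measurable leb" "v \<in> borel_measurable leb" using uv by (auto simp: L2_on_def)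
  have "integrable leb (\<lambda>z. (cmod (u z + v z))\<^sup>2)"
  proof (rule Bochner_Integration.integrable_bound)
    show "integrable leb (\<lambda>z. 2 * (cmod (u z))\<^sup>2 + 2 * (cmod (v z))\<^sup>2)"
      using uv by (simp add: L2_on_def)
    have "(cmod (x + y))\<^sup>2 \<le> 2 * (cmod x)\<^sup>2 + 2 * (cmod y)\<^sup>2" for x y
      using power_mono[OF norm_triangle_ineq[of x y], of 2] sum_squares_bound[of "cmod x" "cmod y"]
      by (simp add: power2_sum)
    then show "AE z in leb. norm ((cmod (u z + v z))\<^sup>2) \<le> norm (2 * (cmod (u z))\<^sup>2 + 2 * (cmod (v z))\<^sup>2)"
      by (intro AE_I2) simp
  qed measurable
  then show ?thesis by (simp add: L2_on_def)
qed

lemma L2_on_scale: "L2_on L u \<Longrightarrow> L2_on L (\<lambda>z. c * u z)"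
  by (auto simp: L2_on_def norm_mult power_mult_distrib intro!: borel_measurable_times)

lemma L2_on_const: "L2_on L (\<lambda>z. c)"
proof -
  have "finite_measure leb" by (rule finite_measureI) (use len_pos in \<open>simp add: emeasure_restrict_space\<close>)
  then show ?thesis unfolding L2_on_def by (auto intro!: finite_measure.integrable_const)
qed

lemma L2_on_diff: "L2_on L u \<Longrightarrow> L2_on L v \<Longrightarrow> L2_on L (\<lambda>z. u z - v z)"
  using L2_on_add[of u "\<lambda>z. (-1) * v z"] L2_on_scale[of v "-1"] by simp

lemma L2_on_sum: "(\<And>i. i \<in> I \<Longrightarrow> L2_on L (u i)) \<Longrightarrow> L2_on L (\<lambda>z. \<Sum>i\<in>I. u i z)"
  by (induction I rule: infinite_finite_induct) (auto intro: L2_on_const L2_on_add)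

lemma integrable_L2: "L2_on L u \<Longrightarrow> integrable leb u"
  using integrable_L2_product[OF L2_on_const[of 1]] by simp

lemma integrable_leb_iff:
  fixes f :: "real \<Rightarrow> 'a::euclidean_space"
  shows "integrable leb f \<longleftrightarrow> f absolutely_integrable_on {0..L}"
  unfolding absolutely_integrable_on_Icc_iff_Ioo by (simp add: set_integrable_def integrable_restrict_space)

lemma integral_leb:
  fixes f :: "real \<Rightarrow> 'a::euclidean_space"
  assumes "integrable leb f"
  shows "integral\<^sup>L leb f = integral {0..L} f"
  using lebesgue_integral_eq_integral[OF assms] by (simp add: integral_open_interval_real)

lemma L2_on_continuous:
  assumes "continuous_on {0..L} u"
  shows "L2_on L u"
proof -
  have "integrable leb (\<lambda>z. (cmod (u z))\<^sup>2)"
    unfolding integrable_leb_iff using assms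
    by (intro absolutely_integrable_continuous_real continuous_intros)
  moreover have "integrable leb u"
    unfolding integrable_leb_iff using assms by (rule absolutely_integrable_continuous_real)
  ultimately show ?thesis by (auto simp: L2_on_def)
qed

lemma Hsp_hadd [intro, simp]: "Hsp P a \<Longrightarrow> Hsp P b \<Longrightarrow> Hsp P (hadd a b)"
  by (simp add: Hsp_def L2_on_add)
lemma Hsp_hscale [intro, simp]: "Hsp P a \<Longrightarrow> Hsp P (hscale c a)"
  by (simp add: Hsp_def L2_on_scale)
lemma Hsp_hsub [intro, simp]: "Hsp P a \<Longrightarrow> Hsp P b \<Longrightarrow> Hsp P (hsub a b)"
  by (simp add: Hsp_def L2_on_diff)

definition hzero :: "hvec" where "hzero = ((\<lambda>_. 0), 0)"

lemma Hsp_hzero [simp]: "Hsp P hzero" by (simp add: hzero_def Hsp_def L2_on_const)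

lemma hinner_add_right:
  assumes "Hsp P a" "Hsp P b" "Hsp P c"
  shows "hinner P a (hadd b c) = hinner P a b + hinner P a c"
  using integrable_L2_product assms unfolding hinner_def Hsp_def
  by (simp add: distrib_left add_divide_distrib)

lemma hinner_scale_right: "hinner P a (hscale c b) = c * hinner P a b"
  unfolding hinner_def by (simp add: mult.left_commute[of _ c] distrib_left)

lemma hinner_cnj: "hinner P b a = cnj (hinner P a b)"
proof -
  have "integral\<^sup>L leb (\<lambda>z. cnj (cnj (fst a z) * fst b z)) = cnj (integral\<^sup>L leb (\<lambda>z. cnj (fst a z) * fst b z))"
    by (rule Bochner_Integration.integral_cnj)
  then show ?thesis unfolding hinner_def by (simp add: mult.commute del: Bochner_Integration.integral_cnj)
qed

lemma hinner_sub_right: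
  assumes "Hsp P a" "Hsp P b" "Hsp P c"
  shows "hinner P a (hsub b c) = hinner P a b - hinner P a c"
  unfolding hsub_def using assms by (simp add: hinner_add_right hinner_scale_right)

lemma hinner_add_left: "Hsp P a \<Longrightarrow> Hsp P b \<Longrightarrow> Hsp P c \<Longrightarrow> hinner P (hadd b c) a = hinner P b a + hinner P c a"
  by (subst (1 2 3) hinner_cnj) (simp add: hinner_add_right)
lemma hinner_sub_left: "Hsp P a \<Longrightarrow> Hsp P b \<Longrightarrow> Hsp P c \<Longrightarrow> hinner P (hsub b c) a = hinner P b a - hinner P c a"
  by (subst (1 2 3) hinner_cnj) (simp add: hinner_sub_right)
lemma hinner_scale_left: "hinner P (hscale c b) a = cnj c * hinner P b a"
  by (subst (1 2) hinner_cnj) (simp add: hinner_scale_right)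

lemma hinner_zero_right [simp]: "hinner P a hzero = 0" by (simp add: hinner_def hzero_def)

lemmas hinner_linear = hinner_add_right hinner_scale_right hinner_sub_right hinner_add_left hinner_scale_left hinner_sub_left

lemma hinner_self: "hinner P a a = of_real (integral\<^sup>L leb (\<lambda>z. (cmod (fst a z))\<^sup>2) + (cmod (snd a))\<^sup>2 / rho P)"
proof -
  have *: "cnj x * x = of_real ((cmod x)\<^sup>2)" for x using complex_norm_square[of x] by (simp add: mult.commute)
  show ?thesis unfolding hinner_def * by (simp only: integral_complex_of_real of_real_add of_real_divide)
qed

lemma hinner_self_real: "0 \<le> Re (hinner P a a)" "hinner P a a = of_real (Re (hinner P a a))"
  using rho_pos by (auto simp: hinner_self)

lemma hnorm_square: "(hnorm P a)\<^sup>2 = integral\<^sup>L leb (\<lambda>z. (cmod (fst a z))\<^sup>2) + (cmod (snd a))\<^sup>2 / rho P"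
  unfolding hnorm_def using hinner_self_real(1)[of a] by (simp add: hinner_self)

lemma hinner_self_hnorm: "hinner P a a = of_real ((hnorm P a)\<^sup>2)"
  by (simp only: hnorm_square hinner_self)

lemma hnorm_nonneg [simp]: "0 \<le> hnorm P a"
  using hinner_self_real(1)[of a] by (simp add: hnorm_def)

lemma hnorm_hscale: "hnorm P (hscale c a) = cmod c * hnorm P a"
proof -
  have "hinner P (hscale c a) (hscale c a) = (c * cnj c) * hinner P a a"
    by (simp add: hinner_scale_left hinner_scale_right)
  also have "\<dots> = of_real ((cmod c * hnorm P a)\<^sup>2)"
    by (simp only: complex_norm_square[symmetric] hinner_self_hnorm of_real_mult[symmetric] power_mult_distrib)
  finally show ?thesis by (simp add: hnorm_def[of P "hscale c a"])
qed

lemma hnorm_hzero [simp]: "hnorm P hzero = 0" by (simp add: hnorm_def)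

lemma hnorm_sub_square:
  assumes "Hsp P a" "Hsp P b"
  shows "(hnorm P (hsub a b))\<^sup>2 = (hnorm P a)\<^sup>2 - 2 * Re (hinner P a b) + (hnorm P b)\<^sup>2"
proof -
  have "hinner P (hsub a b) (hsub a b) = of_real ((hnorm P a)\<^sup>2) - (hinner P a b + cnj (hinner P a b)) + of_real ((hnorm P b)\<^sup>2)"
    unfolding hinner_self_hnorm[symmetric] using assms by (simp add: hinner_linear hinner_cnj[of b a])
  then have "of_real ((hnorm P (hsub a b))\<^sup>2) = complex_of_real ((hnorm P a)\<^sup>2 - 2 * Re (hinner P a b) + (hnorm P b)\<^sup>2)"
    by (simp add: hinner_self_hnorm complex_add_cnj)
  then show ?thesis using of_real_eq_iff by blast
qed

text \<open>A quadratic polynomial in the real parameter \<open>s\<close>, obtained from the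
  multiples \<open>s * ?w\<close> of \<open>a\<close>, is nonnegative. Since \<open>hnorm\<close> is
  only a seminorm on representatives, the case \<open>hnorm P a = 0\<close> does not make
  \<open>a\<close> the zero function and gets its own argument.\<close>

lemma hinner_Cauchy_Schwarz:
  assumes a: "Hsp P a" and b: "Hsp P b"
  shows "cmod (hinner P a b) \<le> hnorm P a * hnorm P b"
proof -
  let ?w = "hinner P a b"
  have *: "0 \<le> (cmod t)\<^sup>2 * (hnorm P a)\<^sup>2 - 2 * Re (cnj t * ?w) + (hnorm P b)\<^sup>2" for t
  proof -
    have "0 \<le> (hnorm P (hsub (hscale t a) b))\<^sup>2" by simp
    then show ?thesis using hnorm_sub_square[of "hscale t a" b] a b
      by (simp add: hnorm_hscale hinner_linear power_mult_distrib)
  qed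
  have s: "0 \<le> s\<^sup>2 * (cmod ?w)\<^sup>2 * (hnorm P a)\<^sup>2 - 2 * s * (cmod ?w)\<^sup>2 + (hnorm P b)\<^sup>2" for s :: real
  proof -
    have "cnj (of_real s * ?w) * ?w = of_real (s * (cmod ?w)\<^sup>2)"
      using complex_norm_square[of ?w] by (simp add: mult.commute mult.left_commute)
    then have "Re (cnj (of_real s * ?w) * ?w) = s * (cmod ?w)\<^sup>2" by (simp only: Re_complex_of_real)
    then show ?thesis using *[of "of_real s * ?w"]
      by (simp only: norm_mult power_mult_distrib norm_of_real power2_abs mult.assoc)
  qed
  have "(cmod ?w)\<^sup>2 \<le> (hnorm P a)\<^sup>2 * (hnorm P b)\<^sup>2"
  proof (cases "hnorm P a = 0")
    case True
    show ?thesis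
    proof (rule ccontr)
      assume "\<not> ?thesis"
      then have w: "(cmod ?w)\<^sup>2 > 0" using True by simp
      \<comment> \<open>Chosen so that the linear term equals \<open>(hnorm P b)\<^sup>2 + 1\<close>
        and outweighs the constant term.\<close>
      define t where "t = ((hnorm P b)\<^sup>2 + 1) / (2 * (cmod ?w)\<^sup>2)"
      have "t * (cmod ?w)\<^sup>2 = ((hnorm P b)\<^sup>2 + 1) / 2" using w by (simp add: t_def)
      then show False using s[of t] True by (simp add: mult.assoc)
    qed
  next
    case False
    then have n: "(hnorm P a)\<^sup>2 > 0" by simp
    have "0 \<le> (1 / (hnorm P a)\<^sup>2)\<^sup>2 * (cmod ?w)\<^sup>2 * (hnorm P a)\<^sup>2 - 2 * (1 / (hnorm P a)\<^sup>2) * (cmod ?w)\<^sup>2 + (hnorm P b)\<^sup>2"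
      by (rule s)
    also have "\<dots> = (hnorm P b)\<^sup>2 - (cmod ?w)\<^sup>2 / (hnorm P a)\<^sup>2"
      using n by (simp add: field_simps power2_eq_square)
    finally show ?thesis using n by (simp add: field_simps)
  qed
  then show ?thesis by (simp add: power_mult_distrib[symmetric] power2_le_iff_abs_le abs_mult)
qed

lemma hnorm_sub_commute: "hnorm P (hsub a b) = hnorm P (hsub b a)"
proof -
  have "hsub b a = hscale (-1) (hsub a b)" by (simp add: prod_eq_iff)
  then show ?thesis by (simp add: hnorm_hscale)
qed

lemma hnorm_triangle:
  assumes a: "Hsp P a" and b: "Hsp P b"
  shows "hnorm P (hadd a b) \<le> hnorm P a + hnorm P b"
proof -
  have "hadd a b = hsub a (hscale (-1) b)" by (simp add: prod_eq_iff)
  then have "(hnorm P (hadd a b))\<^sup>2 = (hnorm P a)\<^sup>2 + 2 * Re (hinner P a b) + (hnorm P b)\<^sup>2"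
    using hnorm_sub_square[of a "hscale (-1) b"] a b by (simp add: hnorm_hscale hinner_linear)
  also have "\<dots> \<le> (hnorm P a)\<^sup>2 + 2 * (hnorm P a * hnorm P b) + (hnorm P b)\<^sup>2"
    using hinner_Cauchy_Schwarz[OF a b] complex_Re_le_cmod[of "hinner P a b"] by simp
  also have "\<dots> = (hnorm P a + hnorm P b)\<^sup>2" by (simp add: power2_sum)
  finally show ?thesis by (rule power2_le_imp_le) simp
qed

lemma hnorm_sub_triangle:
  assumes "Hsp P a" "Hsp P b" "Hsp P c"
  shows "hnorm P (hsub a c) \<le> hnorm P (hsub a b) + hnorm P (hsub b c)"
proof -
  have "hsub a c = hadd (hsub a b) (hsub b c)" by (simp add: prod_eq_iff)
  then show ?thesis using hnorm_triangle assms by simp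
qed

text \<open>Identities in \<open>H\<close> hold up to \<open>heq\<close>; this turns them into
  statements on norms, in which limits can be taken.\<close>

lemma heq_iff_hnorm:
  assumes a: "Hsp P a" and b: "Hsp P b"
  shows "heq P a b \<longleftrightarrow> hnorm P (hsub a b) = 0"
proof -
  have L: "L2_on L (\<lambda>z. fst a z - fst b z)" using a b by (simp add: Hsp_def L2_on_diff)
  let ?I = "integral\<^sup>L leb (\<lambda>z. (cmod (fst a z - fst b z))\<^sup>2)"
  have "hnorm P (hsub a b) = 0 \<longleftrightarrow> (hnorm P (hsub a b))\<^sup>2 = 0" by simp
  also have "\<dots> \<longleftrightarrow> ?I = 0 \<and> (cmod (snd a - snd b))\<^sup>2 / rho P = 0"
    unfolding hnorm_square using rho_pos by (subst add_nonneg_eq_0_iff) auto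
  also have "?I = 0 \<longleftrightarrow> (AE z in leb. (cmod (fst a z - fst b z))\<^sup>2 = 0)"
    by (rule integral_nonneg_eq_0_iff_AE) (use L in \<open>auto simp: L2_on_def\<close>)
  finally show ?thesis using rho_pos by (simp add: heq_def)
qed

lemma heq_refl [simp]: "heq P a a" by (simp add: heq_def)
lemma heq_sym: "heq P a b \<Longrightarrow> heq P b a" unfolding heq_def by (auto elim: eventually_mono)
lemma heq_trans: "heq P a b \<Longrightarrow> heq P b c \<Longrightarrow> heq P a c"
  unfolding heq_def by (auto elim: eventually_elim2)

lemma hinner_cong:
  assumes "Hsp P a" "Hsp P b" "Hsp P b'" "heq P b b'"
  shows "hinner P a b = hinner P a b'"
proof -
  have "cmod (hinner P a (hsub b b')) \<le> hnorm P a * hnorm P (hsub b b')"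
    by (rule hinner_Cauchy_Schwarz) (use assms in auto)
  then show ?thesis using heq_iff_hnorm[of b b'] assms by (simp add: hinner_linear)
qed

lemma hinner_cong_left:
  assumes "Hsp P a" "Hsp P b" "Hsp P b'" "heq P b b'"
  shows "hinner P b a = hinner P b' a"
  by (subst (1 2) hinner_cnj) (simp add: hinner_cong[OF assms])

lemma hnorm_cong:
  assumes "Hsp P b" "Hsp P b'" "heq P b b'"
  shows "hnorm P b = hnorm P b'"
  unfolding hnorm_def using hinner_cong[of b b b'] hinner_cong_left[of b' b b'] assms by simp

definition hsum :: "'i set \<Rightarrow> ('i \<Rightarrow> complex) \<Rightarrow> ('i \<Rightarrow> hvec) \<Rightarrow> hvec" where
  "hsum I c e = ((\<lambda>z. \<Sum>i\<in>I. c i * fst (e i) z), \<Sum>i\<in>I. c i * snd (e i))"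

lemma hsum_empty: "hsum {} c e = hzero" by (simp add: hsum_def hzero_def)
lemma hsum_insert: "finite I \<Longrightarrow> i \<notin> I \<Longrightarrow> hsum (insert i I) c e = hadd (hscale (c i) (e i)) (hsum I c e)"
  by (simp add: hsum_def prod_eq_iff)

lemma Hsp_hsum: "(\<And>i. i \<in> I \<Longrightarrow> Hsp P (e i)) \<Longrightarrow> Hsp P (hsum I c e)"
  unfolding Hsp_def hsum_def by (simp add: L2_on_sum L2_on_scale)

lemma hinner_hsum_right:
  assumes "finite I" "Hsp P a" "\<And>i. i \<in> I \<Longrightarrow> Hsp P (e i)"
  shows "hinner P a (hsum I c e) = (\<Sum>i\<in>I. c i * hinner P a (e i))"
  using assms by (induction I rule: finite_induct)
    (simp_all add: hsum_empty hsum_insert Hsp_hsum hinner_linear)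

end

text \<open>The product is absolutely continuous, hence the integral of a density, and off a null
  set that density is given by the product rule. Derivatives almost everywhere suffice, which is all
  that \<open>domA\<close> offers for the second derivative.\<close>

lemma ac_on_integration_by_parts:
  fixes f g :: "real \<Rightarrow> complex"
  assumes ab: "a < b" and f: "ac_on a b f" and g: "ac_on a b g"
    and N: "negligible N"
    and df: "\<And>x. x \<in> {a..b} - N \<Longrightarrow> (f has_vector_derivative f' x) (at x within {a..b})"
    and dg: "\<And>x. x \<in> {a..b} - N \<Longrightarrow> (g has_vector_derivative g' x) (at x within {a..b})"
  shows "((\<lambda>x. f' x * g x + f x * g' x) has_integral (f b * g b - f a * g a)) {a..b}"
proof -
  obtain p N' where p: "p absolutely_integrable_on {a..b}" "negligible N'"
    "\<And>x. x \<in> {a..b} - N' \<Longrightarrow> ((\<lambda>x. f x * g x) has_vector_derivative p x) (at x within {a..b})"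
    "\<And>x. x \<in> {a..b} \<Longrightarrow> integral {a..x} p = f x * g x - f a * g a"
    using ac_on_fundamental_theorem[OF less_imp_le[OF ab] ac_on_mult[OF f g]] by blast
  have "(p has_integral (f b * g b - f a * g a)) {a..b}"
    using p(4)[of b] ab set_lebesgue_integral_eq_integral(1)[OF p(1)] by (metis atLeastAtMost_iff integrable_integral less_imp_le order_refl)
  then show ?thesis
  proof (rule has_integral_spike[of "N \<union> N'", rotated 2])
    fix x assume x: "x \<in> {a..b} - (N \<union> N')"
    have "((\<lambda>x. f x * g x) has_vector_derivative f x * g' x + f' x * g x) (at x within {a..b})"
      by (rule has_vector_derivative_mult) (use df dg x in auto)
    then show "f' x * g x + f x * g' x = p x"
      using vector_derivative_unique_within_closed_interval[of a b x "\<lambda>x. f x * g x"] p(3)[of x] x ab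
      by (simp add: add.commute)
  qed (use N p(2) in auto)
qed

lemma has_vector_derivative_cong_on:
  assumes "x \<in> S" "\<And>y. y \<in> S \<Longrightarrow> f y = g y"
  shows "(f has_vector_derivative d) (at x within S) \<longleftrightarrow> (g has_vector_derivative d) (at x within S)"
  using has_vector_derivative_transform[OF assms(1), of f g d] has_vector_derivative_transform[OF assms(1), of g f d] assms(2)
  by auto

context wave_bvp
begin

section \<open>Derivatives on [0, \<ell>] and the regularity class behind D(A)\<close>

lemma dz_cong:
  assumes "z \<in> {0..L}" "\<And>y. y \<in> {0..L} \<Longrightarrow> u y = v y"
  shows "dz P u z = dz P v z"
  unfolding dz_def vector_derivative_def using has_vector_derivative_cong_on[OF assms] by simp

lemma dz_eqI:
  assumes "z \<in> {0..L}" "(u has_vector_derivative d) (at z within {0..L})"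
  shows "dz P u z = d"
  unfolding dz_def using vector_derivative_within_cbox[of 0 L z u d] assms len_pos by simp

text \<open>Off a null set \<open>dz\<close> coincides with the density of \<open>u\<close>; its
  unspecified values elsewhere change neither integrability nor the integral.\<close>

lemma ac_on_dz:
  assumes u: "ac_on 0 L u"
  obtains N where "negligible N" "dz P u absolutely_integrable_on {0..L}"
    "\<And>z. z \<in> {0..L} - N \<Longrightarrow> (u has_vector_derivative dz P u z) (at z within {0..L})"
    "\<And>z. z \<in> {0..L} \<Longrightarrow> integral {0..z} (dz P u) = u z - u 0"
proof -
  obtain g N where g: "g absolutely_integrable_on {0..L}" "negligible N"
    "\<And>x. x \<in> {0..L} - N \<Longrightarrow> (u has_vector_derivative g x) (at x within {0..L})"
    "\<And>x. x \<in> {0..L} \<Longrightarrow> integral {0..x} g = u x - u 0"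
    using ac_on_fundamental_theorem[OF less_imp_le[OF len_pos] u] by blast
  have eq: "dz P u x = g x" if "x \<in> {0..L} - N" for x
    using dz_eqI[of x u "g x"] g(3)[OF that] that by auto
  show ?thesis
  proof (rule that[OF g(2)])
    show "dz P u absolutely_integrable_on {0..L}" by (rule absolutely_integrable_spike[OF g(1,2)]) (use eq in auto)
    show "(u has_vector_derivative dz P u z) (at z within {0..L})" if "z \<in> {0..L} - N" for z
      using g(3)[OF that] eq[OF that] by simp
    show "integral {0..z} (dz P u) = u z - u 0" if "z \<in> {0..L}" for z
    proof -
      have "integral {0..z} (dz P u) = integral {0..z} g" by (rule integral_spike[OF g(2)]) (use eq that in auto)
      then show ?thesis using g(4)[OF that] by simp
    qed
  qed
qed

definition regular :: "(real \<Rightarrow> complex) \<Rightarrow> bool" where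
  "regular u \<longleftrightarrow> ac_on 0 L u \<and> ac_on 0 L (dz P u) \<and> L2_on L (dz P (dz P u))"

text \<open>The derivative is continuous, so \<open>u\<close> is the integral of a continuous
  function and is differentiable at every point, not merely almost everywhere.\<close>

lemma regular_deriv:
  assumes "regular u" "z \<in> {0..L}"
  shows "(u has_vector_derivative dz P u z) (at z within {0..L})"
proof -
  have c: "continuous_on {0..L} (dz P u)" using assms by (simp add: regular_def ac_on_imp_continuous_on)
  obtain I: "\<And>z. z \<in> {0..L} \<Longrightarrow> integral {0..z} (dz P u) = u z - u 0"
    using ac_on_dz[of u] assms by (metis regular_def)
  have "((\<lambda>x. u 0 + integral {0..x} (dz P u)) has_vector_derivative 0 + dz P u z) (at z within {0..L})"
    by (intro has_vector_derivative_add has_vector_derivative_const integral_has_vector_derivative[OF c assms(2)])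
  then show ?thesis
    using has_vector_derivative_cong_on[of z "{0..L}" u "\<lambda>x. u 0 + integral {0..x} (dz P u)"] I assms(2) by simp
qed

lemma regular_deriv2:
  assumes "regular u"
  obtains N where "negligible N"
    "\<And>z. z \<in> {0..L} - N \<Longrightarrow> (dz P u has_vector_derivative dz P (dz P u) z) (at z within {0..L})"
  using ac_on_dz[of "dz P u"] assms by (metis regular_def)

lemma regular_cont:
  assumes "regular u"
  shows "continuous_on {0..L} u" "continuous_on {0..L} (dz P u)" "L2_on L u" "L2_on L (dz P u)" "L2_on L (dz P (dz P u))"
  using assms by (auto simp: regular_def intro: ac_on_imp_continuous_on L2_on_continuous)

lemma AE_leb_negligible:
  assumes "negligible N" "\<And>z. z \<in> {0..L} - N \<Longrightarrow> Q z"
  shows "AE z in leb. Q z"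
proof -
  have "AE z in lebesgue. z \<notin> N" using assms(1) by (simp add: negligible_iff_null_sets AE_not_in)
  then have "AE z in lebesgue. z \<in> {0<..<L} \<longrightarrow> Q z" using assms(2) by (auto elim!: eventually_mono)
  then show ?thesis by (simp add: AE_restrict_space_iff)
qed

lemma L2_on_cong:
  assumes "L2_on L v" "negligible N" "\<And>z. z \<in> {0..L} - N \<Longrightarrow> u z = v z"
  shows "L2_on L u"
proof -
  have i: "integrable leb v" "integrable leb (\<lambda>z. (cmod (v z))\<^sup>2)"
    using integrable_L2[OF assms(1)] assms(1) by (simp_all add: L2_on_def)
  have "integrable leb u" "integrable leb (\<lambda>z. (cmod (u z))\<^sup>2)"
    unfolding integrable_leb_iff
    by (rule absolutely_integrable_spike[OF i(1)[unfolded integrable_leb_iff] assms(2)]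
             absolutely_integrable_spike[OF i(2)[unfolded integrable_leb_iff] assms(2)]; simp add: assms(3))+
  then show ?thesis by (auto simp: L2_on_def)
qed

text \<open>The way to certify explicit functions: candidates \<open>u1\<close> and
  \<open>u2\<close> are supplied, and the second one may fail to be a derivative on the null set
  \<open>N\<close>.\<close>

lemma regularI:
  assumes u: "\<And>z. z \<in> {0..L} \<Longrightarrow> (u has_vector_derivative u1 z) (at z within {0..L})"
    and ac: "ac_on 0 L u1" and N: "negligible N"
    and d: "\<And>z. z \<in> {0..L} - N \<Longrightarrow> (u1 has_vector_derivative u2 z) (at z within {0..L})"
    and L2: "L2_on L u2"
  shows "regular u" "\<And>z. z \<in> {0..L} \<Longrightarrow> dz P u z = u1 z" "\<And>z. z \<in> {0..L} - N \<Longrightarrow> dz P (dz P u) z = u2 z"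
proof -
  show 1: "dz P u z = u1 z" if "z \<in> {0..L}" for z using dz_eqI[OF that u[OF that]] .
  show 2: "dz P (dz P u) z = u2 z" if "z \<in> {0..L} - N" for z
  proof -
    have "dz P (dz P u) z = dz P u1 z" by (rule dz_cong) (use that 1 in auto)
    then show ?thesis using dz_eqI[OF _ d[OF that]] that by simp
  qed
  have "ac_on 0 L u" by (rule C1_imp_ac_on[OF u ac_on_imp_continuous_on[OF ac]])
  moreover have "ac_on 0 L (dz P u)"
    by (rule ac_on_dominated[OF ac ac, where C = 1]) (simp add: 1)
  moreover have "L2_on L (dz P (dz P u))" by (rule L2_on_cong[OF L2 N 2])
  ultimately show "regular u" by (simp add: regular_def)
qed

lemma regular_lincomb:
  assumes u: "regular u" and v: "regular v"
  shows "regular (\<lambda>z. a * u z + c * v z)"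
    "\<And>z. z \<in> {0..L} \<Longrightarrow> dz P (\<lambda>z. a * u z + c * v z) z = a * dz P u z + c * dz P v z"
    "AE z in leb. dz P (dz P (\<lambda>z. a * u z + c * v z)) z = a * dz P (dz P u) z + c * dz P (dz P v) z"
proof -
  obtain N1 where N1: "negligible N1"
    "\<And>z. z \<in> {0..L} - N1 \<Longrightarrow> (dz P u has_vector_derivative dz P (dz P u) z) (at z within {0..L})"
    using regular_deriv2[OF u] by blast
  obtain N2 where N2: "negligible N2"
    "\<And>z. z \<in> {0..L} - N2 \<Longrightarrow> (dz P v has_vector_derivative dz P (dz P v) z) (at z within {0..L})"
    using regular_deriv2[OF v] by blast
  have ac: "ac_on 0 L (\<lambda>z. a * dz P u z + c * dz P v z)"
  proof (rule ac_on_dominated[where f = "dz P u" and g = "dz P v" and C = "max (cmod a) (cmod c)"])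
    show "ac_on 0 L (dz P u)" "ac_on 0 L (dz P v)" using u v by (auto simp: regular_def)
    fix x y
    have "a * dz P u y + c * dz P v y - (a * dz P u x + c * dz P v x) = a * (dz P u y - dz P u x) + c * (dz P v y - dz P v x)"
      by (simp add: algebra_simps)
    also have "cmod \<dots> \<le> cmod a * cmod (dz P u y - dz P u x) + cmod c * cmod (dz P v y - dz P v x)"
      by (metis norm_mult norm_triangle_ineq)
    also have "\<dots> \<le> max (cmod a) (cmod c) * (cmod (dz P u y - dz P u x) + cmod (dz P v y - dz P v x))"
      unfolding distrib_left by (intro add_mono mult_right_mono) auto
    finally show "cmod (a * dz P u y + c * dz P v y - (a * dz P u x + c * dz P v x)) \<le> \<dots>" .
  qed
  have d1: "((\<lambda>z. a * u z + c * v z) has_vector_derivative a * dz P u z + c * dz P v z) (at z within {0..L})" if "z \<in> {0..L}" for z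
    by (intro has_vector_derivative_add has_vector_derivative_mult_right regular_deriv u v that)
  have d2: "((\<lambda>z. a * dz P u z + c * dz P v z) has_vector_derivative a * dz P (dz P u) z + c * dz P (dz P v) z) (at z within {0..L})"
    if "z \<in> {0..L} - (N1 \<union> N2)" for z
    by (intro has_vector_derivative_add has_vector_derivative_mult_right N1 N2) (use that in auto)
  have L2: "L2_on L (\<lambda>z. a * dz P (dz P u) z + c * dz P (dz P v) z)"
    by (intro L2_on_add L2_on_scale regular_cont u v)
  have N: "negligible (N1 \<union> N2)" using N1 N2 by simp
  note R = regularI[OF d1 ac N d2 L2]
  show "regular (\<lambda>z. a * u z + c * v z)" by (rule R(1))
  show "\<And>z. z \<in> {0..L} \<Longrightarrow> dz P (\<lambda>z. a * u z + c * v z) z = a * dz P u z + c * dz P v z" by (rule R(2))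
  show "AE z in leb. dz P (dz P (\<lambda>z. a * u z + c * v z)) z = a * dz P (dz P u) z + c * dz P (dz P v) z"
    by (rule AE_leb_negligible[OF N R(3)])
qed

lemma domA_iff:
  "domA P \<phi> \<longleftrightarrow> regular (fst \<phi>)
     \<and> complex_of_real (cos (alpha P)) * fst \<phi> 0 + complex_of_real (sin (alpha P)) * dz P (fst \<phi>) 0 = 0
     \<and> snd \<phi> = complex_of_real (b1' P) * fst \<phi> L - complex_of_real (b2' P) * dz P (fst \<phi>) L"
  by (auto simp: domA_def regular_def)

lemma domA_Hsp: assumes "domA P \<phi>" shows "Hsp P \<phi>" "Hsp P (Aop P \<phi>)"
proof -
  have r: "regular (fst \<phi>)" using assms by (simp add: domA_iff)
  show "Hsp P \<phi>" using regular_cont[OF r] by (simp add: Hsp_def)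
  show "Hsp P (Aop P \<phi>)"
    using L2_on_add[OF L2_on_scale[OF regular_cont(5)[OF r], of "-1"] L2_on_scale[OF regular_cont(3)[OF r], of "of_real (msq P)"]]
    by (simp add: Hsp_def Aop_def)
qed

lemma domA_lincomb:
  assumes "domA P \<phi>" "domA P \<psi>"
  shows "domA P (hadd (hscale a \<phi>) (hscale c \<psi>))"
    "heq P (Aop P (hadd (hscale a \<phi>) (hscale c \<psi>))) (hadd (hscale a (Aop P \<phi>)) (hscale c (Aop P \<psi>)))"
proof -
  have r: "regular (fst \<phi>)" "regular (fst \<psi>)" using assms by (auto simp: domA_iff)
  note l = regular_lincomb[OF r, where a = a and c = c]
  have 0: "0 \<in> {0..L}" "L \<in> {0..L}" using len_pos by auto
  have e: "complex_of_real (cos (alpha P)) * fst \<phi> 0 + complex_of_real (sin (alpha P)) * dz P (fst \<phi>) 0 = 0"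
    "complex_of_real (cos (alpha P)) * fst \<psi> 0 + complex_of_real (sin (alpha P)) * dz P (fst \<psi>) 0 = 0"
    using assms by (auto simp: domA_iff)
  have "complex_of_real (cos (alpha P)) * (a * fst \<phi> 0 + c * fst \<psi> 0) + complex_of_real (sin (alpha P)) * (a * dz P (fst \<phi>) 0 + c * dz P (fst \<psi>) 0)
      = a * (complex_of_real (cos (alpha P)) * fst \<phi> 0 + complex_of_real (sin (alpha P)) * dz P (fst \<phi>) 0)
       + c * (complex_of_real (cos (alpha P)) * fst \<psi> 0 + complex_of_real (sin (alpha P)) * dz P (fst \<psi>) 0)"
    by (simp add: algebra_simps)
  then have bc: "complex_of_real (cos (alpha P)) * (a * fst \<phi> 0 + c * fst \<psi> 0) + complex_of_real (sin (alpha P)) * (a * dz P (fst \<phi>) 0 + c * dz P (fst \<psi>) 0) = 0"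
    using e by simp
  have s: "snd \<phi> = complex_of_real (b1' P) * fst \<phi> L - complex_of_real (b2' P) * dz P (fst \<phi>) L"
    "snd \<psi> = complex_of_real (b1' P) * fst \<psi> L - complex_of_real (b2' P) * dz P (fst \<psi>) L"
    using assms by (auto simp: domA_iff)
  show "domA P (hadd (hscale a \<phi>) (hscale c \<psi>))"
    using l(1) bc unfolding domA_iff
    by (simp add: l(2)[OF 0(1)] l(2)[OF 0(2)]) (simp add: s algebra_simps)
  show "heq P (Aop P (hadd (hscale a \<phi>) (hscale c \<psi>))) (hadd (hscale a (Aop P \<phi>)) (hscale c (Aop P \<psi>)))"
    unfolding heq_def
  proof
    show "AE z in leb. fst (Aop P (hadd (hscale a \<phi>) (hscale c \<psi>))) z = fst (hadd (hscale a (Aop P \<phi>)) (hscale c (Aop P \<psi>))) z"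
      using l(3) by (rule eventually_mono) (simp add: Aop_def algebra_simps)
    show "snd (Aop P (hadd (hscale a \<phi>) (hscale c \<psi>))) = snd (hadd (hscale a (Aop P \<phi>)) (hscale c (Aop P \<psi>)))"
      by (simp add: Aop_def l(2)[OF 0(2)] algebra_simps)
  qed
qed

lemma domA_hscale:
  assumes "domA P \<phi>"
  shows "domA P (hscale a \<phi>)" "heq P (Aop P (hscale a \<phi>)) (hscale a (Aop P \<phi>))"
proof -
  have "hadd (hscale a \<psi>) (hscale 0 \<xi>) = hscale a \<psi>" for \<psi> \<xi> by (simp add: prod_eq_iff)
  then show "domA P (hscale a \<phi>)" "heq P (Aop P (hscale a \<phi>)) (hscale a (Aop P \<phi>))"
    using domA_lincomb[OF assms assms, of a 0] by auto
qed

lemma domA_hsub: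
  assumes "domA P \<phi>" "domA P \<psi>"
  shows "domA P (hsub \<phi> \<psi>)" "heq P (Aop P (hsub \<phi> \<psi>)) (hsub (Aop P \<phi>) (Aop P \<psi>))"
proof -
  have "hscale 1 a = a" for a by (simp add: prod_eq_iff)
  then show "domA P (hsub \<phi> \<psi>)" "heq P (Aop P (hsub \<phi> \<psi>)) (hsub (Aop P \<phi>) (Aop P \<psi>))"
    using domA_lincomb[OF assms, of 1 "-1"] by (auto simp: hsub_def)
qed

subsection \<open>Green's formula\<close>

definition dform :: "hvec \<Rightarrow> hvec \<Rightarrow> complex" where
  "dform \<phi> \<xi> = integral\<^sup>L leb (\<lambda>z. cnj (dz P (fst \<phi>) z) * dz P (fst \<xi>) z)
     + of_real (msq P) * integral\<^sup>L leb (\<lambda>z. cnj (fst \<phi> z) * fst \<xi> z)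
     + of_real (- cot (alpha P)) * (cnj (fst \<phi> 0) * fst \<xi> 0)
     + bdry_form (fst \<phi> L) (dz P (fst \<phi>) L) (fst \<xi> L) (dz P (fst \<xi>) L)"

lemma dform_cnj: "dform \<phi> \<xi> = cnj (dform \<xi> \<phi>)"
proof -
  have "integral\<^sup>L leb (\<lambda>z. cnj (u z) * v z) = cnj (integral\<^sup>L leb (\<lambda>z. cnj (v z) * u z))" for u v :: "real \<Rightarrow> complex"
  proof -
    have "integral\<^sup>L leb (\<lambda>z. cnj (cnj (v z) * u z)) = cnj (integral\<^sup>L leb (\<lambda>z. cnj (v z) * u z))" by (rule Bochner_Integration.integral_cnj)
    then show ?thesis by (simp add: mult.commute del: Bochner_Integration.integral_cnj)
  qed
  from this[of "fst \<phi>" "fst \<xi>"] this[of "dz P (fst \<phi>)" "dz P (fst \<xi>)"]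
  show ?thesis unfolding dform_def bdry_form_cnj[of "fst \<phi> L" "dz P (fst \<phi>) L"] by (simp add: mult.commute del: Bochner_Integration.integral_cnj)
qed

text \<open>Multiplication by the conjugate value at 0 lets one formula cover both boundary
  conditions: for \<alpha> = 0 both sides vanish together with that value, and otherwise the
  condition is divided by the sine.\<close>

lemma Robin:
  assumes "domA P \<phi>" "domA P \<xi>"
  shows "cnj (fst \<phi> 0) * dz P (fst \<xi>) 0 = of_real (- cot (alpha P)) * (cnj (fst \<phi> 0) * fst \<xi> 0)"
proof (cases "alpha P = 0")
  case True
  then show ?thesis using assms by (simp add: domA_iff)
next
  case False
  then have "0 < alpha P" "alpha P < pi" using alpha_range pi_gt_zero by (auto simp del: pi_gt_zero)
  then have s: "sin (alpha P) \<noteq> 0" using sin_gt_zero by force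
  have "complex_of_real (cos (alpha P)) * fst \<xi> 0 + complex_of_real (sin (alpha P)) * dz P (fst \<xi>) 0 = 0"
    using assms by (simp add: domA_iff)
  then have "dz P (fst \<xi>) 0 = - (complex_of_real (cos (alpha P)) / complex_of_real (sin (alpha P))) * fst \<xi> 0"
    using s by (simp add: field_simps add_eq_0_iff)
  then show ?thesis by (simp add: cot_def)
qed

text \<open>After integration by parts the flux at 0 is the cotangent term by \<open>Robin\<close>.
  The flux at \<ell> cancels against the second component, because \<rho> is the determinant of the
  coefficients in the two boundary expressions; what is left there is
  \<open>bdry_form\<close>.\<close>

theorem Green_formula:
  assumes \<phi>: "domA P \<phi>" and \<xi>: "domA P \<xi>"
  shows "hinner P \<phi> (Aop P \<xi>) = dform \<phi> \<xi>"
proof -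
  let ?u = "fst \<phi>" and ?v = "fst \<xi>"
  have u: "regular ?u" and v: "regular ?v" using \<phi> \<xi> by (auto simp: domA_iff)
  obtain N where N: "negligible N"
    "\<And>z. z \<in> {0..L} - N \<Longrightarrow> (dz P ?v has_vector_derivative dz P (dz P ?v) z) (at z within {0..L})"
    using regular_deriv2[OF v] by blast
  have i1: "integrable leb (\<lambda>z. cnj (dz P ?u z) * dz P ?v z)"
    and i2: "integrable leb (\<lambda>z. cnj (?u z) * dz P (dz P ?v) z)"
    and i3: "integrable leb (\<lambda>z. cnj (?u z) * ?v z)"
    using integrable_L2_product regular_cont[OF u] regular_cont[OF v] by auto
  have "((\<lambda>z. cnj (dz P ?u z) * dz P ?v z + cnj (?u z) * dz P (dz P ?v) z)
     has_integral (cnj (?u L) * dz P ?v L - cnj (?u 0) * dz P ?v 0)) {0..L}"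
  proof (rule ac_on_integration_by_parts[OF len_pos _ _ N(1)])
    show "ac_on 0 L (\<lambda>z. cnj (?u z))" "ac_on 0 L (dz P ?v)" using u v by (auto simp: regular_def ac_on_cnj)
    show "((\<lambda>z. cnj (?u z)) has_vector_derivative cnj (dz P ?u z)) (at z within {0..L})" if "z \<in> {0..L} - N" for z
      using regular_deriv[OF u, of z] that by (intro has_vector_derivative_cnj) auto
  qed (use N in auto)
  then have "integral\<^sup>L leb (\<lambda>z. cnj (dz P ?u z) * dz P ?v z + cnj (?u z) * dz P (dz P ?v) z)
     = cnj (?u L) * dz P ?v L - cnj (?u 0) * dz P ?v 0"
    using i1 i2 by (subst integral_leb) (auto intro: integral_unique)
  then have I: "integral\<^sup>L leb (\<lambda>z. cnj (?u z) * dz P (dz P ?v) z)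
     = cnj (?u L) * dz P ?v L - cnj (?u 0) * dz P ?v 0 - integral\<^sup>L leb (\<lambda>z. cnj (dz P ?u z) * dz P ?v z)"
    using i1 i2 by (simp add: algebra_simps)
  have "integral\<^sup>L leb (\<lambda>z. cnj (?u z) * fst (Aop P \<xi>) z)
     = - integral\<^sup>L leb (\<lambda>z. cnj (?u z) * dz P (dz P ?v) z) + of_real (msq P) * integral\<^sup>L leb (\<lambda>z. cnj (?u z) * ?v z)"
  proof -
    have "(\<lambda>z. cnj (?u z) * fst (Aop P \<xi>) z) = (\<lambda>z. of_real (msq P) * (cnj (?u z) * ?v z) - cnj (?u z) * dz P (dz P ?v) z)"
      by (simp add: Aop_def algebra_simps)
    then show ?thesis using i2 i3 by simp
  qed
  moreover have "cnj (snd \<phi>) * snd (Aop P \<xi>) / of_real (rho P) - cnj (?u L) * dz P ?v L = bdry_form (?u L) (dz P ?u L) (?v L) (dz P ?v L)"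
  proof -
    have r: "complex_of_real (rho P) \<noteq> 0" using rho_pos by simp
    have "cnj (snd \<phi>) * snd (Aop P \<xi>) - of_real (rho P) * (cnj (?u L) * dz P ?v L) = of_real (rho P) * bdry_form (?u L) (dz P ?u L) (?v L) (dz P ?v L)"
    proof -
      have sn: "snd \<phi> = complex_of_real (b1' P) * ?u L - complex_of_real (b2' P) * dz P ?u L"
        using \<phi> by (simp add: domA_iff)
      have rr: "complex_of_real (rho P) = of_real (b1' P) * of_real (b2 P) - of_real (b1 P) * of_real (b2' P)"
        by (simp add: rho_def)
      have "of_real (rho P) * bdry_form (?u L) (dz P ?u L) (?v L) (dz P ?v L)
        = - of_real (b1 P * b1' P) * cnj (?u L) * ?v L + of_real (b1 P * b2' P) * (cnj (?u L) * dz P ?v L + cnj (dz P ?u L) * ?v L)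
          - of_real (b2 P * b2' P) * cnj (dz P ?u L) * dz P ?v L"
        using r by (simp add: bdry_form_def)
      then show ?thesis by (simp add: Aop_def sn rr algebra_simps)
    qed
    then show ?thesis using r by (simp add: field_simps)
  qed
  ultimately show ?thesis
    unfolding hinner_def dform_def using Robin[OF \<phi> \<xi>] I by (simp add: algebra_simps)
qed

theorem A_symmetric:
  assumes \<phi>: "domA P \<phi>" and \<xi>: "domA P \<xi>"
  shows "hinner P \<phi> (Aop P \<xi>) = hinner P (Aop P \<phi>) \<xi>"
  using Green_formula[OF \<phi> \<xi>] Green_formula[OF \<xi> \<phi>] dform_cnj[of \<phi> \<xi>] hinner_cnj[of "Aop P \<phi>" \<xi>] by simp

lemma A_form_bound:
  assumes \<phi>: "domA P \<phi>"
  shows "integral\<^sup>L leb (\<lambda>z. (cmod (dz P (fst \<phi>) z))\<^sup>2) \<le> Re (hinner P \<phi> (Aop P \<phi>))"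
proof -
  have sq: "cnj x * x = of_real ((cmod x)\<^sup>2)" for x using complex_norm_square[of x] by (simp add: mult.commute)
  have I: "integral\<^sup>L leb (\<lambda>z. cnj (u z) * u z) = of_real (integral\<^sup>L leb (\<lambda>z. (cmod (u z))\<^sup>2))" for u :: "real \<Rightarrow> complex"
    unfolding sq by (rule integral_complex_of_real)
  have "Re (hinner P \<phi> (Aop P \<phi>)) = integral\<^sup>L leb (\<lambda>z. (cmod (dz P (fst \<phi>) z))\<^sup>2)
     + msq P * integral\<^sup>L leb (\<lambda>z. (cmod (fst \<phi> z))\<^sup>2) + (- cot (alpha P)) * (cmod (fst \<phi> 0))\<^sup>2
     + Re (bdry_form (fst \<phi> L) (dz P (fst \<phi>) L) (fst \<phi> L) (dz P (fst \<phi>) L))"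
    unfolding Green_formula[OF \<phi> \<phi>] dform_def I
    unfolding sq by (simp only: plus_complex.sel Re_complex_of_real of_real_mult[symmetric])
  moreover have "0 \<le> msq P * integral\<^sup>L leb (\<lambda>z. (cmod (fst \<phi> z))\<^sup>2)" using msq_nonneg by simp
  moreover have "0 \<le> (- cot (alpha P)) * (cmod (fst \<phi> 0))\<^sup>2" using cot_alpha by (intro mult_nonneg_nonneg) auto
  ultimately show ?thesis using bdry_form_self_nonneg[of "fst \<phi> L" "dz P (fst \<phi>) L"] by linarith
qed

end

section \<open>Pointwise bounds from square integrable derivatives\<close>

lemma ac_on_integral_derivative:
  fixes w :: "real \<Rightarrow> complex"
  assumes ab: "a < b" and w: "ac_on a b w" and N: "negligible N"
    and d: "\<And>x. x \<in> {a..b} - N \<Longrightarrow> (w has_vector_derivative w' x) (at x within {a..b})"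
  shows "w' absolutely_integrable_on {a..b}"
    "\<And>x. x \<in> {a..b} \<Longrightarrow> integral {a..x} w' = w x - w a"
proof -
  obtain g N' where g: "g absolutely_integrable_on {a..b}" "negligible N'"
    "\<And>x. x \<in> {a..b} - N' \<Longrightarrow> (w has_vector_derivative g x) (at x within {a..b})"
    "\<And>x. x \<in> {a..b} \<Longrightarrow> integral {a..x} g = w x - w a"
    using ac_on_fundamental_theorem[OF less_imp_le[OF ab] w] by blast
  have neg: "negligible (N \<union> N')" using N g(2) by simp
  have eq: "w' x = g x" if "x \<in> {a..b} - (N \<union> N')" for x
    using vector_derivative_unique_within_closed_interval[of a b x w "w' x" "g x"] d[of x] g(3)[of x] that ab by simp
  show "w' absolutely_integrable_on {a..b}" by (rule absolutely_integrable_spike[OF g(1) neg eq])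
  show "integral {a..x} w' = w x - w a" if "x \<in> {a..b}" for x
    using integral_spike[OF neg, of "{a..x}" w' g] eq that g(4)[OF that] by auto
qed

text \<open>Integrating \<open>w'\<close> recovers \<open>w\<close>, and the integral of a
  continuous function is differentiable everywhere. The explicit resolvent is differentiated almost
  everywhere at first and upgraded with this.\<close>

lemma ac_on_C1I:
  fixes w :: "real \<Rightarrow> complex"
  assumes ab: "a < b" and w: "ac_on a b w" and N: "negligible N"
    and d: "\<And>x. x \<in> {a..b} - N \<Longrightarrow> (w has_vector_derivative w' x) (at x within {a..b})"
    and c: "continuous_on {a..b} w'" and x: "x \<in> {a..b}"
  shows "(w has_vector_derivative w' x) (at x within {a..b})"
proof -
  have "((\<lambda>x. w a + integral {a..x} w') has_vector_derivative 0 + w' x) (at x within {a..b})"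
    by (intro has_vector_derivative_add has_vector_derivative_const integral_has_vector_derivative[OF c x])
  moreover have "w y = w a + integral {a..y} w'" if "y \<in> {a..b}" for y
  proof -
    have "integral {a..y} w' = w y - w a"
      by (rule ac_on_integral_derivative(2)[OF ab w N _ that]) (rule d)
    then show ?thesis by simp
  qed
  ultimately show ?thesis
    using has_vector_derivative_transform[OF x, of w "\<lambda>x. w a + integral {a..x} w'" "0 + w' x"]
    by (metis add.left_neutral)
qed

lemma of_real_has_vector_derivative:
  "(f has_real_derivative d) F \<Longrightarrow> ((\<lambda>x. complex_of_real (f x)) has_vector_derivative complex_of_real d) F"
  by (simp add: has_vector_derivative_complex_iff)

context wave_bvp
begin

text \<open>Bound the increment by the integral of the modulus of \<open>w'\<close> and apply
  Young's inequality with a free parameter \<open>s\<close>; the best \<open>s\<close> gives the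
  Cauchy-Schwarz bound.\<close>

lemma oscillation_bound:
  fixes w :: "real \<Rightarrow> complex"
  assumes w: "ac_on 0 L w" and N: "negligible N"
    and d: "\<And>x. x \<in> {0..L} - N \<Longrightarrow> (w has_vector_derivative w' x) (at x within {0..L})"
    and L2: "L2_on L w'" and xy: "x \<in> {0..L}" "y \<in> {0..L}"
  shows "(cmod (w y - w x))\<^sup>2 \<le> \<bar>y - x\<bar> * integral\<^sup>L leb (\<lambda>z. (cmod (w' z))\<^sup>2)"
proof -
  let ?I = "integral\<^sup>L leb (\<lambda>z. (cmod (w' z))\<^sup>2)"
  have I1: "w' absolutely_integrable_on {0..L}"
    by (rule ac_on_integral_derivative(1)[OF len_pos w N]) (rule d)
  have I: "integral {0..z} w' = w z - w 0" if "z \<in> {0..L}" for z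
    by (rule ac_on_integral_derivative(2)[OF len_pos w N _ that]) (rule d)
  have sqi: "integrable leb (\<lambda>z. (cmod (w' z))\<^sup>2)" using L2 by (simp add: L2_on_def)
  then have sqa: "(\<lambda>z. (cmod (w' z))\<^sup>2) absolutely_integrable_on {0..L}" by (simp add: integrable_leb_iff)
  have sqh: "(\<lambda>z. (cmod (w' z))\<^sup>2) integrable_on {0..L}" using set_lebesgue_integral_eq_integral(1)[OF sqa] .
  have wh: "w' integrable_on {0..L}" using set_lebesgue_integral_eq_integral(1)[OF I1] .
  have *: "2 * cmod (w y - w x) \<le> s * (y - x) + ?I / s"
    if xy: "x \<in> {0..L}" "y \<in> {0..L}" "x \<le> y" and s: "s > 0" for x y s
  proof -
    have sub: "{x..y} \<subseteq> {0..L}" using xy by auto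
    have "integral {0..x} w' + integral {x..y} w' = integral {0..y} w'"
      by (rule Henstock_Kurzweil_Integration.integral_combine)
         (use xy in \<open>auto intro: integrable_on_subinterval[OF wh]\<close>)
    then have "w y - w x = integral {x..y} w'"
      unfolding I[OF xy(1)] I[OF xy(2)] by (simp add: algebra_simps)
    also have "cmod \<dots> \<le> integral {x..y} (\<lambda>z. s / 2 + (cmod (w' z))\<^sup>2 / (2 * s))"
    proof (rule integral_norm_bound_integral)
      show "w' integrable_on {x..y}" by (rule integrable_on_subinterval[OF wh sub])
      show "(\<lambda>z. s / 2 + (cmod (w' z))\<^sup>2 / (2 * s)) integrable_on {x..y}"
        by (intro integrable_add integrable_const_ivl integrable_on_divide integrable_on_subinterval[OF sqh sub])
      show "cmod (w' z) \<le> s / 2 + (cmod (w' z))\<^sup>2 / (2 * s)" for z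
        using s sum_squares_bound[of "cmod (w' z)" s] by (simp add: field_simps power2_eq_square)
    qed
    also have "\<dots> = s / 2 * (y - x) + integral {x..y} (\<lambda>z. (cmod (w' z))\<^sup>2) / (2 * s)"
      using xy integrable_on_divide[OF integrable_on_subinterval[OF sqh sub]]
      by (subst integral_add) (auto intro: integrable_const_ivl)
    also have "integral {x..y} (\<lambda>z. (cmod (w' z))\<^sup>2) \<le> ?I"
      unfolding integral_leb[OF sqi]
      by (rule integral_subset_le[OF sub integrable_on_subinterval[OF sqh sub] sqh]) simp
    finally show ?thesis using s by (simp add: field_simps)
  qed
  have I0: "0 \<le> ?I" by simp
  have le: "(cmod (w y - w x))\<^sup>2 \<le> (y - x) * ?I" if xy: "x \<in> {0..L}" "y \<in> {0..L}" "x \<le> y" for x y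
  proof (cases "cmod (w y - w x) = 0 \<or> x = y")
    case True
    then show ?thesis using I0 xy by auto
  next
    case False
    let ?D = "cmod (w y - w x)"
    have D: "?D > 0" "y - x > 0" using False xy by auto
    \<comment> \<open>The parameter \<open>?D / (y - x)\<close> makes the first term equal to
      \<open>?D\<close>, so that it is absorbed on the left.\<close>
    then have "2 * ?D \<le> ?D / (y - x) * (y - x) + ?I / (?D / (y - x))" by (intro *[OF xy]) simp
    then have "?D \<le> ?I * (y - x) / ?D" using D by simp
    then show ?thesis using D by (simp add: field_simps power2_eq_square)
  qed
  show ?thesis using le[of x y] le[of y x] xy by (cases "x \<le> y") (auto simp: norm_minus_commute)
qed

text \<open>Compare \<open>w x\<close> with \<open>w y\<close> by \<open>oscillation_bound\<close>
  and average over \<open>y\<close>. This is the one-dimensional Sobolev embedding with explicit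
  constants.\<close>

lemma sup_bound:
  fixes w :: "real \<Rightarrow> complex"
  assumes w: "ac_on 0 L w" and N: "negligible N"
    and d: "\<And>x. x \<in> {0..L} - N \<Longrightarrow> (w has_vector_derivative w' x) (at x within {0..L})"
    and L2: "L2_on L w'" and x: "x \<in> {0..L}"
  shows "(cmod (w x))\<^sup>2 \<le> 2 / L * integral\<^sup>L leb (\<lambda>z. (cmod (w z))\<^sup>2) + 2 * L * integral\<^sup>L leb (\<lambda>z. (cmod (w' z))\<^sup>2)"
proof -
  let ?I = "integral\<^sup>L leb (\<lambda>z. (cmod (w' z))\<^sup>2)"
  have I0: "0 \<le> ?I" by simp
  have pw: "(cmod (w x))\<^sup>2 \<le> 2 * (cmod (w y))\<^sup>2 + 2 * (L * ?I)" if y: "y \<in> {0..L}" for y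
  proof -
    have "cmod (w x) \<le> cmod (w y) + cmod (w x - w y)" by (metis norm_triangle_sub)
    then have "(cmod (w x))\<^sup>2 \<le> (cmod (w y) + cmod (w x - w y))\<^sup>2" by (intro power_mono) auto
    also have "\<dots> \<le> 2 * (cmod (w y))\<^sup>2 + 2 * (cmod (w x - w y))\<^sup>2"
      using sum_squares_bound[of "cmod (w y)" "cmod (w x - w y)"] by (simp add: power2_sum)
    also have "(cmod (w x - w y))\<^sup>2 \<le> \<bar>x - y\<bar> * ?I" by (rule oscillation_bound[OF w N _ L2 y x]) (rule d)
    also have "\<bar>x - y\<bar> * ?I \<le> L * ?I" using x y I0 by (intro mult_right_mono) auto
    finally show ?thesis by simp
  qed
  have meas: "measure leb {0<..<L} = L" using len_pos by (simp add: measure_restrict_space)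
  have ci: "integrable leb (\<lambda>z. c :: real)" for c
    unfolding integrable_leb_iff by (rule absolutely_integrable_continuous_real) simp
  have wi: "integrable leb (\<lambda>z. (cmod (w z))\<^sup>2)"
    using L2_on_continuous[OF ac_on_imp_continuous_on[OF w]] by (simp add: L2_on_def)
  have "integral\<^sup>L leb (\<lambda>z. (cmod (w x))\<^sup>2) \<le> integral\<^sup>L leb (\<lambda>z. 2 * (cmod (w z))\<^sup>2 + 2 * (L * ?I))"
    by (rule integral_mono) (use wi ci pw in \<open>auto simp: space_restrict_space\<close>)
  then have "L * (cmod (w x))\<^sup>2 \<le> 2 * integral\<^sup>L leb (\<lambda>z. (cmod (w z))\<^sup>2) + L * (2 * (L * ?I))"
    using wi ci meas by (simp add: space_restrict_space)
  then show ?thesis using len_pos by (simp add: field_simps)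
qed

lemma L2_part_le_hnorm: "integral\<^sup>L leb (\<lambda>z. (cmod (fst a z))\<^sup>2) \<le> (hnorm P a)\<^sup>2" "(cmod (snd a))\<^sup>2 \<le> rho P * (hnorm P a)\<^sup>2"
proof -
  have "0 \<le> integral\<^sup>L leb (\<lambda>z. (cmod (fst a z))\<^sup>2)" "0 \<le> (cmod (snd a))\<^sup>2 / rho P" using rho_pos by auto
  then have "integral\<^sup>L leb (\<lambda>z. (cmod (fst a z))\<^sup>2) \<le> (hnorm P a)\<^sup>2" "(cmod (snd a))\<^sup>2 / rho P \<le> (hnorm P a)\<^sup>2"
    unfolding hnorm_square by auto
  then show "integral\<^sup>L leb (\<lambda>z. (cmod (fst a z))\<^sup>2) \<le> (hnorm P a)\<^sup>2" "(cmod (snd a))\<^sup>2 \<le> rho P * (hnorm P a)\<^sup>2"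
    using rho_pos by (auto simp: field_simps)
qed

lemma A_form_nonneg: "domA P \<phi> \<Longrightarrow> 0 \<le> Re (hinner P \<phi> (Aop P \<phi>))"
  using A_form_bound[of \<phi>] by (rule order_trans[rotated]) simp_all

lemma deriv_L2_bound:
  assumes "domA P \<phi>"
  shows "integral\<^sup>L leb (\<lambda>z. (cmod (dz P (fst \<phi>) z))\<^sup>2) \<le> hnorm P \<phi> * hnorm P (Aop P \<phi>)"
  using A_form_bound[OF assms] hinner_Cauchy_Schwarz[OF domA_Hsp[OF assms]] complex_Re_le_cmod[of "hinner P \<phi> (Aop P \<phi>)"]
  by linarith

lemma gnorm_ge: "hnorm P \<phi> \<le> gnorm P \<phi>" "hnorm P (Aop P \<phi>) \<le> gnorm P \<phi>" "0 \<le> gnorm P \<phi>"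
  by (auto simp: gnorm_def)

text \<open>The second derivative is \<open>m^2 u\<close> minus the first component of
  \<open>A \<phi>\<close>, so \<open>sup_bound\<close> applies to \<open>u\<close> and to its
  derivative. Point evaluations of both, at the ends included, are thereby continuous in the graph
  norm.\<close>

lemma uniform_bound_gnorm:
  obtains C where "0 \<le> C"
    "\<forall>\<phi> x. domA P \<phi> \<longrightarrow> x \<in> {0..L} \<longrightarrow> cmod (fst \<phi> x) \<le> C * gnorm P \<phi> \<and> cmod (dz P (fst \<phi>) x) \<le> C * gnorm P \<phi>"
proof -
  \<comment> \<open>\<open>2 / L\<close> and \<open>2 * L\<close> come from
    \<open>sup_bound\<close>; the summand 1 pays for the first derivative and
    \<open>2 * (msq P)\<^sup>2 + 2\<close> for the second.\<close>
  define K where "K = 2 / L + 2 * L * (1 + 2 * (msq P)\<^sup>2 + 2)"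
  have K0: "0 \<le> K" using len_pos by (simp add: K_def)
  have "cmod (fst \<phi> x) \<le> sqrt K * gnorm P \<phi> \<and> cmod (dz P (fst \<phi>) x) \<le> sqrt K * gnorm P \<phi>"
    if \<phi>: "domA P \<phi>" and x: "x \<in> {0..L}" for \<phi> x
  proof -
    let ?u = "fst \<phi>" and ?g = "gnorm P \<phi>"
    have r: "regular ?u" using \<phi> by (simp add: domA_iff)
    have i0: "integral\<^sup>L leb (\<lambda>z. (cmod (?u z))\<^sup>2) \<le> ?g\<^sup>2"
      using L2_part_le_hnorm(1)[of \<phi>] power_mono[OF gnorm_ge(1)[of \<phi>], of 2] by simp
    have i1: "integral\<^sup>L leb (\<lambda>z. (cmod (dz P ?u z))\<^sup>2) \<le> ?g\<^sup>2"
      using deriv_L2_bound[OF \<phi>] mult_mono[OF gnorm_ge(1)[of \<phi>] gnorm_ge(2)[of \<phi>] gnorm_ge(3)] 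
      by (simp add: power2_eq_square)
    have i2: "integral\<^sup>L leb (\<lambda>z. (cmod (dz P (dz P ?u) z))\<^sup>2) \<le> (2 * (msq P)\<^sup>2 + 2) * ?g\<^sup>2"
    proof -
      have "integral\<^sup>L leb (\<lambda>z. (cmod (dz P (dz P ?u) z))\<^sup>2)
        \<le> integral\<^sup>L leb (\<lambda>z. 2 * (msq P)\<^sup>2 * (cmod (?u z))\<^sup>2 + 2 * (cmod (fst (Aop P \<phi>) z))\<^sup>2)"
      proof (rule integral_mono)
        show "integrable leb (\<lambda>z. (cmod (dz P (dz P ?u) z))\<^sup>2)" using regular_cont(5)[OF r] by (simp add: L2_on_def)
        show "integrable leb (\<lambda>z. 2 * (msq P)\<^sup>2 * (cmod (?u z))\<^sup>2 + 2 * (cmod (fst (Aop P \<phi>) z))\<^sup>2)"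
          using domA_Hsp[OF \<phi>] by (simp add: Hsp_def L2_on_def)
        fix z
        have "dz P (dz P ?u) z = of_real (msq P) * ?u z - fst (Aop P \<phi>) z" by (simp add: Aop_def)
        then have "cmod (dz P (dz P ?u) z) \<le> msq P * cmod (?u z) + cmod (fst (Aop P \<phi>) z)"
          using norm_triangle_ineq4[of "of_real (msq P) * ?u z" "fst (Aop P \<phi>) z"] msq_nonneg by (simp add: norm_mult)
        then have "(cmod (dz P (dz P ?u) z))\<^sup>2 \<le> (msq P * cmod (?u z) + cmod (fst (Aop P \<phi>) z))\<^sup>2"
          by (intro power_mono) auto
        also have "\<dots> \<le> 2 * (msq P * cmod (?u z))\<^sup>2 + 2 * (cmod (fst (Aop P \<phi>) z))\<^sup>2"
          using sum_squares_bound[of "msq P * cmod (?u z)" "cmod (fst (Aop P \<phi>) z)"] by (simp add: power2_sum)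
        finally show "(cmod (dz P (dz P ?u) z))\<^sup>2 \<le> 2 * (msq P)\<^sup>2 * (cmod (?u z))\<^sup>2 + 2 * (cmod (fst (Aop P \<phi>) z))\<^sup>2"
          by (simp add: power_mult_distrib)
      qed
      also have "\<dots> = 2 * (msq P)\<^sup>2 * integral\<^sup>L leb (\<lambda>z. (cmod (?u z))\<^sup>2) + 2 * integral\<^sup>L leb (\<lambda>z. (cmod (fst (Aop P \<phi>) z))\<^sup>2)"
        using domA_Hsp[OF \<phi>] by (simp add: Hsp_def L2_on_def)
      also have "\<dots> \<le> 2 * (msq P)\<^sup>2 * ?g\<^sup>2 + 2 * ?g\<^sup>2"
        using L2_part_le_hnorm(1)[of "Aop P \<phi>"] power_mono[OF gnorm_ge(2)[of \<phi>], of 2] i0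
        by (intro add_mono mult_left_mono) auto
      finally show ?thesis by (simp add: algebra_simps)
    qed
    obtain N where N: "negligible N"
      "\<And>z. z \<in> {0..L} - N \<Longrightarrow> (dz P ?u has_vector_derivative dz P (dz P ?u) z) (at z within {0..L})"
      using regular_deriv2[OF r] by blast
    have "(cmod (?u x))\<^sup>2 \<le> 2 / L * integral\<^sup>L leb (\<lambda>z. (cmod (?u z))\<^sup>2) + 2 * L * integral\<^sup>L leb (\<lambda>z. (cmod (dz P ?u z))\<^sup>2)"
      by (rule sup_bound[OF _ negligible_empty]) (use r x in \<open>auto simp: regular_def intro: regular_deriv regular_cont\<close>)
    also have "\<dots> \<le> 2 / L * ?g\<^sup>2 + 2 * L * ?g\<^sup>2"
      using i0 i1 len_pos by (intro add_mono mult_left_mono) auto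
    also have "\<dots> \<le> K * ?g\<^sup>2" using len_pos by (simp add: K_def algebra_simps)
    finally have 1: "(cmod (?u x))\<^sup>2 \<le> K * ?g\<^sup>2" .
    have "(cmod (dz P ?u x))\<^sup>2 \<le> 2 / L * integral\<^sup>L leb (\<lambda>z. (cmod (dz P ?u z))\<^sup>2) + 2 * L * integral\<^sup>L leb (\<lambda>z. (cmod (dz P (dz P ?u) z))\<^sup>2)"
      by (rule sup_bound[OF _ N(1)]) (use r x N(2) in \<open>auto simp: regular_def\<close>)
    also have "\<dots> \<le> 2 / L * ?g\<^sup>2 + 2 * L * ((2 * (msq P)\<^sup>2 + 2) * ?g\<^sup>2)"
      using i1 i2 len_pos by (intro add_mono mult_left_mono) auto
    also have "\<dots> \<le> K * ?g\<^sup>2" using len_pos by (simp add: K_def algebra_simps)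
    finally have 2: "(cmod (dz P ?u x))\<^sup>2 \<le> K * ?g\<^sup>2" .
    have "K * ?g\<^sup>2 = (sqrt K * ?g)\<^sup>2" using K0 by (simp add: power_mult_distrib)
    then show ?thesis using 1 2 K0 gnorm_ge(3)[of \<phi>]
      by (metis mult_nonneg_nonneg power2_le_imp_le real_sqrt_ge_zero)
  qed
  then show ?thesis using that[of "sqrt K"] K0 by auto
qed

subsection \<open>The resolvent\<close>

definition dvec :: "(real \<Rightarrow> complex) \<Rightarrow> hvec" where
  "dvec u = (u, of_real (b1' P) * u L - of_real (b2' P) * dz P u L)"

text \<open>A solution of \<open>u'' = (m^2 + 1) u\<close> that obeys the condition at 0 is
  annihilated by \<open>A + 1\<close> in the first component. If the second component vanished too,
  positivity would give \<open>v = 0\<close> in \<open>H\<close>, hence vanishing value and slope at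
  0, so that sine and cosine of \<alpha> would both be 0. The vector serves to correct the second
  component in \<open>resolvent_exists\<close>.\<close>

lemma resolvent_homogeneous:
  obtains v where "domA P v" "fst (hadd (Aop P v) v) = (\<lambda>z. - dz P (dz P (fst v)) z + (of_real (msq P) + 1) * fst v z)"
    "AE z in leb. fst (hadd (Aop P v) v) z = 0" "snd (hadd (Aop P v) v) \<noteq> 0"
proof -
  define w where "w = sqrt (msq P + 1)"
  have w: "w > 0" "w\<^sup>2 = msq P + 1" using msq_nonneg by (auto simp: w_def)
  \<comment> \<open>Value sin \<alpha> and slope - cos \<alpha> at 0 satisfy the boundary condition
    for every \<alpha>, the Dirichlet case included.\<close>
  define u where "u z = complex_of_real (sin (alpha P) * cosh (w * z) - cos (alpha P) * sinh (w * z) / w)" for z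
  define u1 where "u1 z = complex_of_real (sin (alpha P) * (w * sinh (w * z)) - cos (alpha P) * cosh (w * z))" for z
  have d1: "(u has_vector_derivative u1 z) (at z within {0..L})" for z
    unfolding u_def u1_def
    by (rule of_real_has_vector_derivative) (use w in \<open>auto intro!: derivative_eq_intros simp: field_simps\<close>)
  have d2: "(u1 has_vector_derivative of_real (w\<^sup>2) * u z) (at z within {0..L})" for z
  proof -
    have "of_real (w\<^sup>2) * u z = complex_of_real (sin (alpha P) * (w * (w * cosh (w * z))) - cos (alpha P) * (w * sinh (w * z)))"
      unfolding u_def of_real_mult[symmetric] using w(1) by (intro arg_cong[where f = of_real]) (simp add: field_simps power2_eq_square)
    then show ?thesis
      unfolding u1_def
      by (simp only:) (rule of_real_has_vector_derivative, auto intro!: derivative_eq_intros simp: field_simps)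
  qed
  have cu: "continuous_on {0..L} u"
    using d1 by (intro continuous_on_vector_derivative) auto
  note R = regularI[OF d1 C1_imp_ac_on[OF d2] negligible_empty d2 L2_on_continuous]
  have r: "regular u" "\<And>z. z \<in> {0..L} \<Longrightarrow> dz P u z = u1 z" "\<And>z. z \<in> {0..L} \<Longrightarrow> dz P (dz P u) z = of_real (w\<^sup>2) * u z"
  proof -
    have "continuous_on {0..L} (\<lambda>x. of_real (w\<^sup>2) * u x)" by (intro continuous_intros cu)
    then show "regular u" "\<And>z. z \<in> {0..L} \<Longrightarrow> dz P u z = u1 z"
      "\<And>z. z \<in> {0..L} \<Longrightarrow> dz P (dz P u) z = of_real (w\<^sup>2) * u z"
      using R by auto
  qed
  have z0: "0 \<in> {0..L}" "L \<in> {0..L}" using len_pos by auto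
  define v where "v = dvec u"
  have fv: "fst v = u" by (simp add: v_def dvec_def)
  have dv: "domA P v"
    unfolding domA_iff fv using r(1) by (simp add: r(2)[OF z0(1)] v_def dvec_def u_def u1_def)
  have ae: "AE z in leb. fst (hadd (Aop P v) v) z = 0"
  proof (rule AE_leb_negligible[OF negligible_empty])
    fix z assume "z \<in> {0..L} - {}"
    then show "fst (hadd (Aop P v) v) z = 0"
      using r(3)[of z] w(2) by (simp add: Aop_def fv algebra_simps)
  qed
  have "snd (hadd (Aop P v) v) \<noteq> 0"
  proof
    assume s: "snd (hadd (Aop P v) v) = 0"
    have H: "Hsp P v" "Hsp P (Aop P v)" by (rule domA_Hsp[OF dv])+
    have "heq P (hadd (Aop P v) v) hzero" using ae s by (simp add: heq_def hzero_def)
    then have "hinner P v (hadd (Aop P v) v) = 0" using hinner_cong[of v "hadd (Aop P v) v" hzero] H by simp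
    then have "Re (hinner P v (Aop P v)) + (hnorm P v)\<^sup>2 = 0"
      using H by (simp add: hinner_linear hinner_self_hnorm complex_eq_iff)
    then have n0: "hnorm P v = 0" using A_form_nonneg[OF dv] by (smt (verit) zero_le_power2 power2_eq_iff_nonneg hnorm_nonneg zero_power2)
    have "heq P (Aop P v) (hscale (-1) v)"
      using ae s unfolding heq_def by (auto elim!: eventually_mono simp: add_eq_0_iff)
    then have "hnorm P (Aop P v) = 0" using hnorm_cong[of "Aop P v" "hscale (-1) v"] H n0 by (simp add: hnorm_hscale)
    then have g0: "gnorm P v = 0" using n0 by (simp add: gnorm_def)
    obtain C where "0 \<le> C" and C: "\<forall>\<phi> x. domA P \<phi> \<longrightarrow> x \<in> {0..L} \<longrightarrow> cmod (fst \<phi> x) \<le> C * gnorm P \<phi> \<and> cmod (dz P (fst \<phi>) x) \<le> C * gnorm P \<phi>"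
      by (rule uniform_bound_gnorm)
    have "u 0 = 0" "dz P u 0 = 0" using C[rule_format, OF dv z0(1)] g0 by (auto simp: fv)
    then have "sin (alpha P) = 0" "cos (alpha P) = 0" by (auto simp: r(2)[OF z0(1)] u_def u1_def)
    then show False using sin_cos_squared_add[of "alpha P"] by simp
  qed
  then show ?thesis using that[of v] dv ae by (simp add: Aop_def algebra_simps)
qed

text \<open>Variation of constants solves the equation for the first component with zero data at 0,
  so the condition there is automatic. A multiple of the homogeneous solution then adjusts the
  second component.\<close>

lemma resolvent_exists:
  assumes \<eta>: "Hsp P \<eta>"
  obtains \<phi> where "domA P \<phi>" "heq P (hadd (Aop P \<phi>) \<phi>) \<eta>"
proof -
  define w where "w = sqrt (msq P + 1)"
  have w: "w > 0" "w\<^sup>2 = msq P + 1" using msq_nonneg by (auto simp: w_def)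
  let ?h = "fst \<eta>"
  define C where "C z = complex_of_real (cosh (w * z))" for z
  define S where "S z = complex_of_real (sinh (w * z))" for z
  have dC: "(C has_vector_derivative of_real w * S z) (at z within T)" for z T
    unfolding C_def S_def of_real_mult[symmetric]
    by (rule of_real_has_vector_derivative) (auto intro!: derivative_eq_intros)
  have dS: "(S has_vector_derivative of_real w * C z) (at z within T)" for z T
    unfolding C_def S_def of_real_mult[symmetric]
    by (rule of_real_has_vector_derivative) (auto intro!: derivative_eq_intros)
  have cC: "continuous_on T C" for T by (rule continuous_on_vector_derivative[OF dC])
  have cS: "continuous_on T S" for T by (rule continuous_on_vector_derivative[OF dS])
  have acC: "ac_on 0 L C" by (rule C1_imp_ac_on[OF dC]) (intro continuous_intros cS)
  have acS: "ac_on 0 L S" by (rule C1_imp_ac_on[OF dS]) (intro continuous_intros cC)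
  have L2h: "L2_on L ?h" using \<eta> by (simp add: Hsp_def)
  have cj: "cnj (C z) = C z" "cnj (S z) = S z" for z by (auto simp: C_def S_def)
  have Ch: "(\<lambda>s. C s * ?h s) absolutely_integrable_on {0..L}" and Sh: "(\<lambda>s. S s * ?h s) absolutely_integrable_on {0..L}"
    using integrable_L2_product[OF L2_on_continuous[OF cC] L2h] integrable_L2_product[OF L2_on_continuous[OF cS] L2h]
    unfolding integrable_leb_iff cj by auto
  define p where "p z = integral {0..z} (\<lambda>s. C s * ?h s)" for z
  define q where "q z = integral {0..z} (\<lambda>s. S s * ?h s)" for z
  have acp: "ac_on 0 L p" unfolding p_def by (rule ac_on_integral[OF Ch])
  have acq: "ac_on 0 L q" unfolding q_def by (rule ac_on_integral[OF Sh])
  obtain N1 where N1: "negligible N1" "\<And>x. x \<in> {0..L} - N1 \<Longrightarrow> (p has_vector_derivative C x * ?h x) (at x within {0..L})"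
    using ae_derivative_integral[OF Ch] unfolding p_def[abs_def] by blast
  obtain N2 where N2: "negligible N2" "\<And>x. x \<in> {0..L} - N2 \<Longrightarrow> (q has_vector_derivative S x * ?h x) (at x within {0..L})"
    using ae_derivative_integral[OF Sh] unfolding q_def[abs_def] by blast
  let ?N = "N1 \<union> N2"
  have N: "negligible ?N" using N1 N2 by simp
  define iw where "iw = complex_of_real (1 / w)"
  have iw: "iw * of_real w = 1" "of_real w * iw = 1" using w(1) by (simp_all add: iw_def)
  \<comment> \<open>This is \<open>- 1 / w\<close> times the integral of
    \<open>sinh (w * (z - s)) * h s\<close> over [0, z]. The addition theorem separates the
    variables, so that only the indefinite integrals \<open>p\<close> and \<open>q\<close> have to
    be differentiated.\<close>
  define u where "u z = (- iw) * (S z * p z - C z * q z)" for z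
  define u1 where "u1 z = (-1) * (C z * p z - S z * q z)" for z
  define u2 where "u2 z = of_real (w\<^sup>2) * u z - ?h z" for z
  have acc: "ac_on 0 L (\<lambda>z. c)" for c :: complex by (rule lipschitz_imp_ac_on[where C = 0]) simp
  have acu: "ac_on 0 L u" and acu1: "ac_on 0 L u1"
    unfolding u_def u1_def by (intro ac_on_mult ac_on_diff acc acC acS acp acq)+
  have CS: "C z * C z - S z * S z = 1" for z
    unfolding C_def S_def of_real_mult[symmetric] of_real_diff[symmetric]
    using cosh_square_eq[of "w * z"] by (simp add: power2_eq_square)
  have du_ae: "(u has_vector_derivative u1 z) (at z within {0..L})" if z: "z \<in> {0..L} - ?N" for z
  proof -
    have "((\<lambda>z. (- iw) * (S z * p z - C z * q z)) has_vector_derivative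
       (- iw) * ((S z * (C z * ?h z) + of_real w * C z * p z) - (C z * (S z * ?h z) + of_real w * S z * q z))) (at z within {0..L})"
      by (intro has_vector_derivative_mult_right has_vector_derivative_diff has_vector_derivative_mult dC dS N1(2) N2(2)) (use z in auto)
    moreover have "(- iw) * ((S z * (C z * ?h z) + of_real w * C z * p z) - (C z * (S z * ?h z) + of_real w * S z * q z))
       = - (iw * of_real w) * (C z * p z - S z * q z)" by (simp add: algebra_simps)
    ultimately show ?thesis unfolding u_def[abs_def] u1_def iw by simp
  qed
  have cu1: "continuous_on {0..L} u1" and cu: "continuous_on {0..L} u"
    using acu1 acu by (auto intro: ac_on_imp_continuous_on)
  \<comment> \<open>The product rule holds only where \<open>p\<close> and \<open>q\<close> are
    differentiable; since \<open>u1\<close> is continuous, it is nevertheless the derivative at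
    every point.\<close>
  have du: "(u has_vector_derivative u1 z) (at z within {0..L})" if "z \<in> {0..L}" for z
    by (rule ac_on_C1I[OF len_pos acu N _ cu1 that]) (rule du_ae)
  have du1: "(u1 has_vector_derivative u2 z) (at z within {0..L})" if z: "z \<in> {0..L} - ?N" for z
  proof -
    have "((\<lambda>z. (-1) * (C z * p z - S z * q z)) has_vector_derivative
       (-1) * ((C z * (C z * ?h z) + of_real w * S z * p z) - (S z * (S z * ?h z) + of_real w * C z * q z))) (at z within {0..L})"
      by (intro has_vector_derivative_mult_right has_vector_derivative_diff has_vector_derivative_mult dC dS N1(2) N2(2)) (use z in auto)
    moreover have "(-1) * ((C z * (C z * ?h z) + of_real w * S z * p z) - (S z * (S z * ?h z) + of_real w * C z * q z)) = u2 z"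
    proof -
      have "u2 z = of_real w * (of_real w * iw) * (C z * q z - S z * p z) - (C z * C z - S z * S z) * ?h z"
        unfolding u2_def u_def CS by (simp add: algebra_simps power2_eq_square)
      then show ?thesis unfolding iw by (simp add: algebra_simps)
    qed
    ultimately show ?thesis unfolding u1_def[abs_def] by simp
  qed
  have L2u2: "L2_on L u2" unfolding u2_def by (intro L2_on_diff L2_on_scale L2_on_continuous cu L2h)
  have R: "regular u" "\<And>z. z \<in> {0..L} \<Longrightarrow> dz P u z = u1 z" "\<And>z. z \<in> {0..L} - ?N \<Longrightarrow> dz P (dz P u) z = u2 z"
    using regularI[OF du acu1 N du1 L2u2] by auto
  have z0: "0 \<in> {0..L}" "L \<in> {0..L}" using len_pos by auto
  define f where "f = dvec u"
  have ff: "fst f = u" by (simp add: f_def dvec_def)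
  have pq0: "p 0 = 0" "q 0 = 0" by (auto simp: p_def q_def)
  have df: "domA P f"
    unfolding domA_iff ff using R(1) by (simp add: R(2)[OF z0(1)] u_def u1_def f_def dvec_def pq0)
  have fae: "AE z in leb. fst (hadd (Aop P f) f) z = ?h z"
  proof (rule AE_leb_negligible[OF N])
    fix z assume "z \<in> {0..L} - ?N"
    then show "fst (hadd (Aop P f) f) z = ?h z"
      using R(3)[of z] w(2) by (simp add: Aop_def ff u2_def algebra_simps)
  qed
  obtain v where v: "domA P v" "AE z in leb. fst (hadd (Aop P v) v) z = 0" "snd (hadd (Aop P v) v) \<noteq> 0"
    using resolvent_homogeneous by blast
  define c where "c = (snd \<eta> - snd (hadd (Aop P f) f)) / snd (hadd (Aop P v) v)"
  let ?\<phi> = "hadd (hscale 1 f) (hscale c v)"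
  have D: "domA P ?\<phi>" "heq P (Aop P ?\<phi>) (hadd (hscale 1 (Aop P f)) (hscale c (Aop P v)))"
    using domA_lincomb[OF df v(1), of 1 c] by auto
  have "heq P (hadd (Aop P ?\<phi>) ?\<phi>) \<eta>"
    unfolding heq_def
  proof
    have "AE z in leb. fst (Aop P ?\<phi>) z = fst (Aop P f) z + c * fst (Aop P v) z" using D(2) by (simp add: heq_def)
    then show "AE z in leb. fst (hadd (Aop P ?\<phi>) ?\<phi>) z = ?h z"
      using fae v(2)
    proof eventually_elim
      case (elim z)
      have "fst (hadd (Aop P ?\<phi>) ?\<phi>) z = fst (hadd (Aop P f) f) z + c * fst (hadd (Aop P v) v) z"
        using elim(1) by (simp add: algebra_simps)
      then show ?case unfolding elim(2,3) by simp
    qed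
    have "snd (hadd (Aop P ?\<phi>) ?\<phi>) = snd (hadd (Aop P f) f) + c * snd (hadd (Aop P v) v)"
      using D(2) by (simp add: heq_def algebra_simps)
    also have "\<dots> = snd \<eta>" using v(3) by (simp only: c_def) (simp del: snd_hadd)
    finally show "snd (hadd (Aop P ?\<phi>) ?\<phi>) = snd \<eta>" .
  qed
  then show ?thesis using that[OF D(1)] by blast
qed

end

lemma tendsto_zero_squeeze:
  fixes x y :: "nat \<Rightarrow> real"
  assumes "\<And>n. 0 \<le> x n" "\<And>n. x n \<le> y n" "y \<longlonglongrightarrow> 0"
  shows "x \<longlonglongrightarrow> 0"
  by (rule tendsto_sandwich[OF _ _ tendsto_const assms(3)]) (simp_all add: assms(1,2))

lemma tendsto_zero_squeeze_square:
  fixes x y :: "nat \<Rightarrow> real"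
  assumes "\<And>n. 0 \<le> x n" "\<And>n. (x n)\<^sup>2 \<le> y n" "y \<longlonglongrightarrow> 0"
  shows "x \<longlonglongrightarrow> 0"
proof -
  have "(\<lambda>n. (x n)\<^sup>2) \<longlonglongrightarrow> 0" by (rule tendsto_zero_squeeze[OF _ assms(2,3)]) simp
  then have "(\<lambda>n. sqrt ((x n)\<^sup>2)) \<longlonglongrightarrow> sqrt 0" by (rule tendsto_real_sqrt)
  then show ?thesis using assms(1) by simp
qed

context wave_bvp
begin

lemma abs_le_square: "s > 0 \<Longrightarrow> x \<le> s / 2 + x\<^sup>2 / (2 * s)" for x s :: real
  using sum_squares_bound[of x s] by (simp add: field_simps power2_eq_square)

lemma integral_abs_le:
  assumes "L2_on L u" "s > 0"
  shows "integral\<^sup>L leb (\<lambda>z. cmod (u z)) \<le> s * L / 2 + integral\<^sup>L leb (\<lambda>z. (cmod (u z))\<^sup>2) / (2 * s)"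
proof -
  have meas: "measure leb {0<..<L} = L" using len_pos by (simp add: measure_restrict_space)
  have ci: "integrable leb (\<lambda>z. c :: real)" for c
    unfolding integrable_leb_iff by (rule absolutely_integrable_continuous_real) simp
  have ui: "integrable leb (\<lambda>z. (cmod (u z))\<^sup>2)" using assms by (simp add: L2_on_def)
  have "integral\<^sup>L leb (\<lambda>z. cmod (u z)) \<le> integral\<^sup>L leb (\<lambda>z. s / 2 + (cmod (u z))\<^sup>2 / (2 * s))"
    by (rule integral_mono) (use integrable_L2[OF assms(1)] ui ci abs_le_square[OF assms(2)] in \<open>auto\<close>)
  also have "\<dots> = s * L / 2 + integral\<^sup>L leb (\<lambda>z. (cmod (u z))\<^sup>2) / (2 * s)"
    using ui ci meas by (simp add: space_restrict_space)
  finally show ?thesis .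
qed

subsection \<open>Completeness\<close>

text \<open>The L2 increments decay geometrically, hence so do the L1 increments, and their sum is
  finite almost everywhere; this gives a pointwise limit. Fatou's lemma turns it into a limit in
  norm.\<close>

theorem Riesz_Fischer:
  assumes a: "\<And>n. Hsp P (a n)" and step: "\<And>n. hnorm P (hsub (a (Suc n)) (a n)) \<le> (1/2)^n"
  obtains b where "Hsp P b" "(\<lambda>n. hnorm P (hsub (a n) b)) \<longlonglongrightarrow> 0"
proof -
  let ?u = "\<lambda>n. fst (a n)"
  define d where "d n z = cmod (?u (Suc n) z - ?u n z)" for n z
  have um[measurable]: "?u n \<in> borel_measurable leb" for n using a[of n] by (simp add: Hsp_def L2_on_def)
  have L2d: "L2_on L (\<lambda>z. ?u m z - ?u n z)" for m n using a by (simp add: Hsp_def L2_on_diff)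
  have dist: "hnorm P (hsub (a (n + k)) (a n)) \<le> 2 * (1/2)^n" for n k
  proof -
    have "hnorm P (hsub (a (n + k)) (a n)) \<le> (\<Sum>i<k. (1/2)^(n + i))"
    proof (induction k)
      case 0
      have "hsub (a n) (a n) = hzero" by (simp add: prod_eq_iff hzero_def)
      then show ?case by simp
    next
      case (Suc k)
      then show ?case
        using hnorm_sub_triangle[OF a[of "Suc (n + k)"] a[of "n + k"] a[of n]] step[of "n + k"] by simp
    qed
    also have "\<dots> = (1/2)^n * (\<Sum>i<k. (1/2)^i)" by (simp add: power_add sum_distrib_left)
    also have "(\<Sum>i<k. (1/2::real)^i) = 2 - 2 * (1/2)^k" by (induction k) auto
    also have "(1/2)^n * (2 - 2 * (1/2::real)^k) \<le> 2 * (1/2)^n" by simp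
    finally show ?thesis .
  qed
  \<comment> \<open>Taking \<open>s = (1/2)^n\<close> in \<open>integral_abs_le\<close> makes both
    of its terms of order \<open>(1/2)^n\<close>.\<close>
  have di: "integral\<^sup>L leb (d n) \<le> (L + 1) / 2 * (1/2)^n" for n
  proof -
    have "integral\<^sup>L leb (\<lambda>z. (cmod (?u (Suc n) z - ?u n z))\<^sup>2) \<le> (hnorm P (hsub (a (Suc n)) (a n)))\<^sup>2"
      using L2_part_le_hnorm(1)[of "hsub (a (Suc n)) (a n)"] by simp
    also have "\<dots> \<le> ((1/2)^n)\<^sup>2" by (rule power_mono[OF step hnorm_nonneg])
    finally have "integral\<^sup>L leb (\<lambda>z. (cmod (?u (Suc n) z - ?u n z))\<^sup>2) / (2 * (1/2)^n) \<le> (1/2)^n / 2"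
      by (simp add: field_simps power2_eq_square)
    then show ?thesis
      using integral_abs_le[OF L2d[of "Suc n" n], of "(1/2)^n"] unfolding d_def by (simp add: field_simps)
  qed
  have "(\<integral>\<^sup>+z. (\<Sum>n. ennreal (d n z)) \<partial>leb) = (\<Sum>n. \<integral>\<^sup>+z. ennreal (d n z) \<partial>leb)"
    unfolding d_def by (rule nn_integral_suminf) measurable
  also have "\<dots> \<le> (\<Sum>n. ennreal ((L + 1) / 2 * (1/2)^n))"
  proof (rule suminf_le)
    fix n
    have "(\<integral>\<^sup>+z. ennreal (d n z) \<partial>leb) = ennreal (integral\<^sup>L leb (d n))"
      using integrable_norm[OF integrable_L2[OF L2d[of "Suc n" n]]]
      by (intro nn_integral_eq_integral) (auto simp: d_def)
    then show "(\<integral>\<^sup>+z. ennreal (d n z) \<partial>leb) \<le> ennreal ((L + 1) / 2 * (1/2)^n)"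
      using di[of n] by (simp add: ennreal_leI)
  qed auto
  also have "\<dots> = ennreal (\<Sum>n. (L + 1) / 2 * (1/2)^n)"
    using len_pos by (intro suminf_ennreal2 summable_mult) (auto simp: summable_geometric)
  also have "\<dots> < \<infinity>" by simp
  finally have "AE z in leb. (\<Sum>n. ennreal (d n z)) \<noteq> \<infinity>"
    by (intro nn_integral_PInf_AE) (auto simp: d_def)
  then have conv: "AE z in leb. convergent (\<lambda>n. ?u n z)"
  proof (rule eventually_mono)
    fix z assume "(\<Sum>n. ennreal (d n z)) \<noteq> \<infinity>"
    then have "summable (\<lambda>n. d n z)" by (intro summable_suminf_not_top) (auto simp: d_def)
    then have "summable (\<lambda>n. ?u (Suc n) z - ?u n z)" unfolding d_def by (rule summable_norm_cancel)
    then have "convergent (\<lambda>n. \<Sum>i<n. ?u (Suc i) z - ?u i z)" by (simp add: summable_iff_convergent)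
    then have "convergent (\<lambda>n. (?u n z - ?u 0 z) + ?u 0 z)"
      unfolding sum_lessThan_telescope[of "\<lambda>i. ?u i z"] by (rule convergent_add[OF _ convergent_const])
    then show "convergent (\<lambda>n. ?u n z)" by simp
  qed
  define v where "v z = lim (\<lambda>n. ?u n z)" for z
  have vm[measurable]: "v \<in> borel_measurable leb" unfolding v_def by (rule borel_measurable_lim_metric) measurable
  have lim: "AE z in leb. (\<lambda>n. ?u n z) \<longlonglongrightarrow> v z"
    using conv by (rule eventually_mono) (simp add: v_def convergent_LIMSEQ_iff)
  have fat: "(\<integral>\<^sup>+z. ennreal ((cmod (v z - ?u n z))\<^sup>2) \<partial>leb) \<le> ennreal ((2 * (1/2)^n)\<^sup>2)" for n
  proof -
    have "(\<integral>\<^sup>+z. ennreal ((cmod (v z - ?u n z))\<^sup>2) \<partial>leb)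
       = (\<integral>\<^sup>+z. liminf (\<lambda>k. ennreal ((cmod (?u (n + k) z - ?u n z))\<^sup>2)) \<partial>leb)"
    proof (rule nn_integral_cong_AE, rule eventually_mono[OF lim])
      fix z assume "(\<lambda>n. ?u n z) \<longlonglongrightarrow> v z"
      then have "(\<lambda>k. ?u (n + k) z) \<longlonglongrightarrow> v z" using LIMSEQ_ignore_initial_segment[of "\<lambda>n. ?u n z" "v z" n] by (simp add: add.commute)
      then have "(\<lambda>k. ennreal ((cmod (?u (n + k) z - ?u n z))\<^sup>2)) \<longlonglongrightarrow> ennreal ((cmod (v z - ?u n z))\<^sup>2)"
        by (intro tendsto_intros)
      then show "ennreal ((cmod (v z - ?u n z))\<^sup>2) = liminf (\<lambda>k. ennreal ((cmod (?u (n + k) z - ?u n z))\<^sup>2))"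
        by (rule lim_imp_Liminf[OF trivial_limit_sequentially, symmetric])
    qed
    also have "\<dots> \<le> liminf (\<lambda>k. \<integral>\<^sup>+z. ennreal ((cmod (?u (n + k) z - ?u n z))\<^sup>2) \<partial>leb)"
      by (rule nn_integral_liminf) measurable
    also have "\<dots> \<le> ennreal ((2 * (1/2)^n)\<^sup>2)"
    proof (rule Liminf_le)
      show "\<forall>\<^sub>F k in sequentially. (\<integral>\<^sup>+z. ennreal ((cmod (?u (n + k) z - ?u n z))\<^sup>2) \<partial>leb) \<le> ennreal ((2 * (1/2)^n)\<^sup>2)"
      proof (rule always_eventually, rule allI)
        fix k
        have "(\<integral>\<^sup>+z. ennreal ((cmod (?u (n + k) z - ?u n z))\<^sup>2) \<partial>leb) = ennreal (integral\<^sup>L leb (\<lambda>z. (cmod (?u (n + k) z - ?u n z))\<^sup>2))"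
          using L2d[of "n + k" n] by (intro nn_integral_eq_integral) (auto simp: L2_on_def)
        moreover have "integral\<^sup>L leb (\<lambda>z. (cmod (?u (n + k) z - ?u n z))\<^sup>2) \<le> (2 * (1/2)^n)\<^sup>2"
          using L2_part_le_hnorm(1)[of "hsub (a (n + k)) (a n)"] power_mono[OF dist[of n k] hnorm_nonneg, of 2] by simp
        ultimately show "(\<integral>\<^sup>+z. ennreal ((cmod (?u (n + k) z - ?u n z))\<^sup>2) \<partial>leb) \<le> ennreal ((2 * (1/2)^n)\<^sup>2)"
          by (simp only: ennreal_leI)
      qed
    qed simp
    finally show ?thesis .
  qed
  have vi: "integrable leb (\<lambda>z. (cmod (v z - ?u n z))\<^sup>2)" for n
    using le_less_trans[OF fat[of n] ennreal_less_top] by (intro integrableI_bounded) auto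
  have vle: "integral\<^sup>L leb (\<lambda>z. (cmod (v z - ?u n z))\<^sup>2) \<le> (2 * (1/2)^n)\<^sup>2" for n
    using fat[of n] nn_integral_eq_integral[OF vi[of n]] by simp
  have "L2_on L (\<lambda>z. v z - ?u 0 z)" using vi[of 0] by (simp add: L2_on_def)
  then have L2v: "L2_on L v" using L2_on_add[of "\<lambda>z. v z - ?u 0 z" "?u 0"] a[of 0] by (simp add: Hsp_def)
  have sn: "cmod (snd (a (Suc n)) - snd (a n)) \<le> sqrt (rho P) * (1/2)^n" for n
  proof -
    have "(cmod (snd (a (Suc n)) - snd (a n)))\<^sup>2 \<le> rho P * ((1/2)^n)\<^sup>2"
      using L2_part_le_hnorm(2)[of "hsub (a (Suc n)) (a n)"] power_mono[OF step[of n] hnorm_nonneg, of 2] rho_pos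
      by (smt (verit) hnorm_nonneg mult_left_mono snd_hsub)
    also have "\<dots> = (sqrt (rho P) * (1/2)^n)\<^sup>2" using rho_pos by (simp add: power_mult_distrib)
    finally show ?thesis by (rule power2_le_imp_le) (use rho_pos in auto)
  qed
  have "summable (\<lambda>n. snd (a (Suc n)) - snd (a n))"
    by (rule summable_comparison_test'[where g = "\<lambda>n. sqrt (rho P) * (1/2)^n" and N = 0])
       (use sn in \<open>auto intro!: summable_mult summable_geometric\<close>)
  then have "convergent (\<lambda>n. \<Sum>i<n. snd (a (Suc i)) - snd (a i))" by (simp add: summable_iff_convergent)
  then have "convergent (\<lambda>n. (snd (a n) - snd (a 0)) + snd (a 0))"
    unfolding sum_lessThan_telescope[of "\<lambda>i. snd (a i)"] by (rule convergent_add[OF _ convergent_const])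
  then obtain c where c: "(\<lambda>n. snd (a n)) \<longlonglongrightarrow> c" by (auto simp: convergent_def)
  let ?b = "(v, c)"
  have bH: "Hsp P ?b" using L2v by (simp add: Hsp_def)
  have nb: "(hnorm P (hsub (a n) ?b))\<^sup>2 \<le> (2 * (1/2)^n)\<^sup>2 + (cmod (snd (a n) - c))\<^sup>2 / rho P" for n
    using vle[of n] unfolding hnorm_square by (simp add: norm_minus_commute)
  have "(\<lambda>n. (2 * (1/2)^n)\<^sup>2 + (cmod (snd (a n) - c))\<^sup>2 / rho P) \<longlonglongrightarrow> (2 * 0)\<^sup>2 + (cmod (c - c))\<^sup>2 / rho P"
    using rho_pos by (intro tendsto_intros c LIMSEQ_realpow_zero) auto
  then have "(\<lambda>n. (2 * (1/2)^n)\<^sup>2 + (cmod (snd (a n) - c))\<^sup>2 / rho P) \<longlonglongrightarrow> 0" by simp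
  then have "(\<lambda>n. hnorm P (hsub (a n) ?b)) \<longlonglongrightarrow> 0"
    by (rule tendsto_zero_squeeze_square[OF hnorm_nonneg nb])
  then show ?thesis using that bH by blast
qed

subsection \<open>The compact resolvent\<close>

text \<open>An element of \<open>H\<close> is known only up to null sets, but on D(A) pointwise
  values are under control: \<open>deriv_L2_bound\<close> removes the derivative as well, and
  \<open>sup_bound\<close> gives zero on the whole closed interval.\<close>

lemma domA_zero:
  assumes d: "domA P \<phi>" and z: "hnorm P \<phi> = 0"
  shows "\<And>z. z \<in> {0..L} \<Longrightarrow> fst \<phi> z = 0" "hnorm P (Aop P \<phi>) = 0"
proof -
  let ?u = "fst \<phi>"
  have r: "regular ?u" using d by (simp add: domA_iff)
  have i0: "integral\<^sup>L leb (\<lambda>z. (cmod (?u z))\<^sup>2) \<le> 0" using L2_part_le_hnorm(1)[of \<phi>] z by simp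
  have i1: "integral\<^sup>L leb (\<lambda>z. (cmod (dz P ?u z))\<^sup>2) \<le> 0" using deriv_L2_bound[OF d] z by simp
  show 0: "?u x = 0" if "x \<in> {0..L}" for x
  proof -
    have "(cmod (?u x))\<^sup>2 \<le> 2 / L * integral\<^sup>L leb (\<lambda>z. (cmod (?u z))\<^sup>2) + 2 * L * integral\<^sup>L leb (\<lambda>z. (cmod (dz P ?u z))\<^sup>2)"
      by (rule sup_bound[OF _ negligible_empty]) (use r that in \<open>auto simp: regular_def intro: regular_deriv regular_cont\<close>)
    also have "\<dots> \<le> 2 / L * 0 + 2 * L * 0"
      using i0 i1 len_pos by (intro add_mono mult_left_mono) auto
    finally show ?thesis by simp
  qed
  have dz0: "dz P u x = 0" if "\<And>z. z \<in> {0..L} \<Longrightarrow> u z = 0" "x \<in> {0..L}" for u x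
    by (rule dz_eqI[OF that(2)], subst has_vector_derivative_cong_on[OF that(2), of u "\<lambda>_. 0"]) (use that(1) in auto)
  have 1: "dz P ?u x = 0" if "x \<in> {0..L}" for x using dz0[OF 0 that] by simp
  have 2: "dz P (dz P ?u) x = 0" if "x \<in> {0..L}" for x using dz0[OF 1 that] by simp
  have L: "L \<in> {0..L}" using len_pos by simp
  have "heq P (Aop P \<phi>) hzero"
    unfolding heq_def
  proof
    show "AE z in leb. fst (Aop P \<phi>) z = fst hzero z"
      by (rule AE_leb_negligible[OF negligible_empty]) (simp add: Aop_def hzero_def 0 2)
    show "snd (Aop P \<phi>) = snd hzero" by (simp add: Aop_def hzero_def 0[OF L] 1[OF L])
  qed
  then show "hnorm P (Aop P \<phi>) = 0" using hnorm_cong[of "Aop P \<phi>" hzero] domA_Hsp[OF d] by simp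
qed

lemma domA_heq:
  assumes "domA P \<phi>" "domA P \<psi>" "heq P \<phi> \<psi>"
  shows "\<And>z. z \<in> {0..L} \<Longrightarrow> fst \<phi> z = fst \<psi> z" "heq P (Aop P \<phi>) (Aop P \<psi>)"
proof -
  have d: "domA P (hsub \<phi> \<psi>)" "heq P (Aop P (hsub \<phi> \<psi>)) (hsub (Aop P \<phi>) (Aop P \<psi>))"
    by (rule domA_hsub[OF assms(1,2)])+
  have H: "Hsp P \<phi>" "Hsp P \<psi>" "Hsp P (Aop P \<phi>)" "Hsp P (Aop P \<psi>)" using assms domA_Hsp by auto
  have n: "hnorm P (hsub \<phi> \<psi>) = 0" using assms(3) heq_iff_hnorm H by simp
  show "\<And>z. z \<in> {0..L} \<Longrightarrow> fst \<phi> z = fst \<psi> z" using domA_zero(1)[OF d(1) n] by simp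
  have "hnorm P (hsub (Aop P \<phi>) (Aop P \<psi>)) = 0"
    using domA_zero(2)[OF d(1) n] hnorm_cong[OF _ _ d(2)] domA_Hsp[OF d(1)] H by simp
  then show "heq P (Aop P \<phi>) (Aop P \<psi>)" using heq_iff_hnorm H by simp
qed

definition A1 :: "hvec \<Rightarrow> hvec" where "A1 \<phi> = hadd (Aop P \<phi>) \<phi>"

lemma A1_Hsp: "domA P \<phi> \<Longrightarrow> Hsp P (A1 \<phi>)" by (simp add: A1_def domA_Hsp)

text \<open>By positivity of \<open>A\<close> the square of \<open>hnorm P \<phi>\<close> is at most
  the real part of the inner product of \<phi> with \<open>A1 \<phi>\<close>, and Cauchy-Schwarz
  cancels one factor. The constants 2 and 3 come from the triangle inequality.\<close>

lemma A1_bounds: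
  assumes d: "domA P \<phi>"
  shows "hnorm P \<phi> \<le> hnorm P (A1 \<phi>)" "hnorm P (Aop P \<phi>) \<le> 2 * hnorm P (A1 \<phi>)" "gnorm P \<phi> \<le> 3 * hnorm P (A1 \<phi>)"
proof -
  have H: "Hsp P \<phi>" "Hsp P (Aop P \<phi>)" by (rule domA_Hsp[OF d])+
  have "(hnorm P \<phi>)\<^sup>2 \<le> Re (hinner P \<phi> (A1 \<phi>))"
    using A_form_nonneg[OF d] H unfolding A1_def by (simp add: hinner_linear hinner_self_hnorm)
  also have "\<dots> \<le> hnorm P \<phi> * hnorm P (A1 \<phi>)"
    using hinner_Cauchy_Schwarz[OF H(1) A1_Hsp[OF d]] complex_Re_le_cmod order_trans by blast
  finally show 1: "hnorm P \<phi> \<le> hnorm P (A1 \<phi>)"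
    using hnorm_nonneg[of \<phi>] hnorm_nonneg[of "A1 \<phi>"] by (cases "hnorm P \<phi> = 0") (auto simp: power2_eq_square less_le)
  have "Aop P \<phi> = hsub (A1 \<phi>) \<phi>" by (simp add: A1_def prod_eq_iff)
  then have "Aop P \<phi> = hadd (A1 \<phi>) (hscale (-1) \<phi>)" by (simp add: hsub_def)
  then have "hnorm P (Aop P \<phi>) \<le> hnorm P (A1 \<phi>) + hnorm P (hscale (-1) \<phi>)"
    using hnorm_triangle[OF A1_Hsp[OF d], of "hscale (-1) \<phi>"] H by simp
  then show 2: "hnorm P (Aop P \<phi>) \<le> 2 * hnorm P (A1 \<phi>)" using 1 by (simp add: hnorm_hscale)
  show "gnorm P \<phi> \<le> 3 * hnorm P (A1 \<phi>)" using 1 2 by (simp add: gnorm_def)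
qed

lemma A1_symmetric: "domA P \<phi> \<Longrightarrow> domA P \<psi> \<Longrightarrow> hinner P \<phi> (A1 \<psi>) = hinner P (A1 \<phi>) \<psi>"
  unfolding A1_def using domA_Hsp[of \<phi>] domA_Hsp[of \<psi>] A_symmetric[of \<phi> \<psi>] by (simp add: hinner_linear)

lemma A1_lincomb:
  assumes "domA P \<phi>" "domA P \<psi>"
  shows "heq P (A1 (hadd (hscale a \<phi>) (hscale c \<psi>))) (hadd (hscale a (A1 \<phi>)) (hscale c (A1 \<psi>)))"
  using domA_lincomb(2)[OF assms, of a c] unfolding heq_def A1_def
  by (auto elim!: eventually_mono simp: algebra_simps)

text \<open>A representative of the solution is picked arbitrarily, so linearity holds only up to
  \<open>heq\<close>.\<close>

definition res :: "hvec \<Rightarrow> hvec" where "res \<eta> = (SOME \<phi>. domA P \<phi> \<and> heq P (A1 \<phi>) \<eta>)"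

lemma res:
  assumes "Hsp P \<eta>"
  shows "domA P (res \<eta>)" "heq P (A1 (res \<eta>)) \<eta>"
proof -
  have "\<exists>\<phi>. domA P \<phi> \<and> heq P (A1 \<phi>) \<eta>" using resolvent_exists[OF assms] unfolding A1_def by blast
  from someI_ex[OF this] show "domA P (res \<eta>)" "heq P (A1 (res \<eta>)) \<eta>" unfolding res_def by auto
qed

lemma res_Hsp [simp]: "Hsp P \<eta> \<Longrightarrow> Hsp P (res \<eta>)" using res(1) domA_Hsp by blast

lemma res_eqI:
  assumes \<eta>: "Hsp P \<eta>" and d: "domA P \<phi>" and e: "heq P (A1 \<phi>) \<eta>"
  shows "heq P (res \<eta>) \<phi>"
proof -
  note r = res[OF \<eta>]
  have h: "hadd (hscale 1 x) (hscale (-1) y) = hsub x y" for x y by (simp add: prod_eq_iff)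
  have D: "domA P (hsub (res \<eta>) \<phi>)" by (rule domA_hsub[OF r(1) d])
  have "heq P (A1 (hsub (res \<eta>) \<phi>)) (hsub (A1 (res \<eta>)) (A1 \<phi>))" using A1_lincomb[OF r(1) d, of 1 "-1"] unfolding h .
  moreover have "heq P (hsub (A1 (res \<eta>)) (A1 \<phi>)) hzero"
    using heq_trans[OF r(2) heq_sym[OF e]] unfolding heq_def hzero_def by (auto elim!: eventually_mono)
  ultimately have "heq P (A1 (hsub (res \<eta>) \<phi>)) hzero" by (rule heq_trans)
  then have "hnorm P (A1 (hsub (res \<eta>) \<phi>)) = 0"
    using hnorm_cong[OF A1_Hsp[OF D] Hsp_hzero] by simp
  then have "hnorm P (hsub (res \<eta>) \<phi>) = 0" using A1_bounds(1)[OF D] by (simp add: antisym)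
  then show ?thesis using heq_iff_hnorm \<eta> domA_Hsp[OF d] by simp
qed

lemma res_symmetric:
  assumes "Hsp P a" "Hsp P b"
  shows "hinner P (res a) b = hinner P a (res b)"
proof -
  have "hinner P (res a) b = hinner P (res a) (A1 (res b))"
    by (rule hinner_cong) (use assms res heq_sym A1_Hsp in auto)
  also have "\<dots> = hinner P (A1 (res a)) (res b)" by (rule A1_symmetric) (use assms res in auto)
  also have "\<dots> = hinner P a (res b)" by (rule hinner_cong_left) (use assms res A1_Hsp in auto)
  finally show ?thesis .
qed

lemma res_lincomb:
  assumes "Hsp P a" "Hsp P b"
  shows "heq P (res (hadd (hscale x a) (hscale y b))) (hadd (hscale x (res a)) (hscale y (res b)))"
proof (rule res_eqI)
  show "domA P (hadd (hscale x (res a)) (hscale y (res b)))" by (rule domA_lincomb) (use res assms in auto)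
  have "heq P (hadd (hscale x (A1 (res a))) (hscale y (A1 (res b)))) (hadd (hscale x a) (hscale y b))"
    using res(2)[OF assms(1)] res(2)[OF assms(2)] unfolding heq_def by (auto elim!: eventually_elim2)
  then show "heq P (A1 (hadd (hscale x (res a)) (hscale y (res b)))) (hadd (hscale x a) (hscale y b))"
    using A1_lincomb[OF res(1)[OF assms(1)] res(1)[OF assms(2)], of x y] heq_trans by blast
qed (use assms in auto)

lemma res_hsub:
  assumes "Hsp P a" "Hsp P b"
  shows "heq P (res (hsub a b)) (hsub (res a) (res b))"
proof -
  have h: "hadd (hscale 1 x) (hscale (-1) y) = hsub x y" for x y by (simp add: prod_eq_iff)
  show ?thesis using res_lincomb[OF assms, of 1 "-1"] unfolding h .
qed

lemma res_bound: assumes "Hsp P a" shows "hnorm P (res a) \<le> hnorm P a"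
  using A1_bounds(1)[OF res(1)[OF assms]] hnorm_cong[OF A1_Hsp[OF res(1)[OF assms]] assms res(2)[OF assms]] by simp

lemma res_dist:
  assumes "Hsp P a" "Hsp P b"
  shows "hnorm P (hsub (res a) (res b)) \<le> hnorm P (hsub a b)"
  using res_bound[of "hsub a b"] hnorm_cong[OF _ _ res_hsub[OF assms]] assms by simp

lemma res_positive:
  assumes "Hsp P a" shows "0 \<le> Re (hinner P a (res a))"
proof -
  have "hinner P (res a) a = hinner P (res a) (A1 (res a))"
    by (rule hinner_cong) (use assms res heq_sym A1_Hsp in auto)
  moreover have "0 \<le> Re (hinner P (res a) (A1 (res a)))"
    using A_form_nonneg[OF res(1)[OF assms]] domA_Hsp[OF res(1)[OF assms]]
    by (simp add: A1_def hinner_linear hinner_self_hnorm)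
  ultimately show ?thesis using res_symmetric[OF assms assms] by simp
qed

text \<open>The graph norms of the images are bounded. This yields a uniform bound and, through the
  L2 bound on the derivative, Hoelder continuity of order 1/2 with a common constant. Arzela-Ascoli
  then gives uniform convergence along a subsequence, which is stronger than convergence in
  \<open>H\<close>.\<close>

theorem res_compact:
  assumes a: "\<And>n::nat. Hsp P (a n)" and b: "\<And>n. hnorm P (a n) \<le> 1"
  obtains \<xi> k where "Hsp P \<xi>" "strict_mono (k :: nat \<Rightarrow> nat)" "(\<lambda>n. hnorm P (hsub (res (a (k n))) \<xi>)) \<longlonglongrightarrow> 0"
proof -
  let ?r = "\<lambda>n. res (a n)"
  have d: "domA P (?r n)" for n using res a by blast
  have A1n: "hnorm P (A1 (?r n)) \<le> 1" for n
    using hnorm_cong[OF A1_Hsp[OF d] a res(2)[OF a]] b by simp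
  obtain C where C0: "0 \<le> C" and C: "\<forall>\<phi> x. domA P \<phi> \<longrightarrow> x \<in> {0..L} \<longrightarrow> cmod (fst \<phi> x) \<le> C * gnorm P \<phi> \<and> cmod (dz P (fst \<phi>) x) \<le> C * gnorm P \<phi>"
    by (rule uniform_bound_gnorm)
  have gn: "gnorm P (?r n) \<le> 3" for n using A1_bounds(3)[OF d[of n]] A1n[of n] by simp
  have b1: "cmod (fst (?r n) x) \<le> 3 * C" if "x \<in> {0..L}" for n x
    using C[rule_format, OF d[of n] that] mult_left_mono[OF gn[of n] C0] by simp
  have b2: "cmod (snd (?r n)) \<le> sqrt (rho P)" for n
  proof -
    have "(cmod (snd (?r n)))\<^sup>2 \<le> rho P * (hnorm P (?r n))\<^sup>2" by (rule L2_part_le_hnorm)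
    also have "\<dots> \<le> rho P * 1\<^sup>2"
      using rho_pos res_bound[OF a[of n]] b[of n] by (intro mult_left_mono power_mono) auto
    finally show ?thesis by (simp add: real_le_rsqrt)
  qed
  have osc: "(cmod (fst (?r n) y - fst (?r n) x))\<^sup>2 \<le> \<bar>y - x\<bar> * 2" if xy: "x \<in> {0..L}" "y \<in> {0..L}" for n x y
  proof -
    have r: "regular (fst (?r n))" using d[of n] by (simp add: domA_iff)
    have "(cmod (fst (?r n) y - fst (?r n) x))\<^sup>2 \<le> \<bar>y - x\<bar> * integral\<^sup>L leb (\<lambda>z. (cmod (dz P (fst (?r n)) z))\<^sup>2)"
      by (rule oscillation_bound[OF _ negligible_empty]) (use r xy in \<open>auto simp: regular_def intro: regular_deriv regular_cont\<close>)
    also have "\<dots> \<le> \<bar>y - x\<bar> * 2"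
    proof (rule mult_left_mono)
      have "hnorm P (?r n) * hnorm P (Aop P (?r n)) \<le> 1 * 2"
        using A1_bounds(1,2)[OF d[of n]] A1n[of n] by (intro mult_mono) auto
      then show "integral\<^sup>L leb (\<lambda>z. (cmod (dz P (fst (?r n)) z))\<^sup>2) \<le> 2"
        using deriv_L2_bound[OF d[of n]] by simp
    qed simp
    finally show ?thesis .
  qed
  \<comment> \<open>The second component rides along as a function constant in \<open>z\<close>, so
    that one subsequence serves both components.\<close>
  define F where "F n z = (fst (?r n) z, snd (?r n))" for n z
  obtain g k where gk: "continuous_on {0..L} g" "strict_mono (k :: nat \<Rightarrow> nat)"
      "\<And>e. 0 < e \<Longrightarrow> \<exists>N. \<forall>n x. n \<ge> N \<and> x \<in> {0..L} \<longrightarrow> norm (F (k n) x - g x) < e"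
  proof -
    have bd: "norm (F n x) \<le> 3 * C + sqrt (rho P)" if "x \<in> {0..L}" for n x
      using norm_Pair_le[of "fst (?r n) x" "snd (?r n)"] b1[OF that, of n] b2[of n] by (simp add: F_def)
    have eqc: "\<exists>d. 0 < d \<and> (\<forall>n y. y \<in> {0..L} \<and> norm (x - y) < d \<longrightarrow> norm (F n x - F n y) < e)" if x: "x \<in> {0..L}" and e: "0 < e" for x e
    proof (intro exI[of _ "e\<^sup>2 / 2"] conjI allI impI)
      fix n y assume y: "y \<in> {0..L} \<and> norm (x - y) < e\<^sup>2 / 2"
      have "(cmod (fst (?r n) x - fst (?r n) y))\<^sup>2 < e\<^sup>2" using osc[of y x n] x y by simp
      then have "cmod (fst (?r n) x - fst (?r n) y) < e" using e power2_less_imp_less by fastforce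
      then show "norm (F n x - F n y) < e" by (simp add: F_def norm_Pair)
    qed (use e in simp)
    show ?thesis
      by (rule Arzela_Ascoli[of "{0..L}" F "3 * C + sqrt (rho P)"]) (use bd eqc in \<open>simp_all add: that\<close>)
  qed
  define \<xi> where "\<xi> = ((\<lambda>z. fst (g z)), snd (g 0))"
  have H: "Hsp P \<xi>" unfolding Hsp_def \<xi>_def using gk(1) by (auto intro!: L2_on_continuous continuous_on_fst)
  have "(\<lambda>n. hnorm P (hsub (?r (k n)) \<xi>)) \<longlonglongrightarrow> 0"
  proof (rule LIMSEQ_I)
    fix e :: real assume e: "0 < e"
    \<comment> \<open>A uniform error \<open>s\<close> in both components costs at most
      \<open>K * s\<^sup>2\<close> in the squared norm.\<close>
    define K where "K = L + 1 / rho P"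
    have K: "K > 0" using len_pos rho_pos by (simp add: K_def add_pos_pos)
    define s where "s = e / (sqrt K * 2)"
    have s: "s > 0" using e K by (simp add: s_def)
    obtain N where N: "\<And>n x. n \<ge> N \<Longrightarrow> x \<in> {0..L} \<Longrightarrow> norm (F (k n) x - g x) < s" using gk(3)[OF s] by blast
    have "hnorm P (hsub (?r (k n)) \<xi>) < e" if n: "n \<ge> N" for n
    proof -
      have pn: "norm (fst y) \<le> norm y" "norm (snd y) \<le> norm y" for y :: "complex \<times> complex"
        using norm_fst_le[of "fst y" "snd y"] norm_snd_le[of "snd y" "fst y"] by simp_all
      have c1: "cmod (fst (?r (k n)) x - fst (g x)) \<le> s" if "x \<in> {0..L}" for x
        using less_imp_le[OF N[OF n that]] order_trans[OF pn(1)[of "F (k n) x - g x"]] by (simp add: F_def)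
      have "cmod (snd (?r (k n)) - snd (g 0)) \<le> s"
        using less_imp_le[OF N[OF n, of 0]] len_pos order_trans[OF pn(2)[of "F (k n) 0 - g 0"]] by (simp add: F_def)
      then have c2: "(cmod (snd (?r (k n)) - snd (g 0)))\<^sup>2 \<le> s\<^sup>2" by (intro power_mono) auto
      have ci: "integrable leb (\<lambda>z. s\<^sup>2)"
        unfolding integrable_leb_iff by (rule absolutely_integrable_continuous_real) simp
      have meas: "measure leb {0<..<L} = L" using len_pos by (simp add: measure_restrict_space)
      have "Hsp P (hsub (?r (k n)) \<xi>)" using H a by simp
      then have "integral\<^sup>L leb (\<lambda>z. (cmod (fst (?r (k n)) z - fst (g z)))\<^sup>2) \<le> integral\<^sup>L leb (\<lambda>z. s\<^sup>2)"
        using c1 ci by (intro integral_mono) (auto simp: Hsp_def L2_on_def \<xi>_def space_restrict_space intro!: power_mono)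
      then have "integral\<^sup>L leb (\<lambda>z. (cmod (fst (?r (k n)) z - fst (g z)))\<^sup>2) \<le> L * s\<^sup>2"
        using meas by (simp add: space_restrict_space)
      then have "(hnorm P (hsub (?r (k n)) \<xi>))\<^sup>2 \<le> L * s\<^sup>2 + s\<^sup>2 / rho P"
        unfolding hnorm_square using c2 rho_pos by (simp add: \<xi>_def divide_right_mono add_mono)
      also have "\<dots> = (sqrt K * s)\<^sup>2" using K by (simp add: power_mult_distrib K_def algebra_simps)
      finally have "hnorm P (hsub (?r (k n)) \<xi>) \<le> sqrt K * s" by (rule power2_le_imp_le) (use K s in auto)
      also have "\<dots> < e" using e K by (simp add: s_def)
      finally show ?thesis .
    qed
    then show "\<exists>N. \<forall>n\<ge>N. norm (hnorm P (hsub (?r (k n)) \<xi>) - 0) < e" by auto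
  qed
  then show ?thesis using that H gk(2) by blast
qed

subsection \<open>Eigenvectors\<close>

definition eigenvalue :: "hvec \<Rightarrow> real" where "eigenvalue e = (SOME lam. eigA P lam e)"

text \<open>Members are representatives. Two normalised representatives of the same vector have
  inner product 1, so at most one of them lies in such a set and distinct members are distinct in
  \<open>H\<close>.\<close>

definition orthonormal_eigen :: "hvec set \<Rightarrow> bool" where
  "orthonormal_eigen B \<longleftrightarrow> (\<forall>e\<in>B. (\<exists>lam. eigA P lam e) \<and> hnorm P e = 1) \<and> (\<forall>e\<in>B. \<forall>e'\<in>B. e \<noteq> e' \<longrightarrow> hinner P e e' = 0)"

lemma maximal_orthonormal_eigen:
  obtains B where "orthonormal_eigen B" "\<forall>X. orthonormal_eigen X \<longrightarrow> B \<subseteq> X \<longrightarrow> X = B"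
proof -
  have "\<exists>M\<in>Collect orthonormal_eigen. \<forall>X\<in>Collect orthonormal_eigen. M \<subseteq> X \<longrightarrow> X = M"
  proof (rule subset_Zorn')
    fix C assume "subset.chain (Collect orthonormal_eigen) C"
    then have C: "\<And>X. X \<in> C \<Longrightarrow> orthonormal_eigen X" "\<And>X Y. X \<in> C \<Longrightarrow> Y \<in> C \<Longrightarrow> X \<subseteq> Y \<or> Y \<subseteq> X"
      by (auto simp: subset.chain_def)
    have "orthonormal_eigen (\<Union>C)"
      unfolding orthonormal_eigen_def
    proof (intro conjI ballI impI)
      fix e assume "e \<in> \<Union>C"
      then show "\<exists>lam. eigA P lam e" "hnorm P e = 1" using C(1) unfolding orthonormal_eigen_def by blast+
    next
      fix e e' assume "e \<in> \<Union>C" "e' \<in> \<Union>C" "e \<noteq> e'"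
      then obtain X Y where XY: "X \<in> C" "e \<in> X" "Y \<in> C" "e' \<in> Y" by blast
      then have "e \<in> Y \<or> e' \<in> X" using C(2) by blast
      then show "hinner P e e' = 0"
        using XY C(1)[OF XY(1)] C(1)[OF XY(3)] \<open>e \<noteq> e'\<close> unfolding orthonormal_eigen_def by blast
    qed
    then show "\<Union>C \<in> Collect orthonormal_eigen" by simp
  qed
  then show ?thesis using that by blast
qed

end

locale eigenbasis = wave_bvp +
  fixes B :: "hvec set"
  assumes orthonormal: "orthonormal_eigen B"
    and maximal: "\<forall>X. orthonormal_eigen X \<longrightarrow> B \<subseteq> X \<longrightarrow> X = B"
begin

section \<open>Fourier coefficients, Bessel's inequality and completeness\<close>

lemma eigen_basis:
  assumes "e \<in> B"
  shows "domA P e" "Hsp P e" "hnorm P e = 1" "heq P (Aop P e) (hscale (of_real (eigenvalue e)) e)" "0 \<le> eigenvalue e"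
    "eigA P (eigenvalue e) e"
proof -
  show 6: "eigA P (eigenvalue e) e"
    using assms orthonormal unfolding orthonormal_eigen_def eigenvalue_def by (metis someI_ex)
  then show 1: "domA P e" and 4: "heq P (Aop P e) (hscale (of_real (eigenvalue e)) e)" by (auto simp: eigA_def)
  show 2: "Hsp P e" by (rule domA_Hsp[OF 1])
  show 3: "hnorm P e = 1" using assms orthonormal by (simp add: orthonormal_eigen_def)
  have "hinner P e (Aop P e) = of_real (eigenvalue e)"
    using hinner_cong[OF 2 domA_Hsp(2)[OF 1] _ 4] 2 3 by (simp add: hinner_linear hinner_self_hnorm)
  then show "0 \<le> eigenvalue e" using A_form_nonneg[OF 1] by simp
qed

lemma eigen_orth: "e \<in> B \<Longrightarrow> e' \<in> B \<Longrightarrow> hinner P e e' = (if e = e' then 1 else 0)"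
  using orthonormal eigen_basis(3)[of e] hinner_self_hnorm[of e] by (auto simp: orthonormal_eigen_def)

lemma coeff_Aop:
  assumes e: "e \<in> B" and d: "domA P \<phi>"
  shows "hinner P e (Aop P \<phi>) = of_real (eigenvalue e) * hinner P e \<phi>"
proof -
  note b = eigen_basis[OF e]
  have "hinner P e (Aop P \<phi>) = hinner P (Aop P e) \<phi>" by (rule A_symmetric[OF b(1) d])
  also have "\<dots> = hinner P (hscale (of_real (eigenvalue e)) e) \<phi>"
    by (rule hinner_cong_left) (use b d domA_Hsp in auto)
  finally show ?thesis by (simp add: hinner_linear)
qed

lemma coeff_A1: "e \<in> B \<Longrightarrow> domA P \<phi> \<Longrightarrow> hinner P e (A1 \<phi>) = of_real (1 + eigenvalue e) * hinner P e \<phi>"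
  using coeff_Aop[of e \<phi>] eigen_basis(2)[of e] domA_Hsp[of \<phi>] by (simp add: A1_def hinner_linear algebra_simps)

lemma coeff_res:
  assumes e: "e \<in> B" and h: "Hsp P \<eta>"
  shows "hinner P e (res \<eta>) = hinner P e \<eta> / of_real (1 + eigenvalue e)"
proof -
  have "hinner P e \<eta> = hinner P e (A1 (res \<eta>))"
    by (rule hinner_cong) (use e h eigen_basis res heq_sym A1_Hsp in auto)
  also have "\<dots> = of_real (1 + eigenvalue e) * hinner P e (res \<eta>)"
    by (rule coeff_A1[OF e res(1)[OF h]])
  finally show ?thesis using eigen_basis(5)[OF e] by (simp add: field_simps of_real_add[symmetric] del: of_real_add)
qed

abbreviation "lincomb F c \<equiv> hsum F c (\<lambda>e. e)"

lemma lincomb_Hsp: "F \<subseteq> B \<Longrightarrow> Hsp P (lincomb F c)"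
  by (rule Hsp_hsum) (use eigen_basis in auto)

lemma coeff_lincomb:
  assumes "finite F" "F \<subseteq> B" "e \<in> B"
  shows "hinner P e (lincomb F c) = (if e \<in> F then c e else 0)"
proof -
  have "hinner P e (lincomb F c) = (\<Sum>i\<in>F. c i * hinner P e i)"
    by (rule hinner_hsum_right) (use assms eigen_basis in auto)
  also have "\<dots> = (\<Sum>i\<in>F. if i = e then c e else 0)"
    by (intro sum.cong) (use assms in \<open>auto simp: eigen_orth subset_eq\<close>)
  finally show ?thesis using assms by simp
qed

lemma hinner_lincomb:
  assumes "finite F" "F \<subseteq> B" "Hsp P a"
  shows "hinner P a (lincomb F c) = (\<Sum>e\<in>F. c e * cnj (hinner P e a))"
  by (subst hinner_hsum_right) (use assms eigen_basis in \<open>auto simp: hinner_cnj[of a] intro!: sum.cong\<close>)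

lemma hnorm_lincomb:
  assumes "finite F" "F \<subseteq> B"
  shows "(hnorm P (lincomb F c))\<^sup>2 = (\<Sum>e\<in>F. (cmod (c e))\<^sup>2)"
proof -
  have "hinner P (lincomb F c) (lincomb F c) = (\<Sum>e\<in>F. c e * cnj (c e))"
    using hinner_lincomb[OF assms lincomb_Hsp[OF assms(2), of c], of c] assms coeff_lincomb[OF assms]
    by (simp add: subset_eq)
  also have "\<dots> = of_real (\<Sum>e\<in>F. (cmod (c e))\<^sup>2)" unfolding of_real_sum complex_norm_square ..
  finally show ?thesis unfolding hinner_self_hnorm of_real_eq_iff .
qed

lemma hnorm_minus_projection:
  assumes F: "finite F" "F \<subseteq> B" and a: "Hsp P a"
  shows "(hnorm P (hsub a (lincomb F (\<lambda>e. hinner P e a))))\<^sup>2 = (hnorm P a)\<^sup>2 - (\<Sum>e\<in>F. (cmod (hinner P e a))\<^sup>2)"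
proof -
  have "hinner P a (lincomb F (\<lambda>e. hinner P e a)) = of_real (\<Sum>e\<in>F. (cmod (hinner P e a))\<^sup>2)"
    unfolding hinner_lincomb[OF F a] of_real_sum complex_norm_square ..
  then show ?thesis
    using hnorm_sub_square[OF a lincomb_Hsp[OF F(2)]] hnorm_lincomb[OF F] by simp
qed

lemma Bessel: "finite F \<Longrightarrow> F \<subseteq> B \<Longrightarrow> Hsp P a \<Longrightarrow> (\<Sum>e\<in>F. (cmod (hinner P e a))\<^sup>2) \<le> (hnorm P a)\<^sup>2"
  using hnorm_minus_projection[of F a] by (smt (verit) zero_le_power2)

lemma lincomb_diff:
  assumes "F \<subseteq> G" "finite G"
  shows "hsub (lincomb G c) (lincomb F c) = lincomb (G - F) c"
  using assms by (simp add: hsum_def prod_eq_iff sum_diff)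

text \<open>\<open>B\<close> is not known to be countable. Finite sets are chosen whose sums come
  within \<open>((1/2)^n)\<^sup>2\<close> of the supremum, and are made increasing; their
  combinations form a rapidly converging sequence, to which \<open>Riesz_Fischer\<close>
  applies.\<close>

theorem synthesis:
  assumes c: "\<And>F. finite F \<Longrightarrow> F \<subseteq> B \<Longrightarrow> (\<Sum>e\<in>F. (cmod (c e))\<^sup>2) \<le> C"
  obtains b F where "Hsp P b" "\<forall>e\<in>B. hinner P e b = c e" "\<forall>n::nat. finite (F n) \<and> F n \<subseteq> B"
    "(\<lambda>n. hnorm P (hsub (lincomb (F n) c) b)) \<longlonglongrightarrow> 0"
proof -
  let ?S = "\<lambda>F. \<Sum>e\<in>F. (cmod (c e))\<^sup>2"
  let ?FF = "{F. finite F \<and> F \<subseteq> B}"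
  define s where "s = Sup (?S ` ?FF)"
  have bdd: "bdd_above (?S ` ?FF)" using c by (intro bdd_aboveI2[of _ _ C]) auto
  have le: "?S F \<le> s" if "finite F" "F \<subseteq> B" for F
    unfolding s_def by (rule cSUP_upper[OF _ bdd]) (use that in auto)
  have "\<exists>F. finite F \<and> F \<subseteq> B \<and> s - ((1/2)^n)\<^sup>2 < ?S F" for n :: nat
  proof -
    have "s - ((1/2)^n)\<^sup>2 < Sup (?S ` ?FF)" unfolding s_def by simp
    then show ?thesis using less_cSUP_iff[OF _ bdd] by (metis (no_types, lifting) empty_subsetI finite.emptyI mem_Collect_eq empty_iff)
  qed
  then obtain G where G: "\<And>n::nat. finite (G n)" "\<And>n. G n \<subseteq> B" "\<And>n. s - ((1/2)^n)\<^sup>2 < ?S (G n)" by metis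
  define F where "F n = (\<Union>i\<le>n. G i)" for n
  have F: "finite (F n)" "F n \<subseteq> B" "F n \<subseteq> F (Suc n)" "G n \<subseteq> F n" for n
  proof -
    show "finite (F n)" "F n \<subseteq> B" using G by (auto simp: F_def)
    show "F n \<subseteq> F (Suc n)" unfolding F_def by (rule UN_mono) auto
    show "G n \<subseteq> F n" by (auto simp: F_def)
  qed
  have Fs: "s - ((1/2)^n)\<^sup>2 < ?S (F n)" for n
    using G(3)[of n] sum_mono2[OF F(1)[of n] F(4)[of n], of "\<lambda>e. (cmod (c e))\<^sup>2"] by simp
  have step: "hnorm P (hsub (lincomb (F (Suc n)) c) (lincomb (F n) c)) \<le> (1/2)^n" for n
  proof -
    have "(hnorm P (hsub (lincomb (F (Suc n)) c) (lincomb (F n) c)))\<^sup>2 = ?S (F (Suc n) - F n)"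
      unfolding lincomb_diff[OF F(3) F(1)] by (rule hnorm_lincomb) (use F in auto)
    also have "\<dots> = ?S (F (Suc n)) - ?S (F n)" using F by (simp add: sum_diff)
    also have "\<dots> \<le> ((1/2)^n)\<^sup>2" using le[OF F(1) F(2), of "Suc n"] Fs[of n] by simp
    finally show ?thesis by (rule power2_le_imp_le) simp
  qed
  obtain b where b: "Hsp P b" "(\<lambda>n. hnorm P (hsub (lincomb (F n) c) b)) \<longlonglongrightarrow> 0"
    using Riesz_Fischer[of "\<lambda>n. lincomb (F n) c", OF lincomb_Hsp[OF F(2)] step] by blast
  have "hinner P e b = c e" if e: "e \<in> B" for e
  proof -
    have "(\<lambda>n. hinner P e (hsub (lincomb (F n) c) b)) \<longlonglongrightarrow> 0"
    proof (rule Lim_null_comparison[OF _ b(2)])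
      show "\<forall>\<^sub>F n in sequentially. norm (hinner P e (hsub (lincomb (F n) c) b)) \<le> hnorm P (hsub (lincomb (F n) c) b)"
        using hinner_Cauchy_Schwarz[OF eigen_basis(2)[OF e]] eigen_basis(3)[OF e] lincomb_Hsp[OF F(2)] b(1)
        by (intro always_eventually allI) (metis Hsp_hsub mult_1)
    qed
    then have "(\<lambda>n. hinner P e (hsub (lincomb (F n) c) b) + hinner P e b) \<longlonglongrightarrow> 0 + hinner P e b"
      by (intro tendsto_intros)
    then have lim: "(\<lambda>n. if e \<in> F n then c e else 0) \<longlonglongrightarrow> hinner P e b"
      using eigen_basis(2)[OF e] lincomb_Hsp[OF F(2)] b(1) by (simp add: hinner_linear coeff_lincomb[OF F(1) F(2) e])
    show ?thesis
    proof (cases "\<exists>n. e \<in> F n")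
      case True
      then obtain n where n: "e \<in> F n" by blast
      have "e \<in> F (n + k)" for k using n F(3) by (induction k) auto
      then have "e \<in> F m" if "n \<le> m" for m using that by (metis le_add_diff_inverse)
      then have "\<forall>\<^sub>F m in sequentially. (if e \<in> F m then c e else 0) = c e"
        unfolding eventually_sequentially by auto
      then have "(\<lambda>n. if e \<in> F n then c e else 0) \<longlonglongrightarrow> c e" by (rule tendsto_eventually)
      then show ?thesis using LIMSEQ_unique lim by blast
    next
      case False
      \<comment> \<open>A coefficient outside all \<open>F n\<close> must vanish: adjoined to
        \<open>F n\<close> it would otherwise push the sum above the supremum.\<close>
      have "(cmod (c e))\<^sup>2 \<le> ((1/2)^n)\<^sup>2" for n
      proof -
        have "e \<notin> F n" "finite (F n)" "F n \<subseteq> B" using False F by auto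
        then have "(cmod (c e))\<^sup>2 + ?S (F n) \<le> s" using le[of "insert e (F n)"] e by simp
        then show ?thesis using Fs[of n] by linarith
      qed
      then have "cmod (c e) \<le> (1/2)^n" for n by (rule power2_le_imp_le) simp_all
      moreover have "(\<lambda>n. (1/2::real)^n) \<longlonglongrightarrow> 0" by (intro LIMSEQ_realpow_zero) auto
      ultimately have "cmod (c e) \<le> 0" by (intro LIMSEQ_le_const) auto
      moreover have "hinner P e b = 0" using lim False LIMSEQ_unique[of "\<lambda>_. 0"] by auto
      ultimately show ?thesis by simp
    qed
  qed
  then show ?thesis using that[of b F] b F by blast
qed

text \<open>On the orthogonal complement of B the norm of the resolvent is attained, by compactness, which yields an
  eigenvector of the square of the resolvent and hence one of A.\<close>

theorem total:
  assumes psi0: "Hsp P \<psi>0" and orth0: "\<And>e. e \<in> B \<Longrightarrow> hinner P e \<psi>0 = 0"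
  shows "hnorm P \<psi>0 = 0"
proof (rule ccontr)
  assume nz: "hnorm P \<psi>0 \<noteq> 0"
  define U where "U = {\<psi>. Hsp P \<psi> \<and> hnorm P \<psi> = 1 \<and> (\<forall>e\<in>B. hinner P e \<psi> = 0)}"
  define NN where "NN = {\<psi>. Hsp P \<psi> \<and> (\<forall>e\<in>B. hinner P e \<psi> = 0)}"
  have NNres: "res \<psi> \<in> NN" if "\<psi> \<in> NN" for \<psi> using that coeff_res by (auto simp: NN_def)
  have NNscale: "hscale c \<psi> \<in> NN" if "\<psi> \<in> NN" for \<psi> c using that by (auto simp: NN_def hinner_linear)
  have Uscale: "hscale (of_real (1 / hnorm P \<psi>)) \<psi> \<in> U" if "\<psi> \<in> NN" "hnorm P \<psi> \<noteq> 0" for \<psi>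
    using that NNscale[OF that(1)] by (auto simp: U_def NN_def hnorm_hscale norm_divide)
  \<comment> \<open>The norm of the resolvent on the unit sphere of the orthogonal complement, which
    \<open>res\<close> leaves invariant by \<open>coeff_res\<close>.\<close>
  define mu where "mu = Sup ((\<lambda>\<psi>. hnorm P (res \<psi>)) ` U)"
  have bdd: "bdd_above ((\<lambda>\<psi>. hnorm P (res \<psi>)) ` U)"
    by (rule bdd_aboveI2[of _ _ 1]) (use res_bound in \<open>force simp: U_def\<close>)
  have Ule: "hnorm P (res \<psi>) \<le> mu" if "\<psi> \<in> U" for \<psi> unfolding mu_def by (rule cSUP_upper[OF that bdd])
  have Une: "U \<noteq> {}" using Uscale[of \<psi>0] psi0 orth0 nz by (auto simp: NN_def)
  have res_scale: "hnorm P (res (hscale c \<psi>)) = cmod c * hnorm P (res \<psi>)" if "Hsp P \<psi>" for c \<psi>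
  proof -
    have "hadd (hscale c x) (hscale 0 y) = hscale c x" for x y by (simp add: prod_eq_iff)
    then have "heq P (res (hscale c \<psi>)) (hscale c (res \<psi>))" using res_lincomb[OF that that, of c 0] by simp
    then show ?thesis using hnorm_cong[of "res (hscale c \<psi>)" "hscale c (res \<psi>)"] that by (simp add: hnorm_hscale)
  qed
  have le: "hnorm P (res \<psi>) \<le> mu * hnorm P \<psi>" if "\<psi> \<in> NN" for \<psi>
  proof (cases "hnorm P \<psi> = 0")
    case True
    then show ?thesis using res_bound[of \<psi>] that by (simp add: NN_def)
  next
    case False
    have "\<bar>1 / hnorm P \<psi>\<bar> * hnorm P (res \<psi>) \<le> mu"
      using Ule[OF Uscale[OF that False]] res_scale[of \<psi> "of_real (1 / hnorm P \<psi>)"] that by (simp add: NN_def norm_divide)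
    then have *: "hnorm P (res \<psi>) / hnorm P \<psi> \<le> mu" by simp
    have "0 < hnorm P \<psi>" using False hnorm_nonneg[of \<psi>] by linarith
    then show ?thesis using * by (simp add: pos_divide_le_eq)
  qed
  have mu0: "mu > 0"
  proof -
    obtain u where u: "u \<in> U" using Une by blast
    then have uH: "Hsp P u" "hnorm P u = 1" by (auto simp: U_def)
    have "hnorm P (res u) \<noteq> 0"
    proof
      assume z: "hnorm P (res u) = 0"
      then have "hnorm P (A1 (res u)) \<le> 0"
        using domA_zero(2)[OF res(1)[OF uH(1)]] hnorm_triangle[OF domA_Hsp(2) domA_Hsp(1), OF res(1)[OF uH(1)] res(1)[OF uH(1)]]
        by (simp add: A1_def)
      then show False using hnorm_cong[OF A1_Hsp[OF res(1)[OF uH(1)]] uH(1) res(2)[OF uH(1)]] uH(2) by simp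
    qed
    then show ?thesis using Ule[OF u] hnorm_nonneg[of "res u"] by linarith
  qed
  have "\<exists>\<psi>\<in>U. mu - 1 / real (Suc n) < hnorm P (res \<psi>)" for n
    using less_cSUP_iff[OF Une bdd, of "mu - 1 / real (Suc n)"] by (simp add: mu_def)
  then obtain a where a: "\<And>n. a n \<in> U" "\<And>n. mu - 1 / real (Suc n) < hnorm P (res (a n))" by metis
  have aH: "Hsp P (a n)" "hnorm P (a n) = 1" "a n \<in> NN" for n using a(1)[of n] by (auto simp: U_def NN_def)
  have lim_mu: "(\<lambda>n. hnorm P (res (a n))) \<longlonglongrightarrow> mu"
  proof (rule tendsto_sandwich)
    show "\<forall>\<^sub>F n in sequentially. mu - 1 / real (Suc n) \<le> hnorm P (res (a n))" using a(2) by (intro always_eventually allI less_imp_le)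
    show "\<forall>\<^sub>F n in sequentially. hnorm P (res (a n)) \<le> mu" using Ule a(1) by auto
    have "(\<lambda>n. mu - inverse (real (Suc n))) \<longlonglongrightarrow> mu - 0" by (intro tendsto_intros LIMSEQ_inverse_real_of_nat)
    then show "(\<lambda>n. mu - 1 / real (Suc n)) \<longlonglongrightarrow> mu" by (simp add: inverse_eq_divide)
  qed auto
  obtain \<xi> k where k: "Hsp P \<xi>" "strict_mono (k :: nat \<Rightarrow> nat)" "(\<lambda>n. hnorm P (hsub (res (a (k n))) \<xi>)) \<longlonglongrightarrow> 0"
    using res_compact[of a] aH by auto
  define b where "b n = a (k n)" for n
  have bH: "Hsp P (b n)" "hnorm P (b n) = 1" "b n \<in> NN" for n using aH by (auto simp: b_def)
  have blim: "(\<lambda>n. hnorm P (res (b n))) \<longlonglongrightarrow> mu"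
    using LIMSEQ_subseq_LIMSEQ[OF lim_mu k(2)] by (simp add: b_def o_def)
  have near: "(\<lambda>n. hnorm P (hsub (res (res (b n))) (hscale (of_real (mu\<^sup>2)) (b n)))) \<longlonglongrightarrow> 0"
  proof -
    \<comment> \<open>Expand the square, using \<open>res_symmetric\<close> for the mixed term and
      the bound \<open>mu\<close> on the complement for the first. The right side tends to 0 because
      \<open>b\<close> is a maximising sequence.\<close>
    have "(hnorm P (hsub (res (res (b n))) (hscale (of_real (mu\<^sup>2)) (b n))))\<^sup>2 \<le> mu^4 - mu\<^sup>2 * (hnorm P (res (b n)))\<^sup>2" for n
    proof -
      have "hinner P (res (res (b n))) (hscale (of_real (mu\<^sup>2)) (b n)) = of_real (mu\<^sup>2 * (hnorm P (res (b n)))\<^sup>2)"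
        using res_symmetric[of "res (b n)" "b n"] bH by (simp add: hinner_linear hinner_self_hnorm)
      then have "(hnorm P (hsub (res (res (b n))) (hscale (of_real (mu\<^sup>2)) (b n))))\<^sup>2
        = (hnorm P (res (res (b n))))\<^sup>2 - 2 * (mu\<^sup>2 * (hnorm P (res (b n)))\<^sup>2) + (mu\<^sup>2)\<^sup>2"
        using hnorm_sub_square[of "res (res (b n))" "hscale (of_real (mu\<^sup>2)) (b n)"] bH
        by (simp add: hnorm_hscale norm_power)
      moreover have "(hnorm P (res (res (b n))))\<^sup>2 \<le> (mu * hnorm P (res (b n)))\<^sup>2"
        by (intro power_mono le NNres bH) auto
      ultimately show ?thesis by (simp add: power_mult_distrib)
    qed
    moreover have "(\<lambda>n. mu^4 - mu\<^sup>2 * (hnorm P (res (b n)))\<^sup>2) \<longlonglongrightarrow> mu^4 - mu\<^sup>2 * mu\<^sup>2" by (intro tendsto_intros blim)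
    moreover have "mu^4 - mu\<^sup>2 * mu\<^sup>2 = 0" by (simp flip: power_add)
    ultimately show ?thesis by (intro tendsto_zero_squeeze_square[OF hnorm_nonneg]) simp_all
  qed
  \<comment> \<open>Since \<open>res (b n)\<close> tends to \<xi>, the vectors
    \<open>mu\<^sup>2 b n\<close> tend to \<open>res \<xi>\<close>. Defining the limit as a multiple
    of a value of \<open>res\<close> puts it into D(A).\<close>
  define x where "x = hscale (of_real (1 / mu\<^sup>2)) (res \<xi>)"
  have xH: "Hsp P x" using k(1) by (simp add: x_def)
  have xd: "domA P x" unfolding x_def by (rule domA_hscale(1)[OF res(1)[OF k(1)]])
  have bx: "(\<lambda>n. hnorm P (hsub (b n) x)) \<longlonglongrightarrow> 0"
  proof -
    have "hnorm P (hsub (b n) x) \<le> (1 / mu\<^sup>2) * (hnorm P (hsub (res (res (b n))) (hscale (of_real (mu\<^sup>2)) (b n))) + hnorm P (hsub (res (b n)) \<xi>))" for n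
    proof -
      have eq: "hsub (b n) x = hscale (of_real (1 / mu\<^sup>2)) (hsub (hscale (of_real (mu\<^sup>2)) (b n)) (res \<xi>))"
        using mu0 by (simp add: prod_eq_iff x_def algebra_simps fun_eq_iff flip: of_real_power)
      have "hnorm P (hsub (hscale (of_real (mu\<^sup>2)) (b n)) (res \<xi>))
         \<le> hnorm P (hsub (hscale (of_real (mu\<^sup>2)) (b n)) (res (res (b n)))) + hnorm P (hsub (res (res (b n))) (res \<xi>))"
        by (rule hnorm_sub_triangle) (use bH k in auto)
      also have "hnorm P (hsub (res (res (b n))) (res \<xi>)) \<le> hnorm P (hsub (res (b n)) \<xi>)"
        by (rule res_dist) (use bH k in auto)
      finally show ?thesis unfolding eq hnorm_hscale hnorm_sub_commute[of "hscale (of_real (mu\<^sup>2)) (b n)" "res (res (b n))"]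
        using mu0 by (simp add: norm_divide norm_power divide_right_mono)
    qed
    moreover have "(\<lambda>n. (1 / mu\<^sup>2) * (hnorm P (hsub (res (res (b n))) (hscale (of_real (mu\<^sup>2)) (b n))) + hnorm P (hsub (res (b n)) \<xi>))) \<longlonglongrightarrow> (1 / mu\<^sup>2) * (0 + 0)"
      using k(3) unfolding b_def[symmetric] by (intro tendsto_intros near)
    ultimately show ?thesis
      by (intro tendsto_zero_squeeze[OF hnorm_nonneg]) (assumption, simp)
  qed
  have x1: "hnorm P x = 1"
  proof -
    have "\<bar>1 - hnorm P x\<bar> \<le> hnorm P (hsub (b n) x)" for n
    proof -
      have h: "hsub y hzero = y" for y by (simp add: prod_eq_iff hzero_def)
      show ?thesis
        using hnorm_sub_triangle[OF bH(1)[of n] xH Hsp_hzero] hnorm_sub_triangle[OF xH bH(1)[of n] Hsp_hzero] bH(2)[of n]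
          hnorm_sub_commute[of x "b n"] unfolding h by linarith
    qed
    then have "\<bar>1 - hnorm P x\<bar> \<le> 0" by (intro LIMSEQ_le_const[OF bx]) auto
    then show ?thesis by simp
  qed
  have orthx: "hinner P e x = 0" if e: "e \<in> B" for e
  proof -
    have "cmod (hinner P e x) \<le> hnorm P (hsub (b n) x)" for n
    proof -
      have "hinner P e (hsub (b n) x) = - hinner P e x" using eigen_basis(2)[OF e] bH xH e by (simp add: hinner_linear NN_def)
      then show ?thesis using hinner_Cauchy_Schwarz[OF eigen_basis(2)[OF e], of "hsub (b n) x"] bH xH eigen_basis(3)[OF e]
        by (metis Hsp_hsub mult_1 norm_minus_cancel)
    qed
    then have "cmod (hinner P e x) \<le> 0" by (intro LIMSEQ_le_const[OF bx]) auto
    then show ?thesis by simp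
  qed
  have R2x: "heq P (res (res x)) (hscale (of_real (mu\<^sup>2)) x)"
  proof -
    have "hnorm P (hsub (res (res x)) (hscale (of_real (mu\<^sup>2)) x)) \<le> hnorm P (hsub (b n) x)
       + (hnorm P (hsub (res (res (b n))) (hscale (of_real (mu\<^sup>2)) (b n))) + mu\<^sup>2 * hnorm P (hsub (b n) x))" for n
    proof -
      have 1: "hnorm P (hsub (res (res x)) (hscale (of_real (mu\<^sup>2)) x)) \<le> hnorm P (hsub (res (res x)) (res (res (b n)))) + hnorm P (hsub (res (res (b n))) (hscale (of_real (mu\<^sup>2)) x))"
        by (rule hnorm_sub_triangle) (use bH xH in auto)
      have 2: "hnorm P (hsub (res (res (b n))) (hscale (of_real (mu\<^sup>2)) x)) \<le> hnorm P (hsub (res (res (b n))) (hscale (of_real (mu\<^sup>2)) (b n))) + hnorm P (hsub (hscale (of_real (mu\<^sup>2)) (b n)) (hscale (of_real (mu\<^sup>2)) x))"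
        by (rule hnorm_sub_triangle) (use bH xH in auto)
      have 3: "hsub (hscale (of_real (mu\<^sup>2)) (b n)) (hscale (of_real (mu\<^sup>2)) x) = hscale (of_real (mu\<^sup>2)) (hsub (b n) x)"
        by (simp add: prod_eq_iff algebra_simps)
      have 4: "hnorm P (hsub (res (res x)) (res (res (b n)))) \<le> hnorm P (hsub (b n) x)"
        using res_dist[of "res x" "res (b n)"] res_dist[of x "b n"] hnorm_sub_commute[of x "b n"] xH bH by simp
      show ?thesis using 1 2 4 unfolding 3 hnorm_hscale by (simp add: norm_power)
    qed
    moreover have "(\<lambda>n. hnorm P (hsub (b n) x)
       + (hnorm P (hsub (res (res (b n))) (hscale (of_real (mu\<^sup>2)) (b n))) + mu\<^sup>2 * hnorm P (hsub (b n) x))) \<longlonglongrightarrow> 0 + (0 + mu\<^sup>2 * 0)"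
      by (intro tendsto_intros bx near)
    ultimately have "hnorm P (hsub (res (res x)) (hscale (of_real (mu\<^sup>2)) x)) \<le> 0 + (0 + mu\<^sup>2 * 0)"
      by (intro LIMSEQ_le_const) auto
    then have "hnorm P (hsub (res (res x)) (hscale (of_real (mu\<^sup>2)) x)) = 0" by (simp add: antisym)
    then show ?thesis using heq_iff_hnorm xH by simp
  qed
  \<comment> \<open>With R the resolvent, R^2 x = mu^2 x, so (R + mu) x is an eigenvector of R with
    eigenvalue mu. It is nonzero because R is nonnegative and mu is positive.\<close>
  define y where "y = hadd (hscale 1 (res x)) (hscale (of_real mu) x)"
  have yd: "domA P y" unfolding y_def by (rule domA_lincomb(1)[OF res(1)[OF xH] xd])
  have yH: "Hsp P y" by (rule domA_Hsp[OF yd])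
  have Ry: "heq P (res y) (hscale (of_real mu) y)"
  proof -
    have "heq P (res y) (hadd (hscale 1 (res (res x))) (hscale (of_real mu) (res x)))"
      unfolding y_def by (rule res_lincomb) (use xH in auto)
    moreover have "heq P (hadd (hscale 1 (res (res x))) (hscale (of_real mu) (res x))) (hscale (of_real mu) y)"
      using R2x unfolding heq_def y_def by (auto elim!: eventually_mono simp: algebra_simps power2_eq_square)
    ultimately show ?thesis by (rule heq_trans)
  qed
  have "Re (hinner P x y) = Re (hinner P x (res x)) + mu"
    using xH x1 by (simp add: y_def hinner_linear hinner_self_hnorm)
  then have "hinner P x y \<noteq> 0" using res_positive[OF xH] mu0 by auto
  then have y0: "hnorm P y \<noteq> 0" using hinner_Cauchy_Schwarz[OF xH yH] by auto
  \<comment> \<open>From \<open>res y = mu y\<close> and \<open>A1 (res y) = y\<close>, both up to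
    \<open>heq\<close>, the eigenvalue of \<open>A\<close> is \<open>1 / mu - 1\<close>.\<close>
  have Ay: "heq P (Aop P y) (hscale (of_real (1 / mu - 1)) y)"
  proof -
    have d: "domA P (hscale (of_real mu) y)" by (rule domA_hscale(1)[OF yd])
    have 1: "heq P (Aop P (res y)) (hscale (of_real mu) (Aop P y))"
      using domA_heq(2)[OF res(1)[OF yH] d Ry] domA_hscale(2)[OF yd, of "of_real mu"] heq_trans by blast
    have 2: "heq P (hadd (Aop P (res y)) (res y)) y" using res(2)[OF yH] by (simp add: A1_def)
    have "of_real mu \<noteq> (0::complex)" using mu0 by simp
    then have *: "u = of_real (1 / mu - 1) * v" if "w = of_real mu * u" "r = of_real mu * v" "w + r = v" for u v w r :: complex
      using that by (simp add: field_simps)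
    show ?thesis
      unfolding heq_def
    proof
      show "AE z in leb. fst (Aop P y) z = fst (hscale (of_real (1 / mu - 1)) y) z"
        using conjunct1[OF 1[unfolded heq_def]] conjunct1[OF 2[unfolded heq_def]] conjunct1[OF Ry[unfolded heq_def]]
      proof eventually_elim
        case (elim z)
        show ?case using *[of "fst (Aop P (res y)) z" "fst (Aop P y) z" "fst (res y) z" "fst y z"] elim by simp
      qed
      show "snd (Aop P y) = snd (hscale (of_real (1 / mu - 1)) y)"
        using *[of "snd (Aop P (res y))" "snd (Aop P y)" "snd (res y)" "snd y"] 1 2 Ry unfolding heq_def by simp
    qed
  qed
  define e where "e = hscale (of_real (1 / hnorm P y)) y"
  have ed: "domA P e" unfolding e_def by (rule domA_hscale(1)[OF yd])
  have e1: "hnorm P e = 1" using y0 by (simp add: e_def hnorm_hscale norm_divide)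
  have "heq P (Aop P e) (hscale (of_real (1 / mu - 1)) e)"
  proof -
    have "heq P (Aop P e) (hscale (of_real (1 / hnorm P y)) (Aop P y))" unfolding e_def by (rule domA_hscale(2)[OF yd])
    moreover have "heq P (hscale (of_real (1 / hnorm P y)) (Aop P y)) (hscale (of_real (1 / mu - 1)) e)"
      using Ay unfolding heq_def e_def by (auto elim!: eventually_mono simp: algebra_simps)
    ultimately show ?thesis by (rule heq_trans)
  qed
  then have eig: "eigA P (1 / mu - 1) e" using ed e1 by (simp add: eigA_def)
  have orthe: "hinner P f e = 0" if f: "f \<in> B" for f
    using orthx[OF f] coeff_res[OF f xH] eigen_basis(2)[OF f] xH by (simp add: e_def y_def hinner_linear)
  have "orthonormal_eigen (insert e B)"
    unfolding orthonormal_eigen_def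
  proof (intro conjI ballI impI)
    fix f assume "f \<in> insert e B"
    then show "\<exists>lam. eigA P lam f" "hnorm P f = 1"
      using eig e1 orthonormal by (auto simp: orthonormal_eigen_def)
  next
    fix f g assume "f \<in> insert e B" "g \<in> insert e B" "f \<noteq> g"
    then consider "f = e" "g \<in> B" | "f \<in> B" "g = e" | "f \<in> B" "g \<in> B" by blast
    then show "hinner P f g = 0"
    proof cases
      case 1
      then show ?thesis using orthe[of g] hinner_cnj[of e g] by simp
    next
      case 2
      then show ?thesis using orthe[of f] by simp
    next
      case 3
      then show ?thesis using eigen_orth \<open>f \<noteq> g\<close> by simp
    qed
  qed
  then have "e \<in> B" using maximal by blast
  then show False using orthe[of e] e1 hinner_self_hnorm[of e] by simp
qed

end

section \<open>The propagator\<close>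

lemma gE_nonneg:
  assumes "0 \<le> lam"
  shows "gE t lam = (if lam = 0 then - t else - sin (sqrt lam * t) / sqrt lam)"
  using assms by (simp add: gE_def)

text \<open>A consequence of \<open>\<bar>sin x\<bar> \<le> \<bar>x\<bar>\<close>. Being uniform in
  \<open>lam\<close>, the bound passes to the norm of the propagator and to all coefficient
  sums.\<close>

lemma gE_bound: "0 \<le> lam \<Longrightarrow> \<bar>gE t lam\<bar> \<le> \<bar>t\<bar>"
  using abs_sin_x_le_abs_x[of "sqrt lam * t"] by (simp add: gE_nonneg abs_mult field_simps)

lemma gE_minus: "gE (- t) lam = - gE t lam"
  by (simp add: gE_def)

lemma gE_continuous: "0 \<le> lam \<Longrightarrow> continuous_on S (\<lambda>t. gE t lam)"
  by (cases "lam = 0") (auto simp: gE_nonneg intro!: continuous_intros)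

lemma gE_deriv:
  assumes "0 \<le> lam"
  shows "((\<lambda>t. gE t lam) has_real_derivative - cos (sqrt lam * t)) (at t within S)"
    "((\<lambda>t. - cos (sqrt lam * t)) has_real_derivative - lam * gE t lam) (at t within S)"
proof -
  define w where "w = sqrt lam"
  have w: "0 \<le> w" "lam = w * w" using assms by (simp_all add: w_def)
  have g: "gE t lam = (if w = 0 then - t else - sin (w * t) / w)" for t
    using w by (simp add: gE_nonneg)
  have s: "sqrt lam = w" by (simp add: w_def)
  show "((\<lambda>t. gE t lam) has_real_derivative - cos (sqrt lam * t)) (at t within S)"
    unfolding g s by (cases "w = 0") (auto intro!: derivative_eq_intros)
  show "((\<lambda>t. - cos (sqrt lam * t)) has_real_derivative - lam * gE t lam) (at t within S)"
    unfolding g s by (cases "w = 0") (auto intro!: derivative_eq_intros simp: w(2))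
qed

lemma bop_Hsp:
  assumes "bop P T" "Hsp P x"
  shows "Hsp P (T x)"
proof -
  have "\<forall>\<phi>. Hsp P \<phi> \<longrightarrow> Hsp P (T \<phi>)" using assms(1) unfolding bop_def by (rule conjunct1)
  then show ?thesis using assms(2) by blast
qed

lemma bop_linear:
  assumes "bop P T" "Hsp P x" "Hsp P y"
  shows "heq P (T (hadd (hscale a x) (hscale c y))) (hadd (hscale a (T x)) (hscale c (T y)))"
proof -
  have "\<forall>\<phi> \<psi> a c. Hsp P \<phi> \<and> Hsp P \<psi> \<longrightarrow>
      heq P (T (hadd (hscale a \<phi>) (hscale c \<psi>))) (hadd (hscale a (T \<phi>)) (hscale c (T \<psi>)))"
    using assms(1) unfolding bop_def by (elim conjE)
  then show ?thesis using assms(2,3) by blast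
qed

lemma bop_bounded:
  assumes "bop P T"
  obtains C where "\<forall>\<phi>. Hsp P \<phi> \<longrightarrow> hnorm P (T \<phi>) \<le> C * hnorm P \<phi>"
proof -
  have "\<exists>C. \<forall>\<phi>. Hsp P \<phi> \<longrightarrow> hnorm P (T \<phi>) \<le> C * hnorm P \<phi>" using assms unfolding bop_def by (elim conjE)
  then show ?thesis using that by blast
qed

lemma spec_funD:
  assumes "spec_fun P g T"
  shows "bop P T" "eigA P lam v \<Longrightarrow> heq P (T v) (hscale (complex_of_real (g lam)) v)"
  using assms unfolding spec_fun_def by blast+

context eigenbasis
begin

lemma coeff_ext:
  assumes "Hsp P a" "Hsp P b" "\<And>e. e \<in> B \<Longrightarrow> hinner P e a = hinner P e b"
  shows "heq P a b"
proof -
  have "hnorm P (hsub a b) = 0"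
    by (rule total) (use assms eigen_basis in \<open>auto simp: hinner_linear\<close>)
  then show ?thesis using heq_iff_hnorm assms by simp
qed

lemma expansion:
  assumes a: "Hsp P a"
  obtains F where "\<forall>n::nat. finite (F n) \<and> F n \<subseteq> B"
    "(\<lambda>n. hnorm P (hsub (lincomb (F n) (\<lambda>e. hinner P e a)) a)) \<longlonglongrightarrow> 0"
proof -
  obtain b F where bF: "Hsp P b" "\<forall>e\<in>B. hinner P e b = hinner P e a" "\<forall>n::nat. finite (F n) \<and> F n \<subseteq> B"
    "(\<lambda>n. hnorm P (hsub (lincomb (F n) (\<lambda>e. hinner P e a)) b)) \<longlonglongrightarrow> 0"
    by (rule synthesis[of "\<lambda>e. hinner P e a" "(hnorm P a)\<^sup>2"]) (use Bessel a in auto)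
  have ab: "heq P b a" by (rule coeff_ext) (use bF a in auto)
  have "hnorm P (hsub (lincomb (F n) (\<lambda>e. hinner P e a)) b) = hnorm P (hsub (lincomb (F n) (\<lambda>e. hinner P e a)) a)" for n
  proof (rule hnorm_cong)
    have "Hsp P (lincomb (F n) (\<lambda>e. hinner P e a))" using lincomb_Hsp bF(3) by blast
    then show "Hsp P (hsub (lincomb (F n) (\<lambda>e. hinner P e a)) b)" "Hsp P (hsub (lincomb (F n) (\<lambda>e. hinner P e a)) a)"
      using a bF(1) by auto
    show "heq P (hsub (lincomb (F n) (\<lambda>e. hinner P e a)) b) (hsub (lincomb (F n) (\<lambda>e. hinner P e a)) a)"
      using ab unfolding heq_def by (auto elim!: eventually_mono)
  qed
  then show ?thesis using that bF(3,4) by simp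
qed

text \<open>The finite sections of the expansion have norm at most \<open>C\<close> and converge to
  \<open>a\<close>.\<close>

lemma Parseval_le:
  assumes a: "Hsp P a" and C: "0 \<le> C"
    and le: "\<And>F. finite F \<Longrightarrow> F \<subseteq> B \<Longrightarrow> (\<Sum>e\<in>F. (cmod (hinner P e a))\<^sup>2) \<le> C\<^sup>2"
  shows "hnorm P a \<le> C"
proof -
  obtain F where F: "\<forall>n::nat. finite (F n) \<and> F n \<subseteq> B"
    "(\<lambda>n. hnorm P (hsub (lincomb (F n) (\<lambda>e. hinner P e a)) a)) \<longlonglongrightarrow> 0"
    using expansion[OF a] by blast
  have "hnorm P a \<le> C + hnorm P (hsub (lincomb (F n) (\<lambda>e. hinner P e a)) a)" for n
  proof -
    let ?s = "lincomb (F n) (\<lambda>e. hinner P e a)"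
    have s: "Hsp P ?s" using lincomb_Hsp F by blast
    have "(hnorm P ?s)\<^sup>2 \<le> C\<^sup>2" using hnorm_lincomb le F(1) by simp
    then have 1: "hnorm P ?s \<le> C" using C by (rule power2_le_imp_le)
    have "a = hadd ?s (hscale (-1) (hsub ?s a))" by (simp add: prod_eq_iff)
    then have "hnorm P a \<le> hnorm P ?s + hnorm P (hscale (-1) (hsub ?s a))"
      using hnorm_triangle[OF s, of "hscale (-1) (hsub ?s a)"] s a by simp
    then show ?thesis using 1 by (simp add: hnorm_hscale)
  qed
  moreover have "(\<lambda>n. C + hnorm P (hsub (lincomb (F n) (\<lambda>e. hinner P e a)) a)) \<longlonglongrightarrow> C + 0"
    by (intro tendsto_intros F)
  ultimately show ?thesis using LIMSEQ_le_const[of _ "C + 0" "hnorm P a"] by auto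
qed

text \<open>\<open>A + 1\<close> multiplies the coefficient at \<open>e\<close> by
  \<open>1 + eigenvalue e\<close>. Its prospective image is synthesised first, and the resolvent
  then lands in D(A).\<close>

lemma domA_synthesis:
  assumes c: "\<And>F. finite F \<Longrightarrow> F \<subseteq> B \<Longrightarrow> (\<Sum>e\<in>F. (cmod (of_real (1 + eigenvalue e) * c e))\<^sup>2) \<le> C"
  obtains \<phi> where "domA P \<phi>" "\<forall>e\<in>B. hinner P e \<phi> = c e"
proof -
  obtain b F where b: "Hsp P b" "\<forall>e\<in>B. hinner P e b = of_real (1 + eigenvalue e) * c e"
    "\<forall>n::nat. finite (F n) \<and> F n \<subseteq> B"
    "(\<lambda>n. hnorm P (hsub (lincomb (F n) (\<lambda>e. of_real (1 + eigenvalue e) * c e)) b)) \<longlonglongrightarrow> 0"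
    by (rule synthesis[OF c])
  have "hinner P e (res b) = c e" if e: "e \<in> B" for e
  proof -
    have "complex_of_real (1 + eigenvalue e) \<noteq> 0" using eigen_basis(5)[OF e] by (simp only: of_real_eq_0_iff)
    then show ?thesis using coeff_res[OF e b(1)] b(2) e by simp
  qed
  then show ?thesis using that[OF res(1)[OF b(1)]] by blast
qed

text \<open>The weighted coefficients are those of \<open>A1 \<phi>\<close>, to which
  \<open>Parseval_le\<close> applies; the factor 3 is the constant of
  \<open>A1_bounds\<close>.\<close>

lemma gnorm_le_coeffs:
  assumes d: "domA P \<phi>" and C: "0 \<le> C"
    and le: "\<And>F. finite F \<Longrightarrow> F \<subseteq> B \<Longrightarrow> (\<Sum>e\<in>F. (cmod (of_real (1 + eigenvalue e) * hinner P e \<phi>))\<^sup>2) \<le> C\<^sup>2"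
  shows "gnorm P \<phi> \<le> 3 * C"
proof -
  have "hnorm P (A1 \<phi>) \<le> C"
  proof (rule Parseval_le[OF A1_Hsp[OF d] C])
    fix F assume F: "finite F" "F \<subseteq> B"
    have "(\<Sum>e\<in>F. (cmod (hinner P e (A1 \<phi>)))\<^sup>2) = (\<Sum>e\<in>F. (cmod (of_real (1 + eigenvalue e) * hinner P e \<phi>))\<^sup>2)"
      by (intro sum.cong refl) (use coeff_A1[OF _ d] F in \<open>auto simp: subset_eq\<close>)
    then show "(\<Sum>e\<in>F. (cmod (hinner P e (A1 \<phi>)))\<^sup>2) \<le> C\<^sup>2" using le[OF F] by simp
  qed
  then show ?thesis using A1_bounds(3)[OF d] by simp
qed

subsection \<open>The functional calculus\<close>

lemma spec_fun_lincomb: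
  assumes T: "spec_fun P g T" and F: "finite F" "F \<subseteq> B"
  shows "heq P (T (lincomb F c)) (lincomb F (\<lambda>e. of_real (g (eigenvalue e)) * c e))"
  using F
proof (induction F rule: finite_induct)
  case empty
  have b: "bop P T" by (rule spec_funD(1)[OF T])
  \<comment> \<open>Linearity with both scalars equal to 0 yields that \<open>T\<close> maps zero to
    zero up to \<open>heq\<close>.\<close>
  have z: "hadd (hscale 0 x) (hscale 0 y) = hzero" for x y by (simp add: prod_eq_iff hzero_def)
  have "heq P (T (hadd (hscale 0 hzero) (hscale 0 hzero))) (hadd (hscale 0 (T hzero)) (hscale 0 (T hzero)))"
    by (rule bop_linear[OF b Hsp_hzero Hsp_hzero])
  then show ?case unfolding z hsum_empty .
next
  case (insert e F)
  have b: "bop P T" by (rule spec_funD(1)[OF T])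
  have e: "e \<in> B" and F: "F \<subseteq> B" using insert.prems by auto
  have h1: "hscale 1 x = x" for x by (simp add: prod_eq_iff)
  have "heq P (T (hadd (hscale (c e) e) (hscale 1 (lincomb F c)))) (hadd (hscale (c e) (T e)) (hscale 1 (T (lincomb F c))))"
    by (rule bop_linear[OF b eigen_basis(2)[OF e] lincomb_Hsp[OF F]])
  moreover have "heq P (T e) (hscale (of_real (g (eigenvalue e))) e)"
    by (rule spec_funD(2)[OF T eigen_basis(6)[OF e]])
  then have "heq P (hadd (hscale (c e) (T e)) (hscale 1 (T (lincomb F c))))
      (hadd (hscale (of_real (g (eigenvalue e)) * c e) e) (lincomb F (\<lambda>e. of_real (g (eigenvalue e)) * c e)))"
    using insert.IH[OF F] unfolding heq_def by (auto elim!: eventually_elim2)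
  ultimately show ?case
    unfolding hsum_insert[OF insert.hyps] h1 by (rule heq_trans)
qed

text \<open>No symmetry of \<open>T\<close> is given, so it cannot be moved to the eigenvector. The
  formula holds on finite combinations by linearity and extends by boundedness along the expansion
  of \<open>a\<close>.\<close>

lemma spec_fun_coeff:
  assumes T: "spec_fun P g T" and a: "Hsp P a" and e: "e \<in> B"
  shows "hinner P e (T a) = of_real (g (eigenvalue e)) * hinner P e a"
proof -
  have b: "bop P T" by (rule spec_funD(1)[OF T])
  obtain C where C: "\<forall>\<phi>. Hsp P \<phi> \<longrightarrow> hnorm P (T \<phi>) \<le> C * hnorm P \<phi>" by (rule bop_bounded[OF b])
  have TH: "Hsp P (T x)" if "Hsp P x" for x by (rule bop_Hsp[OF b that])
  have Tsub: "heq P (T (hsub x y)) (hsub (T x) (T y))" if "Hsp P x" "Hsp P y" for x y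
  proof -
    have h: "hadd (hscale 1 x) (hscale (-1) y) = hsub x y" for x y by (simp add: prod_eq_iff)
    have "heq P (T (hadd (hscale 1 x) (hscale (-1) y))) (hadd (hscale 1 (T x)) (hscale (-1) (T y)))"
      by (rule bop_linear[OF b that])
    then show ?thesis unfolding h .
  qed
  obtain F where F: "\<forall>n::nat. finite (F n) \<and> F n \<subseteq> B"
    "(\<lambda>n. hnorm P (hsub (lincomb (F n) (\<lambda>e. hinner P e a)) a)) \<longlonglongrightarrow> 0"
    using expansion[OF a] by blast
  let ?s = "\<lambda>n. lincomb (F n) (\<lambda>e. hinner P e a)" and ?g = "complex_of_real (g (eigenvalue e))"
  have s: "Hsp P (?s n)" for n using lincomb_Hsp F by blast
  have Ts: "hinner P e (T (?s n)) = ?g * hinner P e (?s n)" for n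
  proof -
    have "hinner P e (T (?s n)) = hinner P e (lincomb (F n) (\<lambda>e. of_real (g (eigenvalue e)) * hinner P e a))"
      by (rule hinner_cong) (use eigen_basis(2)[OF e] TH[OF s] lincomb_Hsp spec_fun_lincomb[OF T] F in auto)
    then show ?thesis using coeff_lincomb[OF _ _ e] F by simp
  qed
  have "cmod (hinner P e (T a) - ?g * hinner P e a) \<le> (C + cmod ?g) * hnorm P (hsub (?s n) a)" for n
  proof -
    have eq1: "hinner P e (T (hsub (?s n) a)) = hinner P e (T (?s n)) - hinner P e (T a)"
    proof -
      have "hinner P e (T (hsub (?s n) a)) = hinner P e (hsub (T (?s n)) (T a))"
        by (rule hinner_cong[OF eigen_basis(2)[OF e] TH[OF Hsp_hsub[OF s a]] Hsp_hsub[OF TH[OF s] TH[OF a]] Tsub[OF s a]])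
      also have "\<dots> = hinner P e (T (?s n)) - hinner P e (T a)"
        by (rule hinner_sub_right[OF eigen_basis(2)[OF e] TH[OF s] TH[OF a]])
      finally show ?thesis .
    qed
    have eq2: "hinner P e (hsub (?s n) a) = hinner P e (?s n) - hinner P e a"
      using s a eigen_basis(2)[OF e] by (simp add: hinner_linear)
    have "hinner P e (T a) - ?g * hinner P e a = ?g * hinner P e (hsub (?s n) a) - hinner P e (T (hsub (?s n) a))"
      unfolding eq1 eq2 Ts by (simp add: algebra_simps)
    also have "cmod \<dots> \<le> cmod ?g * cmod (hinner P e (hsub (?s n) a)) + cmod (hinner P e (T (hsub (?s n) a)))"
      by (rule order_trans[OF norm_triangle_ineq4]) (simp add: norm_mult)
    also have "\<dots> \<le> cmod ?g * hnorm P (hsub (?s n) a) + C * hnorm P (hsub (?s n) a)"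
    proof (intro add_mono mult_left_mono)
      show "cmod (hinner P e (hsub (?s n) a)) \<le> hnorm P (hsub (?s n) a)"
        using hinner_Cauchy_Schwarz[OF eigen_basis(2)[OF e], of "hsub (?s n) a"] s a eigen_basis(3)[OF e] by simp
      show "cmod (hinner P e (T (hsub (?s n) a))) \<le> C * hnorm P (hsub (?s n) a)"
      proof -
        have sa: "Hsp P (hsub (?s n) a)" by (rule Hsp_hsub[OF s a])
        have "cmod (hinner P e (T (hsub (?s n) a))) \<le> hnorm P (T (hsub (?s n) a))"
          using hinner_Cauchy_Schwarz[OF eigen_basis(2)[OF e] TH[OF sa]] unfolding eigen_basis(3)[OF e] by simp
        also have "\<dots> \<le> C * hnorm P (hsub (?s n) a)" by (rule C[rule_format, OF sa])
        finally show ?thesis .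
      qed
    qed simp
    finally show ?thesis by (simp add: algebra_simps)
  qed
  moreover have "(\<lambda>n. (C + cmod ?g) * hnorm P (hsub (?s n) a)) \<longlonglongrightarrow> (C + cmod ?g) * 0"
    by (intro tendsto_intros F)
  ultimately have "cmod (hinner P e (T a) - ?g * hinner P e a) \<le> (C + cmod ?g) * 0"
    by (intro LIMSEQ_le_const) auto
  then show ?thesis by simp
qed

lemma spec_fun_gE_bound:
  assumes T: "spec_fun P (gE s) T" and a: "Hsp P a"
  shows "hnorm P (T a) \<le> \<bar>s\<bar> * hnorm P a"
proof (rule Parseval_le)
  show "Hsp P (T a)" by (rule bop_Hsp[OF spec_funD(1)[OF T] a])
  fix F assume F: "finite F" "F \<subseteq> B"
  have "(\<Sum>e\<in>F. (cmod (hinner P e (T a)))\<^sup>2) \<le> (\<Sum>e\<in>F. \<bar>s\<bar>\<^sup>2 * (cmod (hinner P e a))\<^sup>2)"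
  proof (rule sum_mono)
    fix e assume "e \<in> F"
    then have e: "e \<in> B" using F by auto
    have "cmod (hinner P e (T a)) \<le> \<bar>s\<bar> * cmod (hinner P e a)"
      unfolding spec_fun_coeff[OF T a e] using gE_bound[OF eigen_basis(5)[OF e], of s] by (simp add: norm_mult mult_right_mono)
    then show "(cmod (hinner P e (T a)))\<^sup>2 \<le> \<bar>s\<bar>\<^sup>2 * (cmod (hinner P e a))\<^sup>2"
      using power_mono[of "cmod (hinner P e (T a))" "\<bar>s\<bar> * cmod (hinner P e a)" 2] by (simp add: power_mult_distrib)
  qed
  also have "\<dots> \<le> \<bar>s\<bar>\<^sup>2 * (hnorm P a)\<^sup>2"
    unfolding sum_distrib_left[symmetric] by (intro mult_left_mono Bessel F a) simp
  finally show "(\<Sum>e\<in>F. (cmod (hinner P e (T a)))\<^sup>2) \<le> (\<bar>s\<bar> * hnorm P a)\<^sup>2" by (simp add: power_mult_distrib)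
qed simp

subsection \<open>Weak integrals\<close>

text \<open>When the test vector is a finite combination of eigenvectors, the weak integral is a
  finite sum of scalar ones, given by the coefficients of \<open>G\<close>. A general \<psi> is
  approximated by such combinations, and dominated convergence carries the integrals along.\<close>

lemma propagator_integral:
  assumes K: "\<forall>s. spec_fun P (gE s) (K s)"
    and hH: "\<And>s. Hsp P (h s)" and hc: "\<And>e. e \<in> B \<Longrightarrow> continuous_on UNIV (\<lambda>s. hinner P e (h s))"
    and hM: "\<And>s. hnorm P (h s) \<le> M" and hT: "\<And>s. T < \<bar>s\<bar> \<Longrightarrow> hnorm P (h s) = 0" and T: "0 \<le> T"
    and G: "Hsp P G" "\<And>e. e \<in> B \<Longrightarrow> hinner P e G = (LINT s:{t..}|lborel. of_real (gE (t - s) (eigenvalue e)) * hinner P e (h s))"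
  shows "hint_on P {t..} (\<lambda>s. K (t - s) (h s)) G"
  unfolding hint_on_def
proof (intro conjI allI impI G(1))
  fix \<psi> assume psi: "Hsp P \<psi>"
  obtain F where F: "\<forall>n::nat. finite (F n) \<and> F n \<subseteq> B"
    "(\<lambda>n. hnorm P (hsub (lincomb (F n) (\<lambda>e. hinner P e \<psi>)) \<psi>)) \<longlonglongrightarrow> 0"
    using expansion[OF psi] by blast
  let ?p = "\<lambda>n. lincomb (F n) (\<lambda>e. hinner P e \<psi>)"
  have p: "Hsp P (?p n)" for n using lincomb_Hsp F by blast
  have KH: "Hsp P (K r a)" if "Hsp P a" for r a
    by (rule bop_Hsp[OF spec_funD(1)[OF K[rule_format]] that])
  have M0: "0 \<le> M" using hM[of 0] hnorm_nonneg[of "h 0"] by linarith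
  \<comment> \<open>The dominating function: outside [-T, T] the data vanish, and inside the
    propagator has norm at most \<open>\<bar>t - s\<bar> \<le> \<bar>t\<bar> + T\<close>.\<close>
  define w where "w s = indicator {-T..T} s * (hnorm P \<psi> * ((\<bar>t\<bar> + T) * M))" for s :: real
  have wi: "integrable lborel w"
    unfolding w_def by (intro integrable_mult_left integrable_real_indicator) (auto simp: emeasure_lborel_Icc_eq)
  have Kb: "hnorm P (K (t - s) (h s)) \<le> indicator {-T..T} s * ((\<bar>t\<bar> + T) * M)" for s
  proof (cases "T < \<bar>s\<bar>")
    case True
    then show ?thesis using spec_fun_gE_bound[OF K[rule_format] hH, of "t - s" s] hT[OF True] M0 T by (auto simp: indicator_def)
  next
    case False
    have "hnorm P (K (t - s) (h s)) \<le> \<bar>t - s\<bar> * hnorm P (h s)" by (rule spec_fun_gE_bound[OF K[rule_format] hH])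
    also have "\<dots> \<le> (\<bar>t\<bar> + T) * M" using False hM M0 T by (intro mult_mono) auto
    finally show ?thesis using False by (auto simp: indicator_def)
  qed
  have pn: "hnorm P (?p n) \<le> hnorm P \<psi>" for n
    using hnorm_lincomb Bessel[OF _ _ psi] F(1) by (intro power2_le_imp_le[OF _ hnorm_nonneg]) simp
  define q where "q n s = indicator {t..} s *\<^sub>R hinner P (?p n) (K (t - s) (h s))" for n s
  have qeq: "q n s = (\<Sum>e\<in>F n. cnj (hinner P e \<psi>) * (indicator {t..} s *\<^sub>R (of_real (gE (t - s) (eigenvalue e)) * hinner P e (h s))))" for n s
  proof -
    have "hinner P (?p n) (K (t - s) (h s)) = cnj (\<Sum>e\<in>F n. hinner P e \<psi> * cnj (hinner P e (K (t - s) (h s))))"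
      using hinner_lincomb[OF _ _ KH[OF hH]] F(1) hinner_cnj[of "?p n" "K (t - s) (h s)"] by simp
    also have "\<dots> = (\<Sum>e\<in>F n. cnj (hinner P e \<psi>) * (of_real (gE (t - s) (eigenvalue e)) * hinner P e (h s)))"
      unfolding cnj_sum using spec_fun_coeff[OF K[rule_format] hH] F(1) by (intro sum.cong) (auto simp: subset_eq)
    finally show ?thesis unfolding q_def by (simp add: scaleR_sum_right)
  qed
  have qm: "q n \<in> borel_measurable lborel" for n
  proof -
    have "(\<lambda>s. indicator {t..} s *\<^sub>R (of_real (gE (t - s) (eigenvalue e)) * hinner P e (h s))) \<in> borel_measurable borel" if "e \<in> F n" for e
    proof (rule borel_measurable_scaleR)
      have e: "e \<in> B" using that F by auto
      have "continuous_on UNIV (\<lambda>s. gE (t - s) (eigenvalue e))"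
        by (rule continuous_on_compose2[OF gE_continuous[OF eigen_basis(5)[OF e], of UNIV]]) (auto intro!: continuous_intros)
      then have "continuous_on UNIV (\<lambda>s. of_real (gE (t - s) (eigenvalue e)) * hinner P e (h s))"
        by (intro continuous_intros hc[OF e])
      then show "(\<lambda>s. of_real (gE (t - s) (eigenvalue e)) * hinner P e (h s)) \<in> borel_measurable borel"
        by (rule borel_measurable_continuous_onI)
    qed simp
    then show ?thesis unfolding qeq measurable_lborel1
      by (intro borel_measurable_sum borel_measurable_times borel_measurable_const) simp
  qed
  have qw: "norm (q n s) \<le> w s" for n s
  proof -
    have "cmod (hinner P (?p n) (K (t - s) (h s))) \<le> hnorm P \<psi> * (indicator {-T..T} s * ((\<bar>t\<bar> + T) * M))"
      by (rule order_trans[OF hinner_Cauchy_Schwarz[OF p KH[OF hH]] mult_mono[OF pn Kb]]) auto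
    then show ?thesis using M0 T by (auto simp: q_def w_def indicator_def split: if_splits)
  qed
  have lim: "(\<lambda>n. q n s) \<longlonglongrightarrow> indicator {t..} s *\<^sub>R hinner P \<psi> (K (t - s) (h s))" for s
  proof -
    have "(\<lambda>n. hinner P (hsub (?p n) \<psi>) (K (t - s) (h s))) \<longlonglongrightarrow> 0"
    proof (rule Lim_null_comparison)
      show "\<forall>\<^sub>F n in sequentially. norm (hinner P (hsub (?p n) \<psi>) (K (t - s) (h s))) \<le> hnorm P (hsub (?p n) \<psi>) * hnorm P (K (t - s) (h s))"
        using hinner_Cauchy_Schwarz[OF Hsp_hsub[OF p psi] KH[OF hH]] by simp
      show "(\<lambda>n. hnorm P (hsub (?p n) \<psi>) * hnorm P (K (t - s) (h s))) \<longlonglongrightarrow> 0" by (rule tendsto_mult_left_zero[OF F(2)])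
    qed
    then have "(\<lambda>n. hinner P (?p n) (K (t - s) (h s)) - hinner P \<psi> (K (t - s) (h s))) \<longlonglongrightarrow> 0"
      using hinner_sub_left[OF KH[OF hH] p psi] by simp
    then have "(\<lambda>n. hinner P (?p n) (K (t - s) (h s))) \<longlonglongrightarrow> hinner P \<psi> (K (t - s) (h s))" by (simp add: LIM_zero_iff)
    then show ?thesis unfolding q_def by (intro tendsto_intros)
  qed
  \<comment> \<open>The operators \<open>K s\<close> are given separately for each time;
    measurability in time comes from the pointwise limit of the finite sums.\<close>
  have lm: "(\<lambda>s. indicator {t..} s *\<^sub>R hinner P \<psi> (K (t - s) (h s))) \<in> borel_measurable lborel"
    by (rule borel_measurable_LIMSEQ_metric[OF qm lim])
  show "set_integrable lborel {t..} (\<lambda>s. hinner P \<psi> (K (t - s) (h s)))"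
    unfolding set_integrable_def by (rule integrable_dominated_convergence[OF lm qm wi AE_I2[OF lim] AE_I2[OF qw]])
  have "(\<lambda>n. \<integral>s. q n s \<partial>lborel) \<longlonglongrightarrow> (LINT s:{t..}|lborel. hinner P \<psi> (K (t - s) (h s)))"
    unfolding set_lebesgue_integral_def by (rule integral_dominated_convergence[OF lm qm wi AE_I2[OF lim] AE_I2[OF qw]])
  moreover have "(\<integral>s. q n s \<partial>lborel) = hinner P (?p n) G" for n
  proof -
    have i: "integrable lborel (\<lambda>s. indicator {t..} s *\<^sub>R (of_real (gE (t - s) (eigenvalue e)) * hinner P e (h s)))" if "e \<in> F n" for e
    proof -
      have e: "e \<in> B" using that F by auto
      have "continuous_on UNIV (\<lambda>s. gE (t - s) (eigenvalue e))"
        by (rule continuous_on_compose2[OF gE_continuous[OF eigen_basis(5)[OF e], of UNIV]]) (auto intro!: continuous_intros)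
      then have c: "continuous_on UNIV (\<lambda>s. of_real (gE (t - s) (eigenvalue e)) * hinner P e (h s))"
        by (intro continuous_intros hc[OF e])
      have z: "hinner P e (h s) = 0" if "s \<notin> {-T..T}" for s
      proof -
        have "T < \<bar>s\<bar>" using that by auto
        then show ?thesis using hinner_Cauchy_Schwarz[OF eigen_basis(2)[OF e] hH, of s] hT by auto
      qed
      have "set_integrable lborel ({-T..T}) (\<lambda>s. of_real (gE (t - s) (eigenvalue e)) * hinner P e (h s))"
        by (rule borel_integrable_atLeastAtMost') (rule continuous_on_subset[OF c], simp)
      then have "integrable lborel (\<lambda>s. indicator {t..} s *\<^sub>R (indicator {-T..T} s *\<^sub>R (of_real (gE (t - s) (eigenvalue e)) * hinner P e (h s))))"
        unfolding set_integrable_def by (rule integrable_mult_indicator[rotated]) simp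
      moreover have "indicator {-T..T} s *\<^sub>R (of_real (gE (t - s) (eigenvalue e)) * hinner P e (h s)) = of_real (gE (t - s) (eigenvalue e)) * hinner P e (h s)" for s
        using z[of s] by (cases "s \<in> {-T..T}") auto
      ultimately show ?thesis by simp
    qed
    have "(\<integral>s. q n s \<partial>lborel) = (\<Sum>e\<in>F n. cnj (hinner P e \<psi>) * hinner P e G)"
    proof -
      have "(\<integral>s. q n s \<partial>lborel) = (\<Sum>e\<in>F n. \<integral>s. cnj (hinner P e \<psi>) * (indicator {t..} s *\<^sub>R (of_real (gE (t - s) (eigenvalue e)) * hinner P e (h s))) \<partial>lborel)"
        unfolding qeq by (rule Bochner_Integration.integral_sum) (rule integrable_mult_right, rule i)
      also have "\<dots> = (\<Sum>e\<in>F n. cnj (hinner P e \<psi>) * hinner P e G)"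
      proof (rule sum.cong[OF refl])
        fix e assume "e \<in> F n"
        then have "e \<in> B" using F by auto
        then show "(\<integral>s. cnj (hinner P e \<psi>) * (indicator {t..} s *\<^sub>R (of_real (gE (t - s) (eigenvalue e)) * hinner P e (h s))) \<partial>lborel) = cnj (hinner P e \<psi>) * hinner P e G"
          by (simp only: G(2) set_lebesgue_integral_def integral_mult_right_zero)
      qed
      finally show ?thesis .
    qed
    also have "\<dots> = cnj (\<Sum>e\<in>F n. hinner P e \<psi> * cnj (hinner P e G))" by (simp add: cnj_sum)
    also have "\<dots> = hinner P (?p n) G"
      using hinner_lincomb[OF _ _ G(1)] F(1) hinner_cnj[of "?p n" G] by simp
    finally show ?thesis .
  qed
  moreover have "(\<lambda>n. hinner P (?p n) G) \<longlonglongrightarrow> hinner P \<psi> G"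
  proof -
    have "(\<lambda>n. hinner P (hsub (?p n) \<psi>) G) \<longlonglongrightarrow> 0"
    proof (rule Lim_null_comparison)
      show "\<forall>\<^sub>F n in sequentially. norm (hinner P (hsub (?p n) \<psi>) G) \<le> hnorm P (hsub (?p n) \<psi>) * hnorm P G"
        using hinner_Cauchy_Schwarz[OF Hsp_hsub[OF p psi] G(1)] by simp
      show "(\<lambda>n. hnorm P (hsub (?p n) \<psi>) * hnorm P G) \<longlonglongrightarrow> 0" by (rule tendsto_mult_left_zero[OF F(2)])
    qed
    then have "(\<lambda>n. hinner P (?p n) G - hinner P \<psi> G) \<longlonglongrightarrow> 0"
      using hinner_sub_left[OF G(1) p psi] by simp
    then show ?thesis by (simp add: LIM_zero_iff)
  qed
  ultimately show "hinner P \<psi> G = (LINT s:{t..}|lborel. hinner P \<psi> (K (t - s) (h s)))"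
    using LIMSEQ_unique by fastforce
qed

end

text \<open>The retarded integral after the substitution r = t' - t. The translation moves the time
  dependence from the kernel into the data, so that difference quotients in t fall on the data
  alone.\<close>

definition ret_coeff :: "real \<Rightarrow> (real \<Rightarrow> complex) \<Rightarrow> complex" where
  "ret_coeff lam u = (LINT r:{0..}|lborel. of_real (gE (- r) lam) * u r)"

lemma ret_coeff_integrand_continuous:
  assumes "0 \<le> lam" "continuous_on UNIV u"
  shows "continuous_on S (\<lambda>r. of_real (gE (- r) lam) * u r :: complex)"
proof -
  have "continuous_on S (\<lambda>r. gE (- r) lam)"
    by (rule continuous_on_compose2[OF gE_continuous[OF assms(1), of UNIV]]) (auto intro!: continuous_intros)
  then show ?thesis by (intro continuous_intros continuous_on_subset[OF assms(2)]) auto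
qed

lemma ret_coeff_eq:
  assumes lam: "0 \<le> lam" and u: "continuous_on UNIV u" and z: "\<And>r. R < r \<Longrightarrow> u r = 0"
  shows "ret_coeff lam u = integral {0..R} (\<lambda>r. of_real (gE (- r) lam) * u r)"
proof -
  have "ret_coeff lam u = (LINT r:{0..R}|lborel. of_real (gE (- r) lam) * u r)"
    unfolding ret_coeff_def set_lebesgue_integral_def
    by (intro Bochner_Integration.integral_cong refl) (use z in \<open>force simp: indicator_def\<close>)
  also have "\<dots> = integral {0..R} (\<lambda>r. of_real (gE (- r) lam) * u r)"
    by (intro set_borel_integral_eq_integral(2) borel_integrable_atLeastAtMost' ret_coeff_integrand_continuous lam u)
  finally show ?thesis .
qed

lemma ret_coeff_translate:
  "(LINT s:{t..}|lborel. of_real (gE (t - s) lam) * u s) = ret_coeff lam (\<lambda>r. u (t + r))"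
  unfolding ret_coeff_def set_lebesgue_integral_def
  by (subst lborel_integral_real_affine[where c = 1 and t = t]) (auto simp: indicator_def intro!: Bochner_Integration.integral_cong)

lemma ret_coeff_diff:
  assumes lam: "0 \<le> lam" and u: "continuous_on UNIV u" "\<And>r. R < r \<Longrightarrow> u r = 0"
    and v: "continuous_on UNIV v" "\<And>r. R < r \<Longrightarrow> v r = 0"
  shows "ret_coeff lam (\<lambda>r. u r - v r) = ret_coeff lam u - ret_coeff lam v"
proof -
  have uv: "continuous_on UNIV (\<lambda>r. u r - v r)" using u v by (intro continuous_intros)
  have i: "(\<lambda>r. of_real (gE (- r) lam) * w r) integrable_on {0..R}" if "continuous_on UNIV w" for w :: "real \<Rightarrow> complex"
    by (intro integrable_continuous_real ret_coeff_integrand_continuous lam that)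
  have "ret_coeff lam (\<lambda>r. u r - v r) = integral {0..R} (\<lambda>r. of_real (gE (- r) lam) * (u r - v r))"
    by (rule ret_coeff_eq[OF lam uv]) (simp add: u(2) v(2))
  moreover have "ret_coeff lam u = integral {0..R} (\<lambda>r. of_real (gE (- r) lam) * u r)"
    by (rule ret_coeff_eq[OF lam u(1)]) (rule u(2))
  moreover have "ret_coeff lam v = integral {0..R} (\<lambda>r. of_real (gE (- r) lam) * v r)"
    by (rule ret_coeff_eq[OF lam v(1)]) (rule v(2))
  ultimately show ?thesis
    using Henstock_Kurzweil_Integration.integral_diff[OF i[OF u(1)] i[OF v(1)]]
    by (simp add: right_diff_distrib)
qed

lemma ret_coeff_mult: "ret_coeff lam (\<lambda>r. c * u r) = c * ret_coeff lam u"
  unfolding ret_coeff_def set_lebesgue_integral_def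
  by (subst integral_mult_right_zero[symmetric]) (auto intro!: Bochner_Integration.integral_cong)

text \<open>Integration by parts against the solution of y'' + lam y = 0 with y(0) = 0, y'(0) = 1.\<close>

lemma ret_coeff_second_derivative:
  assumes lam: "0 \<le> lam"
    and u: "\<And>r. (u has_vector_derivative u' r) (at r)" "\<And>r. (u' has_vector_derivative u'' r) (at r)"
    and c: "continuous_on UNIV u''"
    and z: "\<And>r. R < r \<Longrightarrow> u r = 0" "\<And>r. R < r \<Longrightarrow> u' r = 0" "\<And>r. R < r \<Longrightarrow> u'' r = 0" and R: "0 \<le> R"
  shows "ret_coeff lam u'' + of_real lam * ret_coeff lam u = u 0"
proof -
  have cu: "continuous_on UNIV u" using u(1) by (intro continuous_on_vector_derivative) auto
  define g where "g r = complex_of_real (gE (- r) lam)" for r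
  define k where "k r = complex_of_real (cos (sqrt lam * r))" for r
  have dg: "(g has_vector_derivative k r) (at r within S)" for r S
  proof -
    have "((\<lambda>r. - gE r lam) has_real_derivative - (- cos (sqrt lam * r))) (at r within S)"
      by (intro derivative_intros gE_deriv lam)
    then show ?thesis unfolding g_def[abs_def] k_def gE_minus by (intro of_real_has_vector_derivative) simp
  qed
  have dk: "(k has_vector_derivative - (of_real lam * g r)) (at r within S)" for r S
  proof -
    have "((\<lambda>r. - (- cos (sqrt lam * r))) has_real_derivative - (- lam * gE r lam)) (at r within S)"
      by (intro derivative_intros gE_deriv(2) lam)
    then show ?thesis unfolding g_def k_def[abs_def] gE_minus
      using of_real_has_vector_derivative[of "\<lambda>r. cos (sqrt lam * r)" "lam * gE r lam"] by simp
  qed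
  \<comment> \<open>The upper limit is \<open>R + 1\<close> because the data vanish only strictly
    beyond \<open>R\<close>, and the boundary term needs zero value and zero slope there.\<close>
  have "((\<lambda>r. g r * u'' r + of_real lam * (g r * u r)) has_integral
      (g (R+1) * u' (R+1) - k (R+1) * u (R+1)) - (g 0 * u' 0 - k 0 * u 0)) {0..R+1}"
  proof (rule fundamental_theorem_of_calculus)
    fix r assume "r \<in> {0..R+1}"
    have "((\<lambda>r. g r * u' r - k r * u r) has_vector_derivative (g r * u'' r + k r * u' r) - (k r * u' r + - (of_real lam * g r) * u r)) (at r within {0..R+1})"
      by (intro has_vector_derivative_diff has_vector_derivative_mult dg dk has_vector_derivative_at_within[OF u(1)] has_vector_derivative_at_within[OF u(2)])
    then show "((\<lambda>r. g r * u' r - k r * u r) has_vector_derivative (g r * u'' r + of_real lam * (g r * u r))) (at r within {0..R+1})"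
      by (simp add: algebra_simps)
  qed (use R in simp)
  moreover have "u (R+1) = 0" "u' (R+1) = 0" using z by auto
  moreover have "g 0 = 0" "k 0 = 1" by (simp_all add: g_def k_def gE_def)
  ultimately have "integral {0..R+1} (\<lambda>r. g r * u'' r + of_real lam * (g r * u r)) = u 0"
    by (intro integral_unique) simp
  moreover have "integral {0..R+1} (\<lambda>r. g r * u'' r + of_real lam * (g r * u r))
     = integral {0..R+1} (\<lambda>r. g r * u'' r) + of_real lam * integral {0..R+1} (\<lambda>r. g r * u r)"
    unfolding integral_mult_right[symmetric] g_def
    by (intro Henstock_Kurzweil_Integration.integral_add integrable_continuous_real ret_coeff_integrand_continuous continuous_on_mult continuous_on_const lam c cu)
  moreover have "ret_coeff lam u = integral {0..R+1} (\<lambda>r. g r * u r)" unfolding g_def by (rule ret_coeff_eq[OF lam cu]) (use z in auto)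
  moreover have "ret_coeff lam u'' = integral {0..R+1} (\<lambda>r. g r * u'' r)" unfolding g_def by (rule ret_coeff_eq[OF lam c]) (use z in auto)
  ultimately show ?thesis by simp
qed

context wave_bvp
begin

subsection \<open>Curves in the domain\<close>

lemma gnorm_hsub:
  assumes "domA P a" "domA P b"
  shows "gnorm P (hsub a b) = hnorm P (hsub a b) + hnorm P (hsub (Aop P a) (Aop P b))"
  unfolding gnorm_def using hnorm_cong[OF domA_Hsp(2)[OF domA_hsub(1)[OF assms]] _ domA_hsub(2)[OF assms]] domA_Hsp[OF assms(1)] domA_Hsp[OF assms(2)]
  by simp

lemma gnorm_sub_triangle:
  assumes "domA P a" "domA P b" "domA P c"
  shows "gnorm P (hsub a c) \<le> gnorm P (hsub a b) + gnorm P (hsub b c)"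
  using hnorm_sub_triangle[of a b c] hnorm_sub_triangle[of "Aop P a" "Aop P b" "Aop P c"] assms
  by (simp add: gnorm_hsub domA_Hsp)

lemma gnorm_sub_commute: "domA P a \<Longrightarrow> domA P b \<Longrightarrow> gnorm P (hsub a b) = gnorm P (hsub b a)"
  by (simp add: gnorm_hsub hnorm_sub_commute[of a] hnorm_sub_commute[of "Aop P a"])

lemma gnorm_hscale: "domA P a \<Longrightarrow> gnorm P (hscale c a) = cmod c * gnorm P a"
  unfolding gnorm_def
  using hnorm_cong[of "Aop P (hscale c a)" "hscale c (Aop P a)"] domA_hscale[of a c] domA_Hsp[of a] domA_Hsp[of "hscale c a"]
  by (simp add: hnorm_hscale algebra_simps)

lemma hnorm_hsub_le: "Hsp P a \<Longrightarrow> Hsp P b \<Longrightarrow> hnorm P (hsub a b) \<le> hnorm P a + hnorm P b"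
  using hnorm_triangle[of a "hscale (-1) b"] by (simp add: hsub_def hnorm_hscale)

lemma hsub_hadd: "a = hadd (hsub a b) b" "a = hsub a hzero"
  by (simp_all add: prod_eq_iff hzero_def)

lemma gnorm_hsub_le: "domA P a \<Longrightarrow> domA P b \<Longrightarrow> gnorm P (hsub a b) \<le> gnorm P a + gnorm P b"
  using hnorm_hsub_le[of a b] hnorm_hsub_le[of "Aop P a" "Aop P b"] domA_Hsp[of a] domA_Hsp[of b]
  by (simp add: gnorm_hsub gnorm_def[of P a] gnorm_def[of P b])

lemma gnorm_le_hsub: "domA P a \<Longrightarrow> domA P b \<Longrightarrow> gnorm P a \<le> gnorm P (hsub a b) + gnorm P b"
  using hnorm_triangle[of "hsub a b" b] hnorm_triangle[of "hsub (Aop P a) (Aop P b)" "Aop P b"] domA_Hsp[of a] domA_Hsp[of b]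
  by (simp add: gnorm_hsub gnorm_def[of P a] gnorm_def[of P b] flip: hsub_hadd(1))

lemma A1_le_gnorm: "domA P a \<Longrightarrow> hnorm P (A1 a) \<le> gnorm P a"
  unfolding A1_def gnorm_def using hnorm_triangle[of "Aop P a" a] domA_Hsp[of a] by simp

text \<open>Linear functionals bounded in the graph norm. Inner products, inner products composed
  with \<open>A\<close>, and evaluations of the function or its derivative at a point all qualify,
  so one argument transfers continuity and differentiability in D(A) to each of these
  scalars.\<close>

definition dfunctional :: "(hvec \<Rightarrow> complex) \<Rightarrow> bool" where
  "dfunctional l \<longleftrightarrow> (\<forall>a b. domA P a \<longrightarrow> domA P b \<longrightarrow> l (hsub a b) = l a - l b)
     \<and> (\<forall>a c. domA P a \<longrightarrow> l (hscale c a) = c * l a)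
     \<and> (\<exists>C. \<forall>a. domA P a \<longrightarrow> cmod (l a) \<le> C * gnorm P a)"

lemma dfunctional_hinner:
  assumes "Hsp P \<psi>" shows "dfunctional (\<lambda>a. hinner P \<psi> a)"
  unfolding dfunctional_def
proof (intro conjI allI impI exI[of _ "hnorm P \<psi>"])
  fix a assume "domA P a"
  then show "cmod (hinner P \<psi> a) \<le> hnorm P \<psi> * gnorm P a"
    by (intro order_trans[OF hinner_Cauchy_Schwarz[OF assms]] mult_left_mono gnorm_ge domA_Hsp hnorm_nonneg)
qed (use assms domA_Hsp in \<open>simp_all add: hinner_linear\<close>)

lemma dfunctional_hinner_A:
  assumes "Hsp P \<psi>" shows "dfunctional (\<lambda>a. hinner P \<psi> (Aop P a))"
  unfolding dfunctional_def
proof (intro conjI allI impI exI[of _ "hnorm P \<psi>"])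
  fix a assume a: "domA P a"
  then show "cmod (hinner P \<psi> (Aop P a)) \<le> hnorm P \<psi> * gnorm P a"
    by (intro order_trans[OF hinner_Cauchy_Schwarz[OF assms]] mult_left_mono gnorm_ge domA_Hsp hnorm_nonneg)
  show "hinner P \<psi> (Aop P (hscale c a)) = c * hinner P \<psi> (Aop P a)" for c
    using hinner_cong[OF assms _ _ domA_hscale(2)[OF a]] domA_Hsp[OF a] domA_Hsp[OF domA_hscale(1)[OF a]] by (simp add: hinner_linear)
  fix b assume b: "domA P b"
  show "hinner P \<psi> (Aop P (hsub a b)) = hinner P \<psi> (Aop P a) - hinner P \<psi> (Aop P b)"
    using hinner_cong[OF assms _ _ domA_hsub(2)[OF a b]] domA_Hsp[OF a] domA_Hsp[OF b] domA_Hsp[OF domA_hsub(1)[OF a b]] assms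
    by (simp add: hinner_linear)
qed

lemma dz_hsub_hscale:
  assumes "domA P a" "domA P b" "z \<in> {0..L}"
  shows "dz P (fst (hsub a b)) z = dz P (fst a) z - dz P (fst b) z" "dz P (fst (hscale c a)) z = c * dz P (fst a) z"
  using regular_lincomb(2)[of "fst a" "fst b" z 1 "-1"] regular_lincomb(2)[of "fst a" "fst a" z c 0] assms
  by (auto simp: domA_iff)

lemma dfunctional_eval:
  assumes z: "z \<in> {0..L}" shows "dfunctional (\<lambda>a. fst a z)" "dfunctional (\<lambda>a. dz P (fst a) z)"
proof -
  obtain C where "0 \<le> C" and C: "\<forall>\<phi> x. domA P \<phi> \<longrightarrow> x \<in> {0..L} \<longrightarrow> cmod (fst \<phi> x) \<le> C * gnorm P \<phi> \<and> cmod (dz P (fst \<phi>) x) \<le> C * gnorm P \<phi>"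
    by (rule uniform_bound_gnorm)
  have "\<exists>C. \<forall>a. domA P a \<longrightarrow> cmod (fst a z) \<le> C * gnorm P a" "\<exists>C. \<forall>a. domA P a \<longrightarrow> cmod (dz P (fst a) z) \<le> C * gnorm P a"
    using C z by blast+
  then show "dfunctional (\<lambda>a. fst a z)" "dfunctional (\<lambda>a. dz P (fst a) z)"
    unfolding dfunctional_def using dz_hsub_hscale[OF _ _ z] by (simp_all del: split_paired_All split_paired_Ex)
qed

lemma tendsto_dfunctional:
  assumes l: "dfunctional l" and d: "\<And>s. domA P (x s)" and 0: "((\<lambda>s. gnorm P (x s)) \<longlongrightarrow> 0) F"
  shows "((\<lambda>s. l (x s)) \<longlongrightarrow> 0) F"
proof -
  obtain C where C: "\<forall>a. domA P a \<longrightarrow> cmod (l a) \<le> C * gnorm P a" using l unfolding dfunctional_def by blast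
  show ?thesis
  proof (rule Lim_null_comparison)
    show "\<forall>\<^sub>F s in F. norm (l (x s)) \<le> C * gnorm P (x s)" using C d by (intro always_eventually) blast
    show "((\<lambda>s. C * gnorm P (x s)) \<longlongrightarrow> 0) F" by (rule tendsto_mult_right_zero[OF 0])
  qed
qed

lemma dfunctional_continuous:
  assumes l: "dfunctional l" and d: "\<And>t. domA P (h t)" and c: "\<And>t. cont_DA P h t"
  shows "continuous_on UNIV (\<lambda>t. l (h t))"
  unfolding continuous_on_eq_continuous_at[OF open_UNIV] isCont_def
proof
  fix t
  have "((\<lambda>s. l (hsub (h s) (h t))) \<longlongrightarrow> 0) (at t)"
    by (rule tendsto_dfunctional[OF l]) (use c[of t] d domA_hsub(1) in \<open>auto simp: cont_DA_def\<close>)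
  then have "((\<lambda>s. l (h s) - l (h t)) \<longlongrightarrow> 0) (at t)" using l d unfolding dfunctional_def by (simp del: split_paired_All)
  then show "((\<lambda>s. l (h s)) \<longlongrightarrow> l (h t)) (at t)" by (simp add: LIM_zero_iff)
qed

lemma dfunctional_deriv:
  assumes l: "dfunctional l" and d: "\<And>t. domA P (h t)" "domA P (h' t)" and c: "hderiv_DA P h h' t"
  shows "((\<lambda>t. l (h t)) has_vector_derivative l (h' t)) (at t)"
proof -
  have D: "domA P (hscale (complex_of_real (1 / k)) (hsub (h (t + k)) (h t)))" for k
    by (intro domA_hscale(1) domA_hsub(1) d)
  have "((\<lambda>k. l (hsub (hscale (complex_of_real (1 / k)) (hsub (h (t + k)) (h t))) (h' t))) \<longlongrightarrow> 0) (at 0)"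
    by (rule tendsto_dfunctional[OF l]) (use c d D domA_hsub(1) in \<open>auto simp: hderiv_DA_def\<close>)
  moreover have "l (hsub (hscale (complex_of_real (1 / k)) (hsub (h (t + k)) (h t))) (h' t)) = complex_of_real (1 / k) * (l (h (t + k)) - l (h t)) - l (h' t)" for k
    using l d D[of k] domA_hsub(1)[OF d(1) d(1)] unfolding dfunctional_def by (simp del: split_paired_All)
  ultimately have "((\<lambda>k. complex_of_real (1 / k) * (l (h (t + k)) - l (h t)) - l (h' t)) \<longlongrightarrow> 0) (at 0)" by simp
  then have "((\<lambda>k. (1 / k) *\<^sub>R (l (h (t + k)) - l (h t))) \<longlongrightarrow> l (h' t)) (at 0)" by (simp add: LIM_zero_iff scaleR_conv_of_real)
  then have lim: "((\<lambda>k. norm ((1 / k) *\<^sub>R (l (h (t + k)) - l (h t)) - l (h' t))) \<longlongrightarrow> 0) (at 0)"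
    by (intro tendsto_norm_zero) (simp add: LIM_zero_iff)
  have "((\<lambda>k. norm (l (h (t + k)) - l (h t) - k *\<^sub>R l (h' t)) / norm k) \<longlongrightarrow> 0) (at 0)"
  proof (rule Lim_transform_eventually[OF lim])
    show "\<forall>\<^sub>F k in at 0. norm ((1 / k) *\<^sub>R (l (h (t + k)) - l (h t)) - l (h' t)) = norm (l (h (t + k)) - l (h t) - k *\<^sub>R l (h' t)) / norm k"
      unfolding eventually_at
    proof (intro exI[of _ 1] conjI ballI impI)
      fix k :: real assume k: "k \<noteq> 0 \<and> dist k 0 < 1"
      then have "(1 / k) *\<^sub>R (l (h (t + k)) - l (h t)) - l (h' t) = (1 / k) *\<^sub>R (l (h (t + k)) - l (h t) - k *\<^sub>R l (h' t))"
        by (simp add: scaleR_diff_right)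
      then show "norm ((1 / k) *\<^sub>R (l (h (t + k)) - l (h t)) - l (h' t)) = norm (l (h (t + k)) - l (h t) - k *\<^sub>R l (h' t)) / norm k"
        by (simp add: divide_simps)
    qed simp
  qed
  then show ?thesis unfolding has_vector_derivative_def has_derivative_at by (simp add: bounded_linear_scaleR_left)
qed

lemma dfunctional_simps:
  assumes "dfunctional l"
  shows "domA P a \<Longrightarrow> domA P b \<Longrightarrow> l (hsub a b) = l a - l b" "domA P a \<Longrightarrow> l (hscale c a) = c * l a"
  using assms unfolding dfunctional_def by blast+

text \<open>The mean value theorem with equality is available for the real function
  \<open>Re (l (h t))\<close>; the factor \<open>k\<close> then cancels exactly.\<close>

lemma mean_value_functional:
  assumes l: "dfunctional l" and d: "\<And>t. domA P (h t)" "\<And>t. domA P (h' t)" and c: "\<And>t. hderiv_DA P h h' t"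
    and k: "k \<noteq> 0" and S: "\<And>q. \<bar>q\<bar> \<le> \<bar>k\<bar> \<Longrightarrow> Re (l (hsub (h' (s + q)) (h' s))) \<le> S"
  shows "Re (l (hsub (hscale (complex_of_real (1 / k)) (hsub (h (s + k)) (h s))) (h' s))) \<le> S"
proof -
  have D: "((\<lambda>t. Re (l (h t))) has_real_derivative Re (l (h' t))) (at t)" for t
    using dfunctional_deriv[OF l d c] by (simp add: has_vector_derivative_complex_iff)
  have "\<exists>q. \<bar>q\<bar> \<le> \<bar>k\<bar> \<and> Re (l (h (s + k))) - Re (l (h s)) = k * Re (l (h' (s + q)))"
  proof (cases "k > 0")
    case True
    then obtain z where "s < z" "z < s + k" "Re (l (h (s + k))) - Re (l (h s)) = (s + k - s) * Re (l (h' z))"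
      using MVT2[of s "s + k" "\<lambda>t. Re (l (h t))" "\<lambda>t. Re (l (h' t))"] D by auto
    then show ?thesis by (intro exI[of _ "z - s"]) auto
  next
    case False
    then have "s + k < s" using k by simp
    then obtain z where "s + k < z" "z < s" "Re (l (h s)) - Re (l (h (s + k))) = (s - (s + k)) * Re (l (h' z))"
      using MVT2[of "s + k" s "\<lambda>t. Re (l (h t))" "\<lambda>t. Re (l (h' t))"] D by auto
    then show ?thesis by (intro exI[of _ "z - s"]) auto
  qed
  then obtain q where q: "\<bar>q\<bar> \<le> \<bar>k\<bar>" "Re (l (h (s + k))) - Re (l (h s)) = k * Re (l (h' (s + q)))" by blast
  have "l (hsub (hscale (complex_of_real (1 / k)) (hsub (h (s + k)) (h s))) (h' s))
    = complex_of_real (1 / k) * (l (h (s + k)) - l (h s)) - l (h' s)"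
    using d by (simp only: dfunctional_simps[OF l] domA_hscale(1) domA_hsub(1))
  then have "Re (l (hsub (hscale (complex_of_real (1 / k)) (hsub (h (s + k)) (h s))) (h' s)))
    = (1 / k) * (Re (l (h (s + k))) - Re (l (h s))) - Re (l (h' s))"
    by simp
  also have "\<dots> = Re (l (h' (s + q))) - Re (l (h' s))" using q(2) k by simp
  also have "\<dots> = Re (l (hsub (h' (s + q)) (h' s)))" by (simp only: dfunctional_simps(1)[OF l d(2) d(2)] minus_complex.sel)
  also have "\<dots> \<le> S" by (rule S[OF q(1)])
  finally show ?thesis .
qed

text \<open>Let \<open>?y\<close> be the error of the difference quotient. Testing with the inner
  product against \<open>?y\<close>, and with that of \<open>A\<close> applied to both arguments,
  and cancelling one factor of the norm bounds \<open>?y\<close> and its image under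
  \<open>A\<close> by \<open>S\<close> each; hence the factor 2.\<close>

lemma mean_value_gnorm:
  assumes d: "\<And>t. domA P (h t)" "\<And>t. domA P (h' t)" and c: "\<And>t. hderiv_DA P h h' t"
    and k: "k \<noteq> 0" and S: "\<And>q. \<bar>q\<bar> \<le> \<bar>k\<bar> \<Longrightarrow> gnorm P (hsub (h' (s + q)) (h' s)) \<le> S"
  shows "gnorm P (hsub (hscale (complex_of_real (1 / k)) (hsub (h (s + k)) (h s))) (h' s)) \<le> 2 * S"
proof -
  let ?y = "hsub (hscale (complex_of_real (1 / k)) (hsub (h (s + k)) (h s))) (h' s)"
  have y: "domA P ?y" by (intro domA_hsub(1) domA_hscale(1) d)
  have sub: "domA P (hsub (h' (s + q)) (h' s))" for q by (intro domA_hsub(1) d)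
  have sq: "x \<le> S" if "0 \<le> x" "x * x \<le> x * S" "0 \<le> S" for x
    using mult_left_le_imp_le[OF that(2)] that by linarith
  have S0: "0 \<le> S" by (rule order_trans[OF gnorm_ge(3) S[of 0]]) simp
  have "hnorm P ?y \<le> S"
  proof (rule sq)
    have "Re (hinner P ?y ?y) \<le> hnorm P ?y * S"
    proof (rule mean_value_functional[OF dfunctional_hinner d c k])
      fix q assume q: "\<bar>q\<bar> \<le> \<bar>k\<bar>"
      have "Re (hinner P ?y (hsub (h' (s + q)) (h' s))) \<le> hnorm P ?y * hnorm P (hsub (h' (s + q)) (h' s))"
        by (rule order_trans[OF complex_Re_le_cmod hinner_Cauchy_Schwarz]) (use y sub domA_Hsp in auto)
      also have "\<dots> \<le> hnorm P ?y * S"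
        by (intro mult_left_mono order_trans[OF gnorm_ge(1) S[OF q]]) simp
      finally show "Re (hinner P ?y (hsub (h' (s + q)) (h' s))) \<le> hnorm P ?y * S" .
    qed (use y domA_Hsp in auto)
    then show "hnorm P ?y * hnorm P ?y \<le> hnorm P ?y * S" by (simp add: hinner_self_hnorm power2_eq_square)
  qed (use S0 in auto)
  moreover have "hnorm P (Aop P ?y) \<le> S"
  proof (rule sq)
    have "Re (hinner P (Aop P ?y) (Aop P ?y)) \<le> hnorm P (Aop P ?y) * S"
    proof (rule mean_value_functional[OF dfunctional_hinner_A d c k])
      fix q assume q: "\<bar>q\<bar> \<le> \<bar>k\<bar>"
      have "Re (hinner P (Aop P ?y) (Aop P (hsub (h' (s + q)) (h' s)))) \<le> hnorm P (Aop P ?y) * hnorm P (Aop P (hsub (h' (s + q)) (h' s)))"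
        by (rule order_trans[OF complex_Re_le_cmod hinner_Cauchy_Schwarz]) (use y sub domA_Hsp in auto)
      also have "\<dots> \<le> hnorm P (Aop P ?y) * S"
        by (intro mult_left_mono order_trans[OF gnorm_ge(2) S[OF q]]) simp
      finally show "Re (hinner P (Aop P ?y) (Aop P (hsub (h' (s + q)) (h' s)))) \<le> hnorm P (Aop P ?y) * S" .
    qed (use y domA_Hsp in auto)
    then show "hnorm P (Aop P ?y) * hnorm P (Aop P ?y) \<le> hnorm P (Aop P ?y) * S" by (simp add: hinner_self_hnorm power2_eq_square)
  qed (use S0 in auto)
  ultimately show ?thesis by (simp add: gnorm_def)
qed

text \<open>The class shared by f, f' and f''. The support condition is stated in the graph norm, so
  that it covers \<open>A h\<close> as well.\<close>

definition admissible :: "(real \<Rightarrow> hvec) \<Rightarrow> real \<Rightarrow> bool" where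
  "admissible h T \<longleftrightarrow> 0 \<le> T \<and> (\<forall>t. domA P (h t)) \<and> (\<forall>t. cont_DA P h t) \<and> (\<forall>t. T < \<bar>t\<bar> \<longrightarrow> gnorm P (h t) = 0)"

lemma gnorm_zero: "domA P a \<Longrightarrow> hnorm P a = 0 \<Longrightarrow> gnorm P a = 0"
  using domA_zero(2)[of a] by (simp add: gnorm_def)

lemma admissible_uniformly_continuous:
  assumes h: "admissible h T" and e: "0 < e"
  obtains d where "0 < d" "\<forall>s t. \<bar>s - t\<bar> < d \<longrightarrow> gnorm P (hsub (h s) (h t)) < e"
proof -
  have d: "domA P (h t)" for t using h by (simp add: admissible_def)
  have "\<exists>r>0. \<forall>s. \<bar>s - t\<bar> < r \<longrightarrow> gnorm P (hsub (h s) (h t)) < e / 2" for t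
  proof -
    have "\<forall>\<^sub>F s in at t. gnorm P (hsub (h s) (h t)) < e / 2"
      using h e unfolding admissible_def cont_DA_def by (intro order_tendstoD(2)[of _ 0]) auto
    then obtain r where r: "r > 0" "\<And>s. s \<noteq> t \<Longrightarrow> dist s t < r \<Longrightarrow> gnorm P (hsub (h s) (h t)) < e / 2"
      unfolding eventually_at by blast
    have "hsub (h t) (h t) = hscale 0 (h t)" by (simp add: prod_eq_iff)
    then have "gnorm P (hsub (h t) (h t)) = 0" using gnorm_hscale[OF d] by simp
    then show ?thesis using r e by (intro exI[of _ r]) (metis dist_real_def half_gt_zero)
  qed
  then obtain r where r: "\<And>t. r t > 0" "\<And>t s. \<bar>s - t\<bar> < r t \<Longrightarrow> gnorm P (hsub (h s) (h t)) < e / 2" by metis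
  \<comment> \<open>The interval has a margin of 1 on each side: if \<open>s\<close> lies outside it
    and \<open>\<bar>s - t\<bar> < 1\<close>, then both values vanish.\<close>
  obtain d0 where d0: "d0 > 0" "\<And>x. x \<in> {-T-1..T+1} \<Longrightarrow> \<exists>G\<in>((\<lambda>t. ball t (r t)) ` {-T-1..T+1}). ball x d0 \<subseteq> G"
  proof (rule Heine_Borel_lemma[of "{-T-1..T+1}" "(\<lambda>t. ball t (r t)) ` {-T-1..T+1}"])
    show "{-T-1..T+1} \<subseteq> \<Union> ((\<lambda>t. ball t (r t)) ` {-T-1..T+1})" using r(1) by force
  qed (use that in auto)
  show ?thesis
  proof (rule that[of "min d0 1"])
    show "\<forall>s t. \<bar>s - t\<bar> < min d0 1 \<longrightarrow> gnorm P (hsub (h s) (h t)) < e"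
    proof (intro allI impI)
      fix s t assume st: "\<bar>s - t\<bar> < min d0 1"
      show "gnorm P (hsub (h s) (h t)) < e"
      proof (cases "s \<in> {-T-1..T+1}")
        case True
        then obtain x where x: "ball s d0 \<subseteq> ball x (r x)" using d0(2) by blast
        have "s \<in> ball x (r x)" "t \<in> ball x (r x)" using x st d0(1) by (auto simp: dist_real_def subset_eq)
        then have "gnorm P (hsub (h s) (h x)) < e / 2" "gnorm P (hsub (h t) (h x)) < e / 2"
          using r(2) by (auto simp: dist_real_def abs_minus_commute)
        then show ?thesis
          using gnorm_sub_triangle[OF d[of s] d[of x] d[of t]] gnorm_sub_commute[OF d[of x] d[of t]] by linarith
      next
        case False
        then have "T < \<bar>s\<bar>" "T < \<bar>t\<bar>" using st by auto
        then have "gnorm P (h s) = 0" "gnorm P (h t) = 0" using h by (auto simp: admissible_def)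
        then show ?thesis using gnorm_hsub_le[OF d[of s] d[of t]] e by linarith
      qed
    qed
  qed (use d0 in simp)
qed

lemma admissible_bounded:
  assumes h: "admissible h T"
  obtains M where "0 \<le> M" "\<forall>t. gnorm P (h t) \<le> M"
proof -
  have d: "domA P (h t)" for t using h by (simp add: admissible_def)
  have "isCont (\<lambda>s. gnorm P (h s)) t" for t
  proof -
    have "((\<lambda>s. gnorm P (hsub (h s) (h t))) \<longlongrightarrow> 0) (at t)" using h by (simp add: admissible_def cont_DA_def)
    then have "((\<lambda>s. gnorm P (h s) - gnorm P (h t)) \<longlongrightarrow> 0) (at t)"
    proof (rule Lim_null_comparison[rotated])
      have "\<bar>gnorm P (h s) - gnorm P (h t)\<bar> \<le> gnorm P (hsub (h s) (h t))" for s
        using gnorm_le_hsub[OF d[of s] d[of t]] gnorm_le_hsub[OF d[of t] d[of s]] gnorm_sub_commute[OF d[of s] d[of t]] by linarith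
      then show "\<forall>\<^sub>F s in at t. norm (gnorm P (h s) - gnorm P (h t)) \<le> gnorm P (hsub (h s) (h t))" by simp
    qed
    then show ?thesis unfolding isCont_def by (simp add: LIM_zero_iff)
  qed
  then have "continuous_on {-T..T} (\<lambda>s. gnorm P (h s))" by (simp add: continuous_at_imp_continuous_on)
  then have "bounded ((\<lambda>s. gnorm P (h s)) ` {-T..T})" by (intro compact_imp_bounded compact_continuous_image) auto
  then obtain M where M: "\<forall>t\<in>{-T..T}. \<bar>gnorm P (h t)\<bar> \<le> M" unfolding bounded_iff by auto
  have "gnorm P (h t) \<le> max M 0" for t
  proof (cases "T < \<bar>t\<bar>")
    case True
    then show ?thesis using h by (simp add: admissible_def)
  next
    case False
    then have "t \<in> {-T..T}" by auto
    then have "\<bar>gnorm P (h t)\<bar> \<le> M" using M by blast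
    then show ?thesis by linarith
  qed
  then show ?thesis using that[of "max M 0"] by simp
qed

end

context eigenbasis
begin

text \<open>Duality in place of Minkowski's integral inequality. With \<open>X\<close> the sum in
  question, \<open>X\<close> is the integral over [0, R] of the inner products of
  \<open>?w r\<close> with \<open>A1 (x r)\<close>. The kernel bound gives
  \<open>hnorm P (?w r) \<le> R * sqrt X\<close>, so that
  \<open>X \<le> R * R * M * sqrt X\<close>.\<close>

lemma ret_coeff_sum_bound:
  assumes R: "0 \<le> R" and d: "\<And>r. domA P (x r)" and c: "\<And>e. e \<in> B \<Longrightarrow> continuous_on UNIV (\<lambda>r. hinner P e (x r))"
    and z: "\<And>r. R < r \<Longrightarrow> hnorm P (x r) = 0" and M: "\<And>r. hnorm P (A1 (x r)) \<le> M"
    and F: "finite F" "F \<subseteq> B"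
  shows "(\<Sum>e\<in>F. (cmod (of_real (1 + eigenvalue e) * ret_coeff (eigenvalue e) (\<lambda>r. hinner P e (x r))))\<^sup>2) \<le> (R * R * M)\<^sup>2"
proof -
  define C where "C e = complex_of_real (1 + eigenvalue e) * ret_coeff (eigenvalue e) (\<lambda>r. hinner P e (x r))" for e
  define X where "X = (\<Sum>e\<in>F. (cmod (C e))\<^sup>2)"
  have X0: "0 \<le> X" by (simp add: X_def sum_nonneg)
  have M0: "0 \<le> M" using M[of 0] hnorm_nonneg[of "A1 (x 0)"] by linarith
  let ?w = "\<lambda>r. lincomb F (\<lambda>e. of_real (gE (- r) (eigenvalue e)) * C e)"
  have wH: "Hsp P (?w r)" for r by (rule lincomb_Hsp[OF F(2)])
  have ip: "hinner P (?w r) (A1 (x r)) = (\<Sum>e\<in>F. cnj (C e) * of_real (1 + eigenvalue e) * (of_real (gE (- r) (eigenvalue e)) * hinner P e (x r)))" for r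
  proof -
    have "hinner P (?w r) (A1 (x r)) = cnj (\<Sum>e\<in>F. of_real (gE (- r) (eigenvalue e)) * C e * cnj (hinner P e (A1 (x r))))"
      using hinner_lincomb[OF F A1_Hsp[OF d]] hinner_cnj[of "?w r" "A1 (x r)"] by simp
    also have "\<dots> = (\<Sum>e\<in>F. cnj (C e) * of_real (1 + eigenvalue e) * (of_real (gE (- r) (eigenvalue e)) * hinner P e (x r)))"
      unfolding cnj_sum
    proof (rule sum.cong[OF refl])
      fix e assume "e \<in> F"
      then have "e \<in> B" using F by auto
      then show "cnj (of_real (gE (- r) (eigenvalue e)) * C e * cnj (hinner P e (A1 (x r)))) = cnj (C e) * of_real (1 + eigenvalue e) * (of_real (gE (- r) (eigenvalue e)) * hinner P e (x r))"
        unfolding coeff_A1[OF \<open>e \<in> B\<close> d] by (simp add: mult_ac)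
    qed
    finally show ?thesis .
  qed
  have ce: "continuous_on {0..R} (\<lambda>r. of_real (gE (- r) (eigenvalue e)) * hinner P e (x r) :: complex)" if "e \<in> F" for e
    by (rule ret_coeff_integrand_continuous[OF eigen_basis(5)[OF subsetD[OF F(2) that]] c[OF subsetD[OF F(2) that]]])
  have ci: "continuous_on {0..R} (\<lambda>r. hinner P (?w r) (A1 (x r)))"
    unfolding ip by (intro continuous_on_sum continuous_on_mult continuous_on_const ce)
  have "of_real X = (\<Sum>e\<in>F. cnj (C e) * C e)" unfolding X_def of_real_sum complex_norm_square by (simp add: mult.commute)
  also have "\<dots> = (\<Sum>e\<in>F. integral {0..R} (\<lambda>r. cnj (C e) * of_real (1 + eigenvalue e) * (of_real (gE (- r) (eigenvalue e)) * hinner P e (x r))))"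
  proof (rule sum.cong[OF refl])
    fix e assume "e \<in> F"
    then have e: "e \<in> B" using F by auto
    have "ret_coeff (eigenvalue e) (\<lambda>r. hinner P e (x r)) = integral {0..R} (\<lambda>r. of_real (gE (- r) (eigenvalue e)) * hinner P e (x r))"
    proof (rule ret_coeff_eq[OF eigen_basis(5)[OF e] c[OF e]])
      show "hinner P e (x r) = 0" if "R < r" for r
        using hinner_Cauchy_Schwarz[OF eigen_basis(2)[OF e] domA_Hsp(1)[OF d], of r] z[OF that] by simp
    qed
    then show "cnj (C e) * C e = integral {0..R} (\<lambda>r. cnj (C e) * of_real (1 + eigenvalue e) * (of_real (gE (- r) (eigenvalue e)) * hinner P e (x r)))"
      unfolding integral_mult_right by (simp add: C_def mult.assoc)
  qed
  also have "\<dots> = integral {0..R} (\<lambda>r. hinner P (?w r) (A1 (x r)))"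
    unfolding ip by (rule integral_sum[OF F(1), symmetric])
      (intro integrable_continuous_real continuous_on_mult continuous_on_const ce)
  finally have "X = cmod (integral {0..R} (\<lambda>r. hinner P (?w r) (A1 (x r))))" using X0 by (metis norm_of_real abs_of_nonneg)
  also have "\<dots> \<le> (R * sqrt X * M) * (R - 0)"
  proof (rule integral_bound[OF R ci])
    fix r assume r: "r \<in> {0..R}"
    have "(hnorm P (?w r))\<^sup>2 \<le> (R * sqrt X)\<^sup>2"
    proof -
      have "(hnorm P (?w r))\<^sup>2 = (\<Sum>e\<in>F. (cmod (of_real (gE (- r) (eigenvalue e)) * C e))\<^sup>2)" by (rule hnorm_lincomb[OF F])
      also have "\<dots> \<le> (\<Sum>e\<in>F. R\<^sup>2 * (cmod (C e))\<^sup>2)"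
      proof (rule sum_mono)
        fix e assume "e \<in> F"
        then have e: "e \<in> B" using F by auto
        have "\<bar>gE (- r) (eigenvalue e)\<bar> \<le> R" using gE_bound[OF eigen_basis(5)[OF e], of "- r"] r by simp
        then have "cmod (of_real (gE (- r) (eigenvalue e)) * C e) \<le> R * cmod (C e)" by (simp add: norm_mult mult_right_mono)
        then show "(cmod (of_real (gE (- r) (eigenvalue e)) * C e))\<^sup>2 \<le> R\<^sup>2 * (cmod (C e))\<^sup>2"
          using power_mono[of _ "R * cmod (C e)" 2] by (simp only: power_mult_distrib norm_ge_zero)
      qed
      also have "\<dots> = (R * sqrt X)\<^sup>2" using X0 by (simp add: X_def sum_distrib_left power_mult_distrib)
      finally show ?thesis .
    qed
    then have "hnorm P (?w r) \<le> R * sqrt X" by (rule power2_le_imp_le) (use R X0 in auto)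
    then show "cmod (hinner P (?w r) (A1 (x r))) \<le> R * sqrt X * M"
      by (intro order_trans[OF hinner_Cauchy_Schwarz[OF wH A1_Hsp[OF d]]] mult_mono M) (use R X0 in auto)
  qed
  finally have le: "X \<le> (R * R * M) * sqrt X" by (simp add: mult_ac)
  have "sqrt X \<le> R * R * M"
  proof (cases "X = 0")
    case False
    then have "sqrt X > 0" using X0 by simp
    moreover have "sqrt X * sqrt X \<le> (R * R * M) * sqrt X" using le X0 by simp
    ultimately show ?thesis by (rule mult_right_le_imp_le[rotated])
  qed (use R M0 in simp)
  then have "X \<le> (R * R * M)\<^sup>2" using power_mono[of "sqrt X" "R * R * M" 2] X0 by simp
  then show ?thesis by (simp add: X_def C_def)
qed

section \<open>The retarded solution built from its coefficients\<close>

definition Phi :: "(real \<Rightarrow> hvec) \<Rightarrow> real \<Rightarrow> hvec" where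
  "Phi h t = (SOME \<phi>. domA P \<phi> \<and> (\<forall>e\<in>B. hinner P e \<phi> = ret_coeff (eigenvalue e) (\<lambda>r. hinner P e (h (t + r)))))"

lemma admissible_coeff:
  assumes h: "admissible h T" and e: "e \<in> B"
  shows "continuous_on UNIV (\<lambda>r. hinner P e (h r))" "continuous_on UNIV (\<lambda>r. hinner P e (h (t + r)))"
    "T + \<bar>t\<bar> < r \<Longrightarrow> hnorm P (h (t + r)) = 0" "T + \<bar>t\<bar> < r \<Longrightarrow> hinner P e (h (t + r)) = 0"
proof -
  have d: "domA P (h t)" for t using h by (simp add: admissible_def)
  show c: "continuous_on UNIV (\<lambda>r. hinner P e (h r))"
    by (rule dfunctional_continuous[OF dfunctional_hinner[OF eigen_basis(2)[OF e]]]) (use h in \<open>auto simp: admissible_def\<close>)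
  show "continuous_on UNIV (\<lambda>r. hinner P e (h (t + r)))"
    by (rule continuous_on_compose2[OF c]) (auto intro!: continuous_intros)
  show z: "hnorm P (h (t + r)) = 0" if "T + \<bar>t\<bar> < r"
  proof -
    have "T < \<bar>t + r\<bar>" using that by linarith
    then have "gnorm P (h (t + r)) = 0" using h by (simp add: admissible_def)
    then show ?thesis using gnorm_ge(1)[of "h (t + r)"] hnorm_nonneg[of "h (t + r)"] by linarith
  qed
  show "hinner P e (h (t + r)) = 0" if "T + \<bar>t\<bar> < r"
    using hinner_Cauchy_Schwarz[OF eigen_basis(2)[OF e] domA_Hsp(1)[OF d], of "t + r"] z[OF that] by simp
qed

text \<open>The weighted coefficients are square summable by \<open>ret_coeff_sum_bound\<close>,
  with \<open>T + \<bar>t\<bar>\<close> bounding the support of the translated data, so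
  \<open>domA_synthesis\<close> provides the vector that the definition selects.\<close>

lemma Phi:
  assumes h: "admissible h T"
  shows "domA P (Phi h t)" "e \<in> B \<Longrightarrow> hinner P e (Phi h t) = ret_coeff (eigenvalue e) (\<lambda>r. hinner P e (h (t + r)))"
proof -
  have d: "domA P (h t)" for t using h by (simp add: admissible_def)
  obtain M where M: "0 \<le> M" "\<forall>t. gnorm P (h t) \<le> M" by (rule admissible_bounded[OF h])
  have "\<exists>\<phi>. domA P \<phi> \<and> (\<forall>e\<in>B. hinner P e \<phi> = ret_coeff (eigenvalue e) (\<lambda>r. hinner P e (h (t + r))))"
  proof (rule domA_synthesis)
    fix F assume F: "finite F" "F \<subseteq> B"
    show "(\<Sum>e\<in>F. (cmod (of_real (1 + eigenvalue e) * ret_coeff (eigenvalue e) (\<lambda>r. hinner P e (h (t + r)))))\<^sup>2) \<le> ((T + \<bar>t\<bar>) * (T + \<bar>t\<bar>) * M)\<^sup>2"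
    proof (rule ret_coeff_sum_bound[OF _ d _ _ _ F])
      show "0 \<le> T + \<bar>t\<bar>" using h by (simp add: admissible_def)
      show "hnorm P (A1 (h (t + r))) \<le> M" for r using A1_le_gnorm[OF d] M(2) order_trans by blast
      show "hnorm P (h (t + r)) = 0" if "T + \<bar>t\<bar> < r" for r
      proof -
        have "T < \<bar>t + r\<bar>" using that by linarith
        then have "gnorm P (h (t + r)) = 0" using h by (simp add: admissible_def)
        then show ?thesis using gnorm_ge(1)[of "h (t + r)"] hnorm_nonneg[of "h (t + r)"] by linarith
      qed
    qed (use admissible_coeff[OF h] in auto)
  qed blast+
  from someI_ex[OF this] show "domA P (Phi h t)" "e \<in> B \<Longrightarrow> hinner P e (Phi h t) = ret_coeff (eigenvalue e) (\<lambda>r. hinner P e (h (t + r)))"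
    unfolding Phi_def by auto
qed

lemma gnorm_le_ret_coeff:
  assumes R: "0 \<le> R" and p: "domA P \<phi>" and d: "\<And>r. domA P (x r)"
    and c: "\<And>e. e \<in> B \<Longrightarrow> continuous_on UNIV (\<lambda>r. hinner P e (x r))"
    and z: "\<And>r. R < r \<Longrightarrow> hnorm P (x r) = 0" and M: "\<And>r. gnorm P (x r) \<le> M"
    and eq: "\<And>e. e \<in> B \<Longrightarrow> hinner P e \<phi> = ret_coeff (eigenvalue e) (\<lambda>r. hinner P e (x r))"
  shows "gnorm P \<phi> \<le> 3 * (R * R * M)"
proof (rule gnorm_le_coeffs[OF p])
  have "0 \<le> M" using M[of 0] gnorm_ge(3)[of "x 0"] by linarith
  then show "0 \<le> R * R * M" using R by simp
  fix F assume F: "finite F" "F \<subseteq> B"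
  have "(\<Sum>e\<in>F. (cmod (of_real (1 + eigenvalue e) * hinner P e \<phi>))\<^sup>2)
     = (\<Sum>e\<in>F. (cmod (of_real (1 + eigenvalue e) * ret_coeff (eigenvalue e) (\<lambda>r. hinner P e (x r))))\<^sup>2)"
    by (intro sum.cong refl) (use eq F in \<open>auto simp: subset_eq\<close>)
  also have "\<dots> \<le> (R * R * M)\<^sup>2"
    by (rule ret_coeff_sum_bound[OF R d c z _ F]) (use A1_le_gnorm[OF d] M order_trans in blast)+
  finally show "(\<Sum>e\<in>F. (cmod (of_real (1 + eigenvalue e) * hinner P e \<phi>))\<^sup>2) \<le> (R * R * M)\<^sup>2" .
qed

text \<open>The error of the difference quotient of \<open>Phi h\<close> has the coefficients of the
  retarded integral of the corresponding error for \<open>h\<close>. The latter is uniformly small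
  by \<open>mean_value_gnorm\<close> and uniform continuity of \<open>h'\<close>, and
  \<open>gnorm_le_ret_coeff\<close> carries the bound over.\<close>

lemma Phi_hderiv:
  assumes h: "admissible h T" and h': "admissible h' T" and c: "\<And>t. hderiv_DA P h h' t"
  shows "hderiv_DA P (Phi h) (Phi h') t"
  unfolding hderiv_DA_def
proof (rule LIM_I)
  fix e :: real assume e: "0 < e"
  have T: "0 \<le> T" using h by (simp add: admissible_def)
  have d: "domA P (h t)" "domA P (h' t)" for t using h h' by (simp_all add: admissible_def)
  \<comment> \<open>Beyond \<open>R\<close> the translates by \<open>t\<close> and by
    \<open>t + k\<close> vanish simultaneously for all \<open>k\<close> of modulus below 1.\<close>
  define R where "R = T + \<bar>t\<bar> + 1"
  have R: "R > 0" using T by (simp add: R_def)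
  \<comment> \<open>Makes the final bound equal to \<open>e / 2\<close>.\<close>
  define eta where "eta = e / (12 * (R * R))"
  have eta: "eta > 0" "3 * (R * R * (2 * eta)) < e" using e R by (simp_all add: eta_def field_simps)
  obtain dl where dl: "0 < dl" "\<forall>s t. \<bar>s - t\<bar> < dl \<longrightarrow> gnorm P (hsub (h' s) (h' t)) < eta"
    by (rule admissible_uniformly_continuous[OF h' eta(1)])
  have "norm (gnorm P (hsub (hscale (complex_of_real (1 / k)) (hsub (Phi h (t + k)) (Phi h t))) (Phi h' t)) - 0) < e"
    if k: "k \<noteq> 0" "\<bar>k\<bar> < min dl 1" for k
  proof -
    let ?x = "\<lambda>r. hsub (hscale (complex_of_real (1 / k)) (hsub (h (t + r + k)) (h (t + r)))) (h' (t + r))"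
    let ?p = "hsub (hscale (complex_of_real (1 / k)) (hsub (Phi h (t + k)) (Phi h t))) (Phi h' t)"
    have xd: "domA P (?x r)" for r by (intro domA_hsub(1) domA_hscale(1) d)
    have pd: "domA P ?p" by (intro domA_hsub(1) domA_hscale(1) Phi(1)[OF h] Phi(1)[OF h'])
    have xb: "gnorm P (?x r) \<le> 2 * eta" for r
    proof (rule mean_value_gnorm[OF d c k(1)])
      fix q assume "\<bar>q\<bar> \<le> \<bar>k\<bar>"
      then show "gnorm P (hsub (h' (t + r + q)) (h' (t + r))) \<le> eta" using dl(2) k(2) by (simp add: less_imp_le)
    qed
    have lin: "hinner P e' (?x r) = complex_of_real (1 / k) * (hinner P e' (h (t + k + r)) - hinner P e' (h (t + r))) - hinner P e' (h' (t + r))"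
      if "e' \<in> B" for e' r
      using eigen_basis(2)[OF that] domA_Hsp(1)[OF d(1)] domA_Hsp(1)[OF d(2)] by (simp add: hinner_linear add_ac)
    have "gnorm P ?p \<le> 3 * (R * R * (2 * eta))"
    proof (rule gnorm_le_ret_coeff[OF less_imp_le[OF R] pd xd _ _ xb])
      fix e' assume e': "e' \<in> B"
      note c1 = admissible_coeff[OF h e'] and c2 = admissible_coeff[OF h' e']
      show "continuous_on UNIV (\<lambda>r. hinner P e' (?x r))"
        unfolding lin[OF e'] by (intro continuous_intros c1 c2)
      have s: "R < r \<Longrightarrow> hinner P e' (h (t + k + r)) = 0" "R < r \<Longrightarrow> hinner P e' (h (t + r)) = 0" "R < r \<Longrightarrow> hinner P e' (h' (t + r)) = 0" for r
        using c1(4)[of "t + k" r] c1(4)[of t r] c2(4)[of t r] k(2) by (auto simp: R_def)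
      have lam: "0 \<le> eigenvalue e'" by (rule eigen_basis(5)[OF e'])
      have "ret_coeff (eigenvalue e') (\<lambda>r. hinner P e' (?x r))
        = complex_of_real (1 / k) * (ret_coeff (eigenvalue e') (\<lambda>r. hinner P e' (h (t + k + r))) - ret_coeff (eigenvalue e') (\<lambda>r. hinner P e' (h (t + r))))
          - ret_coeff (eigenvalue e') (\<lambda>r. hinner P e' (h' (t + r)))"
      proof -
        have A: "ret_coeff (eigenvalue e') (\<lambda>r. hinner P e' (h (t + k + r)) - hinner P e' (h (t + r)))
          = ret_coeff (eigenvalue e') (\<lambda>r. hinner P e' (h (t + k + r))) - ret_coeff (eigenvalue e') (\<lambda>r. hinner P e' (h (t + r)))"
          by (rule ret_coeff_diff[OF lam c1(2) s(1) c1(2) s(2)])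
        have "ret_coeff (eigenvalue e') (\<lambda>r. complex_of_real (1 / k) * (hinner P e' (h (t + k + r)) - hinner P e' (h (t + r))) - hinner P e' (h' (t + r)))
          = ret_coeff (eigenvalue e') (\<lambda>r. complex_of_real (1 / k) * (hinner P e' (h (t + k + r)) - hinner P e' (h (t + r)))) - ret_coeff (eigenvalue e') (\<lambda>r. hinner P e' (h' (t + r)))"
        proof (rule ret_coeff_diff[OF lam _ _ c2(2) s(3)])
          show "continuous_on UNIV (\<lambda>r. complex_of_real (1 / k) * (hinner P e' (h (t + k + r)) - hinner P e' (h (t + r))))"
            by (intro continuous_intros c1)
        qed (use s in auto)
        then show ?thesis unfolding lin[OF e'] ret_coeff_mult A .
      qed
      then show "hinner P e' ?p = ret_coeff (eigenvalue e') (\<lambda>r. hinner P e' (?x r))"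
        using Phi[OF h] Phi[OF h'] eigen_basis(2)[OF e'] e' by (simp add: hinner_linear domA_Hsp)
    next
      fix r assume r: "R < r"
      have z: "gnorm P (h s) = 0" "gnorm P (h' s) = 0" if "T < \<bar>s\<bar>" for s using h h' that by (auto simp: admissible_def)
      have "gnorm P (h (t + r + k)) = 0" "gnorm P (h (t + r)) = 0" "gnorm P (h' (t + r)) = 0"
        using r k(2) by (auto intro!: z simp: R_def)
      then have "gnorm P (?x r) \<le> 0"
        using gnorm_hsub_le[OF domA_hscale(1)[OF domA_hsub(1)[OF d(1) d(1)]] d(2), of "complex_of_real (1 / k)" "t + r + k" "t + r" "t + r"]
          gnorm_hsub_le[OF d(1) d(1), of "t + r + k" "t + r"] gnorm_ge(3)[of "hsub (h (t + r + k)) (h (t + r))"]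
        by (simp add: gnorm_hscale[OF domA_hsub(1)[OF d(1) d(1)]])
      then show "hnorm P (?x r) = 0" using gnorm_ge(1)[of "?x r"] hnorm_nonneg[of "?x r"] by linarith
    qed
    then show ?thesis using eta(2) gnorm_ge(3)[of ?p] by simp
  qed
  then show "\<exists>s>0. \<forall>k. k \<noteq> 0 \<and> norm (k - 0) < s \<longrightarrow>
     norm (gnorm P (hsub (hscale (complex_of_real (1 / k)) (hsub (Phi h (t + k)) (Phi h t))) (Phi h' t)) - 0) < e"
    using dl(1) by (intro exI[of _ "min dl 1"]) auto
qed

lemma Phi_cont:
  assumes h: "admissible h T"
  shows "cont_DA P (Phi h) t"
  unfolding cont_DA_def
proof (rule LIM_I)
  fix e :: real assume e: "0 < e"
  have T: "0 \<le> T" using h by (simp add: admissible_def)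
  have d: "domA P (h t)" for t using h by (simp add: admissible_def)
  define R where "R = T + \<bar>t\<bar> + 1"
  have R: "R > 0" using T by (simp add: R_def)
  define eta where "eta = e / (6 * (R * R))"
  have eta: "eta > 0" "3 * (R * R * eta) < e" using e R by (simp_all add: eta_def field_simps)
  obtain dl where dl: "0 < dl" "\<forall>s t. \<bar>s - t\<bar> < dl \<longrightarrow> gnorm P (hsub (h s) (h t)) < eta"
    by (rule admissible_uniformly_continuous[OF h eta(1)])
  have "norm (gnorm P (hsub (Phi h s) (Phi h t)) - 0) < e" if k: "\<bar>s - t\<bar> < min dl 1" for s
  proof -
    let ?x = "\<lambda>r. hsub (h (s + r)) (h (t + r))"
    let ?p = "hsub (Phi h s) (Phi h t)"
    have xd: "domA P (?x r)" for r by (intro domA_hsub(1) d)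
    have pd: "domA P ?p" by (intro domA_hsub(1) Phi(1)[OF h])
    have xb: "gnorm P (?x r) \<le> eta" for r using dl(2) k by (simp add: less_imp_le)
    have lin: "hinner P e' (?x r) = hinner P e' (h (s + r)) - hinner P e' (h (t + r))" if "e' \<in> B" for e' r
      using eigen_basis(2)[OF that] domA_Hsp(1)[OF d] by (simp add: hinner_linear)
    have "gnorm P ?p \<le> 3 * (R * R * eta)"
    proof (rule gnorm_le_ret_coeff[OF less_imp_le[OF R] pd xd _ _ xb])
      fix e' assume e': "e' \<in> B"
      note c1 = admissible_coeff[OF h e']
      show "continuous_on UNIV (\<lambda>r. hinner P e' (?x r))"
        unfolding lin[OF e'] by (intro continuous_intros c1)
      have z: "R < r \<Longrightarrow> hinner P e' (h (s + r)) = 0" "R < r \<Longrightarrow> hinner P e' (h (t + r)) = 0" for r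
        using c1(4)[of s r] c1(4)[of t r] k by (auto simp: R_def)
      have "ret_coeff (eigenvalue e') (\<lambda>r. hinner P e' (?x r))
        = ret_coeff (eigenvalue e') (\<lambda>r. hinner P e' (h (s + r))) - ret_coeff (eigenvalue e') (\<lambda>r. hinner P e' (h (t + r)))"
        unfolding lin[OF e'] by (rule ret_coeff_diff[OF eigen_basis(5)[OF e'] c1(2) z(1) c1(2) z(2)])
      then show "hinner P e' ?p = ret_coeff (eigenvalue e') (\<lambda>r. hinner P e' (?x r))"
        using Phi[OF h] eigen_basis(2)[OF e'] e' by (simp add: hinner_linear domA_Hsp)
    next
      fix r assume r: "R < r"
      have z: "gnorm P (h s) = 0" if "T < \<bar>s\<bar>" for s using h that by (auto simp: admissible_def)
      have "gnorm P (h (s + r)) = 0" "gnorm P (h (t + r)) = 0"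
        using r k by (auto intro!: z simp: R_def)
      then have "gnorm P (?x r) \<le> 0" using gnorm_hsub_le[OF d d, of "s + r" "t + r"] by simp
      then show "hnorm P (?x r) = 0" using gnorm_ge(1)[of "?x r"] hnorm_nonneg[of "?x r"] by linarith
    qed
    then show ?thesis using eta(2) gnorm_ge(3)[of ?p] by simp
  qed
  then show "\<exists>d>0. \<forall>s. s \<noteq> t \<and> norm (s - t) < d \<longrightarrow> norm (gnorm P (hsub (Phi h s) (Phi h t)) - 0) < e"
    using dl(1) by (intro exI[of _ "min dl 1"]) auto
qed

end

context wave_bvp
begin

section \<open>Continuity and supports of derivatives in D(A)\<close>

lemma hderiv_imp_cont:
  assumes d: "\<And>t. domA P (h t)" "\<And>t. domA P (h' t)" and c: "hderiv_DA P h h' t"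
  shows "cont_DA P h t"
proof -
  let ?q = "\<lambda>k. gnorm P (hsub (hscale (complex_of_real (1 / k)) (hsub (h (t + k)) (h t))) (h' t))"
  have q: "(?q \<longlongrightarrow> 0) (at 0)" using c by (simp add: hderiv_DA_def)
  have le: "gnorm P (hsub (h (t + k)) (h t)) \<le> \<bar>k\<bar> * (?q k + gnorm P (h' t))" if "k \<noteq> 0" for k
  proof -
    let ?d = "hsub (h (t + k)) (h t)" let ?s = "hscale (complex_of_real (1 / k)) ?d"
    have D: "domA P ?d" "domA P ?s" by (intro domA_hsub(1) domA_hscale(1) d)+
    have "gnorm P ?d = \<bar>k\<bar> * gnorm P ?s" using that unfolding gnorm_hscale[OF D(1)] by (simp add: norm_divide)
    also have "\<dots> \<le> \<bar>k\<bar> * (?q k + gnorm P (h' t))" by (intro mult_left_mono gnorm_le_hsub D d) simp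
    finally show ?thesis .
  qed
  have "((\<lambda>k. \<bar>k\<bar> * (?q k + gnorm P (h' t))) \<longlongrightarrow> \<bar>0\<bar> * (0 + gnorm P (h' t))) (at 0)"
    by (intro tendsto_intros q)
  then have b: "((\<lambda>k. \<bar>k\<bar> * (?q k + gnorm P (h' t))) \<longlongrightarrow> 0) (at 0)" by simp
  have "\<forall>\<^sub>F k in at 0. norm (gnorm P (hsub (h (t + k)) (h t))) \<le> \<bar>k\<bar> * (?q k + gnorm P (h' t))"
    unfolding eventually_at
  proof (intro exI[of _ 1] conjI ballI impI)
    fix k :: real assume "k \<noteq> 0 \<and> dist k 0 < 1"
    then show "norm (gnorm P (hsub (h (t + k)) (h t))) \<le> \<bar>k\<bar> * (?q k + gnorm P (h' t))"
      using le[of k] by (simp add: gnorm_ge(3))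
  qed simp
  then have "((\<lambda>k. gnorm P (hsub (h (t + k)) (h t))) \<longlongrightarrow> 0) (at 0)"
    by (rule Lim_null_comparison[OF _ b])
  then show ?thesis unfolding cont_DA_def by (rule LIM_offset_zero_cancel)
qed

text \<open>The condition \<open>T < \<bar>t\<bar>\<close> is open, so the difference quotients at
  \<open>t\<close> vanish for small \<open>k\<close>, and the derivative is their limit.\<close>

lemma hderiv_zero_outside:
  assumes d: "\<And>t. domA P (h t)" "\<And>t. domA P (h' t)" and c: "hderiv_DA P h h' t"
    and z: "\<And>t. T < \<bar>t\<bar> \<Longrightarrow> gnorm P (h t) = 0" and t: "T < \<bar>t\<bar>"
  shows "gnorm P (h' t) = 0"
proof -
  let ?q = "\<lambda>k. gnorm P (hsub (hscale (complex_of_real (1 / k)) (hsub (h (t + k)) (h t))) (h' t))"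
  have "gnorm P (h' t) \<le> ?q k" if "\<bar>k\<bar> < \<bar>t\<bar> - T" for k
  proof -
    let ?d = "hsub (h (t + k)) (h t)" let ?s = "hscale (complex_of_real (1 / k)) ?d"
    have D: "domA P ?d" "domA P ?s" by (intro domA_hsub(1) domA_hscale(1) d)+
    have "T < \<bar>t + k\<bar>" using that by linarith
    then have "gnorm P ?d \<le> 0" using gnorm_hsub_le[OF d(1) d(1), of "t + k" t] z t by simp
    then have "gnorm P ?d = 0" using gnorm_ge(3)[of ?d] by linarith
    then have "gnorm P ?s = 0" unfolding gnorm_hscale[OF D(1)] by simp
    then show ?thesis using gnorm_le_hsub[OF d(2) D(2), of t] gnorm_sub_commute[OF d(2) D(2), of t] by linarith
  qed
  then have "\<forall>\<^sub>F k in at 0. gnorm P (h' t) \<le> ?q k"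
    unfolding eventually_at using t by (intro exI[of _ "\<bar>t\<bar> - T"]) auto
  then have "gnorm P (h' t) \<le> 0"
    using c unfolding hderiv_DA_def by (intro tendsto_lowerbound[where F = "at (0::real)"]) auto
  then show ?thesis using gnorm_ge(3)[of "h' t"] by linarith
qed

text \<open>The support of \<open>f\<close> is given in the norm of \<open>H\<close> only. On D(A)
  \<open>gnorm_zero\<close> raises this to the graph norm, in which the derivatives inherit
  it.\<close>

lemma C2_0_admissible:
  assumes f: "C2_0_DA P f f' f''"
  obtains T where "admissible f T" "admissible f' T" "admissible f'' T"
proof -
  have d: "domA P (f t)" "domA P (f' t)" "domA P (f'' t)" and c: "hderiv_DA P f f' t" "hderiv_DA P f' f'' t"
    and k: "cont_DA P f' t" "cont_DA P f'' t" for t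
    using f unfolding C2_0_DA_def C2_DA_def C1_DA_def by blast+
  obtain T0 where T0: "\<forall>t. T0 < \<bar>t\<bar> \<longrightarrow> hnorm P (f t) = 0" using f unfolding C2_0_DA_def by blast
  define T where "T = max T0 0"
  have z: "gnorm P (f t) = 0" if "T < \<bar>t\<bar>" for t using T0 that by (intro gnorm_zero d) (simp add: T_def)
  have z': "gnorm P (f' t) = 0" if "T < \<bar>t\<bar>" for t
    by (rule hderiv_zero_outside[OF d(1,2) c(1) z that])
  have z'': "gnorm P (f'' t) = 0" if "T < \<bar>t\<bar>" for t
    by (rule hderiv_zero_outside[OF d(2,3) c(2) z' that])
  have "cont_DA P f t" for t by (rule hderiv_imp_cont[OF d(1,2) c(1)])
  then show ?thesis using d k z z' z'' by (intro that[of T]) (auto simp: admissible_def T_def)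
qed

end

context eigenbasis
begin

text \<open>The scalar identity behind both halves of the Green property: it gives the equation for
  \<open>Phi f\<close> in \<open>Phi_solves\<close>, and the recovery of \<open>f\<close> from
  \<open>QA P f f''\<close> in \<open>Eret_QA\<close>.\<close>

lemma coeff_identity:
  assumes f: "C2_0_DA P f f' f''" and T: "admissible f T" "admissible f' T" "admissible f'' T" and e: "e \<in> B"
  shows "ret_coeff (eigenvalue e) (\<lambda>r. hinner P e (f'' (t + r)))
    + of_real (eigenvalue e) * ret_coeff (eigenvalue e) (\<lambda>r. hinner P e (f (t + r))) = hinner P e (f t)"
proof -
  have d: "domA P (f t)" "domA P (f' t)" "domA P (f'' t)" and c: "hderiv_DA P f f' t" "hderiv_DA P f' f'' t" for t
    using f unfolding C2_0_DA_def C2_DA_def C1_DA_def by blast+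
  note l = dfunctional_hinner[OF eigen_basis(2)[OF e]]
  have sh: "((\<lambda>r. h (t + r)) has_vector_derivative h' (t + r)) (at r)"
    if "(h has_vector_derivative h' (t + r)) (at (t + r))" for h h' :: "real \<Rightarrow> complex" and r
  proof -
    have "((\<lambda>r. t + r) has_vector_derivative 1) (at r)" by (auto intro!: derivative_eq_intros)
    from vector_diff_chain_at[OF this that] show ?thesis by (simp add: o_def)
  qed
  have "ret_coeff (eigenvalue e) (\<lambda>r. hinner P e (f'' (t + r)))
    + of_real (eigenvalue e) * ret_coeff (eigenvalue e) (\<lambda>r. hinner P e (f (t + r))) = hinner P e (f (t + 0))"
  proof (rule ret_coeff_second_derivative[OF eigen_basis(5)[OF e]])
    show "((\<lambda>r. hinner P e (f (t + r))) has_vector_derivative hinner P e (f' (t + r))) (at r)" for r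
      by (rule sh) (rule dfunctional_deriv[OF l d(1,2) c(1)])
    show "((\<lambda>r. hinner P e (f' (t + r))) has_vector_derivative hinner P e (f'' (t + r))) (at r)" for r
      by (rule sh) (rule dfunctional_deriv[OF l d(2,3) c(2)])
    show "continuous_on UNIV (\<lambda>r. hinner P e (f'' (t + r)))" by (rule admissible_coeff(2)[OF T(3) e])
    show "0 \<le> T + \<bar>t\<bar>" using T(1) by (simp add: admissible_def)
  qed (rule admissible_coeff(4)[OF _ e], use T in auto)+
  then show ?thesis by simp
qed

lemma Phi_solves:
  assumes f: "C2_0_DA P f f' f''" and T: "admissible f T" "admissible f' T" "admissible f'' T"
  shows "C2_DA P (Phi f) (Phi f') (Phi f'')" "heq P (QA P (Phi f) (Phi f'') t) (f t)"
proof -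
  have d: "domA P (f t)" and c: "hderiv_DA P f f' t" "hderiv_DA P f' f'' t" for t
    using f unfolding C2_0_DA_def C2_DA_def C1_DA_def by blast+
  show "C2_DA P (Phi f) (Phi f') (Phi f'')"
    unfolding C2_DA_def C1_DA_def
    using Phi(1)[OF T(1)] Phi(1)[OF T(2)] Phi(1)[OF T(3)]
      Phi_hderiv[OF T(1,2) c(1)] Phi_hderiv[OF T(2,3) c(2)]
      Phi_cont[OF T(2)] Phi_cont[OF T(3)] by blast
  show "heq P (QA P (Phi f) (Phi f'') t) (f t)"
  proof (rule coeff_ext)
    note D = Phi(1)[OF T(1), of t] Phi(1)[OF T(3), of t]
    note H = domA_Hsp[OF D(1)] domA_Hsp[OF D(2)]
    show "Hsp P (QA P (Phi f) (Phi f'') t)" using H by (simp add: QA_def)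
    show "Hsp P (f t)" by (rule domA_Hsp[OF d])
    fix e assume e: "e \<in> B"
    have "hinner P e (QA P (Phi f) (Phi f'') t) = hinner P e (Phi f'' t) + of_real (eigenvalue e) * hinner P e (Phi f t)"
      using H eigen_basis(2)[OF e] by (simp add: QA_def hinner_add_right coeff_Aop[OF e D(1)])
    also have "\<dots> = hinner P e (f t)"
      unfolding Phi(2)[OF T(1) e] Phi(2)[OF T(3) e] by (rule coeff_identity[OF f T e])
    finally show "hinner P e (QA P (Phi f) (Phi f'') t) = hinner P e (f t)" .
  qed
qed

lemma Phi_zero_future:
  assumes T: "admissible f T" and t: "T < t"
  shows "hnorm P (Phi f t) = 0"
proof -
  have T0: "0 \<le> T" using T by (simp add: admissible_def)
  have dphi: "domA P (Phi f t)" by (rule Phi(1)[OF T])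
  have "heq P (Phi f t) hzero"
  proof (rule coeff_ext[OF domA_Hsp(1)[OF dphi] Hsp_hzero])
    fix e assume e: "e \<in> B"
    have "hinner P e (f s) = 0" if "T < \<bar>s\<bar>" for s
    proof -
      have "hnorm P (f s) = 0"
        using T that gnorm_ge(1)[of "f s"] hnorm_nonneg[of "f s"] unfolding admissible_def by (metis order_antisym)
      then show ?thesis
        using T hinner_Cauchy_Schwarz[OF eigen_basis(2)[OF e] domA_Hsp(1), of "f s"] by (simp add: admissible_def)
    qed
    then have "ret_coeff (eigenvalue e) (\<lambda>r. hinner P e (f (t + r))) = 0"
      unfolding ret_coeff_def set_lebesgue_integral_def using t T0
      by (intro integral_eq_zero_AE) (auto simp: indicator_def)
    then show "hinner P e (Phi f t) = hinner P e hzero" using Phi(2)[OF T e] by simp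
  qed
  then show ?thesis using hnorm_cong[OF domA_Hsp(1)[OF dphi] Hsp_hzero] by simp
qed

lemma Eret_Phi:
  assumes K: "\<forall>s. spec_fun P (gE s) (K s)" and T: "admissible f T"
  shows "Eret P K f (Phi f)"
  unfolding Eret_def
proof
  fix t
  have d: "domA P (f t)" for t using T by (simp add: admissible_def)
  obtain M where M: "0 \<le> M" "\<forall>t. gnorm P (f t) \<le> M" by (rule admissible_bounded[OF T])
  show "hint_on P {t..} (\<lambda>t'. K (t - t') (f t')) (Phi f t)"
  proof (rule propagator_integral[OF K domA_Hsp(1)[OF d]])
    show "hnorm P (f s) \<le> M" for s using gnorm_ge(1) M(2) order_trans by blast
    show "hnorm P (f s) = 0" if "T < \<bar>s\<bar>" for s
      using T that gnorm_ge(1)[of "f s"] hnorm_nonneg[of "f s"] unfolding admissible_def by (metis order_antisym)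
    show "0 \<le> T" using T by (simp add: admissible_def)
    show "Hsp P (Phi f t)" by (rule domA_Hsp[OF Phi(1)[OF T]])
    show "hinner P e (Phi f t) = (LINT s:{t..}|lborel. of_real (gE (t - s) (eigenvalue e)) * hinner P e (f s))" if "e \<in> B" for e
      unfolding ret_coeff_translate by (rule Phi(2)[OF T that])
  qed (rule admissible_coeff(1)[OF T])
qed

lemma Eret_QA:
  assumes K: "\<forall>s. spec_fun P (gE s) (K s)"
    and f: "C2_0_DA P f f' f''" and T: "admissible f T" "admissible f' T" "admissible f'' T"
  shows "Eret P K (QA P f f'') f"
  unfolding Eret_def
proof
  fix t
  have d: "domA P (f t)" "domA P (f'' t)" for t using T by (simp_all add: admissible_def)
  have H: "Hsp P (f t)" "Hsp P (Aop P (f t))" "Hsp P (f'' t)" for t using domA_Hsp[OF d(1)] domA_Hsp[OF d(2)] by auto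
  have le: "hnorm P (QA P f f'' s) \<le> gnorm P (f'' s) + gnorm P (f s)" for s
    unfolding QA_def by (intro order_trans[OF hnorm_triangle[OF H(3) H(2)]] add_mono gnorm_ge)
  have ip: "hinner P e (QA P f f'' s) = hinner P e (f'' s) - (- of_real (eigenvalue e)) * hinner P e (f s)" if "e \<in> B" for e s
    using H eigen_basis(2)[OF that] by (simp add: QA_def hinner_add_right coeff_Aop[OF that d(1)])
  obtain M where M: "0 \<le> M" "\<forall>t. gnorm P (f t) \<le> M" by (rule admissible_bounded[OF T(1)])
  obtain M'' where M'': "0 \<le> M''" "\<forall>t. gnorm P (f'' t) \<le> M''" by (rule admissible_bounded[OF T(3)])
  show "hint_on P {t..} (\<lambda>t'. K (t - t') (QA P f f'' t')) (f t)"
  proof (rule propagator_integral[OF K])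
    show "Hsp P (QA P f f'' s)" for s using H by (simp add: QA_def)
    show "hnorm P (QA P f f'' s) \<le> M'' + M" for s using le[of s] M(2) M''(2) by (meson add_mono order_trans)
    show "hnorm P (QA P f f'' s) = 0" if "T < \<bar>s\<bar>" for s
    proof -
      have "gnorm P (f'' s) = 0" "gnorm P (f s) = 0" using T that unfolding admissible_def by blast+
      then show ?thesis using le[of s] hnorm_nonneg[of "QA P f f'' s"] by linarith
    qed
    show "0 \<le> T" using T by (simp add: admissible_def)
    show "Hsp P (f t)" by (rule H)
  next
    fix e assume e: "e \<in> B"
    note c = admissible_coeff[OF T(1) e] and c'' = admissible_coeff[OF T(3) e]
    show "continuous_on UNIV (\<lambda>s. hinner P e (QA P f f'' s))"
      unfolding ip[OF e] by (intro continuous_intros c c'')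
    have "ret_coeff (eigenvalue e) (\<lambda>r. hinner P e (QA P f f'' (t + r)))
      = ret_coeff (eigenvalue e) (\<lambda>r. hinner P e (f'' (t + r))) - ret_coeff (eigenvalue e) (\<lambda>r. (- of_real (eigenvalue e)) * hinner P e (f (t + r)))"
      unfolding ip[OF e]
    proof (rule ret_coeff_diff[OF eigen_basis(5)[OF e] c''(2) c''(4)])
      show "continuous_on UNIV (\<lambda>r. - of_real (eigenvalue e) * hinner P e (f (t + r)))" by (intro continuous_intros c)
      show "- of_real (eigenvalue e) * hinner P e (f (t + r)) = 0" if "T + \<bar>t\<bar> < r" for r
        using c(4)[OF that] by simp
    qed
    also have "\<dots> = hinner P e (f t)" unfolding ret_coeff_mult using coeff_identity[OF f T e, of t] by simp
    finally show "hinner P e (f t) = (LINT s:{t..}|lborel. of_real (gE (t - s) (eigenvalue e)) * hinner P e (QA P f f'' s))"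
      unfolding ret_coeff_translate by simp
  qed
qed

end

section \<open>Finite propagation speed\<close>

lemma max0_square_deriv: "((\<lambda>x::real. (max 0 x)\<^sup>2) has_real_derivative 2 * max 0 x) (at x)"
proof -
  consider "x < 0" | "x = 0" | "x > 0" by linarith
  then show ?thesis
  proof cases
    case 1
    have "((\<lambda>x. 0) has_real_derivative 2 * max 0 x) (at x)" using 1 by simp
    then show ?thesis by (rule has_field_derivative_transform_within_open[of _ _ _ "{..<0}"]) (use 1 in auto)
  next
    case 3
    have "((\<lambda>x. x\<^sup>2) has_real_derivative 2 * max 0 x) (at x)" using 3 by (auto intro!: derivative_eq_intros)
    then show ?thesis by (rule has_field_derivative_transform_within_open[of _ _ _ "{0<..}"]) (use 3 in auto)
  next
    case 2
    have le: "norm ((max 0 h)\<^sup>2 / h) \<le> \<bar>h\<bar>" for h :: real by (cases "h > 0") (auto simp: power2_eq_square max_def)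
    have "((\<lambda>h::real. \<bar>h\<bar>) \<longlongrightarrow> 0) (at 0)" using tendsto_rabs_zero[OF tendsto_ident_at] by simp
    then have "((\<lambda>h::real. (max 0 h)\<^sup>2 / h) \<longlongrightarrow> 0) (at 0)"
      by (rule Lim_null_comparison[rotated]) (simp only: le eventually_True)
    then show ?thesis unfolding DERIV_def 2 by simp
  qed
qed

lemma inner_has_real_derivative:
  fixes x y :: "real \<Rightarrow> complex"
  assumes "(x has_vector_derivative x') (at t)" "(y has_vector_derivative y') (at t)"
  shows "((\<lambda>t. x t \<bullet> y t) has_real_derivative x t \<bullet> y' + x' \<bullet> y t) (at t)"
  using bounded_bilinear.has_vector_derivative[OF bounded_bilinear_inner assms]
  by (simp add: has_real_derivative_iff_has_vector_derivative)

context wave_bvp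
begin

text \<open>The real part of \<open>bdry_form\<close>. Written with the real inner product on the
  complex numbers, it is accessible to the product rule in time.\<close>

definition rbdry :: "complex \<Rightarrow> complex \<Rightarrow> complex \<Rightarrow> complex \<Rightarrow> real" where
  "rbdry a b a' b' = (- (b1 P * b1' P) * (a \<bullet> a') + b1 P * b2' P * (a \<bullet> b' + b \<bullet> a') - b2 P * b2' P * (b \<bullet> b')) / rho P"

lemma Re_bdry_form: "Re (bdry_form a b a' b') = rbdry a b a' b'"
  by (simp add: bdry_form_def rbdry_def inner_complex_def Re_divide_of_real) (simp add: algebra_simps)

text \<open>With \<open>a\<close>, \<open>b\<close> the value and slope at \<ell> and
  \<open>p\<close>, \<open>q\<close> their time derivatives, the left side is the time derivative of
  the boundary energy in the absence of a source. It equals minus the flux at \<ell>, once more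
  because \<rho> is the determinant of the boundary coefficients.\<close>

lemma rbdry_balance:
  "((of_real (b1' P) * p - of_real (b2' P) * q) \<bullet> (of_real (b1 P) * a - of_real (b2 P) * b)) / rho P + rbdry a b p q = - (p \<bullet> b)"
proof -
  have "(of_real (b1' P) * p - of_real (b2' P) * q) \<bullet> (of_real (b1 P) * a - of_real (b2 P) * b)
    + (- (b1 P * b1' P) * (a \<bullet> p) + b1 P * b2' P * (a \<bullet> q + b \<bullet> p) - b2 P * b2' P * (b \<bullet> q)) = - rho P * (p \<bullet> b)"
    by (simp add: inner_complex_def rho_def algebra_simps)
  then show ?thesis unfolding rbdry_def add_divide_distrib[symmetric] using rho_pos by (simp only:) simp
qed

text \<open>An increment splits into a change of time, small uniformly in \<open>z\<close> by the
  graph norm, and a change of \<open>z\<close> at fixed time. Joint continuity is what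
  differentiation of the energy under the integral requires.\<close>

lemma curve_jointly_continuous:
  assumes d: "\<And>t. domA P (h t)" and c: "\<And>t. cont_DA P h t"
  shows "continuous_on (UNIV \<times> {0..L}) (\<lambda>(t, z). fst (h t) z)"
    "continuous_on (UNIV \<times> {0..L}) (\<lambda>(t, z). dz P (fst (h t)) z)"
proof -
  obtain C where C: "0 \<le> C" "\<forall>\<phi> x. domA P \<phi> \<longrightarrow> x \<in> {0..L} \<longrightarrow> cmod (fst \<phi> x) \<le> C * gnorm P \<phi> \<and> cmod (dz P (fst \<phi>) x) \<le> C * gnorm P \<phi>"
    by (rule uniform_bound_gnorm)
  have ic: "isCont (\<lambda>s. gnorm P (hsub (h s) (h t))) t" for t
  proof -
    have "hsub (h t) (h t) = hscale 0 (h t)" by (simp add: prod_eq_iff)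
    then have "gnorm P (hsub (h t) (h t)) = 0" using gnorm_hscale[OF d] by simp
    then show ?thesis using c[of t] by (simp add: isCont_def cont_DA_def)
  qed
  have gen: "continuous_on (UNIV \<times> {0..L}) (\<lambda>(t, z). l (h t) z)"
    if sub: "\<And>a b z. domA P a \<Longrightarrow> domA P b \<Longrightarrow> z \<in> {0..L} \<Longrightarrow> l (hsub a b) z = l a z - l b z"
      and bd: "\<And>a z. domA P a \<Longrightarrow> z \<in> {0..L} \<Longrightarrow> cmod (l a z) \<le> C * gnorm P a"
      and ct: "\<And>a. domA P a \<Longrightarrow> continuous_on {0..L} (l a)" for l :: "hvec \<Rightarrow> real \<Rightarrow> complex"
    unfolding continuous_on_def
  proof
    fix p :: "real \<times> real" assume p: "p \<in> UNIV \<times> {0..L}"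
    obtain t z where tz: "p = (t, z)" by (cases p)
    let ?F = "at p within UNIV \<times> {0..L}"
    have inS: "\<forall>\<^sub>F q in ?F. snd q \<in> {0..L}"
      unfolding eventually_at_topological by (intro exI[of _ UNIV]) auto
    have f1: "(fst \<longlongrightarrow> t) ?F" and f2: "(snd \<longlongrightarrow> z) ?F"
      using tendsto_fst[OF tendsto_ident_at, of p] tendsto_snd[OF tendsto_ident_at, of p] by (simp_all add: tz)
    have "((\<lambda>q. C * gnorm P (hsub (h (fst q)) (h t))) \<longlongrightarrow> C * gnorm P (hsub (h t) (h t))) ?F"
      by (intro tendsto_intros isCont_tendsto_compose[OF ic f1])
    moreover have "gnorm P (hsub (h t) (h t)) = 0"
    proof -
      have "hsub (h t) (h t) = hscale 0 (h t)" by (simp add: prod_eq_iff)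
      then show ?thesis using gnorm_hscale[OF d] by simp
    qed
    ultimately have g0: "((\<lambda>q. C * gnorm P (hsub (h (fst q)) (h t))) \<longlongrightarrow> 0) ?F" by simp
    have 1: "((\<lambda>q. l (h (fst q)) (snd q) - l (h t) (snd q)) \<longlongrightarrow> 0) ?F"
    proof (rule Lim_null_comparison[OF _ g0])
      show "\<forall>\<^sub>F q in ?F. norm (l (h (fst q)) (snd q) - l (h t) (snd q)) \<le> C * gnorm P (hsub (h (fst q)) (h t))"
        using inS
      proof (rule eventually_mono)
        fix q :: "real \<times> real" assume q: "snd q \<in> {0..L}"
        show "norm (l (h (fst q)) (snd q) - l (h t) (snd q)) \<le> C * gnorm P (hsub (h (fst q)) (h t))"
          using bd[OF domA_hsub(1)[OF d d] q] unfolding sub[OF d d q] .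
      qed
    qed
    have "((\<lambda>q. l (h t) (snd q)) \<longlongrightarrow> l (h t) z) ?F"
      by (rule continuous_on_tendsto_compose[OF ct[OF d] f2 _ inS]) (use p tz in simp)
    from tendsto_add[OF 1 this] show "((\<lambda>(t, z). l (h t) z) \<longlongrightarrow> (case p of (t, z) \<Rightarrow> l (h t) z)) ?F"
      by (simp add: tz case_prod_unfold)
  qed
  show "continuous_on (UNIV \<times> {0..L}) (\<lambda>(t, z). fst (h t) z)"
    by (rule gen) (use C(2) regular_cont(1) in \<open>auto simp: domA_iff\<close>)
  show "continuous_on (UNIV \<times> {0..L}) (\<lambda>(t, z). dz P (fst (h t)) z)"
    by (rule gen[of "\<lambda>a. dz P (fst a)"]) (use C(2) regular_cont(2) dz_hsub_hscale(1) in \<open>auto simp: domA_iff\<close>)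
qed

lemma dz_zero:
  assumes z: "z \<in> {0..L}" and e: "0 < e" and u: "\<And>y. y \<in> {0..L} \<Longrightarrow> \<bar>y - z\<bar> < e \<Longrightarrow> u y = 0"
  shows "dz P u z = 0"
proof (rule dz_eqI[OF z])
  have "((\<lambda>_. 0) has_vector_derivative 0) (at z within {0..L})" by simp
  then show "(u has_vector_derivative 0) (at z within {0..L})"
    by (rule has_vector_derivative_transform_within[OF _ e z]) (use u in \<open>auto simp: dist_real_def\<close>)
qed

lemma AE_leb_imp_negligible:
  assumes "AE z in leb. Q z"
  obtains N where "negligible N" "\<forall>z \<in> {0..L} - N. Q z"
proof -
  have "AE z in lebesgue. z \<in> {0<..<L} \<longrightarrow> Q z" using assms by (simp add: AE_restrict_space_iff)
  then obtain N where N: "N \<in> null_sets lebesgue" "{z. \<not> (z \<in> {0<..<L} \<longrightarrow> Q z)} \<subseteq> N"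
    unfolding eventually_ae_filter by auto
  have "negligible (N \<union> {0, L})" using N(1) by (simp add: negligible_iff_null_sets[symmetric])
  moreover have "\<forall>z \<in> {0..L} - (N \<union> {0, L}). Q z"
  proof
    fix z assume "z \<in> {0..L} - (N \<union> {0, L})"
    then have "z \<in> {0<..<L}" "z \<notin> N" by auto
    then show "Q z" using N(2) by blast
  qed
  ultimately show ?thesis by (rule that)
qed

end

text \<open>The weight \<open>w\<close> vanishes outside the forward light cone of \<open>(t0, z0)\<close> and satisfies
  \<open>\<bar>\<partial>w/\<partial>z\<bar> \<le> \<partial>w/\<partial>t\<close>, which makes the weighted energy nondecreasing in \<open>t\<close>.\<close>

locale backward_cone = wave_bvp +
  fixes F F' F'' f :: "real \<Rightarrow> hvec" and t0 z0 T :: real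
  assumes C2: "C2_DA P F F' F''" and fd: "\<And>t. domA P (f t)"
    and eq: "\<And>t. heq P (QA P F F'' t) (f t)"
    and future: "\<And>t. T < t \<Longrightarrow> hnorm P (F t) = 0" "\<And>t. T < t \<Longrightarrow> hnorm P (F' t) = 0"
    and z0: "z0 \<in> {0..L}"
    and cone: "\<And>t z. z \<in> {0..L} \<Longrightarrow> \<bar>z - z0\<bar> \<le> t - t0 \<Longrightarrow> fst (f t) z = 0"
begin

abbreviation "u t z \<equiv> fst (F t) z"
abbreviation "ut t z \<equiv> fst (F' t) z"
abbreviation "utt t z \<equiv> fst (F'' t) z"
abbreviation "uz t z \<equiv> dz P (fst (F t)) z"
abbreviation "utz t z \<equiv> dz P (fst (F' t)) z"

lemma dom: "domA P (F t)" "domA P (F' t)" "domA P (F'' t)"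
  and der: "hderiv_DA P F F' t" "hderiv_DA P F' F'' t"
  and cont: "cont_DA P F' t" "cont_DA P F'' t" "cont_DA P F t"
proof -
  show d: "domA P (F t)" "domA P (F' t)" "domA P (F'' t)" "hderiv_DA P F F' t" "hderiv_DA P F' F'' t" "cont_DA P F' t" "cont_DA P F'' t" for t
    using C2 unfolding C2_DA_def C1_DA_def by blast+
  show "cont_DA P F t" by (rule hderiv_imp_cont[OF d(1,2,4)])
qed

lemma u_deriv:
  assumes z: "z \<in> {0..L}"
  shows "((\<lambda>t. u t z) has_vector_derivative ut t z) (at t)" "((\<lambda>t. ut t z) has_vector_derivative utt t z) (at t)"
    "((\<lambda>t. uz t z) has_vector_derivative utz t z) (at t)" "((\<lambda>t. utz t z) has_vector_derivative dz P (fst (F'' t)) z) (at t)"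
  using dfunctional_deriv[OF dfunctional_eval(1)[OF z] dom(1,2) der(1)] dfunctional_deriv[OF dfunctional_eval(1)[OF z] dom(2,3) der(2)]
    dfunctional_deriv[OF dfunctional_eval(2)[OF z] dom(1,2) der(1)] dfunctional_deriv[OF dfunctional_eval(2)[OF z] dom(2,3) der(2)] by auto

lemmas joint = curve_jointly_continuous(1)[OF dom(1) cont(3)] curve_jointly_continuous(1)[OF dom(2) cont(1)]
  curve_jointly_continuous(1)[OF dom(3) cont(2)] curve_jointly_continuous(2)[OF dom(1) cont(3)] curve_jointly_continuous(2)[OF dom(2) cont(1)]

lemma joint_cont:
  "continuous_on (UNIV \<times> {0..L}) (\<lambda>p. u (fst p) (snd p))" "continuous_on (UNIV \<times> {0..L}) (\<lambda>p. ut (fst p) (snd p))"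
  "continuous_on (UNIV \<times> {0..L}) (\<lambda>p. utt (fst p) (snd p))" "continuous_on (UNIV \<times> {0..L}) (\<lambda>p. uz (fst p) (snd p))"
  "continuous_on (UNIV \<times> {0..L}) (\<lambda>p. utz (fst p) (snd p))"
  using joint by (simp_all add: split_beta)

lemma space_cont:
  "continuous_on {0..L} (\<lambda>z. u t z)" "continuous_on {0..L} (\<lambda>z. ut t z)" "continuous_on {0..L} (\<lambda>z. utt t z)"
  "continuous_on {0..L} (\<lambda>z. uz t z)" "continuous_on {0..L} (\<lambda>z. utz t z)"
  using regular_cont(1,2) dom by (auto simp: domA_iff)

text \<open>The expression is even in \<open>t - t0\<close> and so is positive inside the past cone
  too; the steps that use the cone therefore assume \<open>t0 \<le> t\<close>.\<close>

definition s :: "real \<Rightarrow> real \<Rightarrow> real" where "s t z = max 0 ((t - t0)\<^sup>2 - (z - z0)\<^sup>2)"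
definition w :: "real \<Rightarrow> real \<Rightarrow> real" where "w t z = (s t z)\<^sup>2"
definition wt :: "real \<Rightarrow> real \<Rightarrow> real" where "wt t z = 4 * (t - t0) * s t z"
definition wz :: "real \<Rightarrow> real \<Rightarrow> real" where "wz t z = - 4 * (z - z0) * s t z"

lemma w_deriv:
  "((\<lambda>t. w t z) has_real_derivative wt t z) (at t)" "((\<lambda>z. w t z) has_real_derivative wz t z) (at z within S)"
proof -
  have "((\<lambda>t. (t - t0)\<^sup>2 - (z - z0)\<^sup>2) has_real_derivative 2 * (t - t0)) (at t)"
    by (auto intro!: derivative_eq_intros)
  from DERIV_chain2[OF max0_square_deriv this] show "((\<lambda>t. w t z) has_real_derivative wt t z) (at t)"
    by (simp add: w_def s_def wt_def algebra_simps)
  have "((\<lambda>z. (t - t0)\<^sup>2 - (z - z0)\<^sup>2) has_real_derivative - 2 * (z - z0)) (at z)"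
    by (auto intro!: derivative_eq_intros)
  from DERIV_chain2[OF max0_square_deriv this] have "((\<lambda>z. w t z) has_real_derivative wz t z) (at z)"
    by (simp add: w_def s_def wz_def algebra_simps)
  then show "((\<lambda>z. w t z) has_real_derivative wz t z) (at z within S)" by (rule has_field_derivative_at_within)
qed

lemma s_cont [continuous_intros]:
  assumes "continuous_on S a" "continuous_on S b" shows "continuous_on S (\<lambda>p. s (a p) (b p))"
  unfolding s_def by (intro continuous_intros assms)

lemma s_nonneg: "0 \<le> s t z" by (simp add: s_def)
lemma w_nonneg: "0 \<le> w t z" by (simp add: w_def)

lemma s_pos_cone:
  assumes "s t z \<noteq> 0" "t0 \<le> t"
  shows "\<bar>z - z0\<bar> < t - t0"
proof -
  have "\<bar>z - z0\<bar>\<^sup>2 < (t - t0)\<^sup>2" using assms(1) unfolding s_def power2_abs by linarith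
  then show ?thesis by (rule power_less_imp_less_base) (use assms(2) in simp)
qed

lemma wt_nonneg: "t0 \<le> t \<Longrightarrow> 0 \<le> wt t z" by (simp add: wt_def s_nonneg)

lemma flux_le:
  assumes t: "t0 \<le> t" and d: "\<bar>p\<bar> \<le> d"
  shows "wz t z * p \<le> wt t z * d"
proof (cases "s t z = 0")
  case False
  have "- (z - z0) * p \<le> \<bar>z - z0\<bar> * \<bar>p\<bar>" by (metis abs_ge_self abs_minus_cancel abs_mult)
  also have "\<dots> \<le> (t - t0) * d" using s_pos_cone[OF False t] d by (intro mult_mono) auto
  finally have "s t z * (- (z - z0) * p) \<le> s t z * ((t - t0) * d)" using s_nonneg by (rule mult_left_mono)
  then show ?thesis by (simp add: wz_def wt_def algebra_simps)
qed (simp add: wz_def wt_def)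

definition dens :: "real \<Rightarrow> real \<Rightarrow> real" where
  "dens t z = (ut t z \<bullet> ut t z + uz t z \<bullet> uz t z + msq P * (u t z \<bullet> u t z)) / 2"
definition dens_t :: "real \<Rightarrow> real \<Rightarrow> real" where
  "dens_t t z = ut t z \<bullet> utt t z + uz t z \<bullet> utz t z + msq P * (u t z \<bullet> ut t z)"
text \<open>The energy of the boundary degree of freedom at \<ell>: the kinetic part carries the
  weight 1/\<rho> of \<open>hinner\<close>, the potential part is the boundary form.\<close>

definition bdens :: "real \<Rightarrow> real" where
  "bdens t = ((snd (F' t) \<bullet> snd (F' t)) / rho P + rbdry (u t L) (uz t L) (u t L) (uz t L)) / 2"
definition bdens_t :: "real \<Rightarrow> real" where
  "bdens_t t = (snd (F' t) \<bullet> snd (F'' t)) / rho P + rbdry (u t L) (uz t L) (ut t L) (utz t L)"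

lemma dens_nonneg: "(ut t z \<bullet> ut t z + uz t z \<bullet> uz t z) / 2 \<le> dens t z" "0 \<le> dens t z"
  using msq_nonneg by (simp_all add: dens_def)

lemma bdens_nonneg: "0 \<le> bdens t"
  using bdry_form_self_nonneg rho_pos unfolding bdens_def Re_bdry_form[symmetric] by simp

lemma dens_deriv:
  assumes z: "z \<in> {0..L}"
  shows "((\<lambda>t. dens t z) has_real_derivative dens_t t z) (at t)"
  unfolding dens_def[abs_def]
  by (rule DERIV_cong[OF DERIV_cdivide[OF DERIV_add[OF DERIV_add[OF
      inner_has_real_derivative[OF u_deriv(2)[OF z] u_deriv(2)[OF z]]
      inner_has_real_derivative[OF u_deriv(3)[OF z] u_deriv(3)[OF z]]]
      DERIV_cmult[OF inner_has_real_derivative[OF u_deriv(1)[OF z] u_deriv(1)[OF z]]]]]])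
    (simp add: dens_t_def inner_commute field_simps)

lemma ends: "0 \<in> {0..L}" "L \<in> {0..L}" using len_pos by auto

lemma bdens_deriv: "(bdens has_real_derivative bdens_t t) (at t)"
proof -
  have s: "snd (F' t) = of_real (b1' P) * ut t L - of_real (b2' P) * utz t L"
    "snd (F'' t) = of_real (b1' P) * utt t L - of_real (b2' P) * dz P (fst (F'' t)) L" for t
    using dom by (simp_all add: domA_iff)
  have "((\<lambda>t. snd (F' t)) has_vector_derivative snd (F'' t)) (at t)"
    unfolding s by (intro has_vector_derivative_diff has_vector_derivative_mult_right u_deriv ends)
  then have 1: "((\<lambda>t. snd (F' t) \<bullet> snd (F' t)) has_real_derivative snd (F' t) \<bullet> snd (F'' t) + snd (F'' t) \<bullet> snd (F' t)) (at t)"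
    by (intro inner_has_real_derivative)
  note i = inner_has_real_derivative[OF u_deriv(1)[OF ends(2)] u_deriv(1)[OF ends(2)], of t]
    inner_has_real_derivative[OF u_deriv(1)[OF ends(2)] u_deriv(3)[OF ends(2)], of t]
    inner_has_real_derivative[OF u_deriv(3)[OF ends(2)] u_deriv(1)[OF ends(2)], of t]
    inner_has_real_derivative[OF u_deriv(3)[OF ends(2)] u_deriv(3)[OF ends(2)], of t]
  have 2: "((\<lambda>t. rbdry (u t L) (uz t L) (u t L) (uz t L)) has_real_derivative
     (- (b1 P * b1' P) * (u t L \<bullet> ut t L + ut t L \<bullet> u t L) + b1 P * b2' P * ((u t L \<bullet> utz t L + ut t L \<bullet> uz t L) + (uz t L \<bullet> ut t L + utz t L \<bullet> u t L))
       - b2 P * b2' P * (uz t L \<bullet> utz t L + utz t L \<bullet> uz t L)) / rho P) (at t)"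
    unfolding rbdry_def by (intro DERIV_cdivide DERIV_diff DERIV_add DERIV_cmult i)
  from DERIV_cdivide[OF DERIV_add[OF DERIV_cdivide[OF 1, of "rho P"] 2], of 2]
  show ?thesis unfolding bdens_def[abs_def]
    by (rule DERIV_cong) (simp add: bdens_t_def rbdry_def inner_commute field_simps)
qed

definition energy :: "real \<Rightarrow> real" where
  "energy t = integral {0..L} (\<lambda>z. w t z * dens t z) + w t 0 * (- cot (alpha P) * (u t 0 \<bullet> u t 0) / 2) + w t L * bdens t"
definition energy_t :: "real \<Rightarrow> real" where
  "energy_t t = integral {0..L} (\<lambda>z. wt t z * dens t z + w t z * dens_t t z)
    + (wt t 0 * (- cot (alpha P) * (u t 0 \<bullet> u t 0) / 2) + w t 0 * (- cot (alpha P) * (u t 0 \<bullet> ut t 0)))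
    + (wt t L * bdens t + w t L * bdens_t t)"

lemma dens_cont:
  "continuous_on {0..L} (\<lambda>z. w t z * dens t z)" "continuous_on {0..L} (\<lambda>z. wt t z * dens t z + w t z * dens_t t z)"
  unfolding w_def wt_def dens_def dens_t_def by (intro continuous_intros space_cont; simp)+

lemma energy_deriv: "(energy has_real_derivative energy_t t) (at t)"
proof -
  have 1: "((\<lambda>t. integral {0..L} (\<lambda>z. w t z * dens t z)) has_real_derivative
     integral {0..L} (\<lambda>z. wt t z * dens t z + w t z * dens_t t z)) (at t)"
  proof (rule leibniz_rule_field_derivative[where U = UNIV and a = 0 and b = L, unfolded cbox_interval])
    fix x z assume z: "z \<in> {0..L}"
    show "((\<lambda>t. w t z * dens t z) has_real_derivative wt x z * dens x z + w x z * dens_t x z) (at x)"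
      using DERIV_mult[OF w_deriv(1)[of z x] dens_deriv[OF z]] by (simp add: algebra_simps)
  next
    show "(\<lambda>z. w x z * dens x z) integrable_on {0..L}" for x
      by (intro integrable_continuous_real dens_cont)
    show "continuous_on (UNIV \<times> {0..L}) (\<lambda>(t, z). wt t z * dens t z + w t z * dens_t t z)"
      unfolding w_def wt_def dens_def dens_t_def split_beta
      by (intro continuous_intros joint_cont; simp)
  qed auto
  have 2: "((\<lambda>t. w t 0 * (- cot (alpha P) * (u t 0 \<bullet> u t 0) / 2)) has_real_derivative
      (wt t 0 * (- cot (alpha P) * (u t 0 \<bullet> u t 0) / 2) + w t 0 * (- cot (alpha P) * (u t 0 \<bullet> ut t 0)))) (at t)"
    by (rule DERIV_cong[OF DERIV_mult[OF w_deriv(1) DERIV_cdivide[OF DERIV_cmult[OF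
      inner_has_real_derivative[OF u_deriv(1)[OF ends(1)] u_deriv(1)[OF ends(1)]]]]]])
      (simp add: inner_commute field_simps)
  have 3: "((\<lambda>t. w t L * bdens t) has_real_derivative (wt t L * bdens t + w t L * bdens_t t)) (at t)"
    using DERIV_mult[OF w_deriv(1) bdens_deriv, of L t] by (simp add: algebra_simps)
  show ?thesis unfolding energy_def[abs_def] energy_t_def by (intro DERIV_add 1 2 3)
qed

text \<open>The \<open>z\<close>-derivative of \<open>w * (ut \<bullet> uz)\<close> is integrated.
  The second space derivative, under control only almost everywhere, is eliminated by the wave
  equation.\<close>

lemma flux_identity:
  assumes t: "t0 \<le> t"
  shows "((\<lambda>z. wz t z * (ut t z \<bullet> uz t z) + w t z * dens_t t z) has_integral
     w t L * (ut t L \<bullet> uz t L) - w t 0 * (ut t 0 \<bullet> uz t 0)) {0..L}"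
proof -
  have r: "regular (fst (F t))" "regular (fst (F' t))" using dom by (simp_all add: domA_iff)
  obtain N where N: "negligible N" "\<And>z. z \<in> {0..L} - N \<Longrightarrow> (dz P (fst (F t)) has_vector_derivative dz P (dz P (fst (F t))) z) (at z within {0..L})"
    using regular_deriv2[OF r(1)] by blast
  have "AE z in leb. fst (QA P F F'' t) z = fst (f t) z" using eq[of t] by (simp add: heq_def)
  then obtain N' where N': "negligible N'" "\<forall>z \<in> {0..L} - N'. fst (QA P F F'' t) z = fst (f t) z"
    by (rule AE_leb_imp_negligible)
  let ?g = "\<lambda>z. of_real (w t z) * cnj (ut t z)"
  let ?g' = "\<lambda>z. of_real (w t z) * cnj (utz t z) + of_real (wz t z) * cnj (ut t z)"
  have dg: "(?g has_vector_derivative ?g' z) (at z within {0..L})" if "z \<in> {0..L}" for z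
    by (intro has_vector_derivative_mult of_real_has_vector_derivative w_deriv has_vector_derivative_cnj regular_deriv r that)
  have cg: "continuous_on {0..L} ?g'"
    unfolding w_def wz_def by (intro continuous_intros space_cont)
  have ag: "ac_on 0 L ?g" by (rule C1_imp_ac_on[OF dg cg])
  have "((\<lambda>z. ?g' z * uz t z + ?g z * dz P (dz P (fst (F t))) z) has_integral (?g L * uz t L - ?g 0 * uz t 0)) {0..L}"
    by (rule ac_on_integration_by_parts[OF len_pos ag _ N(1)]) (use r N(2) dg in \<open>auto simp: regular_def\<close>)
  from has_integral_linear[OF this bounded_linear_Re]
  have "((\<lambda>z. wz t z * (ut t z \<bullet> uz t z) + w t z * (utz t z \<bullet> uz t z) + w t z * (ut t z \<bullet> dz P (dz P (fst (F t))) z)) has_integral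
     w t L * (ut t L \<bullet> uz t L) - w t 0 * (ut t 0 \<bullet> uz t 0)) {0..L}"
    by (simp add: o_def inner_complex_def algebra_simps)
  then show ?thesis
  proof (rule has_integral_spike[OF N'(1), rotated])
    fix z assume z: "z \<in> {0..L} - N'"
    \<comment> \<open>Where the weight vanishes both sides are 0. Elsewhere the point lies in the
      cone, so the source is 0 and the homogeneous equation expresses the second space
      derivative.\<close>
    have "w t z * (ut t z \<bullet> dz P (dz P (fst (F t))) z) = w t z * (ut t z \<bullet> utt t z + msq P * (u t z \<bullet> ut t z))"
    proof (cases "s t z = 0")
      case False
      then have "fst (f t) z = 0" using s_pos_cone[OF False t] z cone by (simp add: less_imp_le)
      then have "utt t z + (- dz P (dz P (fst (F t))) z + of_real (msq P) * u t z) = 0"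
        using N'(2) z by (simp add: QA_def Aop_def)
      then have e: "dz P (dz P (fst (F t))) z = utt t z + of_real (msq P) * u t z" by (simp add: algebra_simps)
      show ?thesis unfolding e by (simp add: inner_complex_def algebra_simps)
    qed (simp add: w_def)
    then show "wz t z * (ut t z \<bullet> uz t z) + w t z * dens_t t z
      = wz t z * (ut t z \<bullet> uz t z) + w t z * (utz t z \<bullet> uz t z) + w t z * (ut t z \<bullet> dz P (dz P (fst (F t))) z)"
      by (simp add: dens_t_def inner_commute algebra_simps)
  qed
qed

text \<open>The boundary fluxes of \<open>flux_identity\<close> cancel against the terms in which
  the time derivative falls on the boundary energies. The remaining terms carry \<open>wt\<close> or
  \<open>wz\<close>; \<open>flux_le\<close> lets the former dominate the latter in the
  interior.\<close>

lemma energy_t_nonneg: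
  assumes t: "t0 \<le> t"
  shows "0 \<le> energy_t t"
proof -
  have i: "((\<lambda>z. wt t z * dens t z + w t z * dens_t t z) has_integral integral {0..L} (\<lambda>z. wt t z * dens t z + w t z * dens_t t z)) {0..L}"
    by (intro integrable_integral integrable_continuous_real dens_cont)
  have "w t L * (ut t L \<bullet> uz t L) - w t 0 * (ut t 0 \<bullet> uz t 0) \<le> integral {0..L} (\<lambda>z. wt t z * dens t z + w t z * dens_t t z)"
  proof (rule has_integral_le[OF flux_identity[OF t] i])
    fix z
    have "\<bar>ut t z \<bullet> uz t z\<bar> \<le> norm (ut t z) * norm (uz t z)" by (rule Cauchy_Schwarz_ineq2)
    also have "\<dots> \<le> (ut t z \<bullet> ut t z + uz t z \<bullet> uz t z) / 2"
      using sum_squares_bound[of "norm (ut t z)" "norm (uz t z)"] by (simp add: power2_norm_eq_inner[symmetric] field_simps)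
    also have "\<dots> \<le> dens t z" by (rule dens_nonneg)
    finally show "wz t z * (ut t z \<bullet> uz t z) + w t z * dens_t t z \<le> wt t z * dens t z + w t z * dens_t t z"
      using flux_le[OF t] by simp
  qed
  moreover have "ut t 0 \<bullet> uz t 0 = - cot (alpha P) * (u t 0 \<bullet> ut t 0)"
    using arg_cong[OF Robin[OF dom(2) dom(1), of t t], of Re] by (simp add: inner_complex_def algebra_simps)
  then have "w t 0 * (ut t 0 \<bullet> uz t 0) = w t 0 * (- cot (alpha P) * (u t 0 \<bullet> ut t 0))" by (simp only:)
  moreover have "0 \<le> wt t 0 * (- cot (alpha P) * (u t 0 \<bullet> u t 0) / 2)"
    using cot_alpha wt_nonneg[OF t] by (intro mult_nonneg_nonneg divide_nonneg_nonneg) auto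
  moreover have "0 \<le> wt t L * bdens t" using wt_nonneg[OF t] bdens_nonneg by simp
  moreover have "w t L * bdens_t t = - w t L * (ut t L \<bullet> uz t L)"
  proof (cases "s t L = 0")
    case False
    note c = s_pos_cone[OF False t]
    \<comment> \<open>If the weight is nonzero at \<ell>, then \<open>f t\<close> vanishes on a
      one-sided neighbourhood of \<ell> and not only at \<ell>. So its slope there is 0 as well and,
      by the boundary relation in \<open>domA\<close>, so is its second component.\<close>
    have f0: "fst (f t) z = 0" if "z \<in> {0..L}" "\<bar>z - L\<bar> < (t - t0) - \<bar>L - z0\<bar>" for z
      using that by (intro cone) auto
    have "dz P (fst (f t)) L = 0" by (rule dz_zero[OF ends(2) _ f0]) (use c in auto)
    moreover have "fst (f t) L = 0" by (rule f0) (use c ends in auto)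
    ultimately have "snd (f t) = 0" using fd[of t] by (simp add: domA_iff)
    then have "snd (F'' t) = of_real (b1 P) * u t L - of_real (b2 P) * uz t L"
      using eq[of t] by (simp add: heq_def QA_def Aop_def algebra_simps)
    moreover have "snd (F' t) = of_real (b1' P) * ut t L - of_real (b2' P) * utz t L" using dom by (simp add: domA_iff)
    ultimately have "bdens_t t = - (ut t L \<bullet> uz t L)" unfolding bdens_t_def by (simp only: rbdry_balance)
    then show ?thesis by simp
  qed (simp add: w_def)
  ultimately show ?thesis unfolding energy_t_def by linarith
qed

lemma energy_future:
  assumes t: "T < t"
  shows "energy t = 0"
proof -
  obtain C where C: "0 \<le> C" "\<forall>\<phi> x. domA P \<phi> \<longrightarrow> x \<in> {0..L} \<longrightarrow> cmod (fst \<phi> x) \<le> C * gnorm P \<phi> \<and> cmod (dz P (fst \<phi>) x) \<le> C * gnorm P \<phi>"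
    by (rule uniform_bound_gnorm)
  have g: "gnorm P (F t) = 0" "gnorm P (F' t) = 0" using gnorm_zero dom future t by auto
  have z: "u t z = 0" "ut t z = 0" "uz t z = 0" "utz t z = 0" if "z \<in> {0..L}" for z
    using C(2) dom that g by (metis mult_zero_right norm_le_zero_iff)+
  have "snd (F' t) = 0" using dom(2)[of t] z[OF ends(2)] by (simp add: domA_iff)
  then have b: "bdens t = 0" using z[OF ends(2)] by (simp add: bdens_def rbdry_def)
  have "integral {0..L} (\<lambda>z. w t z * dens t z) = integral {0..L} (\<lambda>z. 0)"
    by (rule Henstock_Kurzweil_Integration.integral_cong) (simp add: dens_def z)
  then show ?thesis using z[OF ends(1)] b by (simp add: energy_def)
qed

text \<open>The energy increases towards the future, where it is 0, so it is nonpositive; as a sum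
  of three nonnegative terms it forces the density to vanish where the weight is positive.\<close>

lemma ut_zero:
  assumes t: "t0 < t"
  shows "ut t z0 = 0"
proof -
  have ge: "0 \<le> integral {0..L} (\<lambda>z. w t z * dens t z)"
    by (intro integral_nonneg integrable_continuous_real dens_cont) (simp add: w_nonneg dens_nonneg)
  have "energy t \<le> energy (max t T + 1)"
  proof (rule DERIV_nonneg_imp_nondecreasing[where f = energy])
    fix x assume "t \<le> x"
    then have "0 \<le> energy_t x" using energy_t_nonneg[of x] t by simp
    then show "\<exists>y. (energy has_real_derivative y) (at x) \<and> 0 \<le> y" using energy_deriv by blast
  qed simp
  also have "\<dots> = 0" by (rule energy_future) simp
  finally have "energy t \<le> 0" .
  moreover have "0 \<le> w t 0 * (- cot (alpha P) * (u t 0 \<bullet> u t 0) / 2)"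
    using cot_alpha w_nonneg by (intro mult_nonneg_nonneg divide_nonneg_nonneg) auto
  moreover have "0 \<le> w t L * bdens t" using w_nonneg bdens_nonneg by simp
  ultimately have "integral {0..L} (\<lambda>z. w t z * dens t z) = 0" using ge unfolding energy_def by linarith
  then have "w t z0 * dens t z0 = 0"
    using integral_eq_0_iff[OF dens_cont(1) len_pos] w_nonneg dens_nonneg z0 by simp
  moreover have "w t z0 \<noteq> 0" using t by (simp add: w_def s_def max_def)
  ultimately have "dens t z0 = 0" by simp
  then have "ut t z0 \<bullet> ut t z0 + uz t z0 \<bullet> uz t z0 \<le> 0" using dens_nonneg(1)[of t z0] by simp
  then have "ut t z0 \<bullet> ut t z0 \<le> 0" using inner_ge_zero[of "uz t z0"] by linarith
  then show ?thesis using inner_ge_zero[of "ut t z0"] by (metis inner_eq_zero_iff order_antisym)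
qed

text \<open>For m = 0 the energy density does not see \<open>u\<close> itself, so \<open>u\<close>
  is recovered by integrating its time derivative back from the future, where it is zero.\<close>

theorem vanishes: "u t0 z0 = 0"
proof -
  define r where "r = max t0 T + 1"
  have r: "t0 \<le> r" "T < r" by (auto simp: r_def)
  have "((\<lambda>t. ut t z0) has_integral (u r z0 - u t0 z0)) {t0..r}"
    by (rule fundamental_theorem_of_calculus[OF r(1)]) (rule has_vector_derivative_at_within[OF u_deriv(1)[OF z0]])
  from has_integral_unique[OF this] have "u r z0 - u t0 z0 = 0" if "((\<lambda>t. ut t z0) has_integral 0) {t0..r}"
    using that by blast
  moreover have "((\<lambda>t. ut t z0) has_integral 0) {t0..r}"
    by (rule has_integral_spike_finite[where S = "{t0}" and f = "\<lambda>_. 0"]) (use ut_zero in auto)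
  moreover have "u r z0 = 0" by (rule domA_zero(1)[OF dom(1) future(1)[OF r(2)] z0])
  ultimately show ?thesis by simp
qed

end

section \<open>The Green operators\<close>

text \<open>Extract a convergent subsequence of the witnesses in \<open>S\<close>. Closedness of the
  causal sets matters because a support is a closure: it reduces the inclusion to points where the
  solution is nonzero.\<close>

lemma closed_exists_compact:
  fixes S :: "'b::metric_space set" and C :: "('a::metric_space \<times> 'b) set"
  assumes S: "compact S" and C: "closed C"
  shows "closed {x. \<exists>y\<in>S. (x, y) \<in> C}"
  unfolding closed_sequential_limits
proof (intro allI impI)
  fix X l assume X: "(\<forall>n. X n \<in> {x. \<exists>y\<in>S. (x, y) \<in> C}) \<and> X \<longlonglongrightarrow> l"
  then obtain Y where Y: "\<And>n. Y n \<in> S" "\<And>n. (X n, Y n) \<in> C" by simp metis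
  obtain y r where yr: "y \<in> S" "strict_mono r" "(Y \<circ> r) \<longlonglongrightarrow> y"
    using S Y(1) unfolding compact_def by blast
  have "(\<lambda>n. (X (r n), Y (r n))) \<longlonglongrightarrow> (l, y)"
    using tendsto_Pair[OF LIMSEQ_subseq_LIMSEQ[OF conjunct2[OF X] yr(2)] yr(3)] by (simp add: o_def)
  then have "(l, y) \<in> C" by (rule closed_sequentially[OF C, rotated]) (rule Y(2))
  then show "l \<in> {x. \<exists>y\<in>S. (x, y) \<in> C}" using yr(1) by blast
qed

lemma closed_Jminus: assumes "compact S" shows "closed (Jminus P S)"
proof -
  have "closed {p::(real \<times> real) \<times> (real \<times> real). snd (fst p) \<in> {0..len P} \<and> \<bar>snd (fst p) - snd (snd p)\<bar> \<le> fst (snd p) - fst (fst p)}"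
    unfolding atLeastAtMost_iff by (intro closed_Collect_conj closed_Collect_le continuous_intros)
  from closed_exists_compact[OF assms this] show ?thesis
    by (rule back_subst[of closed]) (force simp: Jminus_def)
qed

lemma closed_Jplus: assumes "compact S" shows "closed (Jplus P S)"
proof -
  have "closed {p::(real \<times> real) \<times> (real \<times> real). snd (fst p) \<in> {0..len P} \<and> \<bar>snd (fst p) - snd (snd p)\<bar> \<le> fst (fst p) - fst (snd p)}"
    unfolding atLeastAtMost_iff by (intro closed_Collect_conj closed_Collect_le continuous_intros)
  from closed_exists_compact[OF assms this] show ?thesis
    by (rule back_subst[of closed]) (force simp: Jplus_def)
qed

lemma heq_hscale: "heq P a b \<Longrightarrow> heq P (hscale c a) (hscale c b)"
  by (auto simp: heq_def hscale_def)

section \<open>Time reversal\<close>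

lemma hint_on_reflect:
  assumes "hint_on P {- t..} (\<lambda>s. h (- s)) G"
  shows "hint_on P {..t} h G"
proof -
  have ind: "indicator {- t..} s = (indicator {..t} (0 + (- 1) * s) :: real)" for s
    by (auto simp: indicator_def)
  have 1: "set_integrable lborel {..t} g \<longleftrightarrow> set_integrable lborel {- t..} (\<lambda>s. g (- s))" for g :: "real \<Rightarrow> complex"
    unfolding set_integrable_def ind
    using lborel_integrable_real_affine_iff[of "- 1" "\<lambda>s. indicator {..t} s *\<^sub>R g s" 0] by simp
  have 2: "(LINT s:{..t}|lborel. g s) = (LINT s:{- t..}|lborel. g (- s))" for g :: "real \<Rightarrow> complex"
    unfolding set_lebesgue_integral_def ind
    using lborel_integral_real_affine[of "- 1" "\<lambda>s. indicator {..t} s *\<^sub>R g s" 0] by simp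
  show ?thesis using assms unfolding hint_on_def 1 2 .
qed

text \<open>Reflection exchanges the two half-lines of integration, and the sign in the advanced
  operator is absorbed into the reflected kernel.\<close>

lemma Eadv_reflect:
  assumes "Eret P (\<lambda>s \<phi>. hscale (-1) (K (- s) \<phi>)) (\<lambda>t. f (- t)) (\<lambda>t. G (- t))"
  shows "Eadv P K f G"
  unfolding Eadv_def
proof
  fix t
  have "hint_on P {- t..} (\<lambda>t'. hscale (-1) (K (- (- t - t')) (f (- t')))) (G (- (- t)))"
    using assms unfolding Eret_def by blast
  then have "hint_on P {- t..} (\<lambda>s. hscale (-1) (K (t - (- s)) (f (- s)))) (G t)" by (simp add: algebra_simps)
  from hint_on_reflect[where h = "\<lambda>s. hscale (-1) (K (t - s) (f s))", OF this]
  show "hint_on P {..t} (\<lambda>t'. hscale (-1) (K (t - t') (f t'))) (G t)" .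
qed

context wave_bvp
begin

text \<open>\<open>gE\<close> is odd in time, so the reflected kernel \<open>- K (- s)\<close> is
  again the propagator, and the retarded results apply to it.\<close>

lemma spec_fun_reflect:
  assumes K: "spec_fun P (gE (- s)) T"
  shows "spec_fun P (gE s) (\<lambda>\<phi>. hscale (-1) (T \<phi>))"
  unfolding spec_fun_def
proof (intro conjI allI impI)
  have b: "bop P T" by (rule spec_funD(1)[OF K])
  show "bop P (\<lambda>\<phi>. hscale (-1) (T \<phi>))"
    unfolding bop_def
  proof (intro conjI allI impI)
    show "Hsp P (hscale (-1) (T \<phi>))" if "Hsp P \<phi>" for \<phi> using bop_Hsp[OF b that] by simp
    show "heq P (hscale (-1) (T \<phi>)) (hscale (-1) (T \<psi>))" if "Hsp P \<phi> \<and> Hsp P \<psi> \<and> heq P \<phi> \<psi>" for \<phi> \<psi>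
      using conjunct1[OF conjunct2[OF b[unfolded bop_def]]] that by (intro heq_hscale) metis
    show "heq P (hscale (-1) (T (hadd (hscale a \<phi>) (hscale c \<psi>)))) (hadd (hscale a (hscale (-1) (T \<phi>))) (hscale c (hscale (-1) (T \<psi>))))"
      if "Hsp P \<phi> \<and> Hsp P \<psi>" for \<phi> \<psi> a c
    proof -
      have e: "hscale (-1) (hadd (hscale a x) (hscale c y)) = hadd (hscale a (hscale (-1) x)) (hscale c (hscale (-1) y))" for x y
        by (simp add: prod_eq_iff)
      show ?thesis using heq_hscale[OF bop_linear[OF b, of \<phi> \<psi> a c], of "-1"] that unfolding e by blast
    qed
    obtain C where "\<forall>\<phi>. Hsp P \<phi> \<longrightarrow> hnorm P (T \<phi>) \<le> C * hnorm P \<phi>" by (rule bop_bounded[OF b])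
    then show "\<exists>C. \<forall>\<phi>. Hsp P \<phi> \<longrightarrow> hnorm P (hscale (-1) (T \<phi>)) \<le> C * hnorm P \<phi>"
      by (simp add: hnorm_hscale) blast
  qed
  fix lam v assume v: "eigA P lam v"
  have e: "hscale (-1) (hscale (complex_of_real (gE (- s) lam)) v) = hscale (complex_of_real (gE s lam)) v"
    by (simp add: gE_minus prod_eq_iff)
  show "heq P (hscale (-1) (T v)) (hscale (complex_of_real (gE s lam)) v)"
    using heq_hscale[OF spec_funD(2)[OF K v], of "-1"] unfolding e .
qed

text \<open>Each time derivative of a reflected curve produces a sign. Both versions are needed
  because along h, h', h'' the sign appears in the middle and cancels at the end.\<close>

lemma C1_DA_reflect:
  assumes h: "C1_DA P h h'"
  shows "C1_DA P (\<lambda>t. h (- t)) (\<lambda>t. hscale (-1) (h' (- t)))"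
    and "C1_DA P (\<lambda>t. hscale (-1) (h (- t))) (\<lambda>t. h' (- t))"
proof -
  have d: "domA P (h t)" "domA P (h' t)" and c: "hderiv_DA P h h' t" "cont_DA P h' t" for t
    using h unfolding C1_DA_def by blast+
  have c1: "((\<lambda>s. gnorm P (hsub (h' (- s)) (h' (- t)))) \<longlongrightarrow> 0) (at t)" for t
    using c(2)[of "- t"] unfolding cont_DA_def filtermap_at_minus[symmetric] filterlim_filtermap .
  have c2: "((\<lambda>s. gnorm P (hsub (hscale (-1) (h' (- s))) (hscale (-1) (h' (- t))))) \<longlongrightarrow> 0) (at t)" for t
  proof -
    have "hsub (hscale (-1) (h' (- s))) (hscale (-1) (h' (- t))) = hscale (-1) (hsub (h' (- s)) (h' (- t)))" for s
      by (simp add: prod_eq_iff)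
    then show ?thesis using c1[of t] by (simp add: gnorm_hscale[OF domA_hsub(1)[OF d(2) d(2)]])
  qed
  define q where "q t k = hsub (hscale (complex_of_real (1 / k)) (hsub (h (t + k)) (h t))) (h' t)" for t k
  have dq: "domA P (q t k)" for t k unfolding q_def by (intro domA_hsub(1) domA_hscale(1) d)
  have q: "((\<lambda>k. gnorm P (q (- t) (- k))) \<longlongrightarrow> 0) (at 0)" for t
  proof -
    have "((\<lambda>k. gnorm P (q (- t) k)) \<longlongrightarrow> 0) (filtermap uminus (at 0))"
      using c(1)[of "- t"] unfolding hderiv_DA_def q_def filtermap_at_minus by simp
    then show ?thesis unfolding filterlim_filtermap .
  qed
  have q2: "hsub (hscale (complex_of_real (1 / k)) (hsub (hscale (-1) (h (- (t + k)))) (hscale (-1) (h (- t))))) (h' (- t)) = q (- t) (- k)" for t k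
    by (simp add: q_def prod_eq_iff fun_eq_iff algebra_simps)
  have q1: "hsub (hscale (complex_of_real (1 / k)) (hsub (h (- (t + k))) (h (- t)))) (hscale (-1) (h' (- t))) = hscale (-1) (q (- t) (- k))" for t k
    by (simp add: q_def prod_eq_iff fun_eq_iff algebra_simps)
  show "C1_DA P (\<lambda>t. h (- t)) (\<lambda>t. hscale (-1) (h' (- t)))"
    unfolding C1_DA_def hderiv_DA_def cont_DA_def q1 gnorm_hscale[OF dq]
    using d c2 q by (auto intro: domA_hscale(1))
  show "C1_DA P (\<lambda>t. hscale (-1) (h (- t))) (\<lambda>t. h' (- t))"
    unfolding C1_DA_def hderiv_DA_def cont_DA_def q2
    using d c1 q by (auto intro: domA_hscale(1))
qed

lemma C2_DA_reflect:
  "C2_DA P h h' h'' \<Longrightarrow> C2_DA P (\<lambda>t. h (- t)) (\<lambda>t. hscale (-1) (h' (- t))) (\<lambda>t. h'' (- t))"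
  unfolding C2_DA_def using C1_DA_reflect by blast

lemma C2_0_DA_reflect:
  assumes "C2_0_DA P h h' h''"
  shows "C2_0_DA P (\<lambda>t. h (- t)) (\<lambda>t. hscale (-1) (h' (- t))) (\<lambda>t. h'' (- t))"
proof -
  obtain T where "\<forall>t. T < \<bar>t\<bar> \<longrightarrow> hnorm P (h t) = 0" using assms unfolding C2_0_DA_def by blast
  then have "\<forall>t. T < \<bar>t\<bar> \<longrightarrow> hnorm P (h (- t)) = 0" by simp
  then show ?thesis using assms C2_DA_reflect unfolding C2_0_DA_def by blast
qed

lemma compact_supp1:
  assumes "admissible f T"
  shows "compact (supp1 P f)"
proof -
  have "{(t, z). z \<in> {0..L} \<and> fst (f t) z \<noteq> 0} \<subseteq> {-T..T} \<times> {0..L}"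
  proof
    fix p assume "p \<in> {(t, z). z \<in> {0..L} \<and> fst (f t) z \<noteq> 0}"
    then obtain t z where p: "p = (t, z)" and z: "z \<in> {0..L}" and nz: "fst (f t) z \<noteq> 0" by blast
    have d: "domA P (f t)" using assms by (simp add: admissible_def)
    have "t \<in> {-T..T}"
    proof (rule ccontr)
      assume "t \<notin> {-T..T}"
      then have "T < \<bar>t\<bar>" by auto
      then have "gnorm P (f t) = 0" using assms by (simp add: admissible_def)
      then have "hnorm P (f t) = 0" using gnorm_ge(1)[of "f t"] hnorm_nonneg[of "f t"] by linarith
      then show False using domA_zero(1)[OF d _ z] nz by simp
    qed
    then show "p \<in> {-T..T} \<times> {0..L}" using p z by blast
  qed
  then have "bounded {(t, z). z \<in> {0..L} \<and> fst (f t) z \<noteq> 0}"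
    by (rule bounded_subset[OF bounded_Times[OF bounded_closed_interval bounded_closed_interval]])
  then show ?thesis unfolding supp1_def by (simp add: compact_closure)
qed

end

context eigenbasis
begin

section \<open>Support of the solutions and the Green properties\<close>

lemma Phi_vanishes:
  assumes f: "C2_0_DA P f f' f''" and z0: "z0 \<in> {0..L}"
    and cone: "\<And>t z. z \<in> {0..L} \<Longrightarrow> \<bar>z - z0\<bar> \<le> t - t0 \<Longrightarrow> fst (f t) z = 0"
  shows "fst (Phi f t0) z0 = 0"
proof -
  obtain T where T: "admissible f T" "admissible f' T" "admissible f'' T" by (rule C2_0_admissible[OF f])
  interpret backward_cone P "Phi f" "Phi f'" "Phi f''" f t0 z0 T
  proof
    show "C2_DA P (Phi f) (Phi f') (Phi f'')" by (rule Phi_solves(1)[OF f T])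
    show "heq P (QA P (Phi f) (Phi f'') t) (f t)" for t by (rule Phi_solves(2)[OF f T])
    show "domA P (f t)" for t using T by (simp add: admissible_def)
  qed (use Phi_zero_future T z0 cone in auto)
  show ?thesis by (rule vanishes)
qed

theorem retarded:
  assumes K: "\<forall>s. spec_fun P (gE s) (K s)"
  shows "retarded_green P (Eret P K)"
  unfolding retarded_green_def
proof (intro allI impI)
  fix f f' f'' assume f: "C2_0_DA P f f' f''"
  obtain T where T: "admissible f T" "admissible f' T" "admissible f'' T" by (rule C2_0_admissible[OF f])
  have "supp1 P (Phi f) \<subseteq> Jminus P (supp1 P f)"
    unfolding supp1_def[of P "Phi f"]
  proof (rule closure_minimal[OF _ closed_Jminus[OF compact_supp1[OF T(1)]]], clarify)
    fix t0 z0 assume z0: "z0 \<in> {0..L}" and nz: "fst (Phi f t0) z0 \<noteq> 0"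
    \<comment> \<open>The contrapositive of \<open>Phi_vanishes\<close>: a nonzero value forces the
      source to be nonzero somewhere in the forward cone of the point, which places the point in the
      past of the support.\<close>
    then obtain t z where tz: "z \<in> {0..L}" "\<bar>z - z0\<bar> \<le> t - t0" "fst (f t) z \<noteq> 0"
      using Phi_vanishes[OF f z0] by blast
    then have "(t, z) \<in> supp1 P f" unfolding supp1_def by (intro subsetD[OF closure_subset]) simp
    then show "(t0, z0) \<in> Jminus P (supp1 P f)"
      unfolding Jminus_def using tz(2) z0 by (force simp: abs_minus_commute)
  qed
  then show "\<exists>F F' F''. C2_DA P F F' F'' \<and> Eret P K f F \<and> (\<forall>t. heq P (QA P F F'' t) (f t))
      \<and> Eret P K (QA P f f'') f \<and> supp1 P F \<subseteq> Jminus P (supp1 P f)"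
    using Phi_solves[OF f T] Eret_Phi[OF K T(1)] Eret_QA[OF K f T] by blast
qed

theorem advanced:
  assumes K: "\<forall>s. spec_fun P (gE s) (K s)"
  shows "advanced_green P (Eadv P K)"
  unfolding advanced_green_def
proof (intro allI impI)
  fix f f' f'' assume f: "C2_0_DA P f f' f''"
  let ?g = "\<lambda>t. f (- t)" and ?g' = "\<lambda>t. hscale (-1) (f' (- t))" and ?g'' = "\<lambda>t. f'' (- t)"
  let ?K = "\<lambda>s \<phi>. hscale (-1) (K (- s) \<phi>)"
  have g: "C2_0_DA P ?g ?g' ?g''" by (rule C2_0_DA_reflect[OF f])
  have K': "\<forall>s. spec_fun P (gE s) (?K s)" using K spec_fun_reflect by blast
  obtain T where T: "admissible ?g T" "admissible ?g' T" "admissible ?g'' T" by (rule C2_0_admissible[OF g])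
  obtain T' where T': "admissible f T'" by (rule C2_0_admissible[OF f])
  define F where "F t = Phi ?g (- t)" for t
  define F' where "F' t = hscale (-1) (Phi ?g' (- t))" for t
  define F'' where "F'' t = Phi ?g'' (- t)" for t
  have "C2_DA P F F' F''" unfolding F_def[abs_def] F'_def[abs_def] F''_def[abs_def]
    by (rule C2_DA_reflect[OF Phi_solves(1)[OF g T]])
  moreover have "heq P (QA P F F'' t) (f t)" for t
    using Phi_solves(2)[OF g T, of "- t"] by (simp add: QA_def F_def F''_def)
  moreover have "Eadv P K f F"
    by (rule Eadv_reflect) (use Eret_Phi[OF K' T(1)] in \<open>simp add: F_def\<close>)
  moreover have "Eadv P K (QA P f f'') f"
    by (rule Eadv_reflect) (use Eret_QA[OF K' g T] in \<open>simp add: QA_def[abs_def]\<close>)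
  moreover have "supp1 P F \<subseteq> Jplus P (supp1 P f)"
    unfolding supp1_def[of P F]
  proof (rule closure_minimal[OF _ closed_Jplus[OF compact_supp1[OF T']]], clarify)
    fix t0 z0 assume z0: "z0 \<in> {0..L}" and nz: "fst (F t0) z0 \<noteq> 0"
    then obtain t z where tz: "z \<in> {0..L}" "\<bar>z - z0\<bar> \<le> t - (- t0)" "fst (f (- t)) z \<noteq> 0"
      using Phi_vanishes[OF g z0, of "- t0"] unfolding F_def by blast
    then have "(- t, z) \<in> supp1 P f" unfolding supp1_def by (intro subsetD[OF closure_subset]) simp
    moreover have "\<bar>z0 - z\<bar> \<le> t0 - (- t)" using tz(2) by (simp add: abs_minus_commute add.commute)
    ultimately show "(t0, z0) \<in> Jplus P (supp1 P f)"
      unfolding Jplus_def using z0 by blast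
  qed
  ultimately show "\<exists>F F' F''. C2_DA P F F' F'' \<and> Eadv P K f F \<and> (\<forall>t. heq P (QA P F F'' t) (f t))
      \<and> Eadv P K (QA P f f'') f \<and> supp1 P F \<subseteq> Jplus P (supp1 P f)"
    by blast
qed

end

theorem theorem2:
  fixes P :: bvp and K :: "real \<Rightarrow> hvec \<Rightarrow> hvec"
  assumes "len P > 0"
    and "msq P \<ge> 0"
    and "0 \<le> alpha P" and "alpha P < pi"
    and "rho P > 0"
    and "b2' P \<noteq> 0"
    and "alpha P = 0 \<or> (pi / 2 \<le> alpha P \<and> alpha P < pi)"
    and "b2' P > 0 \<longrightarrow> b1 P \<ge> 0 \<and> b2 P < 0 \<and> b1' P < 0"
    and "b2' P < 0 \<longrightarrow> b1 P \<le> 0 \<and> b2 P > 0 \<and> b1' P > 0"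
    and "b2 P \<noteq> 0"
    and "\<forall>s. spec_fun P (gE s) (K s)"
  shows "retarded_green P (Eret P K) \<and> advanced_green P (Eadv P K)"
proof -
  interpret wave_bvp P using assms by unfold_locales
  obtain B where B: "orthonormal_eigen B" "\<forall>X. orthonormal_eigen X \<longrightarrow> B \<subseteq> X \<longrightarrow> X = B"
    by (rule maximal_orthonormal_eigen)
  interpret eigenbasis P B using B by unfold_locales
  show ?thesis using retarded advanced assms(11) by blast
qed

end
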